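(* Let $s\in(0,1)$, $n\ge2$, and let $\varphi_0\in\mathds L^2_\dag$ be a radially symmetric function. Then the Cauchy problem $$\varphi_t+(-\Delta)^s\varphi=0\ \text{ in }\mathbb R^n\times(0,\infty),\qquad \varphi|_{t=0}=\varphi_0,$$ has a unique (radially symmetric) solution in $\mathds L^2_\dag$, which, in the self-similar variables $$\tilde x=\frac{x}{(t+1)^{1/(2s)}},\qquad \tilde t=\log(t+1),\qquad \varphi(t,x)=\frac1{(1+t)^{n/(2s)}}u(\tilde t,\tilde x)$$ (in which the equation reads $u_{\tilde t}+L_su=0$ with $u|_{\tilde t=0}=\varphi_0$), is given by $$u(\tilde t,\tilde r)=\sum_{k=0}^\infty a_ke^{-\nu_k\tilde t}e_k^{(s)}(\tilde r),\qquad a_k:=\langle\varphi_0,e_k^{(s)}\rangle_\dag,\quad \nu_k:=k,\quad \tilde r=|\tilde x|.$$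
   Context: Radial functions on $\mathbb R^n$ are written as functions of $r=|x|$. The Fourier transform is $\widehat u(\xi)=(2\pi)^{-n/2}\int_{\mathbb R^n}e^{-ix\cdot\xi}u(x)\,dx$, written $\widehat u(\zeta)$, $\zeta=|\xi|$, for radial $u$; $(-\Delta)^s$ has Fourier symbol $|\xi|^{2s}$. $L_su=(-\Delta)^su-\frac1{2s}r\partial_ru-\frac n{2s}u$. For radial $u$, $u^\dag=u^\dag(\rho)$ is the radial function on $\mathbb R^n$ whose Fourier transform, in the radial Fourier variable $\vartheta$, is $\widehat u(\vartheta^{1/s})$. $\mathds L^2_\dag=\mathds L^2_\dag(s)$ is the Hilbert space of radial (tempered distributions) $u$ whose Fourier transform is a function and with $u^\dag\in L^2_r(\mathbb R^n,e^{|x|^2/4})$, with scalar product $\langle u_1,u_2\rangle_\dag=\int_0^\infty u_1^\dag(\rho)\overline{u_2^\dag(\rho)}e^{\rho^2/4}\rho^{n-1}\,d\rho$. $\{e_k^{(s)}\}_{k\in\mathbb N}$ ($\mathbb N\ni0$) denotes the orthonormal basis of $\mathds L^2_\dag$ consisting of eigenfunctions of $L_s$, $L_se_k^{(s)}=ke_k^{(s)}$; explicitly $\widehat{e_k^{(s)}}(\zeta)=c_k\,e^{-\zeta^{2s}}\zeta^{2sk}$ with $c_k$ a normalizing constant. A solution "in $\mathds L^2_\dag$" means that in self-similar variables $u(\tilde t,\cdot)\in\mathds L^2_\dag$ for each $\tilde t\ge0$. *)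

theory Defs
  imports "HOL-Analysis.Analysis"
begin

text \<open>Schwartz functions on \<open>\<real>\<^sup>n\<close>, where \<open>n = CARD('n)\<close>.\<close>

definition partial_deriv :: "'n::finite \<Rightarrow> (real^'n \<Rightarrow> complex) \<Rightarrow> real^'n \<Rightarrow> complex" where
  "partial_deriv i f x = frechet_derivative f (at x) (axis i 1)"

definition iterated_partial :: "'n::finite list \<Rightarrow> (real^'n \<Rightarrow> complex) \<Rightarrow> real^'n \<Rightarrow> complex" where
  "iterated_partial is f = foldr partial_deriv is f"

definition schwartz :: "(real^'n::finite \<Rightarrow> complex) set" where
  "schwartz = {f. \<forall>is. iterated_partial is f differentiable_on UNIV \<and>
     (\<forall>N. bounded (range (\<lambda>x. (1 + norm x) ^ N *\<^sub>R iterated_partial is f x)))}"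

definition schwartz_seminorm :: "nat \<Rightarrow> 'n::finite list \<Rightarrow> (real^'n \<Rightarrow> complex) \<Rightarrow> real" where
  "schwartz_seminorm N is f = (SUP x. (1 + norm x) ^ N * norm (iterated_partial is f x))"

text \<open>A distribution is a functional that is extensional on the Schwartz space, so that two
  tempered distributions are equal iff they agree on all test functions. The pairing is bilinear
  (no complex conjugation).\<close>

type_synonym 'n distribution = "((real, 'n) vec \<Rightarrow> complex) \<Rightarrow> complex"

definition tempered :: "'n::finite distribution \<Rightarrow> bool" where
  "tempered T \<longleftrightarrow> T \<in> extensional schwartz \<and>
     (\<forall>\<psi>\<in>schwartz. \<forall>\<eta>\<in>schwartz. \<forall>a b.
        T (\<lambda>x. a * \<psi> x + b * \<eta> x) = a * T \<psi> + b * T \<eta>) \<and>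
     (\<exists>C N. \<forall>\<psi>\<in>schwartz.
        norm (T \<psi>) \<le> C * (\<Sum>is | length is \<le> N. schwartz_seminorm N is \<psi>))"

definition tempered_fun :: "(real^'n::finite \<Rightarrow> complex) \<Rightarrow> bool" where
  "tempered_fun G \<longleftrightarrow> G \<in> borel_measurable borel \<and>
     (\<forall>\<psi>\<in>schwartz. integrable lborel (\<lambda>x. G x * \<psi> x))"

definition dist_of_fun :: "(real^'n::finite \<Rightarrow> complex) \<Rightarrow> 'n distribution" where
  "dist_of_fun G = (\<lambda>\<psi>\<in>schwartz. LINT x|lborel. G x * \<psi> x)"

definition dist_scale :: "complex \<Rightarrow> 'n::finite distribution \<Rightarrow> 'n distribution" where
  "dist_scale c T = (\<lambda>\<psi>\<in>schwartz. c * T \<psi>)"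

text \<open>The distribution \<open>T(x / c)\<close>, for \<open>c > 0\<close>.\<close>

definition dist_dilate :: "real \<Rightarrow> 'n::finite distribution \<Rightarrow> 'n distribution" where
  "dist_dilate c T = (\<lambda>\<psi>\<in>schwartz. of_real (c ^ CARD('n)) * T (\<lambda>x. \<psi> (c *\<^sub>R x)))"

definition radial_dist :: "'n::finite distribution \<Rightarrow> bool" where
  "radial_dist T \<longleftrightarrow>
     (\<forall>A. orthogonal_transformation A \<longrightarrow> (\<forall>\<psi>\<in>schwartz. T (\<psi> \<circ> A) = T \<psi>))"

definition fourier :: "(real^'n::finite \<Rightarrow> complex) \<Rightarrow> real^'n \<Rightarrow> complex" where
  "fourier f \<xi> = of_real ((2 * pi) powr (- real CARD('n) / 2)) *
     (LINT x|lborel. cis (- (x \<bullet> \<xi>)) * f x)"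

definition inv_fourier :: "(real^'n::finite \<Rightarrow> complex) \<Rightarrow> real^'n \<Rightarrow> complex" where
  "inv_fourier F x = of_real ((2 * pi) powr (- real CARD('n) / 2)) *
     (LINT \<xi>|lborel. cis (x \<bullet> \<xi>) * F \<xi>)"

definition fourier_dist :: "'n::finite distribution \<Rightarrow> 'n distribution" where
  "fourier_dist T = (\<lambda>\<psi>\<in>schwartz. T (fourier \<psi>))"

text \<open>The Fourier transform of \<open>T\<close> is the function \<open>F\<close>; \<open>F\<close> is determined up to null sets.\<close>

definition has_fourier_fun :: "'n::finite distribution \<Rightarrow> (real^'n \<Rightarrow> complex) \<Rightarrow> bool" where
  "has_fourier_fun T F \<longleftrightarrow> tempered_fun F \<and> fourier_dist T = dist_of_fun F"

text \<open>The operators \<open>(-\<Delta>)\<^sup>s\<close> and \<open>L\<^sub>s\<close> as (single-valued) relations between tempered distributions: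
  \<open>|\<xi>|\<^sup>2\<^sup>s\<close> is not a smooth multiplier, so \<open>(-\<Delta>)\<^sup>s T\<close> is only meaningful for some \<open>T\<close>.\<close>

definition frac_laplacian :: "real \<Rightarrow> 'n::finite distribution \<Rightarrow> 'n distribution \<Rightarrow> bool" where
  "frac_laplacian s T Q \<longleftrightarrow> tempered Q \<and>
     (\<exists>F. has_fourier_fun T F \<and> has_fourier_fun Q (\<lambda>\<xi>. of_real (norm \<xi> powr (2 * s)) * F \<xi>))"

text \<open>\<open>r \<partial>\<^sub>r T = x \<cdot> \<nabla>T = \<Sum>i. x\<^sub>i \<partial>\<^sub>i T\<close>, by transposition.\<close>

definition r_deriv_r :: "'n::finite distribution \<Rightarrow> 'n distribution" where
  "r_deriv_r T = (\<lambda>\<psi>\<in>schwartz. - (\<Sum>i\<in>UNIV. T (partial_deriv i (\<lambda>x. of_real (x $ i) * \<psi> x))))"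

definition L_op :: "real \<Rightarrow> 'n::finite distribution \<Rightarrow> 'n distribution \<Rightarrow> bool" where
  "L_op s T S \<longleftrightarrow> (\<exists>Q. frac_laplacian s T Q \<and>
     S = (\<lambda>\<psi>\<in>schwartz. Q \<psi> - of_real (1 / (2 * s)) * r_deriv_r T \<psi>
            - of_real (real CARD('n) / (2 * s)) * T \<psi>))"

text \<open>\<open>u\<^sub>t + A u = 0\<close> for \<open>t > 0\<close>, \<open>u|\<^sub>t\<^sub>=\<^sub>0 = u\<^sub>0\<close>, with the time derivative and the initial value
  taken in the weak topology of tempered distributions.\<close>

definition cauchy_solution ::
  "('n::finite distribution \<Rightarrow> 'n distribution \<Rightarrow> bool) \<Rightarrow>
   (real \<Rightarrow> 'n distribution) \<Rightarrow> 'n distribution \<Rightarrow> bool" where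
  "cauchy_solution A u u0 \<longleftrightarrow>
     (\<forall>t\<ge>0. tempered (u t)) \<and>
     (\<forall>t>0. \<exists>S. A (u t) S \<and>
        (\<forall>\<psi>\<in>schwartz. ((\<lambda>t. u t \<psi>) has_vector_derivative - S \<psi>) (at t))) \<and>
     u 0 = u0 \<and>
     (\<forall>\<psi>\<in>schwartz. ((\<lambda>t. u t \<psi>) \<longlongrightarrow> u0 \<psi>) (at_right 0))"

text \<open>\<open>T\<^sup>\<dagger>(\<rho>) = g \<rho>\<close>: the Fourier transform of \<open>T\<close> is a radial function with profile \<open>f\<close>, and that of
  \<open>g(|x|)\<close> has the profile \<open>f(\<theta>\<^sup>1\<^sup>/\<^sup>s)\<close>. The function \<open>g\<close> is determined up to null sets.\<close>

definition is_dagger :: "real \<Rightarrow> 'n::finite distribution \<Rightarrow> (real \<Rightarrow> complex) \<Rightarrow> bool" where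
  "is_dagger s T g \<longleftrightarrow> g \<in> borel_measurable borel \<and>
     tempered_fun (\<lambda>x::real^'n. g (norm x)) \<and>
     (\<exists>f. has_fourier_fun T (\<lambda>\<xi>. f (norm \<xi>)) \<and>
          has_fourier_fun (dist_of_fun (\<lambda>x::real^'n. g (norm x)))
            (\<lambda>\<xi>. f (norm \<xi> powr (1 / s))))"

definition dagger :: "real \<Rightarrow> 'n::finite distribution \<Rightarrow> real \<Rightarrow> complex" where
  "dagger s T = (SOME g. is_dagger s T g)"

definition L2_dagger :: "real \<Rightarrow> 'n::finite distribution set" where
  "L2_dagger s = {T. tempered T \<and> radial_dist T \<and>
     (\<exists>g. is_dagger s T g \<and>
        integrable lborel (\<lambda>x::real^'n. (norm (g (norm x)))\<^sup>2 * exp ((norm x)\<^sup>2 / 4)))}"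

definition inner_dagger :: "real \<Rightarrow> 'n::finite distribution \<Rightarrow> 'n distribution \<Rightarrow> complex" where
  "inner_dagger s T1 T2 =
     (LINT \<rho>:{0..}|lborel. dagger s T1 \<rho> * cnj (dagger s T2 \<rho>) *
        of_real (exp (\<rho>\<^sup>2 / 4) * \<rho> ^ (CARD('n) - 1)))"

definition norm_dagger :: "real \<Rightarrow> 'n::finite distribution \<Rightarrow> real" where
  "norm_dagger s T = sqrt (Re (inner_dagger s T T))"

text \<open>Convergence of a series in the Hilbert space \<open>L2_dagger s\<close>.\<close>

definition sums_dagger :: "real \<Rightarrow> (nat \<Rightarrow> 'n::finite distribution) \<Rightarrow> 'n distribution \<Rightarrow> bool" where
  "sums_dagger s v T \<longleftrightarrow> T \<in> L2_dagger s \<and> (\<forall>k. v k \<in> L2_dagger s) \<and>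
     (\<lambda>N. norm_dagger s (\<lambda>\<psi>\<in>schwartz. T \<psi> - (\<Sum>k<N. v k \<psi>))) \<longlonglongrightarrow> 0"

text \<open>The eigenfunctions \<open>e\<^sub>k\<close> of \<open>L\<^sub>s\<close>: the Fourier transform of \<open>e\<^sub>k\<close> is
  \<open>c\<^sub>k exp (-|\<xi>|\<^sup>2\<^sup>s) |\<xi>|\<^sup>2\<^sup>s\<^sup>k\<close>, with \<open>c\<^sub>k > 0\<close> such that \<open>e\<^sub>k\<close> has norm one. (At \<open>\<xi> = 0\<close>, \<open>k = 0\<close> the
  library sets \<open>0 powr 0 = 0\<close>; this is a null set.)\<close>

definition eigen_unnormalized :: "real \<Rightarrow> nat \<Rightarrow> 'n::finite distribution" where
  "eigen_unnormalized s k = dist_of_fun (inv_fourier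
     (\<lambda>\<xi>. of_real (exp (- (norm \<xi> powr (2 * s))) * norm \<xi> powr (2 * s * real k))))"

definition eigen :: "real \<Rightarrow> nat \<Rightarrow> 'n::finite distribution" where
  "eigen s k = dist_scale (of_real (1 / norm_dagger s (eigen_unnormalized s k :: 'n distribution)))
     (eigen_unnormalized s k)"

text \<open>\<open>\<phi>(t,x) = (1+t)\<^sup>-\<^sup>n\<^sup>/\<^sup>2\<^sup>s u(log (t+1), x / (t+1)\<^sup>1\<^sup>/\<^sup>2\<^sup>s)\<close> for \<open>t \<ge> 0\<close>.\<close>

definition self_similar ::
  "real \<Rightarrow> (real \<Rightarrow> 'n::finite distribution) \<Rightarrow> (real \<Rightarrow> 'n distribution) \<Rightarrow> bool" where
  "self_similar s \<phi> u \<longleftrightarrow> (\<forall>t\<ge>0. \<phi> t =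
     dist_scale (of_real (1 / (1 + t) powr (real CARD('n) / (2 * s))))
       (dist_dilate ((t + 1) powr (1 / (2 * s))) (u (ln (t + 1)))))"

definition in_L2_dagger ::
  "real \<Rightarrow> (real \<Rightarrow> 'n::finite distribution) \<Rightarrow> (real \<Rightarrow> 'n distribution) \<Rightarrow> bool" where
  "in_L2_dagger s \<phi> u \<longleftrightarrow> self_similar s \<phi> u \<and> (\<forall>\<tau>\<ge>0. u \<tau> \<in> L2_dagger s)"

end

(* On the Fourier side the fractional heat equation is the multiplication by exp (-t |xi|^(2 s)).
   Uniqueness among solutions whose Fourier transforms are polynomially bounded functions follows by
   pairing a solution with the backward multiplier, which is not smooth at the origin and therefore has to be
   flattened there and cut off at infinity. A radial function g on R^n in the weighted space expands in a
   power series on the Fourier side with the moments of g as coefficients; after dividing by those of the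
   Gaussian, the coefficients of exp (theta^2) (F g)(theta) are, up to constants, the products of g with the
   Laguerre functions, by a finite difference identity. The substitution theta = |xi|^s turns the
   Laguerre functions into the eigenfunctions of L_s, and in self-similar variables the solution
   has the Fourier transform exp (-theta^2 + exp (-tau) theta^2) (F g)(exp (-tau / 2) theta), in
   which the k-th coefficient of the power series is multiplied by exp (-k tau). Riesz-Fischer supplies an element
   of the space with these coefficients, and the series converges to it. *)
theory Submission
  imports Defs "HOL-Probability.Probability"
begin

text \<open>The equation is known only weakly: \<open>u t \<psi>\<close> is differentiable for each
  fixed \<open>\<psi>\<close>. Pairing with a multiplier that moves in time, or with moving
  dilations, requires the derivative of \<open>T t (\<psi> t)\<close>, where difference quotients
  that converge only pointwise act on moving test functions. Controlling them is a Banach-Steinhaus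
  statement for the Schwartz space; it is obtained by a gliding hump, with bounded families of test
  functions in place of a Frechet topology. The same product rule serves uniqueness and the passage
  between \<open>frac_laplacian s\<close> and \<open>L_op s\<close>. The Gaussian weight enters
  twice. It gives \<open>g\<close> all exponential moments, so the power series converges everywhere
  and the transform is bounded, which puts elements of \<open>L2_dagger\<close> under the growth
  hypothesis of uniqueness. And it cancels the factor exp(-r^2/4) of the Laguerre functions, so that
  their inner products with \<open>g\<close> are finite combinations of moments. Since the
  coefficients determine the power series, they determine the Fourier transform; completeness of the
  basis is hidden in this step.\<close>

type_synonym 'n cfun = "(real, 'n) vec \<Rightarrow> complex"

subsection \<open>Bounded families of Schwartz functions\<close>

text \<open>A bounded subset of the Schwartz space, indexed by \<open>'j\<close>: the constants do
  not depend on \<open>j\<close>. It takes the place of the topology of that space; a single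
  function is the case of the index type \<open>unit\<close>.\<close>

definition bounded_family :: "('j \<Rightarrow> real^'n::finite \<Rightarrow> complex) \<Rightarrow> bool" where
  "bounded_family f \<longleftrightarrow> (\<forall>is j. iterated_partial is (f j) differentiable_on UNIV) \<and>
     (\<forall>is N. \<exists>C. \<forall>j x. (1 + norm x) ^ N * norm (iterated_partial is (f j) x) \<le> C)"

lemma iterated_partial_Nil [simp]: "iterated_partial [] f = f"
  by (simp add: iterated_partial_def)

lemma iterated_partial_Cons: "iterated_partial (i # is) f = partial_deriv i (iterated_partial is f)"
  by (simp add: iterated_partial_def)

lemma iterated_partial_snoc: "iterated_partial (is @ [i]) f = iterated_partial is (partial_deriv i f)"
  by (simp add: iterated_partial_def)

lemma schwartz_iff_bounded_family: "f \<in> schwartz \<longleftrightarrow> bounded_family (\<lambda>_::unit. f)"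
proof -
  have "bounded (range (\<lambda>x. (1 + norm x) ^ N *\<^sub>R iterated_partial is f x)) \<longleftrightarrow>
        (\<exists>C. \<forall>x. (1 + norm x) ^ N * norm (iterated_partial is f x) \<le> C)" for N "is"
    by (simp add: bounded_iff)
  then show ?thesis unfolding schwartz_def bounded_family_def by auto
qed

text \<open>Coinduction over a class \<open>Z\<close> closed under partial derivatives: every
  iterated derivative stays in \<open>Z\<close>, so it suffices to bound the members of
  \<open>Z\<close> themselves. Leibniz and chain rules of higher order never have to be written out;
  the work lies in the choice of \<open>Z\<close>.\<close>

lemma bounded_family_coinduct:
  assumes "f \<in> Z"
    and diff: "\<And>g j x. g \<in> Z \<Longrightarrow> g j differentiable at x"
    and decay: "\<And>g N. g \<in> Z \<Longrightarrow> \<exists>C. \<forall>j x. (1 + norm x) ^ N * norm (g j x) \<le> C"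
    and step: "\<And>g i. g \<in> Z \<Longrightarrow> (\<lambda>j. partial_deriv i (g j)) \<in> Z"
  shows "bounded_family f"
proof -
  have *: "(\<lambda>j. iterated_partial is (f j)) \<in> Z" for "is"
    by (induction "is") (use assms(1) step in \<open>auto simp: iterated_partial_Cons\<close>)
  show ?thesis
    unfolding bounded_family_def differentiable_on_def
    using diff[OF *] decay[OF *] by simp
qed

lemma bounded_family_differentiable:
  assumes "bounded_family f" shows "f j differentiable at x"
proof -
  have "iterated_partial [] (f j) differentiable_on UNIV"
    using assms unfolding bounded_family_def by blast
  then show ?thesis by (simp add: differentiable_on_def)
qed

lemma bounded_family_decay:
  assumes "bounded_family f"
  obtains C where "C > 0" "\<And>j x. (1 + norm x) ^ N * norm (f j x) \<le> C"
proof -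
  obtain C where C: "\<forall>j x. (1 + norm x) ^ N * norm (iterated_partial [] (f j) x) \<le> C"
    using assms unfolding bounded_family_def by meson
  have "max 1 C > 0" "\<And>j x. (1 + norm x) ^ N * norm (f j x) \<le> max 1 C"
    using C by (auto simp: le_max_iff_disj)
  then show ?thesis using that by blast
qed

lemma bounded_family_partial:
  assumes "bounded_family f" shows "bounded_family (\<lambda>j. partial_deriv i (f j))"
  unfolding bounded_family_def
proof (intro conjI allI)
  fix "is" j show "iterated_partial is (partial_deriv i (f j)) differentiable_on UNIV"
    using assms unfolding bounded_family_def by (metis iterated_partial_snoc)
next
  fix "is" N show "\<exists>C. \<forall>j x. (1 + norm x) ^ N * norm (iterated_partial is (partial_deriv i (f j)) x) \<le> C"
    using assms unfolding bounded_family_def by (metis iterated_partial_snoc)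
qed

lemma bounded_family_imp_schwartz: "bounded_family f \<Longrightarrow> f j \<in> schwartz"
  unfolding schwartz_iff_bounded_family unfolding bounded_family_def by blast

lemma bounded_family_reindex: "bounded_family f \<Longrightarrow> bounded_family (\<lambda>j. f (r j))"
  unfolding bounded_family_def by blast

lemma schwartz_imp_bounded_family: "f \<in> schwartz \<Longrightarrow> bounded_family (\<lambda>_. f)"
  unfolding schwartz_iff_bounded_family by (rule bounded_family_reindex)

lemma schwartz_differentiable: "f \<in> schwartz \<Longrightarrow> f differentiable at x"
  unfolding schwartz_iff_bounded_family by (rule bounded_family_differentiable)

lemma schwartz_partial: "f \<in> schwartz \<Longrightarrow> partial_deriv i f \<in> schwartz"
  unfolding schwartz_iff_bounded_family by (rule bounded_family_partial)

lemma partial_deriv_eq: "(f has_derivative D) (at x) \<Longrightarrow> partial_deriv i f x = D (axis i 1)"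
  unfolding partial_deriv_def using frechet_derivative_at by metis

lemma has_derivative_partials:
  fixes f :: "'n::finite cfun"
  assumes "f differentiable at x"
  shows "(f has_derivative (\<lambda>v. \<Sum>k\<in>UNIV. of_real (v $ k) * partial_deriv k f x)) (at x)"
proof -
  have d: "(f has_derivative frechet_derivative f (at x)) (at x)"
    using assms frechet_derivative_works by blast
  have l: "linear (frechet_derivative f (at x))"
    using d has_derivative_linear by blast
  have "frechet_derivative f (at x) v = (\<Sum>k\<in>UNIV. of_real (v $ k) * partial_deriv k f x)" for v
  proof -
    have "v = (\<Sum>k\<in>UNIV. v $ k *\<^sub>R axis k 1)"
      using basis_expansion[of v] by (simp add: scalar_mult_eq_scaleR)
    then have "frechet_derivative f (at x) v = frechet_derivative f (at x) (\<Sum>k\<in>UNIV. v $ k *\<^sub>R axis k 1)"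
      by (rule arg_cong)
    also have "... = (\<Sum>k\<in>UNIV. v $ k *\<^sub>R frechet_derivative f (at x) (axis k 1))"
      by (simp add: linear_sum[OF l] linear_scale[OF l])
    finally show ?thesis by (simp add: partial_deriv_def scaleR_conv_of_real)
  qed
  then have "frechet_derivative f (at x) = (\<lambda>v. \<Sum>k\<in>UNIV. of_real (v $ k) * partial_deriv k f x)"
    by (rule ext)
  with d show ?thesis by simp
qed

lemma bounded_family_has_derivative:
  "bounded_family f \<Longrightarrow>
     (f j has_derivative (\<lambda>v. \<Sum>k\<in>UNIV. of_real (v $ k) * partial_deriv k (f j) x)) (at x)"
  by (rule has_derivative_partials[OF bounded_family_differentiable])

lemma schwartz_has_derivative:
  "f \<in> schwartz \<Longrightarrow>
     (f has_derivative (\<lambda>v. \<Sum>k\<in>UNIV. of_real (v $ k) * partial_deriv k f x)) (at x)"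
  by (rule has_derivative_partials[OF schwartz_differentiable])

lemma sum_axis_component [simp]:
  "(\<Sum>k\<in>UNIV. of_real (axis i (1::real) $ k) * (g k :: complex)) = g i"
proof -
  have "(\<Sum>k\<in>UNIV. of_real (axis i (1::real) $ k) * g k) = (\<Sum>k\<in>UNIV. if k = i then g k else 0)"
    by (intro sum.cong) (auto simp: axis_def)
  then show ?thesis by simp
qed

section \<open>Closure of bounded families under algebraic operations\<close>

lemma bounded_family_add:
  fixes f g :: "'j \<Rightarrow> real^'n::finite \<Rightarrow> complex"
  assumes "bounded_family f" "bounded_family g"
  shows "bounded_family (\<lambda>j x. f j x + g j x)"
proof (rule bounded_family_coinduct[where Z = "{\<lambda>j x. f j x + g j x :: complex | f g :: 'j \<Rightarrow> real^'n \<Rightarrow> complex. bounded_family f \<and> bounded_family g}"])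
  show "(\<lambda>j x. f j x + g j x) \<in> {\<lambda>j x. f j x + g j x :: complex | f g :: 'j \<Rightarrow> real^'n \<Rightarrow> complex. bounded_family f \<and> bounded_family g}"
    using assms by blast
next
  fix h :: "'j \<Rightarrow> real^'n \<Rightarrow> complex" and j x
  assume "h \<in> {\<lambda>j x. f j x + g j x :: complex | f g :: 'j \<Rightarrow> real^'n \<Rightarrow> complex. bounded_family f \<and> bounded_family g}"
  then obtain f g where h: "h = (\<lambda>j x. f j x + g j x)" "bounded_family f" "bounded_family g" by blast
  show "h j differentiable at x"
    unfolding h(1) by (rule differentiable_add[OF bounded_family_differentiable[OF h(2)] bounded_family_differentiable[OF h(3)]])
next
  fix h :: "'j \<Rightarrow> real^'n \<Rightarrow> complex" and N
  assume "h \<in> {\<lambda>j x. f j x + g j x :: complex | f g :: 'j \<Rightarrow> real^'n \<Rightarrow> complex. bounded_family f \<and> bounded_family g}"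
  then obtain f g where h: "h = (\<lambda>j x. f j x + g j x)" "bounded_family f" "bounded_family g" by blast
  obtain A where A: "\<And>j x. (1 + norm x) ^ N * norm (f j x) \<le> A" using bounded_family_decay h(2) by blast
  obtain B where B: "\<And>j x. (1 + norm x) ^ N * norm (g j x) \<le> B" using bounded_family_decay h(3) by blast
  have "(1 + norm x) ^ N * norm (h j x) \<le> A + B" for j x
  proof -
    have "(1 + norm x) ^ N * norm (h j x) \<le> (1 + norm x) ^ N * (norm (f j x) + norm (g j x))"
      unfolding h by (intro mult_left_mono norm_triangle_ineq) auto
    also have "... \<le> A + B" using A[of x j] B[of x j] by (simp add: algebra_simps)
    finally show ?thesis .
  qed
  then show "\<exists>C. \<forall>j x. (1 + norm x) ^ N * norm (h j x) \<le> C" by blast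
next
  fix h :: "'j \<Rightarrow> real^'n \<Rightarrow> complex" and i
  assume "h \<in> {\<lambda>j x. f j x + g j x :: complex | f g :: 'j \<Rightarrow> real^'n \<Rightarrow> complex. bounded_family f \<and> bounded_family g}"
  then obtain f g where h: "h = (\<lambda>j x. f j x + g j x)" "bounded_family f" "bounded_family g" by blast
  have "(\<lambda>j. partial_deriv i (h j)) = (\<lambda>j x. partial_deriv i (f j) x + partial_deriv i (g j) x)"
    unfolding h by (intro ext) (subst partial_deriv_eq[OF has_derivative_add[OF bounded_family_has_derivative[OF h(2)] bounded_family_has_derivative[OF h(3)]]]; simp)
  then show "(\<lambda>j. partial_deriv i (h j)) \<in> {\<lambda>j x. f j x + g j x :: complex | f g :: 'j \<Rightarrow> real^'n \<Rightarrow> complex. bounded_family f \<and> bounded_family g}"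
    by (intro CollectI exI[of _ "\<lambda>j. partial_deriv i (f j)"] exI[of _ "\<lambda>j. partial_deriv i (g j)"])
       (auto simp: bounded_family_partial[OF h(2)] bounded_family_partial[OF h(3)])
qed

lemma bounded_family_cmult:
  fixes f :: "'j \<Rightarrow> real^'n::finite \<Rightarrow> complex"
  assumes "bounded_family f" and c: "\<And>j. norm (c j) \<le> K"
  shows "bounded_family (\<lambda>j x. c j * f j x)"
proof (rule bounded_family_coinduct[where Z = "{\<lambda>j x. c j * f j x :: complex | f :: 'j \<Rightarrow> real^'n \<Rightarrow> complex. bounded_family f}"])
  show "(\<lambda>j x. c j * f j x) \<in> {\<lambda>j x. c j * f j x :: complex | f :: 'j \<Rightarrow> real^'n \<Rightarrow> complex. bounded_family f}"
    using assms by blast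
next
  fix h :: "'j \<Rightarrow> real^'n \<Rightarrow> complex" and j x
  assume "h \<in> {\<lambda>j x. c j * f j x :: complex | f :: 'j \<Rightarrow> real^'n \<Rightarrow> complex. bounded_family f}"
  then obtain f where h: "h = (\<lambda>j x. c j * f j x)" "bounded_family f" by blast
  show "h j differentiable at x"
    unfolding h(1) by (rule differentiable_mult[OF differentiable_const bounded_family_differentiable[OF h(2)]])
next
  fix h :: "'j \<Rightarrow> real^'n \<Rightarrow> complex" and N
  assume "h \<in> {\<lambda>j x. c j * f j x :: complex | f :: 'j \<Rightarrow> real^'n \<Rightarrow> complex. bounded_family f}"
  then obtain f where h: "h = (\<lambda>j x. c j * f j x)" "bounded_family f" by blast
  obtain A where A: "A > 0" "\<And>j x. (1 + norm x) ^ N * norm (f j x) \<le> A" using bounded_family_decay h(2) by blast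
  have "(1 + norm x) ^ N * norm (h j x) \<le> K * A" for j x
  proof -
    have "(1 + norm x) ^ N * norm (h j x) = norm (c j) * ((1 + norm x) ^ N * norm (f j x))"
      unfolding h by (simp add: norm_mult)
    also have "... \<le> K * A" using A(2)[of x j] A(1) c[of j]
      by (intro mult_mono) (auto intro: order_trans[OF norm_ge_zero])
    finally show ?thesis .
  qed
  then show "\<exists>C. \<forall>j x. (1 + norm x) ^ N * norm (h j x) \<le> C" by blast
next
  fix h :: "'j \<Rightarrow> real^'n \<Rightarrow> complex" and i
  assume "h \<in> {\<lambda>j x. c j * f j x :: complex | f :: 'j \<Rightarrow> real^'n \<Rightarrow> complex. bounded_family f}"
  then obtain f where h: "h = (\<lambda>j x. c j * f j x)" "bounded_family f" by blast
  have "(\<lambda>j. partial_deriv i (h j)) = (\<lambda>j x. c j * partial_deriv i (f j) x)"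
    unfolding h by (intro ext) (subst partial_deriv_eq[OF has_derivative_mult_right[OF bounded_family_has_derivative[OF h(2)]]]; simp)
  then show "(\<lambda>j. partial_deriv i (h j)) \<in> {\<lambda>j x. c j * f j x :: complex | f :: 'j \<Rightarrow> real^'n \<Rightarrow> complex. bounded_family f}"
    by (intro CollectI exI[of _ "\<lambda>j. partial_deriv i (f j)"]) (auto simp: bounded_family_partial[OF h(2)])
qed

lemma schwartz_cmult: "f \<in> schwartz \<Longrightarrow> (\<lambda>x. c * f x) \<in> schwartz"
  unfolding schwartz_iff_bounded_family by (rule bounded_family_cmult[of _ _ "norm c"]) auto

lemma schwartz_add: "f \<in> schwartz \<Longrightarrow> g \<in> schwartz \<Longrightarrow> (\<lambda>x. f x + g x) \<in> schwartz"
  unfolding schwartz_iff_bounded_family by (rule bounded_family_add) auto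

lemma schwartz_zero: "(\<lambda>x::real^'a::finite. 0) \<in> schwartz"
proof -
  have p: "partial_deriv i (\<lambda>_::real^'a. 0::complex) = (\<lambda>_. 0)" for i
    by (rule ext) (rule partial_deriv_eq[OF has_derivative_const])
  have "bounded_family (\<lambda>(_::unit) (_::real^'a). 0::complex)"
    by (rule bounded_family_coinduct[where Z = "{\<lambda>_ _. 0}"])
       (auto simp: p differentiable_const simp del: fun_eq_iff)
  then show ?thesis unfolding schwartz_iff_bounded_family .
qed

lemma bounded_family_sum:
  assumes "\<And>k. k \<in> I \<Longrightarrow> bounded_family (f k)"
  shows "bounded_family (\<lambda>j x. \<Sum>k\<in>I. f k j x)"
  using assms
proof (induction I rule: infinite_finite_induct)
  case (infinite A)
  then show ?case using schwartz_imp_bounded_family[OF schwartz_zero] by simp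
next
  case empty
  then show ?case using schwartz_imp_bounded_family[OF schwartz_zero] by simp
next
  case (insert x F)
  then show ?case by (simp add: bounded_family_add)
qed

lemma schwartz_sum: "(\<And>k. k \<in> I \<Longrightarrow> f k \<in> schwartz) \<Longrightarrow> (\<lambda>x. \<Sum>k\<in>I. f k x) \<in> schwartz"
  unfolding schwartz_iff_bounded_family by (rule bounded_family_sum)

lemma has_derivative_component: "((\<lambda>x. of_real (x $ i) :: complex) has_derivative (\<lambda>v. of_real (v $ i))) (at x)"
proof -
  have "bounded_linear (\<lambda>v::real^'a::finite. complex_of_real (v $ i))"
    by (rule bounded_linear_compose[OF bounded_linear_of_real bounded_linear_vec_nth])
  then show ?thesis by (rule bounded_linear_imp_has_derivative)
qed

lemma bounded_family_component_mult:
  fixes f :: "'j \<Rightarrow> real^'n::finite \<Rightarrow> complex"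
  assumes "bounded_family f"
  shows "bounded_family (\<lambda>j x. of_real (x $ i) * f j x)"
proof -
  \<comment> \<open>The summand \<open>g\<close> absorbs the term that the product rule produces
    when the derivative hits the coordinate.\<close>
  let ?Z = "{\<lambda>j x. of_real (x $ i) * f j x + g j x | f g :: 'j \<Rightarrow> real^'n \<Rightarrow> complex. bounded_family f \<and> bounded_family g}"
  have z: "bounded_family (\<lambda>(_::'j) (_::real^'n). 0)" by (rule schwartz_imp_bounded_family[OF schwartz_zero])
  show ?thesis
  proof (rule bounded_family_coinduct[where Z = ?Z])
    show "(\<lambda>j x. of_real (x $ i) * f j x) \<in> ?Z"
      by (intro CollectI exI[of _ f] exI[of _ "\<lambda>_ _. 0"]) (use assms z in auto)
  next
    fix h :: "'j \<Rightarrow> real^'n \<Rightarrow> complex" and j x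
    assume "h \<in> ?Z"
    then obtain f g where h: "h = (\<lambda>j x. of_real (x $ i) * f j x + g j x)" "bounded_family f" "bounded_family g" by blast
    show "h j differentiable at x"
      unfolding h(1)
      by (rule differentiable_add[OF differentiable_mult[OF differentiableI[OF has_derivative_component]
            bounded_family_differentiable[OF h(2)]] bounded_family_differentiable[OF h(3)]])
  next
    fix h :: "'j \<Rightarrow> real^'n \<Rightarrow> complex" and N
    assume "h \<in> ?Z"
    then obtain f g where h: "h = (\<lambda>j x. of_real (x $ i) * f j x + g j x)" "bounded_family f" "bounded_family g" by blast
    obtain A where A: "\<And>j x. (1 + norm x) ^ (Suc N) * norm (f j x) \<le> A" using bounded_family_decay h(2) by blast
    obtain B where B: "\<And>j x. (1 + norm x) ^ N * norm (g j x) \<le> B" using bounded_family_decay h(3) by blast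
    have "(1 + norm x) ^ N * norm (h j x) \<le> A + B" for j x
    proof -
      have "norm (h j x) \<le> norm (of_real (x $ i) * f j x) + norm (g j x)"
        unfolding h by (rule norm_triangle_ineq)
      also have "norm (of_real (x $ i) * f j x) \<le> (1 + norm x) * norm (f j x)"
        using component_le_norm_cart[of x i] by (auto simp: norm_mult intro!: mult_right_mono)
      finally have "(1 + norm x) ^ N * norm (h j x) \<le> (1 + norm x) ^ N * ((1 + norm x) * norm (f j x) + norm (g j x))"
        by (intro mult_left_mono) auto
      also have "... \<le> A + B" using A[of x j] B[of x j] by (simp add: algebra_simps)
      finally show ?thesis .
    qed
    then show "\<exists>C. \<forall>j x. (1 + norm x) ^ N * norm (h j x) \<le> C" by blast
  next
    fix h :: "'j \<Rightarrow> real^'n \<Rightarrow> complex" and k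
    assume "h \<in> ?Z"
    then obtain f g where h: "h = (\<lambda>j x. of_real (x $ i) * f j x + g j x)" "bounded_family f" "bounded_family g" by blast
    have "(\<lambda>j. partial_deriv k (h j)) =
        (\<lambda>j x. of_real (x $ i) * partial_deriv k (f j) x + (of_real (axis k 1 $ i) * f j x + partial_deriv k (g j) x))"
      unfolding h
      by (intro ext) (subst partial_deriv_eq[OF has_derivative_add[OF has_derivative_mult[OF has_derivative_component bounded_family_has_derivative[OF h(2)]] bounded_family_has_derivative[OF h(3)]]]; simp)
    moreover have "bounded_family (\<lambda>j x. of_real (axis k 1 $ i) * f j x + partial_deriv k (g j) x)"
      by (rule bounded_family_add[OF bounded_family_cmult[of _ _ 1] bounded_family_partial]) (use h in \<open>auto simp: axis_def\<close>)
    ultimately show "(\<lambda>j. partial_deriv k (h j)) \<in> ?Z"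
      by (intro CollectI exI[of _ "\<lambda>j. partial_deriv k (f j)"]
            exI[of _ "\<lambda>j x. of_real (axis k 1 $ i) * f j x + partial_deriv k (g j) x"])
         (auto simp: bounded_family_partial[OF h(2)])
  qed
qed

lemma schwartz_component_mult: "f \<in> schwartz \<Longrightarrow> (\<lambda>x. of_real (x $ i) * f x) \<in> schwartz"
  unfolding schwartz_iff_bounded_family by (rule bounded_family_component_mult)

lemma bounded_family_mult:
  fixes f g :: "'j \<Rightarrow> real^'n::finite \<Rightarrow> complex"
  assumes "bounded_family f" "bounded_family g"
  shows "bounded_family (\<lambda>j x. f j x * g j x)"
proof -
  \<comment> \<open>Finite sums of products are stable under the product rule; each differentiation
    doubles the number \<open>m\<close> of summands.\<close>
  let ?Z = "{\<lambda>j x. \<Sum>k<m::nat. f k j x * g k j x | (f :: nat \<Rightarrow> 'j \<Rightarrow> real^'n \<Rightarrow> complex) g m. (\<forall>k. bounded_family (f k)) \<and> (\<forall>k. bounded_family (g k))}"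
  show ?thesis
  proof (rule bounded_family_coinduct[where Z = ?Z])
    show "(\<lambda>j x. f j x * g j x) \<in> ?Z"
      by (intro CollectI exI[of _ "\<lambda>_. f"] exI[of _ "\<lambda>_. g"] exI[of _ 1]) (use assms in auto)
  next
    fix h :: "'j \<Rightarrow> real^'n \<Rightarrow> complex" and j x
    assume "h \<in> ?Z"
    then obtain f g and m::nat where h: "h = (\<lambda>j x. \<Sum>k<m. f k j x * g k j x)" "\<And>k. bounded_family (f k)" "\<And>k. bounded_family (g k)" by blast
    show "h j differentiable at x"
      unfolding h(1) using bounded_family_differentiable[OF h(2)] bounded_family_differentiable[OF h(3)]
      by (intro differentiable_sum ballI differentiable_mult) auto
  next
    fix h :: "'j \<Rightarrow> real^'n \<Rightarrow> complex" and N
    assume "h \<in> ?Z"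
    then obtain f g and m::nat where h: "h = (\<lambda>j x. \<Sum>k<m. f k j x * g k j x)" "\<And>k. bounded_family (f k)" "\<And>k. bounded_family (g k)" by blast
    have "\<exists>A>0. \<forall>j x. (1 + norm x) ^ N * norm (f k j x) \<le> A" for k using bounded_family_decay[OF h(2)] by metis
    then obtain A where A: "\<And>k. A k > 0" "\<And>k j x. (1 + norm x) ^ N * norm (f k j x) \<le> A k" by metis
    have "\<exists>A>0. \<forall>j x. (1 + norm x) ^ 0 * norm (g k j x) \<le> A" for k using bounded_family_decay[OF h(3)] by metis
    then obtain B where B: "\<And>k. B k > 0" "\<And>k j x. norm (g k j x) \<le> B k" by auto metis
    have "(1 + norm x) ^ N * norm (h j x) \<le> (\<Sum>k<m. A k * B k)" for j x
    proof -
      have "(1 + norm x) ^ N * norm (h j x) \<le> (1 + norm x) ^ N * (\<Sum>k<m. norm (f k j x * g k j x))"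
        unfolding h by (intro mult_left_mono norm_sum) auto
      also have "... = (\<Sum>k<m. ((1 + norm x) ^ N * norm (f k j x)) * norm (g k j x))"
        by (simp add: sum_distrib_left norm_mult mult.assoc)
      also have "... \<le> (\<Sum>k<m. A k * B k)"
        by (intro sum_mono mult_mono A B) (auto intro: less_imp_le A)
      finally show ?thesis .
    qed
    then show "\<exists>C. \<forall>j x. (1 + norm x) ^ N * norm (h j x) \<le> C" by blast
  next
    fix h :: "'j \<Rightarrow> real^'n \<Rightarrow> complex" and i
    assume "h \<in> ?Z"
    then obtain f g and m::nat where h: "h = (\<lambda>j x. \<Sum>k<m. f k j x * g k j x)" "\<And>k. bounded_family (f k)" "\<And>k. bounded_family (g k)" by blast
    \<comment> \<open>The first \<open>m\<close> summands carry the derivative on the second factor,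
      the last \<open>m\<close> on the first factor.\<close>
    define f' where "f' = (\<lambda>k. if k < m then f k else (\<lambda>j. partial_deriv i (f (k - m) j)))"
    define g' where "g' = (\<lambda>k. if k < m then (\<lambda>j. partial_deriv i (g k j)) else g (k - m))"
    have "(\<lambda>j. partial_deriv i (h j)) =
        (\<lambda>j x. \<Sum>k<m. f k j x * partial_deriv i (g k j) x + partial_deriv i (f k j) x * g k j x)"
      unfolding h
      by (intro ext) (subst partial_deriv_eq[OF has_derivative_sum[OF has_derivative_mult[OF bounded_family_has_derivative[OF h(2)] bounded_family_has_derivative[OF h(3)]]]]; simp)
    also have "... = (\<lambda>j x. \<Sum>k<m+m. f' k j x * g' k j x)"
    proof (intro ext)
      fix j x
      have "(\<Sum>k<m+l. f' k j x * g' k j x) = (\<Sum>k<m. f' k j x * g' k j x) + (\<Sum>k<l. f' (m + k) j x * g' (m + k) j x)" for l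
        by (induction l) auto
      then show "(\<Sum>k<m. f k j x * partial_deriv i (g k j) x + partial_deriv i (f k j) x * g k j x) = (\<Sum>k<m+m. f' k j x * g' k j x)"
        by (simp add: f'_def g'_def sum.distrib)
    qed
    finally have "(\<lambda>j. partial_deriv i (h j)) = (\<lambda>j x. \<Sum>k<m+m. f' k j x * g' k j x)" .
    moreover have "\<And>k. bounded_family (f' k)" "\<And>k. bounded_family (g' k)"
      using h bounded_family_partial[OF h(2)] bounded_family_partial[OF h(3)] by (auto simp: f'_def g'_def)
    ultimately show "(\<lambda>j. partial_deriv i (h j)) \<in> ?Z" by blast
  qed
qed

lemma schwartz_mult: "f \<in> schwartz \<Longrightarrow> g \<in> schwartz \<Longrightarrow> (\<lambda>x. f x * g x) \<in> schwartz"
  unfolding schwartz_iff_bounded_family by (rule bounded_family_mult)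

section \<open>Affine changes of variable in test functions\<close>

text \<open>The hypothesis on \<open>K\<close> says that the affine map sends points to infinity at
  least linearly, which is what transports decay: a weight of order \<open>N\<close> costs the
  factor \<open>K ^ N\<close>. Dilations, translations and orthogonal maps are the
  instances.\<close>

lemma bounded_family_affine:
  fixes f :: "'j \<Rightarrow> real^'n::finite \<Rightarrow> complex" and L :: "real^'n \<Rightarrow> real^'n"
  assumes f: "bounded_family f" and L: "linear L" and K: "\<And>x. 1 + norm x \<le> K * (1 + norm (L x + b))"
  shows "bounded_family (\<lambda>j x. f j (L x + b))"
proof -
  let ?Z = "{\<lambda>j x. f j (L x + b) | f :: 'j \<Rightarrow> real^'n \<Rightarrow> complex. bounded_family f}"
  have d: "((\<lambda>x. f j (L x + b)) has_derivative (\<lambda>v. \<Sum>k\<in>UNIV. of_real (L v $ k) * partial_deriv k (f j) (L x + b))) (at x)"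
    if "bounded_family f" for f :: "'j \<Rightarrow> real^'n::finite \<Rightarrow> complex" and j x
  proof -
    have 1: "((\<lambda>x. L x + b) has_derivative L) (at x)"
      using has_derivative_add[OF linear_imp_has_derivative[OF L] has_derivative_const[of b]] by simp
    show ?thesis
      using has_derivative_compose[OF 1 bounded_family_has_derivative[OF that]] by simp
  qed
  show ?thesis
  proof (rule bounded_family_coinduct[where Z = ?Z])
    show "(\<lambda>j x. f j (L x + b)) \<in> ?Z" using assms by blast
  next
    fix h :: "'j \<Rightarrow> real^'n \<Rightarrow> complex" and j x
    assume "h \<in> ?Z"
    then show "h j differentiable at x" using d differentiableI by blast
  next
    fix h :: "'j \<Rightarrow> real^'n \<Rightarrow> complex" and N
    assume "h \<in> ?Z"
    then obtain f where h: "h = (\<lambda>j x. f j (L x + b))" "bounded_family f" by blast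
    obtain A where A: "A > 0" "\<And>j x. (1 + norm x) ^ N * norm (f j x) \<le> A" using bounded_family_decay h(2) by blast
    have K0: "K \<ge> 0"
    proof (rule ccontr)
      assume "\<not> 0 \<le> K"
      then have "K * (1 + norm (L 0 + b)) \<le> 0" by (intro mult_nonpos_nonneg) auto
      then show False using K[of 0] by simp
    qed
    have "(1 + norm x) ^ N * norm (h j x) \<le> K ^ N * A" for j x
    proof -
      have "(1 + norm x) ^ N * norm (h j x) \<le> (K * (1 + norm (L x + b))) ^ N * norm (h j x)"
        using K[of x] by (intro mult_right_mono power_mono) auto
      also have "... = K ^ N * ((1 + norm (L x + b)) ^ N * norm (f j (L x + b)))"
        by (simp add: h power_mult_distrib)
      also have "... \<le> K ^ N * A" using A K0 by (intro mult_left_mono) auto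
      finally show ?thesis .
    qed
    then show "\<exists>C. \<forall>j x. (1 + norm x) ^ N * norm (h j x) \<le> C" by blast
  next
    fix h :: "'j \<Rightarrow> real^'n \<Rightarrow> complex" and i
    assume "h \<in> ?Z"
    then obtain f where h: "h = (\<lambda>j x. f j (L x + b))" "bounded_family f" by blast
    have "(\<lambda>j. partial_deriv i (h j)) = (\<lambda>j x. (\<lambda>j x. \<Sum>k\<in>UNIV. of_real (L (axis i 1) $ k) * partial_deriv k (f j) x) j (L x + b))"
      unfolding h by (intro ext) (rule partial_deriv_eq[OF d[OF h(2)]])
    moreover have "bounded_family (\<lambda>j x. \<Sum>k\<in>UNIV. of_real (L (axis i 1) $ k) * partial_deriv k (f j) x)"
    proof (intro bounded_family_sum)
      fix k show "bounded_family (\<lambda>j x. of_real (L (axis i 1) $ k) * partial_deriv k (f j) x)"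
        using bounded_family_cmult[OF bounded_family_partial[OF h(2)], of "\<lambda>_. of_real (L (axis i 1) $ k)"] by blast
    qed
    ultimately show "(\<lambda>j. partial_deriv i (h j)) \<in> ?Z"
      by (intro CollectI exI[of _ "\<lambda>j x. \<Sum>k\<in>UNIV. of_real (L (axis i 1) $ k) * partial_deriv k (f j) x"] conjI)
  qed
qed

lemma bounded_family_dilate:
  fixes f :: "'j \<Rightarrow> real^'n::finite \<Rightarrow> complex"
  assumes "bounded_family f" "c \<noteq> 0" shows "bounded_family (\<lambda>j x. f j (c *\<^sub>R x))"
proof -
  have "1 + norm x \<le> max 1 (1 / \<bar>c\<bar>) * (1 + norm (c *\<^sub>R x + 0))" for x :: "real^'n"
  proof -
    have "1 + norm x = 1 * 1 + (1 / \<bar>c\<bar>) * norm (c *\<^sub>R x)" using assms(2) by simp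
    also have "... \<le> max 1 (1 / \<bar>c\<bar>) * 1 + max 1 (1 / \<bar>c\<bar>) * norm (c *\<^sub>R x)"
      by (intro add_mono mult_right_mono) auto
    finally show ?thesis by (simp add: algebra_simps)
  qed
  from bounded_family_affine[OF assms(1) _ this] show ?thesis
    by (simp add: linear_scaleR)
qed

lemma schwartz_dilate: "f \<in> schwartz \<Longrightarrow> c \<noteq> 0 \<Longrightarrow> (\<lambda>x. f (c *\<^sub>R x)) \<in> schwartz"
  unfolding schwartz_iff_bounded_family by (rule bounded_family_dilate)

lemma schwartz_translate:
  assumes "f \<in> schwartz" shows "(\<lambda>x. f (x + b)) \<in> schwartz"
proof -
  have "1 + norm x \<le> (1 + norm b) * (1 + norm (x + b))" for x
  proof -
    have "norm x \<le> norm (x + b) + norm b" by (metis add_diff_cancel norm_triangle_ineq4)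
    then have "1 + norm x \<le> 1 + norm (x + b) + norm b" by simp
    also have "... \<le> 1 + norm (x + b) + norm b + norm b * norm (x + b)" by simp
    finally show ?thesis by (simp add: algebra_simps)
  qed
  from bounded_family_affine[OF _ linear_id[unfolded id_def] this, of "\<lambda>_::unit. f"] show ?thesis
    using assms unfolding schwartz_iff_bounded_family by simp
qed

lemma schwartz_orthogonal:
  fixes A :: "real^'n::finite \<Rightarrow> real^'n"
  assumes "f \<in> schwartz" "orthogonal_transformation A" shows "f \<circ> A \<in> schwartz"
proof -
  have "bounded_family (\<lambda>(_::unit) x. f (A x + 0))"
    by (rule bounded_family_affine[where f = "\<lambda>_::unit. f" and L = A and b = 0 and K = 1])
       (use assms orthogonal_transformation_norm[OF assms(2)] in
         \<open>auto simp: schwartz_iff_bounded_family orthogonal_transformation_linear\<close>)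
  then show ?thesis
    unfolding schwartz_iff_bounded_family by (simp add: o_def)
qed

subsection \<open>Changes of variables and polar coordinates\<close>

lemma nn_integral_lborel_affine:
  fixes f :: "'a::euclidean_space \<Rightarrow> ennreal"
  assumes [measurable]: "f \<in> borel_measurable borel" and "c \<noteq> 0"
  shows "(\<integral>\<^sup>+x. f x \<partial>lborel) = ennreal (\<bar>c\<bar> ^ DIM('a)) * (\<integral>\<^sup>+x. f (t + c *\<^sub>R x) \<partial>lborel)"
  by (subst lborel_affine[OF assms(2), of t]) (simp add: nn_integral_density nn_integral_distr nn_integral_cmult)

lemma
  fixes f :: "'a::euclidean_space \<Rightarrow> 'b::{banach, second_countable_topology}"
  assumes [measurable]: "f \<in> borel_measurable borel" and "c \<noteq> 0"
  shows lborel_integral_affine: "(LINT x|lborel. f x) = (\<bar>c\<bar> ^ DIM('a)) *\<^sub>R (LINT x|lborel. f (t + c *\<^sub>R x))"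
    and lborel_integrable_affine_iff: "integrable lborel (\<lambda>x. f (t + c *\<^sub>R x)) \<longleftrightarrow> integrable lborel f"
proof -
  show "(LINT x|lborel. f x) = (\<bar>c\<bar> ^ DIM('a)) *\<^sub>R (LINT x|lborel. f (t + c *\<^sub>R x))"
    by (subst lborel_affine[OF assms(2), of t]) (simp add: integral_density integral_distr)
  have "integrable lborel f \<longleftrightarrow> integrable (density (distr lborel borel (\<lambda>x. t + c *\<^sub>R x)) (\<lambda>_. ennreal (\<bar>c\<bar> ^ DIM('a)))) f"
    using lborel_affine[OF assms(2), of t] by simp
  also have "... \<longleftrightarrow> integrable lborel (\<lambda>x. (\<bar>c\<bar> ^ DIM('a)) *\<^sub>R f (t + c *\<^sub>R x))"
    by (subst integrable_density) (auto simp: integrable_distr_eq)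
  finally show "integrable lborel (\<lambda>x. f (t + c *\<^sub>R x)) \<longleftrightarrow> integrable lborel f"
    using assms(2) integrable_scaleR_right[of "1 / \<bar>c\<bar> ^ DIM('a)" lborel "\<lambda>x. (\<bar>c\<bar> ^ DIM('a)) *\<^sub>R f (t + c *\<^sub>R x)"]
    by auto
qed

text \<open>Averaging over translations: both sides, multiplied by the volume of the unit ball \<open>B\<close>, are
  the double integral of \<open>indicator B (y - A x) * indicator S y\<close>.\<close>

lemma distr_lborel_orthogonal:
  fixes A :: "real^'n::finite \<Rightarrow> real^'n"
  assumes A: "orthogonal_transformation A"
  shows "distr lborel borel A = lborel"
proof (rule measure_eqI)
  show "sets (distr lborel borel A) = sets lborel" by simp
next
  fix S :: "(real^'n) set" assume "S \<in> sets (distr lborel borel A)"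
  then have S [measurable]: "S \<in> sets borel" by simp
  have lin: "linear A" using A by (rule orthogonal_transformation_linear)
  have [measurable]: "A \<in> borel \<rightarrow>\<^sub>M borel"
    by (intro borel_measurable_continuous_onI linear_continuous_on linear_conv_bounded_linear[THEN iffD1] lin)
  let ?B = "ball 0 1 :: (real^'n) set"
  have [measurable]: "?B \<in> sets borel" by simp
  have [measurable]: "(\<lambda>x. A (fst x)) \<in> borel_measurable (lborel \<Otimes>\<^sub>M lborel)"
    "(\<lambda>x. A (snd x)) \<in> borel_measurable (lborel \<Otimes>\<^sub>M lborel)"
    by (rule measurable_compose[OF _ \<open>A \<in> borel \<rightarrow>\<^sub>M borel\<close>], simp)+
  have trans: "(\<integral>\<^sup>+x. f (x + t) \<partial>lborel) = (\<integral>\<^sup>+x. f x \<partial>lborel)"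
    if "f \<in> borel_measurable borel" for f :: "real^'n \<Rightarrow> ennreal" and t
    using nn_integral_lborel_affine[OF that, of 1 t] by (simp add: add.commute)
  have refl: "(\<integral>\<^sup>+x. f (t - x) \<partial>lborel) = (\<integral>\<^sup>+x. f x \<partial>lborel)"
    if "f \<in> borel_measurable borel" for f :: "real^'n \<Rightarrow> ennreal" and t
    using nn_integral_lborel_affine[OF that, of "-1" t] by simp
  have "emeasure lborel ?B * emeasure lborel (A -` S) =
      (\<integral>\<^sup>+y. indicator ?B y * (\<integral>\<^sup>+x. indicator S (A x) \<partial>lborel) \<partial>lborel)"
  proof -
    have "(\<integral>\<^sup>+x. indicator S (A x) \<partial>lborel) = (\<integral>\<^sup>+x. indicator (A -` S) x \<partial>(lborel :: (real^'n) measure))"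
      by (intro nn_integral_cong) (auto simp: indicator_def)
    also have "... = emeasure lborel (A -` S)"
      using measurable_sets[OF \<open>A \<in> borel \<rightarrow>\<^sub>M borel\<close> S] by (intro nn_integral_indicator) simp
    finally show ?thesis by (subst nn_integral_multc) (auto intro!: borel_measurable_indicator)
  qed
  also have "... = (\<integral>\<^sup>+y. (\<integral>\<^sup>+x. indicator ?B y * indicator S (A x + y) \<partial>lborel) \<partial>lborel)"
  proof (intro nn_integral_cong)
    fix y
    obtain z where z: "A z = y" using orthogonal_transformation_surj[OF A] by (metis surjD)
    have "(\<integral>\<^sup>+x. indicator S (A x + y) \<partial>lborel) = (\<integral>\<^sup>+x. indicator S (A (x + z)) \<partial>lborel)"
      by (simp add: linear_add[OF lin] z)
    also have "... = (\<integral>\<^sup>+x. indicator S (A x) \<partial>lborel)"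
      by (rule trans[of "\<lambda>x. indicator S (A x)"]) measurable
    finally show "indicator ?B y * (\<integral>\<^sup>+x. indicator S (A x) \<partial>lborel) = (\<integral>\<^sup>+x. indicator ?B y * indicator S (A x + y) \<partial>lborel)"
      by (simp add: nn_integral_cmult)
  qed
  also have "... = (\<integral>\<^sup>+x. (\<integral>\<^sup>+y. indicator ?B y * indicator S (A x + y) \<partial>lborel) \<partial>lborel)"
    by (intro lborel_pair.Fubini') measurable
  also have "... = (\<integral>\<^sup>+x. (\<integral>\<^sup>+y. indicator ?B (y - A x) * indicator S y \<partial>lborel) \<partial>lborel)"
  proof (rule nn_integral_cong)
    fix x
    show "(\<integral>\<^sup>+y. indicator ?B y * indicator S (A x + y) \<partial>lborel) = (\<integral>\<^sup>+y. indicator ?B (y - A x) * indicator S y \<partial>(lborel::(real^'n) measure))"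
      using trans[of "\<lambda>y. indicator ?B (y - A x) * indicator S y" "A x"] by (simp add: add.commute)
  qed
  also have "... = (\<integral>\<^sup>+y. (\<integral>\<^sup>+x. indicator ?B (y - A x) * indicator S y \<partial>lborel) \<partial>lborel)"
    by (intro lborel_pair.Fubini') measurable
  also have "... = (\<integral>\<^sup>+y. emeasure lborel ?B * indicator S y \<partial>(lborel :: (real^'n) measure))"
  proof (intro nn_integral_cong)
    fix y
    obtain z where z: "A z = y" using orthogonal_transformation_surj[OF A] by (metis surjD)
    have "norm (y - A x) = norm (z - x)" for x
      using z orthogonal_transformation_norm[OF A, of "z - x"] by (simp add: linear_diff[OF lin])
    then have "(\<integral>\<^sup>+x. indicator ?B (y - A x) \<partial>lborel) = (\<integral>\<^sup>+x. indicator ?B (z - x) \<partial>(lborel::(real^'n) measure))"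
      by (intro nn_integral_cong) (auto simp: indicator_def)
    also have "... = emeasure lborel ?B"
      using refl[of "indicator ?B" z] by simp
    finally show "(\<integral>\<^sup>+x. indicator ?B (y - A x) * indicator S y \<partial>lborel) = emeasure lborel ?B * indicator S y"
      by (simp add: nn_integral_multc)
  qed
  also have "... = emeasure lborel ?B * emeasure lborel S"
    by (simp add: nn_integral_cmult)
  finally have "emeasure lborel ?B * emeasure lborel (A -` S) = emeasure lborel ?B * emeasure lborel S" .
  moreover have "emeasure lborel ?B \<noteq> 0" "emeasure lborel ?B \<noteq> \<infinity>"
    by (auto simp: emeasure_ball unit_ball_vol_pos less_imp_neq[symmetric])
  ultimately have "emeasure lborel (A -` S) = emeasure lborel S"
    by (simp add: ennreal_mult_cancel_left)
  then show "emeasure (distr lborel borel A) S = emeasure lborel S"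
    by (simp add: emeasure_distr)
qed

lemma lborel_integral_orthogonal:
  fixes A :: "real^'n::finite \<Rightarrow> real^'n" and f :: "real^'n \<Rightarrow> 'b::{banach, second_countable_topology}"
  assumes A: "orthogonal_transformation A" and [measurable]: "f \<in> borel_measurable borel"
  shows "(LINT x|lborel. f (A x)) = (LINT x|lborel. f x)"
proof -
  have [measurable]: "A \<in> borel \<rightarrow>\<^sub>M borel"
    by (intro borel_measurable_continuous_onI linear_continuous_on linear_conv_bounded_linear[THEN iffD1]
        orthogonal_transformation_linear A)
  have "(LINT x|lborel. f x) = (LINT x|distr lborel borel A. f x)"
    by (simp add: distr_lborel_orthogonal[OF A])
  then show ?thesis by (simp add: integral_distr)
qed

section \<open>Polar coordinates with even powers of a linear form\<close>

lemma nn_integral_eq_0_off_point: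
  fixes f :: "'a::euclidean_space \<Rightarrow> ennreal"
  assumes "\<And>x. x \<noteq> a \<Longrightarrow> f x = 0"
  shows "(\<integral>\<^sup>+x. f x \<partial>lborel) = 0"
proof -
  have "AE x in lborel. f x = 0"
    using AE_lborel_singleton[of a] by eventually_elim (rule assms)
  then have "(\<integral>\<^sup>+x. f x \<partial>lborel) = (\<integral>\<^sup>+x. 0 \<partial>(lborel :: 'a measure))"
    by (rule nn_integral_cong_AE)
  then show ?thesis by simp
qed

text \<open>The integral of \<open>(x \<bullet> w) ^ (2 * m)\<close> over the unit sphere, expressed
  through the unit ball: with n the dimension, integrating r^(2m+n-1) over [0,1] gives 1/(2m+n),
  hence the factor in front. For \<open>m = 0\<close> it is the area of the sphere.\<close>

definition polar_const :: "real^'n::finite \<Rightarrow> nat \<Rightarrow> real" where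
  "polar_const w m = real (2 * m + CARD('n)) *
     enn2real (\<integral>\<^sup>+x\<in>cball 0 1. ennreal ((x \<bullet> w) ^ (2 * m)) \<partial>lborel)"

lemma polar_const_nonneg: "polar_const w m \<ge> 0"
  by (simp add: polar_const_def)

lemma polar_const_0_pos: "polar_const (w :: real^'n::finite) 0 > 0"
proof -
  have "emeasure lborel (cball 0 1 :: (real^'n) set) = ennreal (unit_ball_vol (real CARD('n)))"
    by (simp add: emeasure_cball)
  then show ?thesis
    by (simp add: polar_const_def enn2real_positive_iff)
qed

text \<open>Polar coordinates without a surface measure. The integrand is homogeneous, so a ball of
  radius \<open>a\<close> has the mass of the unit ball times a^(2m+n). Both measures therefore
  agree on half-lines, which are stable under intersection and generate the Borel sets.\<close>

lemma distr_norm_moment: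
  fixes w :: "real^'n::finite"
  shows "distr (density lborel (\<lambda>x. ennreal ((x \<bullet> w) ^ (2 * m)))) borel norm =
    density lborel (\<lambda>r. ennreal (polar_const w m * r ^ (2 * m + CARD('n) - 1)) * indicator {0..} r)"
    (is "?M = ?N")
proof -
  define p where "p = 2 * m + CARD('n)"
  have p: "p \<ge> 1" unfolding p_def using zero_less_card_finite[where 'a='n] by linarith
  define V where "V = (\<integral>\<^sup>+x\<in>cball 0 1. ennreal ((x \<bullet> w) ^ (2 * m)) \<partial>lborel)"
  have [measurable]: "cball 0 1 \<in> sets (borel :: (real^'n) measure)" by simp
  have Vfin: "V < \<infinity>"
  proof -
    have "V \<le> (\<integral>\<^sup>+x\<in>cball 0 1. ennreal (norm w ^ (2 * m)) \<partial>(lborel :: (real^'n) measure))"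
      unfolding V_def
    proof (intro nn_integral_mono)
      fix x :: "real^'n"
      have "(x \<bullet> w) ^ (2 * m) \<le> norm w ^ (2 * m)" if "norm x \<le> 1"
      proof -
        have "\<bar>x \<bullet> w\<bar> \<le> norm x * norm w" by (rule Cauchy_Schwarz_ineq2)
        also have "... \<le> norm w" using that mult_right_mono[of "norm x" 1 "norm w"] by simp
        finally have "\<bar>x \<bullet> w\<bar> ^ (2 * m) \<le> norm w ^ (2 * m)" by (intro power_mono) auto
        then show ?thesis by (simp add: power_even_abs)
      qed
      then show "ennreal ((x \<bullet> w) ^ (2 * m)) * indicator (cball 0 1) x \<le> ennreal (norm w ^ (2 * m)) * indicator (cball 0 1) x"
        by (auto simp: indicator_def intro!: ennreal_leI)
    qed
    also have "... < \<infinity>"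
      by (simp add: nn_integral_cmult_indicator emeasure_cball ennreal_mult_less_top)
    finally show ?thesis .
  qed
  \<comment> \<open>Finiteness of \<open>V\<close> is what allows the \<open>enn2real\<close> inside
    \<open>polar_const\<close> to be undone.\<close>
  have V: "V = ennreal (polar_const w m / real p)"
    using Vfin p unfolding polar_const_def V_def[symmetric] p_def[symmetric] by (simp add: less_top[symmetric])
  have eq: "emeasure ?M {..a} = emeasure ?N {..a}" and fin: "emeasure ?M {..a} \<noteq> \<infinity>" for a
  proof -
    have meas: "(\<lambda>x. ennreal ((x \<bullet> w) ^ (2 * m)) * indicator (cball 0 a) x) \<in> borel_measurable borel"
      by (intro borel_measurable_times_ennreal borel_measurable_indicator) auto
    have M: "emeasure ?M {..a} = (\<integral>\<^sup>+x\<in>cball 0 a. ennreal ((x \<bullet> w) ^ (2 * m)) \<partial>lborel)"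
    proof -
      have "emeasure ?M {..a} = emeasure (density lborel (\<lambda>x. ennreal ((x \<bullet> w) ^ (2 * m)))) (norm -` {..a})"
        by (simp add: emeasure_distr)
      also have "norm -` {..a} = (cball 0 a :: (real^'n) set)" by auto
      finally show ?thesis by (simp add: emeasure_density)
    qed
    show "emeasure ?M {..a} = emeasure ?N {..a}"
    proof (cases "a > 0")
      case True
      have "emeasure ?M {..a} = ennreal (a ^ CARD('n)) * (\<integral>\<^sup>+x. ennreal (((a *\<^sub>R x) \<bullet> w) ^ (2 * m)) * indicator (cball 0 a) (a *\<^sub>R x) \<partial>(lborel :: (real^'n) measure))"
        unfolding M using True by (subst nn_integral_lborel_affine[OF meas, where c=a and t=0]) auto
      also have "(\<integral>\<^sup>+x. ennreal (((a *\<^sub>R x) \<bullet> w) ^ (2 * m)) * indicator (cball 0 a) (a *\<^sub>R x) \<partial>(lborel :: (real^'n) measure)) =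
        (\<integral>\<^sup>+x. ennreal (a ^ (2 * m)) * (ennreal ((x \<bullet> w) ^ (2 * m)) * indicator (cball 0 1) x) \<partial>(lborel :: (real^'n) measure))"
        using True by (intro nn_integral_cong) (auto simp: indicator_def ennreal_mult[symmetric] power_mult_distrib)
      also have "... = ennreal (a ^ (2 * m)) * V"
        unfolding V_def by (rule nn_integral_cmult) measurable
      finally have 1: "emeasure ?M {..a} = ennreal (polar_const w m * a ^ p / real p)"
        using True polar_const_nonneg[of w m] by (simp add: V p_def ennreal_mult[symmetric] power_add mult_ac)
      have "emeasure ?N {..a} = (\<integral>\<^sup>+r. ennreal (polar_const w m * r ^ (p - 1)) * indicator {0..a} r \<partial>lborel)"
        unfolding p_def by (subst emeasure_density) (auto intro!: nn_integral_cong simp: indicator_def)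
      also have "... = ennreal (polar_const w m * a ^ p / real p - polar_const w m * 0 ^ p / real p)"
      proof (rule nn_integral_FTC_Icc[where F = "\<lambda>r. polar_const w m * r ^ p / real p"])
        fix x :: real assume "x \<in> {0..a}"
        show "((\<lambda>r. polar_const w m * r ^ p / real p) has_real_derivative polar_const w m * x ^ (p - 1)) (at x)"
          using p by (auto intro!: derivative_eq_intros)
        show "0 \<le> polar_const w m * x ^ (p - 1)" using polar_const_nonneg[of w m] \<open>x \<in> {0..a}\<close> by simp
      qed (use True in auto)
      finally have 2: "emeasure ?N {..a} = ennreal (polar_const w m * a ^ p / real p - polar_const w m * 0 ^ p / real p)" .
      have z: "(0::real) ^ p = 0" using p by (simp add: zero_power)
      show ?thesis unfolding 1 2 z by simp
    next
      case False
      have "emeasure ?M {..a} = 0"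
      proof -
        have "(\<integral>\<^sup>+x\<in>cball 0 a. ennreal ((x \<bullet> w) ^ (2 * m)) \<partial>(lborel :: (real^'n) measure)) = 0"
          using False by (intro nn_integral_eq_0_off_point[of 0]) (auto simp: indicator_def simp flip: zero_less_norm_iff)
        then show ?thesis by (simp add: M)
      qed
      moreover have "emeasure ?N {..a} = 0"
        using False by (subst emeasure_density, simp, simp)
          (intro nn_integral_eq_0_off_point[of 0], auto simp: indicator_def)
      ultimately show ?thesis by simp
    qed
    show "emeasure ?M {..a} \<noteq> \<infinity>"
    proof (cases "a > 0")
      case True
      have "emeasure ?M {..a} = ennreal (a ^ CARD('n)) * (\<integral>\<^sup>+x. ennreal (((a *\<^sub>R x) \<bullet> w) ^ (2 * m)) * indicator (cball 0 a) (a *\<^sub>R x) \<partial>(lborel :: (real^'n) measure))"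
        unfolding M using True by (subst nn_integral_lborel_affine[OF meas, where c=a and t=0]) auto
      also have "(\<integral>\<^sup>+x. ennreal (((a *\<^sub>R x) \<bullet> w) ^ (2 * m)) * indicator (cball 0 a) (a *\<^sub>R x) \<partial>(lborel :: (real^'n) measure)) =
        (\<integral>\<^sup>+x. ennreal (a ^ (2 * m)) * (ennreal ((x \<bullet> w) ^ (2 * m)) * indicator (cball 0 1) x) \<partial>(lborel :: (real^'n) measure))"
        using True by (intro nn_integral_cong) (auto simp: indicator_def ennreal_mult[symmetric] power_mult_distrib)
      also have "... = ennreal (a ^ (2 * m)) * V"
        unfolding V_def by (rule nn_integral_cmult) measurable
      finally show ?thesis using Vfin by (simp add: ennreal_mult_eq_top_iff less_top)
    next
      case False
      then have "(\<integral>\<^sup>+x\<in>cball 0 a. ennreal ((x \<bullet> w) ^ (2 * m)) \<partial>(lborel :: (real^'n) measure)) = 0"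
        by (intro nn_integral_eq_0_off_point[of 0]) (auto simp: indicator_def simp flip: zero_less_norm_iff)
      then show ?thesis by (simp add: M)
    qed
  qed
  show ?thesis
  proof (rule measure_eqI_generator_eq[where E = "range (\<lambda>a::real. {..a})" and \<Omega> = UNIV and A = "\<lambda>i. {..real i}"])
    show "Int_stable (range (\<lambda>a::real. {..a}))"
      by (auto simp: Int_stable_def intro!: exI[of _ "min _ _"])
    show "sets ?M = sigma_sets UNIV (range (\<lambda>a::real. {..a}))" "sets ?N = sigma_sets UNIV (range (\<lambda>a::real. {..a}))"
      by (simp_all add: borel_eq_atMost)
    show "(\<Union>i. {..real i}) = UNIV" using real_arch_simple by auto
  qed (use eq fin in auto)
qed

lemma nn_integral_polar:
  fixes w :: "real^'n::finite"
  assumes [measurable]: "h \<in> borel_measurable borel"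
  shows "(\<integral>\<^sup>+x. ennreal ((x \<bullet> w) ^ (2 * m)) * h (norm x) \<partial>lborel) =
    (\<integral>\<^sup>+r. ennreal (polar_const w m * r ^ (2 * m + CARD('n) - 1)) * indicator {0..} r * h r \<partial>lborel)"
proof -
  have "(\<integral>\<^sup>+r. h r \<partial>distr (density lborel (\<lambda>x. ennreal ((x \<bullet> w) ^ (2 * m)))) borel norm) =
    (\<integral>\<^sup>+x. ennreal ((x \<bullet> w) ^ (2 * m)) * h (norm x) \<partial>lborel)"
    by (simp add: nn_integral_distr nn_integral_density)
  then show ?thesis unfolding distr_norm_moment by (simp add: nn_integral_density)
qed

lemma
  fixes w :: "real^'n::finite" and h :: "real \<Rightarrow> complex"
  assumes [measurable]: "h \<in> borel_measurable borel"
  shows integrable_polar: "integrable lborel (\<lambda>x. of_real ((x \<bullet> w) ^ (2 * m)) * h (norm x)) \<longleftrightarrow>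
       integrable lborel (\<lambda>r. of_real (polar_const w m * r ^ (2 * m + CARD('n) - 1) * indicator {0..} r) * h r)"
    and integral_polar: "(LINT x|lborel. of_real ((x \<bullet> w) ^ (2 * m)) * h (norm x)) =
       (LINT r|lborel. of_real (polar_const w m * r ^ (2 * m + CARD('n) - 1) * indicator {0..} r) * h r)"
proof -
  let ?M = "distr (density lborel (\<lambda>x. ennreal ((x \<bullet> w) ^ (2 * m)))) borel norm"
  let ?d = "\<lambda>r. polar_const w m * r ^ (2 * m + CARD('n) - 1) * indicator {0..} r"
  have N: "?M = density lborel (\<lambda>r. ennreal (?d r))"
    unfolding distr_norm_moment by (intro density_cong) (auto simp: indicator_def)
  have d: "?d r \<ge> 0" for r using polar_const_nonneg[of w m] by (auto simp: indicator_def)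
  have "integrable ?M h \<longleftrightarrow> integrable lborel (\<lambda>x. of_real ((x \<bullet> w) ^ (2 * m)) * h (norm x))"
    by (simp add: integrable_distr_eq integrable_density scaleR_conv_of_real)
  moreover have "integrable ?M h \<longleftrightarrow> integrable lborel (\<lambda>r. of_real (?d r) * h r)"
    unfolding N using d by (subst integrable_density) (auto simp: scaleR_conv_of_real)
  ultimately show "integrable lborel (\<lambda>x. of_real ((x \<bullet> w) ^ (2 * m)) * h (norm x)) \<longleftrightarrow>
       integrable lborel (\<lambda>r. of_real (?d r) * h r)" by simp
  have "integral\<^sup>L ?M h = (LINT x|lborel. of_real ((x \<bullet> w) ^ (2 * m)) * h (norm x))"
    by (simp add: integral_distr integral_density scaleR_conv_of_real)
  moreover have "integral\<^sup>L ?M h = (LINT r|lborel. of_real (?d r) * h r)"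
    unfolding N using d by (subst integral_density) (auto simp: scaleR_conv_of_real)
  ultimately show "(LINT x|lborel. of_real ((x \<bullet> w) ^ (2 * m)) * h (norm x)) = (LINT r|lborel. of_real (?d r) * h r)" by simp
qed

text \<open>The case \<open>w = 0\<close>, \<open>m = 0\<close> of the moment formula, where
  \<open>(x \<bullet> w) ^ (2 * m)\<close> is \<open>0 ^ 0 = 1\<close>: the image of Lebesgue
  measure under the norm has a density that is positive for r > 0 and zero for r < 0, and the point
  0 is null.\<close>

lemma AE_norm_iff:
  assumes [measurable]: "Measurable.pred borel P"
  shows "(AE x in (lborel :: (real^'n::finite) measure). P (norm x)) \<longleftrightarrow> (AE r in lborel. r > 0 \<longrightarrow> P r)"
proof -
  let ?M = "distr (density lborel (\<lambda>x::real^'n. ennreal ((x \<bullet> 0) ^ (2 * 0)))) borel norm"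
  have "(AE r in ?M. P r) \<longleftrightarrow> (AE x in (lborel :: (real^'n::finite) measure). P (norm x))"
    by (simp add: AE_distr_iff AE_density)
  moreover have "(AE r in ?M. P r) \<longleftrightarrow> (AE r in lborel. r > 0 \<longrightarrow> P r)"
    unfolding distr_norm_moment using polar_const_0_pos[of "0::real^'n"]
    apply (subst AE_density, simp)
    apply (rule iffI)
    subgoal by (erule eventually_mono) (auto simp: indicator_def)
    subgoal premises prems using prems(2) AE_lborel_singleton[of 0] by eventually_elim (use prems(1) in \<open>auto simp: indicator_def split: if_splits\<close>)
    done
  ultimately show ?thesis by simp
qed

text \<open>The majorant behind most later applications of dominated convergence. In polar
  coordinates n-1 of the n+1 powers are spent on the Jacobian and 1/(1+r)^2 remains.\<close>

lemma integrable_one_plus_norm: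
  "integrable lborel (\<lambda>x::real^'n::finite. 1 / (1 + norm x) ^ (CARD('n) + 1))"
proof (rule integrableI_nonneg)
  have "(\<integral>\<^sup>+x. ennreal (1 / (1 + norm x) ^ (CARD('n) + 1)) \<partial>(lborel :: (real^'n) measure)) =
     (\<integral>\<^sup>+x. ennreal ((x \<bullet> 0) ^ (2 * 0)) * ennreal (1 / (1 + norm x) ^ (CARD('n) + 1)) \<partial>(lborel :: (real^'n) measure))" by simp
  also have "... = (\<integral>\<^sup>+r. ennreal (polar_const (0::real^'n) 0 * r ^ (CARD('n) - 1)) * indicator {0..} r * ennreal (1 / (1 + r) ^ (CARD('n) + 1)) \<partial>lborel)"
    by (subst nn_integral_polar) auto
  also have "... \<le> (\<integral>\<^sup>+r. ennreal (polar_const (0::real^'n) 0) * (ennreal (1 / (1 + r) ^ 2) * indicator {0..} r) \<partial>lborel)"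
  proof (intro nn_integral_mono)
    fix r :: real
    have "r ^ (CARD('n) - 1) * (1 / (1 + r) ^ (CARD('n) + 1)) \<le> 1 / (1 + r) ^ 2" if "r \<ge> 0"
    proof -
      have n: "CARD('n) \<ge> 1" using zero_less_card_finite[where 'a='n] by linarith
      have "CARD('n) + 1 = (CARD('n) - 1) + 2" using n by simp
      then have "(1 + r) ^ (CARD('n) + 1) = (1 + r) ^ (CARD('n) - 1) * (1 + r) ^ 2"
        by (metis power_add)
      moreover have "r ^ (CARD('n) - 1) \<le> (1 + r) ^ (CARD('n) - 1)" using that by (intro power_mono) auto
      ultimately show ?thesis using that by (simp add: divide_simps)
    qed
    then show "ennreal (polar_const (0::real^'n) 0 * r ^ (CARD('n) - 1)) * indicator {0..} r * ennreal (1 / (1 + r) ^ (CARD('n) + 1))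
      \<le> ennreal (polar_const (0::real^'n) 0) * (ennreal (1 / (1 + r) ^ 2) * indicator {0..} r)"
      using polar_const_nonneg[of "0::real^'n" 0]
      by (auto simp: indicator_def ennreal_mult[symmetric] mult.assoc intro!: ennreal_leI mult_left_mono simp del: times_divide_eq_right)
  qed
  also have "... = ennreal (polar_const (0::real^'n) 0) * (\<integral>\<^sup>+r. ennreal (1 / (1 + r) ^ 2) * indicator {0..} r \<partial>lborel)"
    by (rule nn_integral_cmult) measurable
  also have "(\<integral>\<^sup>+r. ennreal (1 / (1 + r) ^ 2) * indicator {0::real..} r \<partial>lborel) = ennreal (0 - (- 1 / (1 + 0)))"
  proof (rule nn_integral_FTC_atLeast[where F = "\<lambda>x. - 1 / (1 + x)"])
    fix x :: real assume "0 \<le> x"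
    then show "((\<lambda>x. - 1 / (1 + x)) has_real_derivative 1 / (1 + x)\<^sup>2) (at x)"
      by (auto intro!: derivative_eq_intros simp: power2_eq_square)
  next
    show "((\<lambda>x::real. - 1 / (1 + x)) \<longlongrightarrow> 0) at_top"
      by (intro tendsto_divide_0[OF tendsto_const] filterlim_at_top_imp_at_infinity
          filterlim_tendsto_add_at_top[OF tendsto_const] filterlim_ident)
  qed auto
  finally show "(\<integral>\<^sup>+x. ennreal (1 / (1 + norm x) ^ (CARD('n) + 1)) \<partial>(lborel :: (real^'n) measure)) < \<infinity>"
    by (simp add: ennreal_mult_less_top order_le_less_trans)
qed auto

subsection \<open>The Fourier transform on the Schwartz space\<close>

lemma finite_length_le: "finite {is :: 'n::finite list. length is \<le> N}"
  using finite_lists_length_le[of "UNIV :: 'n set" N] by simp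

lemma schwartz_seminorm_upper:
  assumes "f \<in> schwartz"
  shows "(1 + norm x) ^ N * norm (iterated_partial is f x) \<le> schwartz_seminorm N is f"
proof -
  have "bounded (range (\<lambda>x. (1 + norm x) ^ N *\<^sub>R iterated_partial is f x))"
    using assms unfolding schwartz_def by blast
  then have "bdd_above (range (\<lambda>x. (1 + norm x) ^ N * norm (iterated_partial is f x)))"
    by (auto simp: bounded_iff bdd_above_def)
  then show ?thesis unfolding schwartz_seminorm_def by (rule cSUP_upper[OF UNIV_I])
qed

lemma schwartz_seminorm_nonneg: "f \<in> schwartz \<Longrightarrow> schwartz_seminorm N is f \<ge> 0"
  by (rule order_trans[OF _ schwartz_seminorm_upper[of f 0]]) simp

lemma schwartz_seminorm_mono:
  assumes "f \<in> schwartz" "M \<le> N"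
  shows "schwartz_seminorm M is f \<le> schwartz_seminorm N is f"
  unfolding schwartz_seminorm_def[of M]
proof (rule cSUP_least)
  fix x
  have "(1 + norm x) ^ M * norm (iterated_partial is f x) \<le> (1 + norm x) ^ N * norm (iterated_partial is f x)"
    using assms(2) by (intro mult_right_mono power_increasing) auto
  also have "... \<le> schwartz_seminorm N is f" by (rule schwartz_seminorm_upper[OF assms(1)])
  finally show "(1 + norm x) ^ M * norm (iterated_partial is f x) \<le> schwartz_seminorm N is f" .
qed simp

text \<open>The sum that occurs in the continuity bound of \<open>tempered\<close>. It grows with
  \<open>N\<close>, and on a bounded family each of these sums is bounded.\<close>

definition total_seminorm :: "nat \<Rightarrow> (real^'n::finite \<Rightarrow> complex) \<Rightarrow> real" where
  "total_seminorm N f = (\<Sum>is | length is \<le> N. schwartz_seminorm N is f)"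

lemma total_seminorm_nonneg: "f \<in> schwartz \<Longrightarrow> total_seminorm N f \<ge> 0"
  unfolding total_seminorm_def by (intro sum_nonneg schwartz_seminorm_nonneg)

lemma total_seminorm_mono:
  assumes "f \<in> schwartz" "M \<le> N" shows "total_seminorm M f \<le> total_seminorm N f"
proof -
  have "total_seminorm M f \<le> (\<Sum>is | length is \<le> M. schwartz_seminorm N is f)"
    unfolding total_seminorm_def by (intro sum_mono schwartz_seminorm_mono assms)
  also have "... \<le> total_seminorm N f"
    unfolding total_seminorm_def using assms
    by (intro sum_mono2 finite_length_le) (auto intro: schwartz_seminorm_nonneg)
  finally show ?thesis .
qed

lemma total_seminorm_upper:
  assumes "f \<in> schwartz" "length is \<le> N"
  shows "(1 + norm x) ^ N * norm (iterated_partial is f x) \<le> total_seminorm N f"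
proof -
  have "schwartz_seminorm N is f \<le> total_seminorm N f"
    unfolding total_seminorm_def
    by (rule member_le_sum) (auto intro: assms schwartz_seminorm_nonneg finite_length_le)
  then show ?thesis using schwartz_seminorm_upper[OF assms(1)] order_trans by blast
qed

lemma total_seminorm_partial:
  assumes "f \<in> schwartz"
  shows "total_seminorm N (partial_deriv i f) \<le> total_seminorm (Suc N) f"
proof -
  have "total_seminorm N (partial_deriv i f) = (\<Sum>is | length is \<le> N. schwartz_seminorm N (is @ [i]) f)"
    by (simp add: total_seminorm_def schwartz_seminorm_def iterated_partial_snoc)
  also have "... \<le> (\<Sum>is | length is \<le> N. schwartz_seminorm (Suc N) (is @ [i]) f)"
    by (intro sum_mono schwartz_seminorm_mono assms) auto
  also have "... = (\<Sum>is\<in>(\<lambda>is. is @ [i]) ` {is. length is \<le> N}. schwartz_seminorm (Suc N) is f)"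
    by (subst sum.reindex) (auto simp: inj_on_def)
  also have "... \<le> total_seminorm (Suc N) f"
    unfolding total_seminorm_def
    by (intro sum_mono2 finite_length_le) (auto intro: schwartz_seminorm_nonneg assms)
  finally show ?thesis .
qed

lemma bounded_family_total_seminorm:
  assumes "bounded_family f"
  obtains C where "C > 0" "\<And>j. total_seminorm N (f j) \<le> C"
proof -
  have "\<exists>C. \<forall>j x. (1 + norm x) ^ N * norm (iterated_partial is (f j) x) \<le> C" for "is"
    using assms unfolding bounded_family_def by blast
  then obtain C where C: "\<And>is j x. (1 + norm x) ^ N * norm (iterated_partial is (f j) x) \<le> C is"
    by metis
  have "total_seminorm N (f j) \<le> max 1 (\<Sum>is | length is \<le> N. C is)" for j
  proof -
    have "total_seminorm N (f j) \<le> (\<Sum>is | length is \<le> N. C is)"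
      unfolding total_seminorm_def schwartz_seminorm_def by (intro sum_mono cSUP_least C) simp
    then show ?thesis by simp
  qed
  then show ?thesis using that[of "max 1 (\<Sum>is | length is \<le> N. C is)"] by simp
qed

lemma schwartz_continuous: "f \<in> schwartz \<Longrightarrow> continuous_on UNIV f"
  by (simp add: continuous_at_imp_continuous_on differentiable_imp_continuous_within schwartz_differentiable)

lemma schwartz_measurable [measurable_dest]: "f \<in> schwartz \<Longrightarrow> f \<in> borel_measurable borel"
  by (intro borel_measurable_continuous_onI schwartz_continuous)

lemma schwartz_integrable_bound:
  fixes f :: "'n::finite cfun"
  assumes "f \<in> schwartz"
  shows "norm (f x) \<le> total_seminorm (CARD('n) + 1) f * (1 / (1 + norm x) ^ (CARD('n) + 1))"
proof -
  have *: "a \<le> T * (1 / P)" if "P * a \<le> T" "P > 0" for a T P :: real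
    using that by (simp add: field_simps)
  show ?thesis
    using total_seminorm_upper[OF assms, of "[]" "CARD('n) + 1" x] by (intro *) (auto simp: add_pos_nonneg)
qed

lemma schwartz_integrable:
  fixes f :: "'n::finite cfun"
  assumes f: "f \<in> schwartz"
  shows "integrable lborel f"
proof (rule Bochner_Integration.integrable_bound)
  show "integrable lborel (\<lambda>x::real^'n. total_seminorm (CARD('n) + 1) f * (1 / (1 + norm x) ^ (CARD('n) + 1)))"
    by (rule integrable_mult_right[OF integrable_one_plus_norm])
  show "f \<in> borel_measurable lborel" using schwartz_measurable[OF f] by simp
  have "total_seminorm (CARD('n) + 1) f \<ge> 0" by (rule total_seminorm_nonneg[OF f])
  then show "AE x in lborel. norm (f x) \<le> norm (total_seminorm (CARD('n) + 1) f * (1 / (1 + norm x) ^ (CARD('n) + 1)))"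
    using schwartz_integrable_bound[OF f] by (intro AE_I2) simp
qed

section \<open>Derivatives and decay of Fourier transforms\<close>

lemma cis_measurable [measurable]: "cis \<in> borel_measurable borel"
  by (intro borel_measurable_continuous_onI continuous_intros)

lemma integrable_cis_mult:
  fixes f :: "'n::finite cfun" and g :: "real^'n \<Rightarrow> real"
  assumes "integrable lborel f" and [measurable]: "g \<in> borel_measurable borel"
  shows "integrable lborel (\<lambda>x. cis (g x) * f x)"
  by (rule Bochner_Integration.integrable_bound[OF assms(1)]) (use borel_measurable_integrable[OF assms(1)] in \<open>auto simp: norm_mult\<close>)

lemma norm_fourier_le:
  fixes f :: "'n::finite cfun"
  shows "norm (fourier f \<xi>) \<le> (2 * pi) powr (- real CARD('n) / 2) * (LINT x|lborel. norm (f x))"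
proof -
  have "norm (LINT x|lborel. cis (- (x \<bullet> \<xi>)) * f x) \<le> (LINT x|lborel. norm (cis (- (x \<bullet> \<xi>)) * f x))"
    by (rule integral_norm_bound)
  then show ?thesis by (simp add: fourier_def norm_mult mult_left_mono)
qed

lemma norm_diff_le_vector_derivative:
  fixes g :: "real \<Rightarrow> 'a::real_normed_vector"
  assumes "convex S" and d: "\<And>t. t \<in> S \<Longrightarrow> (g has_vector_derivative g' t) (at t within S)"
    and B: "\<And>t. t \<in> S \<Longrightarrow> norm (g' t) \<le> B" and "a \<in> S" "b \<in> S"
  shows "norm (g b - g a) \<le> B * \<bar>b - a\<bar>"
proof -
  have "norm (g b - g a) \<le> B * norm (b - a)"
  proof (rule differentiable_bound[OF assms(1)])
    fix t assume "t \<in> S"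
    then show "(g has_derivative (\<lambda>x. x *\<^sub>R g' t)) (at t within S)"
      using d by (simp add: has_vector_derivative_def)
    have "onorm (\<lambda>x. x *\<^sub>R g' t) \<le> norm (g' t)"
      by (intro onorm_bound) (auto simp: mult.commute)
    then show "onorm (\<lambda>x. x *\<^sub>R g' t) \<le> B" using B[OF \<open>t \<in> S\<close>] by simp
  qed fact+
  then show ?thesis by simp
qed

lemma has_vector_derivative_iff_quotient:
  fixes g :: "real \<Rightarrow> 'a::real_normed_vector"
  shows "(g has_vector_derivative D) (at a within S) \<longleftrightarrow> ((\<lambda>t. (g t - g a) /\<^sub>R (t - a)) \<longlongrightarrow> D) (at a within S)"
proof -
  have "(g has_vector_derivative D) (at a within S) \<longleftrightarrow>
      ((\<lambda>y. norm ((g y - g a) - (y - a) *\<^sub>R D) / norm (y - a)) \<longlongrightarrow> 0) (at a within S)"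
    by (simp add: has_vector_derivative_def has_derivative_iff_norm bounded_linear_scaleR_left)
  also have "... \<longleftrightarrow> ((\<lambda>y. norm ((g y - g a) /\<^sub>R (y - a) - D)) \<longlongrightarrow> 0) (at a within S)"
  proof (rule filterlim_cong[OF refl refl])
    have "norm ((g y - g a) - (y - a) *\<^sub>R D) / norm (y - a) = norm ((g y - g a) /\<^sub>R (y - a) - D)" if "y \<noteq> a" for y
    proof -
      have "(g y - g a) /\<^sub>R (y - a) - D = ((g y - g a) - (y - a) *\<^sub>R D) /\<^sub>R (y - a)"
        using that by (simp add: scaleR_diff_right)
      then show ?thesis by (simp add: divide_inverse mult.commute)
    qed
    then show "\<forall>\<^sub>F y in at a within S. norm ((g y - g a) - (y - a) *\<^sub>R D) / norm (y - a) = norm ((g y - g a) /\<^sub>R (y - a) - D)"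
      by (auto simp: eventually_at_filter)
  qed
  also have "... \<longleftrightarrow> ((\<lambda>t. (g t - g a) /\<^sub>R (t - a)) \<longlongrightarrow> D) (at a within S)"
    by (simp add: tendsto_norm_zero_iff Lim_null[symmetric])
  finally show ?thesis .
qed

lemma schwartz_directional:
  assumes "f \<in> schwartz"
  shows "((\<lambda>t. f (x + t *\<^sub>R axis i 1)) has_vector_derivative partial_deriv i f (x + t *\<^sub>R axis i 1)) (at t within S)"
proof -
  have 1: "((\<lambda>t. x + t *\<^sub>R axis i 1) has_derivative (\<lambda>h. h *\<^sub>R axis i 1)) (at t within S)"
    by (auto intro!: derivative_eq_intros)
  have "(f has_derivative (\<lambda>v. \<Sum>k\<in>UNIV. of_real (v $ k) * partial_deriv k f (x + t *\<^sub>R axis i 1))) (at (x + t *\<^sub>R axis i 1))"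
    by (rule schwartz_has_derivative[OF assms])
  from has_derivative_compose[OF 1 this]
  have "((\<lambda>t. f (x + t *\<^sub>R axis i 1)) has_derivative
     (\<lambda>h. \<Sum>k\<in>UNIV. of_real ((h *\<^sub>R axis i 1) $ k) * partial_deriv k f (x + t *\<^sub>R axis i 1))) (at t within S)" .
  moreover have "(\<Sum>k\<in>UNIV. of_real ((h *\<^sub>R axis i 1) $ k) * partial_deriv k f (x + t *\<^sub>R axis i 1)) = h *\<^sub>R partial_deriv i f (x + t *\<^sub>R axis i 1)" for h
  proof -
    have "(\<Sum>k\<in>UNIV. of_real ((h *\<^sub>R axis i 1) $ k) * partial_deriv k f (x + t *\<^sub>R axis i 1)) =
      of_real h * (\<Sum>k\<in>UNIV. of_real (axis i 1 $ k) * partial_deriv k f (x + t *\<^sub>R axis i 1))"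
      by (simp only: sum_distrib_left) (simp only: mult.assoc of_real_mult vector_scaleR_component real_scaleR_def)
    then show ?thesis by (simp only: sum_axis_component scaleR_conv_of_real)
  qed
  ultimately show ?thesis by (simp add: has_vector_derivative_def)
qed

text \<open>Translation invariance of the integral, applied to the difference quotients of \<open>f\<close>.\<close>

lemma fourier_partial:
  fixes f :: "'n::finite cfun"
  assumes f: "f \<in> schwartz"
  shows "fourier (partial_deriv i f) \<xi> = \<i> * of_real (\<xi> $ i) * fourier f \<xi>"
proof -
  define e where "e = (axis i 1 :: real^'n)"
  define h where "h k = 1 / real (Suc k)" for k
  have h: "0 < h k" "h k \<le> 1" for k by (auto simp: h_def)
  have h0: "h \<longlonglongrightarrow> 0" unfolding h_def by (rule LIMSEQ_Suc[OF lim_1_over_n])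
  define q where "q k x = (f (x + h k *\<^sub>R e) - f x) / of_real (h k)" for k x
  define p where "p = partial_deriv i f"
  have p: "p \<in> schwartz" unfolding p_def by (rule schwartz_partial[OF f])
  define m where "m = CARD('n) + 1"
  define c where "c = total_seminorm m p"
  have c: "c \<ge> 0" unfolding c_def by (rule total_seminorm_nonneg[OF p])
  \<comment> \<open>Mean value inequality along the segment. As \<open>h k \<le> 1\<close>, the
    weight 1+|x| changes by at most the factor 2 along it, which accounts for \<open>2 ^ m\<close>
    and makes the bound uniform in \<open>k\<close>.\<close>
  have qb: "norm (q k x) \<le> c * 2 ^ m * (1 / (1 + norm x) ^ m)" for k x
  proof -
    have "norm (f (x + h k *\<^sub>R e) - f (x + 0 *\<^sub>R e)) \<le> (c * 2 ^ m * (1 / (1 + norm x) ^ m)) * \<bar>h k - 0\<bar>"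
    proof (rule norm_diff_le_vector_derivative[where S = "{0..h k}" and g = "\<lambda>t. f (x + t *\<^sub>R e)"])
      fix t assume t: "t \<in> {0..h k}"
      show "((\<lambda>t. f (x + t *\<^sub>R e)) has_vector_derivative p (x + t *\<^sub>R e)) (at t within {0..h k})"
        unfolding e_def p_def by (rule schwartz_directional[OF f])
      have "norm (t *\<^sub>R e) \<le> 1" using t h(2)[of k] by (simp add: e_def)
      moreover have "norm x \<le> norm (x + t *\<^sub>R e) + norm (t *\<^sub>R e)"
        using norm_triangle_ineq4[of "x + t *\<^sub>R e" "t *\<^sub>R e"] by simp
      ultimately have "1 + norm x \<le> 2 * (1 + norm (x + t *\<^sub>R e))" using norm_ge_zero[of "x + t *\<^sub>R e"] by (smt (verit))
      then have "(1 + norm x) ^ m \<le> (2 * (1 + norm (x + t *\<^sub>R e))) ^ m" by (intro power_mono) auto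
      then have "(1 + norm x) ^ m \<le> 2 ^ m * (1 + norm (x + t *\<^sub>R e)) ^ m" by (simp only: power_mult_distrib)
      moreover have "(1 + norm x) ^ m > 0" "(1 + norm (x + t *\<^sub>R e)) ^ m > 0" by (auto simp: add_pos_nonneg)
      ultimately have "1 / (1 + norm (x + t *\<^sub>R e)) ^ m \<le> 2 ^ m * (1 / (1 + norm x) ^ m)"
        by (simp add: divide_simps)
      then have "c * (1 / (1 + norm (x + t *\<^sub>R e)) ^ m) \<le> c * (2 ^ m * (1 / (1 + norm x) ^ m))"
        by (intro mult_left_mono c)
      then show "norm (p (x + t *\<^sub>R e)) \<le> c * 2 ^ m * (1 / (1 + norm x) ^ m)"
        using schwartz_integrable_bound[OF p, of "x + t *\<^sub>R e"] unfolding m_def[symmetric] c_def[symmetric] by simp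
    qed (use h[of k] in auto)
    then show ?thesis using h[of k] by (simp add: q_def norm_divide divide_le_eq)
  qed
  have ql: "(\<lambda>k. q k x) \<longlonglongrightarrow> p x" for x
  proof -
    have "((\<lambda>t. f (x + t *\<^sub>R e)) has_vector_derivative p (x + 0 *\<^sub>R e)) (at 0)"
      unfolding e_def p_def by (rule schwartz_directional[OF f])
    then have "((\<lambda>t. (f (x + t *\<^sub>R e) - f (x + 0 *\<^sub>R e)) /\<^sub>R (t - 0)) \<longlongrightarrow> p (x + 0 *\<^sub>R e)) (at 0)"
      unfolding has_vector_derivative_iff_quotient .
    moreover have "filterlim h (at 0) sequentially"
      using h0 h(1) by (auto simp: filterlim_at less_imp_neq[symmetric])
    ultimately have "(\<lambda>k. (f (x + h k *\<^sub>R e) - f (x + 0 *\<^sub>R e)) /\<^sub>R (h k - 0)) \<longlonglongrightarrow> p (x + 0 *\<^sub>R e)"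
      by (rule filterlim_compose)
    then show ?thesis by (simp add: q_def scaleR_conv_of_real divide_inverse mult.commute)
  qed
  note [measurable] = schwartz_measurable[OF f] schwartz_measurable[OF p]
  have "(\<lambda>k. LINT x|lborel. cis (- (x \<bullet> \<xi>)) * q k x) \<longlonglongrightarrow> (LINT x|lborel. cis (- (x \<bullet> \<xi>)) * p x)"
  proof (rule integral_dominated_convergence)
    show "integrable lborel (\<lambda>x::real^'n. c * 2 ^ m * (1 / (1 + norm x) ^ m))"
      unfolding m_def by (rule integrable_mult_right[OF integrable_one_plus_norm])
    show "AE x in lborel. (\<lambda>k. cis (- (x \<bullet> \<xi>)) * q k x) \<longlonglongrightarrow> cis (- (x \<bullet> \<xi>)) * p x"
      by (intro AE_I2 tendsto_mult_left ql)
    show "AE x in lborel. norm (cis (- (x \<bullet> \<xi>)) * q k x) \<le> c * 2 ^ m * (1 / (1 + norm x) ^ m)" for k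
      using qb by (intro AE_I2) (simp add: norm_mult)
  qed (auto simp: q_def)
  moreover have "(LINT x|lborel. cis (- (x \<bullet> \<xi>)) * q k x) =
     ((cis (h k * \<xi> $ i) - 1) / of_real (h k)) * (LINT x|lborel. cis (- (x \<bullet> \<xi>)) * f x)" for k
  proof -
    have i1: "integrable lborel (\<lambda>x. cis (- (x \<bullet> \<xi>)) * f x)"
      by (intro integrable_cis_mult schwartz_integrable f) simp
    have i2: "integrable lborel (\<lambda>x. cis (- (x \<bullet> \<xi>)) * f (x + h k *\<^sub>R e))"
      by (intro integrable_cis_mult schwartz_integrable schwartz_translate f) simp
    have "(LINT x|lborel. cis (- (x \<bullet> \<xi>)) * f (x + h k *\<^sub>R e)) = cis (h k * \<xi> $ i) * (LINT x|lborel. cis (- (x \<bullet> \<xi>)) * f x)"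
    proof -
      have "(LINT x|lborel. cis (- (x \<bullet> \<xi>)) * f x) = (LINT x|lborel. cis (- ((h k *\<^sub>R e + x) \<bullet> \<xi>)) * f (h k *\<^sub>R e + x))"
        using lborel_integral_affine[of "\<lambda>x. cis (- (x \<bullet> \<xi>)) * f x" 1 "h k *\<^sub>R e"] by simp
      also have "... = (LINT x|lborel. cis (- (h k * \<xi> $ i)) * (cis (- (x \<bullet> \<xi>)) * f (x + h k *\<^sub>R e)))"
      proof (intro Bochner_Integration.integral_cong refl)
          fix x
          have "cis (- ((h k *\<^sub>R e + x) \<bullet> \<xi>)) = cis (- (h k * \<xi> $ i)) * cis (- (x \<bullet> \<xi>))"
            by (simp add: inner_add_left e_def inner_axis' cis_mult)
          then show "cis (- ((h k *\<^sub>R e + x) \<bullet> \<xi>)) * f (h k *\<^sub>R e + x) =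
              cis (- (h k * \<xi> $ i)) * (cis (- (x \<bullet> \<xi>)) * f (x + h k *\<^sub>R e))"
            by (simp only: mult.assoc add.commute)
        qed
      also have "... = cis (- (h k * \<xi> $ i)) * (LINT x|lborel. cis (- (x \<bullet> \<xi>)) * f (x + h k *\<^sub>R e))"
        by (rule integral_mult_right_zero)
      finally show ?thesis by (simp add: mult.assoc[symmetric] cis_mult)
    qed
    then have "(LINT x|lborel. cis (- (x \<bullet> \<xi>)) * f (x + h k *\<^sub>R e) - cis (- (x \<bullet> \<xi>)) * f x) =
      (cis (h k * \<xi> $ i) - 1) * (LINT x|lborel. cis (- (x \<bullet> \<xi>)) * f x)"
      by (simp only: Bochner_Integration.integral_diff[OF i2 i1] left_diff_distrib mult_1_left)
    moreover have "(LINT x|lborel. cis (- (x \<bullet> \<xi>)) * q k x) =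
      (LINT x|lborel. (cis (- (x \<bullet> \<xi>)) * f (x + h k *\<^sub>R e) - cis (- (x \<bullet> \<xi>)) * f x) / of_real (h k))"
      by (intro Bochner_Integration.integral_cong refl) (simp add: q_def algebra_simps diff_divide_distrib)
    ultimately show ?thesis by simp
  qed
  ultimately have 1: "(\<lambda>k. ((cis (h k * \<xi> $ i) - 1) / of_real (h k)) * (LINT x|lborel. cis (- (x \<bullet> \<xi>)) * f x))
      \<longlonglongrightarrow> (LINT x|lborel. cis (- (x \<bullet> \<xi>)) * p x)" by simp
  have "(\<lambda>k. (cis (h k * \<xi> $ i) - 1) / of_real (h k)) \<longlonglongrightarrow> \<i> * of_real (\<xi> $ i)"
  proof -
    have "((\<lambda>t. cis (t * \<xi> $ i)) has_vector_derivative (\<xi> $ i) *\<^sub>R (\<i> * cis (0 * \<xi> $ i))) (at 0)"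
      using exp_scaleR_has_vector_derivative_right[of "\<i> * complex_of_real (\<xi> $ i)" 0 UNIV]
      by (simp add: cis_conv_exp scaleR_conv_of_real mult_ac)
    then have "((\<lambda>t. (cis (t * \<xi> $ i) - cis (0 * \<xi> $ i)) /\<^sub>R (t - 0)) \<longlongrightarrow> (\<xi> $ i) *\<^sub>R (\<i> * cis (0 * \<xi> $ i))) (at 0)"
      unfolding has_vector_derivative_iff_quotient .
    moreover have "filterlim h (at 0) sequentially"
      using h0 h(1) by (auto simp: filterlim_at less_imp_neq[symmetric])
    ultimately have "(\<lambda>k. (cis (h k * \<xi> $ i) - cis (0 * \<xi> $ i)) /\<^sub>R (h k - 0)) \<longlonglongrightarrow> (\<xi> $ i) *\<^sub>R (\<i> * cis (0 * \<xi> $ i))"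
      by (rule filterlim_compose)
    then show ?thesis by (simp add: scaleR_conv_of_real divide_inverse mult.commute)
  qed
  from tendsto_mult_right[OF this, of "LINT x|lborel. cis (- (x \<bullet> \<xi>)) * f x"]
  have "(LINT x|lborel. cis (- (x \<bullet> \<xi>)) * p x) = \<i> * of_real (\<xi> $ i) * (LINT x|lborel. cis (- (x \<bullet> \<xi>)) * f x)"
    using 1 LIMSEQ_unique by blast
  then show ?thesis by (simp add: fourier_def p_def mult_ac)
qed

lemma norm_cis_taylor: "norm (cis t - 1 - \<i> * of_real t) \<le> t\<^sup>2 / 2"
  using iexp_approx1[of t 1] by (simp add: cis_conv_exp power2_eq_square diff_diff_add)

text \<open>The first-order Taylor remainder of the character is at most (x.v)^2/2, so the error is
  at most \<open>M\<close> |v|^2 with \<open>M\<close> a multiple of the second moment of |f|. This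
  gives the total derivative at once instead of partial derivatives only.\<close>

lemma fourier_has_derivative:
  fixes f :: "'n::finite cfun"
  assumes f: "f \<in> schwartz"
  shows "(fourier f has_derivative (\<lambda>v. \<Sum>k\<in>UNIV. of_real (v $ k) * fourier (\<lambda>x. - \<i> * (of_real (x $ k) * f x)) \<xi>)) (at \<xi>)"
    (is "(_ has_derivative ?L) _")
proof -
  define c where "c = (2 * pi) powr (- real CARD('n) / 2)"
  define g where "g k = (\<lambda>x. - \<i> * (of_real (x $ k) * f x))" for k :: 'n
  have g: "g k \<in> schwartz" for k unfolding g_def by (intro schwartz_cmult schwartz_component_mult f)
  define M where "M = c * (LINT x|lborel. (norm x)\<^sup>2 * norm (f x))"
  note [measurable] = schwartz_measurable[OF f] schwartz_measurable[OF g]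
  have i2: "integrable lborel (\<lambda>x. (norm x)\<^sup>2 * norm (f x))"
  proof -
    have "integrable lborel (\<lambda>x. norm (\<Sum>k\<in>UNIV. of_real (x $ k) * (of_real (x $ k) * f x)))"
      by (intro integrable_norm schwartz_integrable schwartz_sum schwartz_component_mult f)
    moreover have "norm (\<Sum>k\<in>UNIV. of_real (x $ k) * (of_real (x $ k) * f x)) = (norm x)\<^sup>2 * norm (f x)" for x
    proof -
      have "(\<Sum>k\<in>UNIV. of_real (x $ k) * (of_real (x $ k) * f x)) = of_real ((norm x)\<^sup>2) * f x"
        unfolding power2_norm_eq_inner inner_vec_def by (simp add: sum_distrib_right mult.assoc)
      then show ?thesis by (simp add: norm_mult del: of_real_power)
    qed
    ultimately show ?thesis by simp
  qed
  have ic: "integrable lborel (\<lambda>x. cis (- (x \<bullet> \<xi>)) * F x)" if "F \<in> schwartz" for F and \<xi> :: "real^'n"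
    by (intro integrable_cis_mult schwartz_integrable that) simp
  have bound: "norm (fourier f (\<xi> + v) - fourier f \<xi> - ?L v) \<le> M * (norm v)\<^sup>2" for v
  proof -
    have "?L v = of_real c * (\<Sum>k\<in>UNIV. of_real (v $ k) * (LINT x|lborel. cis (- (x \<bullet> \<xi>)) * g k x))"
      unfolding fourier_def g_def[symmetric] c_def by (simp add: sum_distrib_left mult_ac)
    also have "(\<Sum>k\<in>UNIV. of_real (v $ k) * (LINT x|lborel. cis (- (x \<bullet> \<xi>)) * g k x)) =
       (LINT x|lborel. (\<Sum>k\<in>UNIV. of_real (v $ k) * (cis (- (x \<bullet> \<xi>)) * g k x)))"
      by (subst Bochner_Integration.integral_sum) (auto intro!: integrable_mult_right ic g)
    also have "... = (LINT x|lborel. cis (- (x \<bullet> \<xi>)) * (- \<i> * of_real (x \<bullet> v) * f x))"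
      by (intro Bochner_Integration.integral_cong refl)
         (simp add: g_def inner_vec_def sum_distrib_left sum_distrib_right mult_ac sum_negf)
    finally have L: "?L v = of_real c * (LINT x|lborel. cis (- (x \<bullet> \<xi>)) * (- \<i> * of_real (x \<bullet> v) * f x))" .
    have iL: "integrable lborel (\<lambda>x. cis (- (x \<bullet> \<xi>)) * (- \<i> * of_real (x \<bullet> v) * f x))"
    proof -
      have "(\<lambda>x. - \<i> * of_real (x \<bullet> v) * f x) = (\<lambda>x. \<Sum>k\<in>UNIV. of_real (v $ k) * g k x)"
        by (auto simp: g_def inner_vec_def sum_distrib_left sum_distrib_right mult_ac sum_negf fun_eq_iff)
      moreover have "... \<in> schwartz" by (intro schwartz_sum schwartz_cmult g)
      ultimately show ?thesis by (intro ic) simp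
    qed
    have "fourier f (\<xi> + v) - fourier f \<xi> - ?L v = of_real c * (LINT x|lborel.
       cis (- (x \<bullet> (\<xi> + v))) * f x - cis (- (x \<bullet> \<xi>)) * f x - cis (- (x \<bullet> \<xi>)) * (- \<i> * of_real (x \<bullet> v) * f x))"
      unfolding L unfolding fourier_def c_def[symmetric]
      by (simp only: Bochner_Integration.integral_diff[OF Bochner_Integration.integrable_diff[OF ic[OF f] ic[OF f]] iL]
          Bochner_Integration.integral_diff[OF ic[OF f] ic[OF f]] right_diff_distrib)
    also have "norm ... \<le> c * (LINT x|lborel. (norm x)\<^sup>2 * norm (f x) * (norm v)\<^sup>2)"
    proof -
      have "norm (LINT x|lborel. cis (- (x \<bullet> (\<xi> + v))) * f x - cis (- (x \<bullet> \<xi>)) * f x - cis (- (x \<bullet> \<xi>)) * (- \<i> * of_real (x \<bullet> v) * f x))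
        \<le> (LINT x|lborel. norm (cis (- (x \<bullet> (\<xi> + v))) * f x - cis (- (x \<bullet> \<xi>)) * f x - cis (- (x \<bullet> \<xi>)) * (- \<i> * of_real (x \<bullet> v) * f x)))"
        by (rule integral_norm_bound)
      also have "... \<le> (LINT x|lborel. (norm x)\<^sup>2 * norm (f x) * (norm v)\<^sup>2)"
      proof (rule integral_mono)
        show "integrable lborel (\<lambda>x. norm (cis (- (x \<bullet> (\<xi> + v))) * f x - cis (- (x \<bullet> \<xi>)) * f x - cis (- (x \<bullet> \<xi>)) * (- \<i> * of_real (x \<bullet> v) * f x)))"
          by (intro integrable_norm Bochner_Integration.integrable_diff ic[OF f] iL)
        show "integrable lborel (\<lambda>x. (norm x)\<^sup>2 * norm (f x) * (norm v)\<^sup>2)"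
          by (intro integrable_mult_left i2)
        fix x
        have "cis (- (x \<bullet> (\<xi> + v))) * f x - cis (- (x \<bullet> \<xi>)) * f x - cis (- (x \<bullet> \<xi>)) * (- \<i> * of_real (x \<bullet> v) * f x) =
           cis (- (x \<bullet> \<xi>)) * f x * (cis (- (x \<bullet> v)) - 1 - \<i> * of_real (- (x \<bullet> v)))"
        proof -
          have "cis (- (x \<bullet> (\<xi> + v))) = cis (- (x \<bullet> \<xi>)) * cis (- (x \<bullet> v))"
            by (simp add: cis_mult inner_add_right)
          then show ?thesis by (simp only:) (simp add: algebra_simps)
        qed
        then have "norm (cis (- (x \<bullet> (\<xi> + v))) * f x - cis (- (x \<bullet> \<xi>)) * f x - cis (- (x \<bullet> \<xi>)) * (- \<i> * of_real (x \<bullet> v) * f x)) =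
           norm (f x) * norm (cis (- (x \<bullet> v)) - 1 - \<i> * of_real (- (x \<bullet> v)))"
          by (simp only: norm_mult norm_cis mult_1_left)
        also have "... \<le> norm (f x) * ((x \<bullet> v)\<^sup>2 / 2)"
          using norm_cis_taylor[of "- (x \<bullet> v)"] by (intro mult_left_mono) auto
        also have "... \<le> norm (f x) * ((norm x)\<^sup>2 * (norm v)\<^sup>2)"
        proof (intro mult_left_mono norm_ge_zero)
          have "\<bar>x \<bullet> v\<bar>\<^sup>2 \<le> (norm x * norm v)\<^sup>2" by (intro power_mono Cauchy_Schwarz_ineq2) auto
          then show "(x \<bullet> v)\<^sup>2 / 2 \<le> (norm x)\<^sup>2 * (norm v)\<^sup>2" by (simp add: power_mult_distrib) (smt (verit) zero_le_power2)
        qed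
        finally show "norm (cis (- (x \<bullet> (\<xi> + v))) * f x - cis (- (x \<bullet> \<xi>)) * f x - cis (- (x \<bullet> \<xi>)) * (- \<i> * of_real (x \<bullet> v) * f x)) \<le> (norm x)\<^sup>2 * norm (f x) * (norm v)\<^sup>2"
          by (simp add: mult_ac)
      qed
      finally show ?thesis by (simp add: norm_mult c_def mult_left_mono)
    qed
    finally show ?thesis by (simp add: M_def)
  qed
  have lin: "bounded_linear ?L"
  proof (intro bounded_linear_sum bounded_linear_mult_const)
    fix k show "bounded_linear (\<lambda>v::real^'n. complex_of_real (v $ k))"
      by (rule bounded_linear_compose[OF bounded_linear_of_real bounded_linear_vec_nth])
  qed
  show ?thesis
  proof (rule has_derivativeI_sandwich[OF zero_less_one lin])
    fix y assume "y \<noteq> \<xi>"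
    then show "norm ((fourier f y - fourier f \<xi>) - ?L (y - \<xi>)) / norm (y - \<xi>) \<le> M * norm (y - \<xi>)"
      using bound[of "y - \<xi>"] by (simp add: divide_le_eq power2_eq_square mult_ac)
  next
    show "((\<lambda>y. M * norm (y - \<xi>)) \<longlongrightarrow> 0) (at \<xi>)"
      by (auto intro!: tendsto_eq_intros)
  qed
qed

text \<open>Each power of 1+|xi| is traded for a first derivative of \<open>f\<close> by
  \<open>fourier_partial\<close>. The bound is linear in a single seminorm of \<open>f\<close>,
  which makes it usable uniformly over families and for the continuity estimate in
  \<open>tempered_ift\<close>.\<close>

lemma fourier_decay:
  "\<exists>C M. \<forall>f\<in>schwartz. \<forall>\<xi>::real^'n::finite. (1 + norm \<xi>) ^ N * norm (fourier f \<xi>) \<le> C * total_seminorm M f"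
proof (induction N)
  case 0
  define I where "I = (LINT x|lborel. 1 / (1 + norm (x::real^'n)) ^ (CARD('n) + 1))"
  show ?case
  proof (intro exI ballI allI)
    fix f :: "'n cfun" and \<xi> assume f: "f \<in> schwartz"
    have "(LINT x|lborel. norm (f x)) \<le> (LINT x|lborel. total_seminorm (CARD('n) + 1) f * (1 / (1 + norm (x::real^'n)) ^ (CARD('n) + 1)))"
      by (intro integral_mono integrable_norm schwartz_integrable f schwartz_integrable_bound integrable_mult_right integrable_one_plus_norm)
    also have "... = total_seminorm (CARD('n) + 1) f * I" unfolding I_def by (rule integral_mult_right_zero)
    finally have "norm (fourier f \<xi>) \<le> (2 * pi) powr (- real CARD('n) / 2) * (total_seminorm (CARD('n) + 1) f * I)"
      using norm_fourier_le[of f \<xi>] by (meson mult_left_mono order_trans powr_ge_zero)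
    then show "(1 + norm \<xi>) ^ 0 * norm (fourier f \<xi>) \<le> ((2 * pi) powr (- real CARD('n) / 2) * I) * total_seminorm (CARD('n) + 1) f"
      by (simp add: mult_ac)
  qed
next
  case (Suc N)
  then obtain C0 M where C0: "\<And>f \<xi>. f \<in> schwartz \<Longrightarrow> (1 + norm (\<xi>::real^'n)) ^ N * norm (fourier f \<xi>) \<le> C0 * total_seminorm M f"
    by blast
  define C where "C = max C0 0"
  have C: "C \<ge> 0" "f \<in> schwartz \<Longrightarrow> (1 + norm \<xi>) ^ N * norm (fourier f \<xi>) \<le> C * total_seminorm M f" for f and \<xi> :: "real^'n"
  proof -
    show "C \<ge> 0" by (simp add: C_def)
    assume f: "f \<in> schwartz"
    have "C0 * total_seminorm M f \<le> C * total_seminorm M f"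
      by (intro mult_right_mono total_seminorm_nonneg f) (simp add: C_def)
    then show "(1 + norm \<xi>) ^ N * norm (fourier f \<xi>) \<le> C * total_seminorm M f" using C0[OF f, of \<xi>] by linarith
  qed
  show ?case
  proof (intro exI ballI allI)
    fix f :: "'n cfun" and \<xi> assume f: "f \<in> schwartz"
    have "(1 + norm \<xi>) * norm (fourier f \<xi>) \<le> norm (fourier f \<xi>) + (\<Sum>i\<in>UNIV. norm (fourier (partial_deriv i f) \<xi>))"
    proof -
      have "norm \<xi> * norm (fourier f \<xi>) \<le> (\<Sum>i\<in>UNIV. \<bar>\<xi> $ i\<bar>) * norm (fourier f \<xi>)"
        by (intro mult_right_mono norm_le_l1_cart) auto
      also have "... = (\<Sum>i\<in>UNIV. norm (fourier (partial_deriv i f) \<xi>))"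
        by (simp add: fourier_partial[OF f] norm_mult sum_distrib_right)
      finally show ?thesis by (simp add: algebra_simps)
    qed
    then have "(1 + norm \<xi>) ^ N * ((1 + norm \<xi>) * norm (fourier f \<xi>)) \<le>
       (1 + norm \<xi>) ^ N * (norm (fourier f \<xi>) + (\<Sum>i\<in>UNIV. norm (fourier (partial_deriv i f) \<xi>)))"
      by (intro mult_left_mono) auto
    also have "... = (1 + norm \<xi>) ^ N * norm (fourier f \<xi>) + (\<Sum>i\<in>UNIV. (1 + norm \<xi>) ^ N * norm (fourier (partial_deriv i f) \<xi>))"
      by (simp add: distrib_left sum_distrib_left)
    also have "... \<le> C * total_seminorm M f + (\<Sum>i\<in>(UNIV :: 'n set). C * total_seminorm (Suc M) f)"
      by (intro add_mono sum_mono order_trans[OF C(2)] mult_left_mono total_seminorm_partial C(1) f schwartz_partial order_refl)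
    also have "... \<le> C * total_seminorm (Suc M) f + (\<Sum>i\<in>(UNIV :: 'n set). C * total_seminorm (Suc M) f)"
      by (intro add_mono mult_left_mono total_seminorm_mono C(1) f order_refl) auto
    finally show "(1 + norm \<xi>) ^ Suc N * norm (fourier f \<xi>) \<le> (C * (1 + real CARD('n))) * total_seminorm (Suc M) f"
      by (simp add: algebra_simps)
  qed
qed

lemma partial_deriv_fourier:
  assumes "f \<in> schwartz"
  shows "partial_deriv i (fourier f) = fourier (\<lambda>x. - \<i> * (of_real (x $ i) * f x))"
  by (rule ext, subst partial_deriv_eq[OF fourier_has_derivative[OF assms]]) simp

lemma bounded_family_fourier:
  fixes f :: "'j \<Rightarrow> real^'n::finite \<Rightarrow> complex"
  assumes "bounded_family f" shows "bounded_family (\<lambda>j. fourier (f j))"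
proof (rule bounded_family_coinduct[where Z = "{\<lambda>j. fourier (f j) | f :: 'j \<Rightarrow> real^'n \<Rightarrow> complex. bounded_family f}"])
  show "(\<lambda>j. fourier (f j)) \<in> {\<lambda>j. fourier (f j) | f. bounded_family f}" using assms by blast
next
  fix g :: "'j \<Rightarrow> real^'n \<Rightarrow> complex" and j x
  assume "g \<in> {\<lambda>j. fourier (f j) | f. bounded_family f}"
  then obtain f where g: "g = (\<lambda>j. fourier (f j))" "bounded_family f" by blast
  show "g j differentiable at x"
    unfolding g(1) by (rule differentiableI[OF fourier_has_derivative[OF bounded_family_imp_schwartz[OF g(2)]]])
next
  fix g :: "'j \<Rightarrow> real^'n \<Rightarrow> complex" and N
  assume "g \<in> {\<lambda>j. fourier (f j) | f. bounded_family f}"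
  then obtain f where g: "g = (\<lambda>j. fourier (f j))" "bounded_family f" by blast
  obtain C M where C: "\<And>f \<xi>. f \<in> schwartz \<Longrightarrow> (1 + norm (\<xi>::real^'n)) ^ N * norm (fourier f \<xi>) \<le> C * total_seminorm M f"
    using fourier_decay[of N] by blast
  obtain B where B: "B > 0" "\<And>j. total_seminorm M (f j) \<le> B" using bounded_family_total_seminorm[OF g(2)] by blast
  have "(1 + norm x) ^ N * norm (g j x) \<le> max C 0 * B" for j x
  proof -
    have "C * total_seminorm M (f j) \<le> max C 0 * total_seminorm M (f j)"
      by (intro mult_right_mono total_seminorm_nonneg bounded_family_imp_schwartz[OF g(2)]) auto
    also have "... \<le> max C 0 * B" by (intro mult_left_mono B) auto
    finally show ?thesis using C[OF bounded_family_imp_schwartz[OF g(2)], of x j] g(1) by simp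
  qed
  then show "\<exists>C. \<forall>j x. (1 + norm x) ^ N * norm (g j x) \<le> C" by blast
next
  fix g :: "'j \<Rightarrow> real^'n \<Rightarrow> complex" and i
  assume "g \<in> {\<lambda>j. fourier (f j) | f. bounded_family f}"
  then obtain f where g: "g = (\<lambda>j. fourier (f j))" "bounded_family f" by blast
  have "(\<lambda>j. partial_deriv i (g j)) = (\<lambda>j. fourier ((\<lambda>j x. - \<i> * (of_real (x $ i) * f j x)) j))"
    unfolding g(1) by (intro ext) (simp add: partial_deriv_fourier[OF bounded_family_imp_schwartz[OF g(2)]])
  moreover have "bounded_family (\<lambda>j x. - \<i> * (of_real (x $ i) * f j x))"
    by (rule bounded_family_cmult[OF bounded_family_component_mult[OF g(2)], of _ 1]) simp
  ultimately show "(\<lambda>j. partial_deriv i (g j)) \<in> {\<lambda>j. fourier (f j) | f. bounded_family f}"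
    by (intro CollectI exI[of _ "\<lambda>j x. - \<i> * (of_real (x $ i) * f j x)"] conjI)
qed

lemma schwartz_fourier: "f \<in> schwartz \<Longrightarrow> fourier f \<in> schwartz"
  unfolding schwartz_iff_bounded_family by (rule bounded_family_fourier)

lemma inv_fourier_eq: "inv_fourier f x = fourier f (- x)"
  by (simp add: inv_fourier_def fourier_def inner_commute)

lemma bounded_family_reflect: "bounded_family f \<Longrightarrow> bounded_family (\<lambda>j x. f j (- x))"
  using bounded_family_dilate[of f "-1"] by simp

lemma bounded_family_inv_fourier: "bounded_family f \<Longrightarrow> bounded_family (\<lambda>j. inv_fourier (f j))"
  using bounded_family_reflect[OF bounded_family_fourier, of f] by (simp add: inv_fourier_eq[abs_def])

lemma schwartz_inv_fourier: "f \<in> schwartz \<Longrightarrow> inv_fourier f \<in> schwartz"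
  unfolding schwartz_iff_bounded_family by (rule bounded_family_inv_fourier)

subsection \<open>Gaussians and Fourier inversion\<close>

text \<open>Polynomials times base families, with coefficients bounded in \<open>j\<close>. Once the
  derivatives of the base families land in this span, the whole span is closed under
  differentiation, so it can serve as the class \<open>Z\<close> of the coinduction.\<close>

inductive_set poly_span :: "('j \<Rightarrow> real^'n::finite \<Rightarrow> complex) set \<Rightarrow> ('j \<Rightarrow> real^'n \<Rightarrow> complex) set"
  for B where
  poly_span_base: "f \<in> B \<Longrightarrow> f \<in> poly_span B"
| poly_span_component: "f \<in> poly_span B \<Longrightarrow> (\<lambda>j x. of_real (x $ i) * f j x) \<in> poly_span B"
| poly_span_add: "f \<in> poly_span B \<Longrightarrow> g \<in> poly_span B \<Longrightarrow> (\<lambda>j x. f j x + g j x) \<in> poly_span B"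
| poly_span_cmult: "f \<in> poly_span B \<Longrightarrow> (\<And>j. norm (c j) \<le> K) \<Longrightarrow> (\<lambda>j x. c j * f j x) \<in> poly_span B"

lemma bounded_family_poly_span:
  fixes f :: "'j \<Rightarrow> real^'n::finite \<Rightarrow> complex"
  assumes "f \<in> poly_span B"
    and diff: "\<And>b j x. b \<in> B \<Longrightarrow> b j differentiable at x"
    and decay: "\<And>b N. b \<in> B \<Longrightarrow> \<exists>C. \<forall>j x. (1 + norm x) ^ N * norm (b j x) \<le> C"
    and step: "\<And>b i. b \<in> B \<Longrightarrow> (\<lambda>j. partial_deriv i (b j)) \<in> poly_span B"
  shows "bounded_family f"
proof -
  have D: "f j differentiable at x" if "f \<in> poly_span B" for f j x
    using that
  proof (induction)
    case (poly_span_component f i)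
    then show ?case by (intro differentiable_mult differentiableI[OF has_derivative_component])
  qed (auto intro: diff differentiable_add differentiable_mult)
  have der: "(f j has_derivative (\<lambda>v. \<Sum>k\<in>UNIV. of_real (v $ k) * partial_deriv k (f j) x)) (at x)"
    if "f \<in> poly_span B" for f j x
    by (rule has_derivative_partials[OF D[OF that]])
  show ?thesis
  proof (rule bounded_family_coinduct[OF assms(1)])
    fix g :: "'j \<Rightarrow> real^'n \<Rightarrow> complex" and j x assume "g \<in> poly_span B"
    then show "g j differentiable at x" by (rule D)
  next
    fix g :: "'j \<Rightarrow> real^'n \<Rightarrow> complex" and N assume "g \<in> poly_span B"
    then show "\<exists>C. \<forall>j x. (1 + norm x) ^ N * norm (g j x) \<le> C"
    proof (induction arbitrary: N)
      case (poly_span_base f) then show ?case by (rule decay)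
    next
      case (poly_span_component f i)
      from poly_span_component.IH[of "Suc N"]
      obtain C where C: "\<And>j x. (1 + norm x) ^ Suc N * norm (f j x) \<le> C" by blast
      have "(1 + norm x) ^ N * norm (of_real (x $ i) * f j x) \<le> C" for j x
      proof -
        have "norm (of_real (x $ i) * f j x) \<le> (1 + norm x) * norm (f j x)"
          using component_le_norm_cart[of x i] by (auto simp: norm_mult intro!: mult_right_mono)
        then have "(1 + norm x) ^ N * norm (of_real (x $ i) * f j x) \<le> (1 + norm x) ^ N * ((1 + norm x) * norm (f j x))"
          by (intro mult_left_mono) auto
        then show ?thesis using C[of x j] by (simp add: mult_ac)
      qed
      then show ?case by blast
    next
      case (poly_span_add f g)
      from poly_span_add.IH[of N] obtain C C' where C: "\<And>j x. (1 + norm x) ^ N * norm (f j x) \<le> C"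
        "\<And>j x. (1 + norm x) ^ N * norm (g j x) \<le> C'" by blast
      have "(1 + norm x) ^ N * norm (f j x + g j x) \<le> C + C'" for j x
      proof -
        have "(1 + norm x) ^ N * norm (f j x + g j x) \<le> (1 + norm x) ^ N * (norm (f j x) + norm (g j x))"
          by (intro mult_left_mono norm_triangle_ineq) auto
        then show ?thesis using C(1)[of x j] C(2)[of x j] by (simp add: distrib_left)
      qed
      then show ?case by blast
    next
      case (poly_span_cmult f c K)
      from poly_span_cmult.IH[of N] obtain C where C: "\<And>j x. (1 + norm x) ^ N * norm (f j x) \<le> C" by blast
      have "(1 + norm x) ^ N * norm (c j * f j x) \<le> K * C" for j x
      proof -
        have "norm (c j) * ((1 + norm x) ^ N * norm (f j x)) \<le> K * C"
          using poly_span_cmult(2)[of j] C[of x j] by (intro mult_mono) (auto intro: order_trans[OF norm_ge_zero])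
        then show ?thesis by (simp add: norm_mult mult_ac)
      qed
      then show ?case by blast
    qed
  next
    fix g :: "'j \<Rightarrow> real^'n \<Rightarrow> complex" and k assume "g \<in> poly_span B"
    then show "(\<lambda>j. partial_deriv k (g j)) \<in> poly_span B"
    proof (induction)
      case (poly_span_base f) then show ?case by (rule step)
    next
      case (poly_span_component f i)
      have "(\<lambda>j. partial_deriv k (\<lambda>x. of_real (x $ i) * f j x)) =
         (\<lambda>j x. of_real (x $ i) * partial_deriv k (f j) x + of_real (axis k 1 $ i) * f j x)"
        by (intro ext) (subst partial_deriv_eq[OF has_derivative_mult[OF has_derivative_component der[OF poly_span_component.hyps]]]; simp)
      moreover have "(\<lambda>j x. of_real (axis k 1 $ i) * f j x) \<in> poly_span B"
        by (rule poly_span.poly_span_cmult[OF poly_span_component.hyps, of _ 1]) (auto simp: axis_def)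
      ultimately show ?case
        using poly_span.poly_span_add[OF poly_span.poly_span_component[OF poly_span_component.IH]] by simp
    next
      case (poly_span_add f g)
      have "(\<lambda>j. partial_deriv k (\<lambda>x. f j x + g j x)) = (\<lambda>j x. partial_deriv k (f j) x + partial_deriv k (g j) x)"
        by (intro ext) (subst partial_deriv_eq[OF has_derivative_add[OF der[OF poly_span_add.hyps(1)] der[OF poly_span_add.hyps(2)]]]; simp)
      then show ?case using poly_span.poly_span_add[OF poly_span_add.IH] by simp
    next
      case (poly_span_cmult f c K)
      have "(\<lambda>j. partial_deriv k (\<lambda>x. c j * f j x)) = (\<lambda>j x. c j * partial_deriv k (f j) x)"
        by (intro ext) (subst partial_deriv_eq[OF has_derivative_mult_right[OF der[OF poly_span_cmult.hyps(1)]]]; simp)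
      then show ?case using poly_span.poly_span_cmult[OF poly_span_cmult.IH poly_span_cmult.hyps(2)] by simp
    qed
  qed
qed

text \<open>From 1+r <= exp r and the maximum N^2/(4a) of N r - a r^2.\<close>

lemma power_exp_bound:
  assumes "a > 0" "r \<ge> (0::real)"
  shows "(1 + r) ^ N * exp (- a * r\<^sup>2) \<le> exp ((real N)\<^sup>2 / (4 * a))"
proof -
  have "(1 + r) ^ N \<le> exp r ^ N" using assms exp_ge_add_one_self[of r] by (intro power_mono) auto
  also have "... = exp (real N * r)" by (simp add: exp_of_nat_mult)
  finally have "(1 + r) ^ N * exp (- a * r\<^sup>2) \<le> exp (real N * r) * exp (- a * r\<^sup>2)"
    by (intro mult_right_mono) auto
  also have "... = exp (real N * r - a * r\<^sup>2)" by (simp add: exp_add[symmetric])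
  also have "real N * r - a * r\<^sup>2 \<le> (real N)\<^sup>2 / (4 * a)"
  proof -
    have "0 \<le> (real N - 2 * a * r)\<^sup>2" by simp
    then have "4 * a * (real N * r - a * r\<^sup>2) \<le> (real N)\<^sup>2"
      by (simp add: power2_eq_square algebra_simps)
    then show ?thesis using assms(1) by (simp add: field_simps)
  qed
  finally show ?thesis by simp
qed

section \<open>Gaussians as test functions and their transforms\<close>

lemma has_derivative_norm_power2:
  "((\<lambda>x::'a::real_inner. (norm x)\<^sup>2) has_derivative (\<lambda>v. 2 * (x \<bullet> v))) (at x)"
  unfolding power2_norm_eq_inner by (auto intro!: derivative_eq_intros simp: inner_commute)

lemma schwartz_gaussian:
  assumes a: "a > 0"
  shows "(\<lambda>x::real^'n::finite. of_real (exp (- a * (norm x)\<^sup>2)) :: complex) \<in> schwartz"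
proof -
  define b :: "unit \<Rightarrow> real^'n \<Rightarrow> complex" where "b = (\<lambda>_ x. of_real (exp (- a * (norm x)\<^sup>2)))"
  have d: "(b j has_derivative (\<lambda>v. of_real (- a * (2 * (x \<bullet> v)) * exp (- a * (norm x)\<^sup>2)))) (at x)" for j x
  proof -
    have "((\<lambda>x. exp (- a * (norm x)\<^sup>2)) has_derivative (\<lambda>v. - a * (2 * (x \<bullet> v)) * exp (- a * (norm x)\<^sup>2))) (at x)"
      by (rule has_derivative_eq_rhs[OF DERIV_compose_FDERIV[OF DERIV_exp has_derivative_mult_right[OF has_derivative_norm_power2]]])
         (simp add: mult_ac)
    from bounded_linear.has_derivative[OF bounded_linear_of_real this]
    show ?thesis by (simp add: b_def)
  qed
  have "bounded_family b"
  proof (rule bounded_family_poly_span[where B = "{b}"])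
    show "b \<in> poly_span {b}" by (rule poly_span_base) simp
    show "f j differentiable at x" if "f \<in> {b}" for f j x using d that differentiableI by blast
    show "\<exists>C. \<forall>j x. (1 + norm x) ^ N * norm (f j x) \<le> C" if "f \<in> {b}" for f N
      using that power_exp_bound[OF a, of "norm _" N] by (auto simp: b_def)
    show "(\<lambda>j. partial_deriv i (f j)) \<in> poly_span {b}" if "f \<in> {b}" for f i
    proof -
      have "(\<lambda>j. partial_deriv i (b j)) = (\<lambda>j x. of_real (- 2 * a) * (of_real (x $ i) * b j x))"
        by (intro ext) (subst partial_deriv_eq[OF d]; simp add: b_def inner_axis)
      moreover have "... \<in> poly_span {b}"
        by (rule poly_span_cmult[OF poly_span_component[OF poly_span_base], of _ _ _ "2 * a"]) (use a in \<open>auto simp: norm_mult\<close>)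
      ultimately show ?thesis using that by simp
    qed
  qed
  then show ?thesis unfolding schwartz_iff_bounded_family b_def .
qed

text \<open>This is the characteristic function of the standard normal distribution with the
  normalization of the density removed.\<close>

lemma gaussian_char_real:
  "(LINT x|lborel. cis (t * x) * of_real (exp (- x\<^sup>2 / 2))) = of_real (sqrt (2 * pi) * exp (- t\<^sup>2 / 2))"
proof -
  have "of_real (exp (- t\<^sup>2 / 2)) = char std_normal_distribution t"
    by (simp add: char_std_normal_distribution)
  also have "... = (LINT x|lborel. std_normal_density x *\<^sub>R cis (t * x))"
    by (simp add: char_def integral_density cis_conv_exp)
  also have "... = (LINT x|lborel. of_real (1 / sqrt (2 * pi)) * (cis (t * x) * of_real (exp (- x\<^sup>2 / 2))))"
    by (intro Bochner_Integration.integral_cong refl)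
       (simp add: std_normal_density_def scaleR_conv_of_real mult_ac)
  also have "... = of_real (1 / sqrt (2 * pi)) * (LINT x|lborel. cis (t * x) * of_real (exp (- x\<^sup>2 / 2)))"
    by (rule integral_mult_right_zero)
  finally show ?thesis by (simp add: field_simps)
qed

lemma integrable_gaussian_char_real:
  "integrable lborel (\<lambda>x. cis (t * x) * of_real (exp (- x\<^sup>2 / 2)))"
proof -
  have "integrable lborel (\<lambda>x. sqrt (2 * pi) * std_normal_density x)"
    by (intro integrable_mult_right integrable_normal_density) simp
  then have "integrable lborel (\<lambda>x::real. exp (- x\<^sup>2 / 2))"
    by (simp add: std_normal_density_def)
  then show ?thesis
    by (rule Bochner_Integration.integrable_bound) (auto simp: norm_mult)
qed

text \<open>Lebesgue measure is the product over the basis and the integrand factorizes, so the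
  one-dimensional formula applies in each coordinate.\<close>

lemma gaussian_char:
  fixes z :: "real^'n::finite"
  shows "(LINT x|lborel. cis (x \<bullet> z) * of_real (exp (- (norm x)\<^sup>2 / 2))) =
    of_real ((2 * pi) powr (real CARD('n) / 2) * exp (- (norm z)\<^sup>2 / 2))"
proof -
  let ?P = "\<Pi>\<^sub>M b\<in>(Basis :: (real^'n) set). lborel :: real measure"
  let ?S = "\<lambda>f::(real^'n \<Rightarrow> real). \<Sum>b\<in>Basis. f b *\<^sub>R b"
  interpret product_sigma_finite "\<lambda>_::real^'n. lborel :: real measure" ..
  have "(LINT x|lborel. cis (x \<bullet> z) * of_real (exp (- (norm x)\<^sup>2 / 2))) =
    (LINT f|?P. cis (?S f \<bullet> z) * of_real (exp (- (norm (?S f))\<^sup>2 / 2)))"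
    by (subst lborel_eq, subst integral_distr) auto
  also have "... = (LINT f|?P. (\<Prod>b\<in>Basis. cis ((z \<bullet> b) * f b) * of_real (exp (- (f b)\<^sup>2 / 2))))"
  proof (intro Bochner_Integration.integral_cong refl)
    fix f
    have n: "(norm (?S f))\<^sup>2 = (\<Sum>b\<in>Basis. (f b)\<^sup>2)"
      unfolding power2_norm_eq_inner by (subst euclidean_inner) (simp add: power2_eq_square)
    have i: "?S f \<bullet> z = (\<Sum>b\<in>Basis. (z \<bullet> b) * f b)"
      by (subst inner_sum_left) (simp add: inner_commute mult.commute)
    have "cis (?S f \<bullet> z) = (\<Prod>b\<in>Basis. cis ((z \<bullet> b) * f b))"
      unfolding i cis_conv_exp exp_sum[OF finite_Basis, symmetric] of_real_sum sum_distrib_left ..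
    moreover have "exp (- (norm (?S f))\<^sup>2 / 2) = (\<Prod>b\<in>Basis. exp (- (f b)\<^sup>2 / 2))"
      unfolding n exp_sum[OF finite_Basis, symmetric] sum_divide_distrib[symmetric] sum_negf ..
    ultimately show "cis (?S f \<bullet> z) * of_real (exp (- (norm (?S f))\<^sup>2 / 2)) =
      (\<Prod>b\<in>Basis. cis ((z \<bullet> b) * f b) * of_real (exp (- (f b)\<^sup>2 / 2)))"
      by (simp add: prod.distrib)
  qed
  also have "... = (\<Prod>b\<in>Basis. of_real (sqrt (2 * pi) * exp (- (z \<bullet> b)\<^sup>2 / 2)))"
    by (subst product_integral_prod[OF finite_Basis integrable_gaussian_char_real]) (simp only: gaussian_char_real)
  also have "... = of_real (\<Prod>b\<in>(Basis :: (real^'n) set). sqrt (2 * pi) * exp (- (z \<bullet> b)\<^sup>2 / 2))"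
    by simp
  also have "(\<Prod>b\<in>(Basis :: (real^'n) set). sqrt (2 * pi) * exp (- (z \<bullet> b)\<^sup>2 / 2)) =
     sqrt (2 * pi) ^ CARD('n) * exp (- (norm z)\<^sup>2 / 2)"
  proof -
    have "(norm z)\<^sup>2 = (\<Sum>b\<in>Basis. (z \<bullet> b)\<^sup>2)"
      unfolding power2_norm_eq_inner by (subst euclidean_inner) (simp add: power2_eq_square)
    then show ?thesis
      unfolding prod.distrib exp_sum[OF finite_Basis, symmetric] sum_divide_distrib[symmetric] sum_negf prod_constant
      by simp
  qed
  also have "sqrt (2 * pi) ^ CARD('n) = (2 * pi) powr (real CARD('n) / 2)"
    by (simp add: powr_half_sqrt[symmetric] powr_realpow[symmetric] powr_powr)
  finally show ?thesis .
qed

lemma gaussian_integral: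
  "(LINT x|lborel. complex_of_real (exp (- (norm (x::real^'n::finite))\<^sup>2 / 2))) = of_real ((2 * pi) powr (real CARD('n) / 2))"
  using gaussian_char[of "0::real^'n"] by simp

lemma schwartz_std_gaussian: "(\<lambda>x::real^'n::finite. complex_of_real (exp (- (norm x)\<^sup>2 / 2))) \<in> schwartz"
  using schwartz_gaussian[of "1/2"] by simp

section \<open>Fubini for bounded kernels and the inversion formula\<close>

text \<open>The product \<open>a x * b y\<close> is integrable on the product space and, up to the
  constant \<open>K\<close>, dominates the integrand. Characters as kernels give the symmetry of the
  Fourier transform and the regularized inversion, Gaussians give the averaging in
  \<open>AE_zero_if_schwartz_integrals_zero\<close>.\<close>

lemma lborel_fubini_kernel:
  fixes a :: "'a::euclidean_space \<Rightarrow> complex" and b :: "'b::euclidean_space \<Rightarrow> complex"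
  assumes a: "integrable lborel a" and b: "integrable lborel b"
    and k: "(\<lambda>(x, y). k x y) \<in> borel_measurable (borel \<Otimes>\<^sub>M borel)" and k1: "\<And>x y. norm (k x y) \<le> K"
  shows "(LINT x|lborel. a x * (LINT y|lborel. k x y * b y)) = (LINT y|lborel. b y * (LINT x|lborel. k x y * a x))"
proof -
  note [measurable] = borel_measurable_integrable[OF a] borel_measurable_integrable[OF b]
  have [measurable]: "(\<lambda>(x, y). k x y) \<in> borel_measurable (lborel \<Otimes>\<^sub>M lborel)"
    using k by (simp cong: measurable_cong_sets sets_pair_measure_cong)
  have ab: "integrable (lborel \<Otimes>\<^sub>M lborel) (\<lambda>(x, y). a x * b y)"
    by (rule lborel_pair.Fubini_integrable) (auto simp: norm_mult intro!: integrable_mult_right integrable_mult_left integrable_norm a b)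
  have K: "integrable (lborel \<Otimes>\<^sub>M lborel) (\<lambda>(x, y). a x * (k x y * b y))"
  proof (rule Bochner_Integration.integrable_bound[OF integrable_mult_right[OF ab, of "of_real K"]])
    show "AE z in lborel \<Otimes>\<^sub>M lborel. norm (case z of (x, y) \<Rightarrow> a x * (k x y * b y)) \<le> norm (of_real K * (case z of (x, y) \<Rightarrow> a x * b y))"
    proof (intro AE_I2, clarsimp simp: norm_mult)
      fix x y
      have "norm (k x y) \<le> \<bar>K\<bar>" using k1[of x y] by linarith
      then have "norm (k x y) * (norm (a x) * norm (b y)) \<le> \<bar>K\<bar> * (norm (a x) * norm (b y))"
        by (rule mult_right_mono) simp
      then show "norm (a x) * (norm (k x y) * norm (b y)) \<le> \<bar>K\<bar> * (norm (a x) * norm (b y))"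
        by (simp add: mult_ac)
    qed
  qed measurable
  have "(LINT x|lborel. a x * (LINT y|lborel. k x y * b y)) = (LINT x|lborel. (LINT y|lborel. a x * (k x y * b y)))"
    by simp
  also have "... = (LINT y|lborel. (LINT x|lborel. a x * (k x y * b y)))"
    by (rule lborel_pair.Fubini_integral[symmetric, OF K])
  also have "... = (LINT y|lborel. b y * (LINT x|lborel. k x y * a x))"
    by (intro Bochner_Integration.integral_cong refl) (simp add: mult_ac flip: integral_mult_right_zero)
  finally show ?thesis .
qed

lemma cis_inner_measurable [measurable]:
  "(\<lambda>(x, y). cis (- (x \<bullet> y))) \<in> borel_measurable (borel \<Otimes>\<^sub>M (borel :: 'a::euclidean_space measure))"
  "(\<lambda>(x, y). cis (x \<bullet> y)) \<in> borel_measurable (borel \<Otimes>\<^sub>M (borel :: 'a::euclidean_space measure))"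
  by measurable

lemma fourier_swap:
  fixes f g :: "'n::finite cfun"
  assumes "integrable lborel f" "integrable lborel g"
  shows "(LINT x|lborel. f x * fourier g x) = (LINT x|lborel. fourier f x * g x)"
proof -
  have "(LINT x|lborel. f x * (LINT y|lborel. cis (- (x \<bullet> y)) * g y)) = (LINT y|lborel. g y * (LINT x|lborel. cis (- (x \<bullet> y)) * f x))"
    by (rule lborel_fubini_kernel[OF assms cis_inner_measurable(1), of 1]) simp
  moreover have "(LINT x|lborel. f x * fourier g x) =
      of_real ((2 * pi) powr (- real CARD('n) / 2)) * (LINT x|lborel. f x * (LINT y|lborel. cis (- (x \<bullet> y)) * g y))"
    unfolding integral_mult_right_zero[symmetric, where f = "\<lambda>x. f x * (LINT y|lborel. cis (- (x \<bullet> y)) * g y)"]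
    by (intro Bochner_Integration.integral_cong refl) (simp add: fourier_def inner_commute mult.left_commute)
  moreover have "(LINT x|lborel. fourier f x * g x) =
      of_real ((2 * pi) powr (- real CARD('n) / 2)) * (LINT y|lborel. g y * (LINT x|lborel. cis (- (x \<bullet> y)) * f x))"
    unfolding integral_mult_right_zero[symmetric, where f = "\<lambda>y. g y * (LINT x|lborel. cis (- (x \<bullet> y)) * f x)"]
    by (intro Bochner_Integration.integral_cong refl) (simp add: fourier_def mult.commute mult.left_commute)
  ultimately show ?thesis by simp
qed

text \<open>Regularise the inversion integral by the Gaussian \<open>exp (-|\<xi>|\<^sup>2 / (2 k\<^sup>2))\<close>; by Fubini it becomes
  an average of \<open>f\<close> over Gaussians of width \<open>1 / k\<close> around \<open>x\<close>.\<close>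

lemma inv_fourier_fourier:
  fixes f :: "'n::finite cfun"
  assumes f: "f \<in> schwartz"
  shows "inv_fourier (fourier f) = f"
proof
  fix x
  define G where "G = (\<lambda>z::real^'n. complex_of_real (exp (- (norm z)\<^sup>2 / 2)))"
  define h where "h k = 1 / real (Suc k)" for k
  have h: "h k > 0" for k by (simp add: h_def)
  have h0: "h \<longlonglongrightarrow> 0" unfolding h_def by (rule LIMSEQ_Suc[OF lim_1_over_n])
  define c where "c = (2 * pi) powr (real CARD('n) / 2)"
  have c: "c > 0" by (simp add: c_def)
  have c': "(2 * pi) powr (- real CARD('n) / 2) = 1 / c"
    by (simp add: c_def powr_minus_divide[symmetric])
  have G: "G \<in> schwartz" unfolding G_def by (rule schwartz_std_gaussian)
  note [measurable] = schwartz_measurable[OF f] schwartz_measurable[OF G] schwartz_measurable[OF schwartz_fourier[OF f]]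
  have Gh: "(\<lambda>\<xi>. G (h k *\<^sub>R \<xi>)) \<in> schwartz" for k using h[of k] by (intro schwartz_dilate G) simp
  have Gi: "(LINT \<xi>|lborel. cis (\<xi> \<bullet> w) * G (h k *\<^sub>R \<xi>)) = of_real (c / h k ^ CARD('n)) * G ((1 / h k) *\<^sub>R w)" for w k
  proof -
    have "of_real (c * exp (- (norm ((1 / h k) *\<^sub>R w))\<^sup>2 / 2)) = (LINT \<xi>|lborel. cis (\<xi> \<bullet> ((1 / h k) *\<^sub>R w)) * G \<xi>)"
      unfolding G_def c_def by (rule gaussian_char[symmetric])
    also have "... = (h k ^ CARD('n)) *\<^sub>R (LINT \<xi>|lborel. cis (\<xi> \<bullet> w) * G (h k *\<^sub>R \<xi>))"
      using h[of k] by (subst lborel_integral_affine[where c="h k" and t=0]) auto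
    finally show ?thesis using h[of k] by (simp add: G_def scaleR_conv_of_real field_simps)
  qed
  have L: "(LINT \<xi>|lborel. cis (\<xi> \<bullet> x) * G (h k *\<^sub>R \<xi>) * fourier f \<xi>) = (LINT z|lborel. f (x + h k *\<^sub>R z) * G z)" for k
  proof -
    have 1: "integrable lborel (\<lambda>\<xi>. cis (\<xi> \<bullet> x) * G (h k *\<^sub>R \<xi>))"
      by (intro integrable_cis_mult schwartz_integrable Gh) simp
    have "(LINT \<xi>|lborel. (cis (\<xi> \<bullet> x) * G (h k *\<^sub>R \<xi>)) * (LINT y|lborel. cis (- (\<xi> \<bullet> y)) * f y)) =
       (LINT y|lborel. f y * (LINT \<xi>|lborel. cis (- (\<xi> \<bullet> y)) * (cis (\<xi> \<bullet> x) * G (h k *\<^sub>R \<xi>))))"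
      by (rule lborel_fubini_kernel[OF 1 schwartz_integrable[OF f] cis_inner_measurable(1), of 1]) simp
    also have "... = (LINT y|lborel. f y * (of_real (c / h k ^ CARD('n)) * G ((1 / h k) *\<^sub>R (x - y))))"
    proof (intro Bochner_Integration.integral_cong refl)
      fix y
      have "(LINT \<xi>|lborel. cis (- (\<xi> \<bullet> y)) * (cis (\<xi> \<bullet> x) * G (h k *\<^sub>R \<xi>))) = (LINT \<xi>|lborel. cis (\<xi> \<bullet> (x - y)) * G (h k *\<^sub>R \<xi>))"
        by (simp add: mult.assoc[symmetric] cis_mult inner_diff_right)
      then show "f y * (LINT \<xi>|lborel. cis (- (\<xi> \<bullet> y)) * (cis (\<xi> \<bullet> x) * G (h k *\<^sub>R \<xi>))) = f y * (of_real (c / h k ^ CARD('n)) * G ((1 / h k) *\<^sub>R (x - y)))"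
        by (simp add: Gi)
    qed
    also have "... = of_real (c / h k ^ CARD('n)) * (LINT y|lborel. f y * G ((1 / h k) *\<^sub>R (x - y)))"
      by (subst integral_mult_right_zero[symmetric]) (simp add: mult_ac)
    also have "(LINT y|lborel. f y * G ((1 / h k) *\<^sub>R (x - y))) = (h k ^ CARD('n)) *\<^sub>R (LINT z|lborel. f (x + h k *\<^sub>R z) * G z)"
      using h[of k] by (subst lborel_integral_affine[where c="h k" and t=x]) (auto simp: G_def)
    finally have 2: "(LINT \<xi>|lborel. (cis (\<xi> \<bullet> x) * G (h k *\<^sub>R \<xi>)) * (LINT y|lborel. cis (- (\<xi> \<bullet> y)) * f y)) =
       of_real (c / h k ^ CARD('n)) * ((h k ^ CARD('n)) *\<^sub>R (LINT z|lborel. f (x + h k *\<^sub>R z) * G z))" .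
    have "(LINT \<xi>|lborel. cis (\<xi> \<bullet> x) * G (h k *\<^sub>R \<xi>) * fourier f \<xi>) =
       (LINT \<xi>|lborel. of_real (1 / c) * ((cis (\<xi> \<bullet> x) * G (h k *\<^sub>R \<xi>)) * (LINT y|lborel. cis (- (\<xi> \<bullet> y)) * f y)))"
      by (intro Bochner_Integration.integral_cong refl) (simp only: fourier_def c', simp only: inner_commute mult_ac)
    also have "... = of_real (1 / c) * (LINT \<xi>|lborel. (cis (\<xi> \<bullet> x) * G (h k *\<^sub>R \<xi>)) * (LINT y|lborel. cis (- (\<xi> \<bullet> y)) * f y))"
      by (rule integral_mult_right_zero)
    also have "... = (LINT z|lborel. f (x + h k *\<^sub>R z) * G z)"
      unfolding 2 scaleR_conv_of_real[of _ "LINT z|lborel. f (x + h k *\<^sub>R z) * G z"] using h[of k] c by simp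
    finally show ?thesis .
  qed
  obtain B where B: "B > 0" "\<And>x. norm (f x) \<le> B"
    using bounded_family_decay[OF schwartz_imp_bounded_family[OF f], of 0] by (metis mult_1 power_0)
  \<comment> \<open>The regularized integral tends to the inversion integral; in the form given by
    \<open>L\<close> it tends to \<open>f x\<close> times the mass of the Gaussian. Comparing the
    two limits is the inversion formula.\<close>
  have "(\<lambda>k. LINT \<xi>|lborel. cis (\<xi> \<bullet> x) * G (h k *\<^sub>R \<xi>) * fourier f \<xi>) \<longlonglongrightarrow> (LINT \<xi>|lborel. cis (\<xi> \<bullet> x) * 1 * fourier f \<xi>)"
  proof (rule integral_dominated_convergence)
    show "integrable lborel (\<lambda>\<xi>. norm (fourier f \<xi>))"
      by (intro integrable_norm schwartz_integrable schwartz_fourier f)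
    have "(\<lambda>k. G (h k *\<^sub>R \<xi>)) \<longlonglongrightarrow> G (0 *\<^sub>R \<xi>)" for \<xi>
      unfolding G_def by (intro tendsto_intros h0) auto
    then have "(\<lambda>k. G (h k *\<^sub>R \<xi>)) \<longlonglongrightarrow> 1" for \<xi> by (simp add: G_def)
    then show "AE \<xi> in lborel. (\<lambda>k. cis (\<xi> \<bullet> x) * G (h k *\<^sub>R \<xi>) * fourier f \<xi>) \<longlonglongrightarrow> cis (\<xi> \<bullet> x) * 1 * fourier f \<xi>"
      by (intro AE_I2 tendsto_intros)
    show "AE \<xi> in lborel. norm (cis (\<xi> \<bullet> x) * G (h k *\<^sub>R \<xi>) * fourier f \<xi>) \<le> norm (fourier f \<xi>)" for k
      by (intro AE_I2) (simp add: norm_mult G_def mult_left_le_one_le)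
  qed auto
  moreover have "(\<lambda>k. LINT z|lborel. f (x + h k *\<^sub>R z) * G z) \<longlonglongrightarrow> (LINT z|lborel. f x * G z)"
  proof (rule integral_dominated_convergence)
    show "integrable lborel (\<lambda>z. B * norm (G z))"
      by (intro integrable_mult_right integrable_norm schwartz_integrable G)
    show "AE z in lborel. (\<lambda>k. f (x + h k *\<^sub>R z) * G z) \<longlonglongrightarrow> f x * G z"
    proof (intro AE_I2 tendsto_mult_right)
      fix z
      have "isCont f x" using schwartz_continuous[OF f] by (simp add: continuous_on_eq_continuous_at)
      moreover have "(\<lambda>k. x + h k *\<^sub>R z) \<longlonglongrightarrow> x + 0 *\<^sub>R z" by (intro tendsto_intros h0)
      ultimately show "(\<lambda>k. f (x + h k *\<^sub>R z)) \<longlonglongrightarrow> f x" using isCont_tendsto_compose[of x f "\<lambda>k. x + h k *\<^sub>R z" sequentially] by simp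
    qed
    show "AE z in lborel. norm (f (x + h k *\<^sub>R z) * G z) \<le> B * norm (G z)" for k
      using B by (intro AE_I2) (simp add: norm_mult mult_right_mono)
  qed auto
  ultimately have "(LINT \<xi>|lborel. cis (\<xi> \<bullet> x) * 1 * fourier f \<xi>) = (LINT z|lborel. f x * G z)"
    unfolding L by (rule LIMSEQ_unique)
  also have "... = f x * of_real c"
    using gaussian_integral[where 'n='n] by (simp add: G_def c_def)
  finally show "inv_fourier (fourier f) x = f x"
    using c c' by (simp add: inv_fourier_def inner_commute)
qed

lemma fourier_reflect:
  fixes f :: "'n::finite cfun"
  assumes [measurable]: "f \<in> borel_measurable borel"
  shows "fourier (\<lambda>x. f (- x)) \<xi> = fourier f (- \<xi>)"
proof -
  have "(LINT x|lborel. cis (- (x \<bullet> \<xi>)) * f (- x)) = (LINT x|lborel. cis (- (x \<bullet> - \<xi>)) * f x)"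
    using lborel_integral_affine[of "\<lambda>x. cis (- (x \<bullet> - \<xi>)) * f x" "-1" 0] by simp
  then show ?thesis by (simp add: fourier_def)
qed

text \<open>Inversion in the other order follows by reflection, since \<open>inv_fourier f\<close>
  is \<open>fourier f\<close> evaluated at the opposite point.\<close>

lemma fourier_inv_fourier:
  fixes f :: "'n::finite cfun"
  assumes f: "f \<in> schwartz"
  shows "fourier (inv_fourier f) = f"
proof
  fix x
  have "fourier (inv_fourier f) x = fourier (\<lambda>y. fourier f (- y)) x"
    by (simp add: inv_fourier_eq[abs_def])
  also have "... = fourier (fourier f) (- x)"
    by (rule fourier_reflect) (rule schwartz_measurable[OF schwartz_fourier[OF f]])
  also have "... = inv_fourier (fourier f) x" by (simp add: inv_fourier_eq)
  also have "... = f x" by (simp add: inv_fourier_fourier[OF f])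
  finally show "fourier (inv_fourier f) x = f x" .
qed

subsection \<open>Distributions given by functions\<close>

text \<open>The positive and negative parts of \<open>r\<close> are densities of two finite measures
  that agree on boxes and hence everywhere. On the set where r > 0 the second measure vanishes, so
  the first vanishes there as well.\<close>

lemma AE_zero_if_box_integrals_zero_real:
  fixes r :: "'a::euclidean_space \<Rightarrow> real"
  assumes r: "integrable lborel r" and 0: "\<And>l u. (LINT x|lborel. indicator (box l u) x * r x) = 0"
  shows "AE x in lborel. r x \<le> 0"
proof -
  note [measurable] = borel_measurable_integrable[OF r, unfolded measurable_lborel1]
  let ?P = "density lborel (\<lambda>x. ennreal (max 0 (r x)))" and ?N = "density lborel (\<lambda>x. ennreal (max 0 (- r x)))"
  have int: "integrable lborel (\<lambda>x. max 0 (r x))" "integrable lborel (\<lambda>x. max 0 (- r x))"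
    by (intro Bochner_Integration.integrable_max integrable_zero r Bochner_Integration.integrable_minus)+
  have int': "integrable lborel (\<lambda>x. indicator (box l u) x * max 0 (r x))" "integrable lborel (\<lambda>x. indicator (box l u) x * max 0 (- r x))" for l u
    using integrable_real_mult_indicator[OF _ int(1), of "box l u"] integrable_real_mult_indicator[OF _ int(2), of "box l u"]
    by (simp_all add: mult.commute)
  have eq: "emeasure ?P (box l u) = emeasure ?N (box l u)" for l u
  proof -
    have "emeasure ?P (box l u) = (\<integral>\<^sup>+x. ennreal (indicator (box l u) x * max 0 (r x)) \<partial>lborel)"
      by (subst emeasure_density) (auto intro!: nn_integral_cong simp: indicator_def)
    also have "... = ennreal (LINT x|lborel. indicator (box l u) x * max 0 (r x))"
      by (rule nn_integral_eq_integral[OF int'(1)]) simp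
    also have "(LINT x|lborel. indicator (box l u) x * max 0 (r x)) = (LINT x|lborel. indicator (box l u) x * max 0 (- r x))"
    proof -
      have "(LINT x|lborel. indicator (box l u) x * max 0 (r x)) - (LINT x|lborel. indicator (box l u) x * max 0 (- r x)) =
        (LINT x|lborel. indicator (box l u) x * max 0 (r x) - indicator (box l u) x * max 0 (- r x))"
        by (rule Bochner_Integration.integral_diff[OF int', symmetric])
      also have "... = (LINT x|lborel. indicator (box l u) x * r x)"
        by (intro Bochner_Integration.integral_cong refl) (auto simp: indicator_def)
      finally show ?thesis using 0 by simp
    qed
    also have "ennreal (LINT x|lborel. indicator (box l u) x * max 0 (- r x)) = (\<integral>\<^sup>+x. ennreal (indicator (box l u) x * max 0 (- r x)) \<partial>lborel)"
      by (rule nn_integral_eq_integral[OF int'(2), symmetric]) simp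
    also have "... = emeasure ?N (box l u)"
      by (subst emeasure_density) (auto intro!: nn_integral_cong simp: indicator_def)
    finally show ?thesis .
  qed
  have "?P = ?N"
  proof (rule measure_eqI_generator_eq)
    let ?E = "range (\<lambda>(a, b). box a b::'a set)"
    show "Int_stable ?E" by (auto simp: Int_stable_def box_Int_box)
    show "?E \<subseteq> Pow UNIV" "sets ?P = sigma_sets UNIV ?E" "sets ?N = sigma_sets UNIV ?E"
      by (simp_all add: borel_eq_box)
    let ?A = "\<lambda>n::nat. box (- (real n *\<^sub>R One)) (real n *\<^sub>R One) :: 'a set"
    show "range ?A \<subseteq> ?E" "(\<Union>i. ?A i) = UNIV" unfolding UN_box_eq_UNIV by auto
    show "emeasure ?P (?A i) \<noteq> \<infinity>" for i
    proof -
      have "emeasure ?P (?A i) \<le> emeasure ?P (space ?P)" by (intro emeasure_mono) auto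
      also have "... = (\<integral>\<^sup>+x. ennreal (max 0 (r x)) \<partial>lborel)" by (subst emeasure_density) auto
      also have "... = ennreal (LINT x|lborel. max 0 (r x))" by (rule nn_integral_eq_integral[OF int(1)]) simp
      finally show ?thesis by (auto simp: top_unique)
    qed
    show "emeasure ?P X = emeasure ?N X" if "X \<in> ?E" for X using that eq by auto
  qed
  then have "emeasure ?P {x. r x > 0} = emeasure ?N {x. r x > 0}" by simp
  also have "... = (\<integral>\<^sup>+x. ennreal (max 0 (- r x)) * indicator {x. r x > 0} x \<partial>lborel)"
    by (subst emeasure_density) auto
  also have "... = (\<integral>\<^sup>+x. 0 \<partial>(lborel :: 'a measure))"
    by (rule nn_integral_cong) (auto simp: indicator_def max_def)
  finally have "(\<integral>\<^sup>+x. ennreal (max 0 (r x)) * indicator {x. r x > 0} x \<partial>lborel) = 0"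
    by (subst (asm) emeasure_density) auto
  then have "AE x in lborel. ennreal (max 0 (r x)) * indicator {x. r x > 0} x = 0"
    by (subst (asm) nn_integral_0_iff_AE) auto
  then show ?thesis by eventually_elim (auto simp: indicator_def max_def ennreal_eq_0_iff split: if_splits)
qed

lemma AE_zero_if_box_integrals_zero:
  fixes H :: "'a::euclidean_space \<Rightarrow> complex"
  assumes H: "integrable lborel H" and 0: "\<And>l u. (LINT x|lborel. indicator (box l u) x * H x) = 0"
  shows "AE x in lborel. H x = 0"
proof -
  have iH: "integrable lborel (\<lambda>x. indicator (box l u) x * H x)" for l u
    using integrable_mult_indicator[OF _ H, of "box l u"] by (simp add: scaleR_conv_of_real of_real_indicator)
  have *: "(LINT x|lborel. indicator (box l u) x * Re (H x)) = 0" "(LINT x|lborel. indicator (box l u) x * Im (H x)) = 0" for l u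
  proof -
    have "Re (indicator (box l u) x * H x) = indicator (box l u) x * Re (H x)"
      "Im (indicator (box l u) x * H x) = indicator (box l u) x * Im (H x)" for x
      by (auto simp: indicator_def)
    then show "(LINT x|lborel. indicator (box l u) x * Re (H x)) = 0" "(LINT x|lborel. indicator (box l u) x * Im (H x)) = 0"
      using integral_Re[OF iH, of l u] integral_Im[OF iH, of l u] 0[of l u] by simp_all
  qed
  have R: "integrable lborel (\<lambda>x. Re (H x))" "integrable lborel (\<lambda>x. Im (H x))"
    using H by (auto intro: integrable_Re integrable_Im)
  have "AE x in lborel. Re (H x) \<le> 0" "AE x in lborel. Im (H x) \<le> 0"
    by (rule AE_zero_if_box_integrals_zero_real[OF R(1) *(1)] AE_zero_if_box_integrals_zero_real[OF R(2) *(2)])+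
  moreover have "AE x in lborel. - Re (H x) \<le> 0"
    by (rule AE_zero_if_box_integrals_zero_real[OF Bochner_Integration.integrable_minus[OF R(1)]]) (simp add: *)
  moreover have "AE x in lborel. - Im (H x) \<le> 0"
    by (rule AE_zero_if_box_integrals_zero_real[OF Bochner_Integration.integrable_minus[OF R(2)]]) (simp add: *)
  ultimately show ?thesis by eventually_elim (auto simp: complex_eq_iff)
qed

text \<open>Test \<open>G\<close> against a Gaussian times translated Gaussians of width \<open>h \<rightarrow> 0\<close>, average the
  translates over a box, and let \<open>h \<rightarrow> 0\<close>.\<close>

lemma AE_zero_if_schwartz_integrals_zero:
  fixes G :: "'n::finite cfun"
  assumes G: "tempered_fun G" and 0: "\<And>\<psi>. \<psi> \<in> schwartz \<Longrightarrow> (LINT x|lborel. G x * \<psi> x) = 0"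
  shows "AE x in lborel. G x = 0"
proof -
  define g where "g = (\<lambda>z::real^'n. complex_of_real (exp (- (norm z)\<^sup>2 / 2)))"
  have g: "g \<in> schwartz" unfolding g_def by (rule schwartz_std_gaussian)
  \<comment> \<open>The Gaussian makes the product integrable and has no zeros, so it can be divided
    out at the end.\<close>
  define H where "H = (\<lambda>x. G x * g x)"
  define h where "h k = 1 / real (Suc k)" for k
  have h: "h k > 0" for k by (simp add: h_def)
  have h0: "h \<longlonglongrightarrow> 0" unfolding h_def by (rule LIMSEQ_Suc[OF lim_1_over_n])
  note [measurable] = schwartz_measurable[OF g]
  have H: "integrable lborel H" using G g by (auto simp: tempered_fun_def H_def)
  note [measurable] = borel_measurable_integrable[OF H, unfolded measurable_lborel1]
  define c where "c = (2 * pi) powr (real CARD('n) / 2)"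
  have c: "c > 0" by (simp add: c_def)
  have gc: "(LINT z|lborel. g z) = of_real c" unfolding g_def c_def by (rule gaussian_integral)
  have gi: "integrable lborel g" by (rule schwartz_integrable[OF g])
  have "(LINT x|lborel. indicator (box l u) x * H x) = 0" for l u
  proof -
    let ?I = "\<lambda>x. indicator (box l u) x :: complex"
    have iI: "integrable lborel ?I"
    proof -
      have "integrable lborel (indicator (box l u) :: _ \<Rightarrow> real)"
        by (rule integrable_real_indicator) (auto simp: emeasure_lborel_box_eq)
      then have "integrable lborel (\<lambda>x. complex_of_real (indicator (box l u) x))" by (rule integrable_of_real)
      then show ?thesis by (simp add: of_real_indicator)
    qed
    define W where "W k x = (LINT z|lborel. ?I (x + h k *\<^sub>R z) * g z)" for k x
    have W0: "(LINT x|lborel. H x * W k x) = 0" for k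
    proof -
      have "(LINT x|lborel. H x * (LINT y|lborel. g ((1 / h k) *\<^sub>R (x - y)) * ?I y)) =
         (LINT y|lborel. ?I y * (LINT x|lborel. g ((1 / h k) *\<^sub>R (x - y)) * H x))"
        by (rule lborel_fubini_kernel[OF H iI, of _ 1]) (measurable, simp add: g_def)
      also have "... = (LINT y|lborel. ?I y * 0)"
      proof (intro Bochner_Integration.integral_cong refl arg_cong2[where f="(*)"])
        fix y
        have "(\<lambda>x. g x * g ((1 / h k) *\<^sub>R (x + - y))) \<in> schwartz"
          using h[of k] schwartz_translate[OF schwartz_dilate[OF g, of "1 / h k"], of "- y"]
          by (intro schwartz_mult g) simp
        from 0[OF this] show "(LINT x|lborel. g ((1 / h k) *\<^sub>R (x - y)) * H x) = 0"
          by (simp add: H_def mult_ac)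
      qed
      finally have 1: "(LINT x|lborel. H x * (LINT y|lborel. g ((1 / h k) *\<^sub>R (x - y)) * ?I y)) = 0" by simp
      have "(LINT y|lborel. g ((1 / h k) *\<^sub>R (x - y)) * ?I y) = of_real (h k ^ CARD('n)) * W k x" for x
      proof -
        have "(LINT y|lborel. g ((1 / h k) *\<^sub>R (x - y)) * ?I y) = (h k ^ CARD('n)) *\<^sub>R (LINT z|lborel. g ((1 / h k) *\<^sub>R (x - (x + h k *\<^sub>R z))) * ?I (x + h k *\<^sub>R z))"
          using h[of k] by (subst lborel_integral_affine[where c="h k" and t=x]) auto
        also have "(LINT z|lborel. g ((1 / h k) *\<^sub>R (x - (x + h k *\<^sub>R z))) * ?I (x + h k *\<^sub>R z)) = W k x"
          unfolding W_def using h[of k] by (intro Bochner_Integration.integral_cong refl) (simp add: g_def)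
        finally show ?thesis by (simp add: scaleR_conv_of_real)
      qed
      then have "(LINT x|lborel. of_real (h k ^ CARD('n)) * (H x * W k x)) = 0" using 1 by (simp add: mult_ac)
      then show ?thesis using h[of k] by (simp only: integral_mult_right_zero) auto
    qed
    have [measurable]: "(\<lambda>x. W k x) \<in> borel_measurable borel" for k
      unfolding W_def by measurable
    have Wb: "norm (W k x) \<le> c" for k x
    proof -
      have "norm (W k x) \<le> (LINT z|lborel. norm (?I (x + h k *\<^sub>R z) * g z))" unfolding W_def by (rule integral_norm_bound)
      also have "... \<le> (LINT z|lborel. norm (g z))"
      proof (rule integral_mono_AE')
        show "integrable lborel (\<lambda>z. norm (g z))" using gi by simp
        show "AE z in lborel. norm (?I (x + h k *\<^sub>R z) * g z) \<le> norm (g z)"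
          by (intro AE_I2) (auto simp: norm_mult indicator_def)
      qed auto
      also have "(LINT z|lborel. norm (g z)) = Re (LINT z|lborel. g z)"
        by (subst integral_Re[OF gi, symmetric]) (simp add: g_def)
      finally show ?thesis by (simp add: gc)
    qed
    have Wl: "(\<lambda>k. W k x) \<longlonglongrightarrow> ?I x * of_real c" if x: "x \<notin> frontier (box l u)" for x
    proof -
      have "(\<lambda>k. LINT z|lborel. ?I (x + h k *\<^sub>R z) * g z) \<longlonglongrightarrow> (LINT z|lborel. ?I x * g z)"
      proof (rule integral_dominated_convergence)
        show "integrable lborel (\<lambda>z. norm (g z))" using gi by simp
        show "AE z in lborel. norm (?I (x + h k *\<^sub>R z) * g z) \<le> norm (g z)" for k
          by (intro AE_I2) (auto simp: norm_mult indicator_def)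
        show "AE z in lborel. (\<lambda>k. ?I (x + h k *\<^sub>R z) * g z) \<longlonglongrightarrow> ?I x * g z"
        proof (intro AE_I2 tendsto_mult_right)
          fix z
          have l: "(\<lambda>k. x + h k *\<^sub>R z) \<longlonglongrightarrow> x"
            using tendsto_add[OF tendsto_const[of x] tendsto_scaleR[OF h0 tendsto_const[of z]]] by simp
          have "x \<in> box l u \<or> x \<in> - closure (box l u)"
            using x interior_open[OF open_box, of l u] by (auto simp: frontier_def)
          then have "eventually (\<lambda>k. ?I (x + h k *\<^sub>R z) = ?I x) sequentially"
          proof
            assume "x \<in> box l u"
            then show ?thesis using topological_tendstoD[OF l open_box, of l u]
              by (auto elim!: eventually_mono simp: indicator_def)
          next
            assume "x \<in> - closure (box l u)"
            then have x': "x \<in> - closure (box l u)" "x \<notin> box l u" using closure_subset by auto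
            have "open (- closure (box l u))" by auto
            from topological_tendstoD[OF l this x'(1)] show ?thesis
              by (rule eventually_mono) (use x'(2) closure_subset in \<open>auto simp: indicator_def\<close>)
          qed
          then show "(\<lambda>k. ?I (x + h k *\<^sub>R z)) \<longlonglongrightarrow> ?I x"
            by (rule tendsto_eventually)
        qed
      qed auto
      then show ?thesis by (simp add: W_def gc)
    qed
    have "(\<lambda>k. LINT x|lborel. H x * W k x) \<longlonglongrightarrow> (LINT x|lborel. H x * (?I x * of_real c))"
    proof (rule integral_dominated_convergence)
      show "integrable lborel (\<lambda>x. norm (H x) * c)" using H by simp
      show "AE x in lborel. norm (H x * W k x) \<le> norm (H x) * c" for k
        using Wb by (intro AE_I2) (simp add: norm_mult mult_left_mono)
      \<comment> \<open>Convergence of the averages is proved off the boundary, which is a null set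
        because the box is convex.\<close>
      have "AE x in lborel. x \<notin> frontier (box l u)"
      proof -
        have "frontier (box l u) \<in> null_sets lebesgue"
          using negligible_convex_frontier[OF convex_box(2)] by (simp add: negligible_iff_null_sets)
        then have "frontier (box l u) \<in> null_sets lborel"
          by (auto simp: null_sets_def emeasure_completion[symmetric] intro!: borel_closed)
        then show ?thesis by (rule AE_not_in)
      qed
      then show "AE x in lborel. (\<lambda>k. H x * W k x) \<longlonglongrightarrow> H x * (?I x * of_real c)"
        by eventually_elim (intro tendsto_mult_left Wl)
    qed auto
    then have "(LINT x|lborel. H x * (?I x * of_real c)) = 0"
      unfolding W0 using LIMSEQ_unique tendsto_const by blast
    then have "of_real c * (LINT x|lborel. ?I x * H x) = 0"
      by (subst integral_mult_right_zero[symmetric]) (simp add: mult_ac)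
    then show ?thesis using c by simp
  qed
  then have "AE x in lborel. H x = 0" by (rule AE_zero_if_box_integrals_zero[OF H])
  then show ?thesis by eventually_elim (simp add: H_def g_def)
qed

lemma dist_of_fun_eq_imp_AE:
  assumes "tempered_fun F" "tempered_fun G" "dist_of_fun F = dist_of_fun G"
  shows "AE x in lborel. F x = G x"
proof -
  have "(LINT x|lborel. (F x - G x) * \<psi> x) = 0" if "\<psi> \<in> schwartz" for \<psi>
  proof -
    have "(LINT x|lborel. F x * \<psi> x) = (LINT x|lborel. G x * \<psi> x)"
      using fun_cong[OF assms(3), of \<psi>] that by (simp add: dist_of_fun_def)
    then show ?thesis using assms(1,2) that by (simp add: left_diff_distrib tempered_fun_def)
  qed
  moreover have "tempered_fun (\<lambda>x. F x - G x)"
    using assms(1,2) by (auto simp: tempered_fun_def left_diff_distrib)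
  ultimately have "AE x in lborel. F x - G x = 0" by (intro AE_zero_if_schwartz_integrals_zero)
  then show ?thesis by simp
qed

lemma dist_of_fun_cong_AE:
  assumes "F \<in> borel_measurable borel" "G \<in> borel_measurable borel" "AE x in lborel. F x = G x"
  shows "dist_of_fun F = dist_of_fun G"
  unfolding dist_of_fun_def
proof (rule restrict_ext)
  fix \<psi> :: "real^'a \<Rightarrow> complex" assume "\<psi> \<in> schwartz"
  then show "(LINT x|lborel. F x * \<psi> x) = (LINT x|lborel. G x * \<psi> x)"
    using assms schwartz_measurable[of \<psi>] by (intro integral_cong_AE) (auto elim!: eventually_mono)
qed

section \<open>Distributions prescribed by their Fourier image\<close>

text \<open>The inverse Fourier transform of \<open>F\<close> as a distribution, defined by
  transposition. Elements of \<open>L2_dagger\<close> and the solutions considered here are all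
  brought into this form.\<close>

definition ift :: "(real^'n::finite \<Rightarrow> complex) \<Rightarrow> 'n distribution" where
  "ift F = (\<lambda>\<psi>\<in>schwartz. LINT \<xi>|lborel. F \<xi> * inv_fourier \<psi> \<xi>)"

lemma has_fourier_fun_eq_ift:
  assumes "has_fourier_fun T F" "T \<in> extensional schwartz"
  shows "T = ift F"
proof (rule extensionalityI[OF assms(2)])
  show "ift F \<in> extensional schwartz" by (simp add: ift_def)
  fix \<psi> :: "real^'a \<Rightarrow> complex" assume \<psi>: "\<psi> \<in> schwartz"
  have "T (fourier (inv_fourier \<psi>)) = (LINT x|lborel. F x * inv_fourier \<psi> x)"
  proof -
    have "fourier_dist T (inv_fourier \<psi>) = dist_of_fun F (inv_fourier \<psi>)"
      using assms(1) by (simp add: has_fourier_fun_def)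
    then show ?thesis
      by (simp only: fourier_dist_def dist_of_fun_def restrict_apply' schwartz_inv_fourier[OF \<psi>])
  qed
  then show "T \<psi> = ift F \<psi>" using \<psi> by (simp add: fourier_inv_fourier ift_def)
qed

lemma has_fourier_fun_ift: "tempered_fun F \<Longrightarrow> has_fourier_fun (ift F) F"
  by (auto simp: has_fourier_fun_def fourier_dist_def dist_of_fun_def ift_def schwartz_fourier inv_fourier_fourier
      intro!: restrict_ext)

lemma has_fourier_fun_unique:
  "has_fourier_fun T F \<Longrightarrow> has_fourier_fun T G \<Longrightarrow> AE \<xi> in lborel. F \<xi> = G \<xi>"
  unfolding has_fourier_fun_def using dist_of_fun_eq_imp_AE by metis

lemma ift_cong_AE:
  assumes "F \<in> borel_measurable borel" "G \<in> borel_measurable borel" "AE x in lborel. F x = G x"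
  shows "ift F = ift G"
  unfolding ift_def
proof (rule restrict_ext)
  fix \<psi> :: "real^'a \<Rightarrow> complex" assume "\<psi> \<in> schwartz"
  then show "(LINT x|lborel. F x * inv_fourier \<psi> x) = (LINT x|lborel. G x * inv_fourier \<psi> x)"
    using assms schwartz_measurable[OF schwartz_inv_fourier, of \<psi>] by (intro integral_cong_AE) (auto elim!: eventually_mono)
qed

text \<open>\<open>tempered_fun\<close> asks only for integrability against each test function. The
  explicit growth bound also yields the seminorm estimate in \<open>tempered\<close>, and it
  survives multiplication by |xi|^(2s) or the heat multiplier as well as dilations.\<close>

definition poly_bounded :: "(real^'n::finite \<Rightarrow> complex) \<Rightarrow> bool" where
  "poly_bounded F \<longleftrightarrow> F \<in> borel_measurable borel \<and> (\<exists>C N. \<forall>\<xi>. norm (F \<xi>) \<le> C * (1 + norm \<xi>) ^ N)"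

lemma poly_boundedE:
  assumes "poly_bounded F"
  obtains C N where "C > 0" "\<And>\<xi>. norm (F \<xi>) \<le> C * (1 + norm \<xi>) ^ N"
proof -
  obtain C N where C: "\<And>\<xi>. norm (F \<xi>) \<le> C * (1 + norm \<xi>) ^ N" using assms unfolding poly_bounded_def by blast
  have "norm (F \<xi>) \<le> max C 1 * (1 + norm \<xi>) ^ N" for \<xi>
    using C[of \<xi>] by (rule order_trans) (intro mult_right_mono, auto)
  then show ?thesis using that[of "max C 1" N] by auto
qed

lemma poly_bounded_measurable [measurable_dest]: "poly_bounded F \<Longrightarrow> F \<in> borel_measurable borel"
  by (simp add: poly_bounded_def)

lemma poly_bounded_bounded:
  assumes "F \<in> borel_measurable borel" "\<And>\<xi>. norm (F \<xi>) \<le> C" shows "poly_bounded F"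
  unfolding poly_bounded_def using assms by (intro conjI exI[of _ C] exI[of _ 0]) auto

lemma poly_bounded_mult:
  assumes F: "poly_bounded F" and G: "poly_bounded G"
  shows "poly_bounded (\<lambda>\<xi>. F \<xi> * G \<xi>)"
proof -
  obtain C N where C: "C > 0" "\<And>\<xi>. norm (F \<xi>) \<le> C * (1 + norm \<xi>) ^ N" using poly_boundedE[OF F] by blast
  obtain D M where D: "D > 0" "\<And>\<xi>. norm (G \<xi>) \<le> D * (1 + norm \<xi>) ^ M" using poly_boundedE[OF G] by blast
  have "norm (F \<xi> * G \<xi>) \<le> (C * D) * (1 + norm \<xi>) ^ (N + M)" for \<xi>
  proof -
    have "norm (F \<xi>) * norm (G \<xi>) \<le> (C * (1 + norm \<xi>) ^ N) * (D * (1 + norm \<xi>) ^ M)"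
      using C D by (intro mult_mono) auto
    then show ?thesis by (simp add: norm_mult power_add mult_ac)
  qed
  then show ?thesis using F G unfolding poly_bounded_def by (blast intro: borel_measurable_times)
qed

text \<open>Of the N+n+1 powers of decay, \<open>N\<close> pay for the growth of \<open>F\<close>
  and n+1 leave an integrable majorant.\<close>

lemma poly_bounded_schwartz_bound:
  fixes F :: "'n::finite cfun"
  assumes "norm (F \<xi>) \<le> C * (1 + norm \<xi>) ^ N" "(1 + norm \<xi>) ^ (N + CARD('n) + 1) * norm (\<psi> \<xi>) \<le> B" "C \<ge> 0"
  shows "norm (F \<xi> * \<psi> \<xi>) \<le> C * B * (1 / (1 + norm \<xi>) ^ (CARD('n) + 1))"
proof -
  let ?r = "1 + norm \<xi>"
  have r: "?r ^ (CARD('n) + 1) > 0" by (simp add: add_pos_nonneg)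
  have "norm (F \<xi> * \<psi> \<xi>) * ?r ^ (CARD('n) + 1) \<le> (C * ?r ^ N * norm (\<psi> \<xi>)) * ?r ^ (CARD('n) + 1)"
    unfolding norm_mult by (intro mult_right_mono assms) auto
  also have "... = C * (?r ^ (N + CARD('n) + 1) * norm (\<psi> \<xi>))" by (simp add: power_add mult_ac)
  also have "... \<le> C * B" by (intro mult_left_mono assms)
  finally show ?thesis using r by (simp add: pos_le_divide_eq del: power_Suc)
qed

lemma poly_bounded_tempered_fun:
  fixes F :: "'n::finite cfun"
  assumes F: "poly_bounded F" shows "tempered_fun F"
  unfolding tempered_fun_def
proof (intro conjI ballI)
  show [measurable]: "F \<in> borel_measurable borel" using F by (simp add: poly_bounded_def)
  fix \<psi> :: "'n cfun" assume \<psi>: "\<psi> \<in> schwartz"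
  obtain C N where C: "C > 0" "\<And>\<xi>. norm (F \<xi>) \<le> C * (1 + norm \<xi>) ^ N" using poly_boundedE[OF F] by blast
  obtain B where B: "B > 0" "\<And>\<xi>. (1 + norm \<xi>) ^ (N + CARD('n) + 1) * norm (\<psi> \<xi>) \<le> B"
    using bounded_family_decay[OF schwartz_imp_bounded_family[OF \<psi>]] by (metis (no_types, lifting))
  show "integrable lborel (\<lambda>x. F x * \<psi> x)"
  proof (rule Bochner_Integration.integrable_bound)
    show "integrable lborel (\<lambda>x::real^'n. C * B * (1 / (1 + norm x) ^ (CARD('n) + 1)))"
      by (rule integrable_mult_right[OF integrable_one_plus_norm])
    show "(\<lambda>x. F x * \<psi> x) \<in> borel_measurable lborel" using schwartz_measurable[OF \<psi>] by simp
    show "AE x in lborel. norm (F x * \<psi> x) \<le> norm (C * B * (1 / (1 + norm x) ^ (CARD('n) + 1)))"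
    proof (rule AE_I2)
      fix x
      have "norm (F x * \<psi> x) \<le> C * B * (1 / (1 + norm x) ^ (CARD('n) + 1))"
        using C B by (intro poly_bounded_schwartz_bound[where N=N]) auto
      also have "... \<le> norm (C * B * (1 / (1 + norm x) ^ (CARD('n) + 1)))" by (metis norm_ge_zero abs_ge_self real_norm_def)
      finally show "norm (F x * \<psi> x) \<le> norm (C * B * (1 / (1 + norm x) ^ (CARD('n) + 1)))" .
    qed
  qed
qed

lemma inv_fourier_linear:
  assumes "f \<in> schwartz" "g \<in> schwartz"
  shows "inv_fourier (\<lambda>x. a * f x + b * g x) \<xi> = a * inv_fourier f \<xi> + b * inv_fourier g \<xi>"
proof -
  have i: "integrable lborel (\<lambda>x. cis (\<xi> \<bullet> x) * f x)" "integrable lborel (\<lambda>x. cis (\<xi> \<bullet> x) * g x)"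
    by (intro integrable_cis_mult schwartz_integrable assms; simp)+
  have "(LINT x|lborel. cis (\<xi> \<bullet> x) * (a * f x + b * g x)) = (LINT x|lborel. a * (cis (\<xi> \<bullet> x) * f x) + b * (cis (\<xi> \<bullet> x) * g x))"
    by (intro Bochner_Integration.integral_cong refl) (simp add: algebra_simps)
  also have "... = a * (LINT x|lborel. cis (\<xi> \<bullet> x) * f x) + b * (LINT x|lborel. cis (\<xi> \<bullet> x) * g x)"
    using i by (subst Bochner_Integration.integral_add) auto
  finally show ?thesis by (simp add: inv_fourier_def algebra_simps)
qed

lemma tempered_ift:
  fixes F :: "'n::finite cfun"
  assumes F: "poly_bounded F" shows "tempered (ift F)"
  unfolding tempered_def
proof (intro conjI ballI allI)
  show "ift F \<in> extensional schwartz" by (simp add: ift_def)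
next
  fix \<psi> \<eta> :: "'n cfun" and a b assume s: "\<psi> \<in> schwartz" "\<eta> \<in> schwartz"
  have i: "integrable lborel (\<lambda>x. F x * inv_fourier \<psi> x)" "integrable lborel (\<lambda>x. F x * inv_fourier \<eta> x)"
    using poly_bounded_tempered_fun[OF F] s schwartz_inv_fourier by (auto simp: tempered_fun_def)
  have "(\<lambda>x. a * \<psi> x + b * \<eta> x) \<in> schwartz" by (intro schwartz_add schwartz_cmult s)
  then have "ift F (\<lambda>x. a * \<psi> x + b * \<eta> x) = (LINT x|lborel. a * (F x * inv_fourier \<psi> x) + b * (F x * inv_fourier \<eta> x))"
    by (simp add: ift_def inv_fourier_linear[OF s] algebra_simps)
  also have "... = a * ift F \<psi> + b * ift F \<eta>"
    using i s by (subst Bochner_Integration.integral_add) (auto simp: ift_def)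
  finally show "ift F (\<lambda>x. a * \<psi> x + b * \<eta> x) = a * ift F \<psi> + b * ift F \<eta>" .
next
  obtain C N where C: "C > 0" "\<And>\<xi>. norm (F \<xi>) \<le> C * (1 + norm \<xi>) ^ N" using poly_boundedE[OF F] by blast
  obtain D M where D: "\<And>f \<xi>. f \<in> schwartz \<Longrightarrow> (1 + norm (\<xi>::real^'n)) ^ (N + CARD('n) + 1) * norm (fourier f \<xi>) \<le> D * total_seminorm M f"
    using fourier_decay[of "N + CARD('n) + 1"] by blast
  define I where "I = (LINT x|lborel. 1 / (1 + norm (x::real^'n)) ^ (CARD('n) + 1))"
  have "norm (ift F \<psi>) \<le> (C * D * I) * (\<Sum>is | length is \<le> M. schwartz_seminorm M is \<psi>)" if \<psi>: "\<psi> \<in> schwartz" for \<psi>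
  proof -
    have i: "integrable lborel (\<lambda>x. F x * inv_fourier \<psi> x)"
      using poly_bounded_tempered_fun[OF F] \<psi> schwartz_inv_fourier by (auto simp: tempered_fun_def)
    have "norm (ift F \<psi>) \<le> (LINT x|lborel. norm (F x * inv_fourier \<psi> x))"
      using \<psi> by (simp add: ift_def integral_norm_bound)
    also have "... \<le> (LINT x|lborel. C * (D * total_seminorm M \<psi>) * (1 / (1 + norm (x::real^'n)) ^ (CARD('n) + 1)))"
    proof (intro integral_mono integrable_norm i integrable_mult_right integrable_one_plus_norm poly_bounded_schwartz_bound[where N=N])
      fix x show "(1 + norm x) ^ (N + CARD('n) + 1) * norm (inv_fourier \<psi> x) \<le> D * total_seminorm M \<psi>"
        using D[OF \<psi>, of "- x"] by (simp add: inv_fourier_eq)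
    qed (use C in auto)
    also have "... = C * (D * total_seminorm M \<psi>) * I" unfolding I_def by (rule integral_mult_right_zero)
    finally show ?thesis by (simp add: total_seminorm_def mult_ac)
  qed
  then show "\<exists>C N. \<forall>\<psi>\<in>schwartz. norm (ift F \<psi>) \<le> C * (\<Sum>is | length is \<le> N. schwartz_seminorm N is \<psi>)" by blast
qed

text \<open>Boundedness together with pointwise convergence suffices. The seminorms give an
  integrable majorant for \<open>inv_fourier (Q j) \<xi>\<close> at fixed \<open>\<xi>\<close>, and
  since the transforms form a bounded family again, also one for the outer integral.\<close>

lemma ift_tendsto:
  fixes F :: "'n::finite cfun"
  assumes F: "poly_bounded F" and Q: "bounded_family Q" and \<psi>: "\<psi> \<in> schwartz"
    and lim: "\<And>x. (\<lambda>j::nat. Q j x) \<longlonglongrightarrow> \<psi> x"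
  shows "(\<lambda>j. ift F (Q j)) \<longlonglongrightarrow> ift F \<psi>"
proof -
  have Qs: "Q j \<in> schwartz" for j by (rule bounded_family_imp_schwartz[OF Q])
  note [measurable] = schwartz_measurable[OF Qs] schwartz_measurable[OF \<psi>] poly_bounded_measurable[OF F]
    schwartz_measurable[OF schwartz_inv_fourier[OF Qs]] schwartz_measurable[OF schwartz_inv_fourier[OF \<psi>]]
  obtain B where B: "B > 0" "\<And>j. total_seminorm (CARD('n) + 1) (Q j) \<le> B" using bounded_family_total_seminorm[OF Q] by blast
  have I: "(\<lambda>j. inv_fourier (Q j) \<xi>) \<longlonglongrightarrow> inv_fourier \<psi> \<xi>" for \<xi>
    unfolding inv_fourier_def
  proof (rule tendsto_mult_left, rule integral_dominated_convergence)
    show "integrable lborel (\<lambda>x::real^'n. B * (1 / (1 + norm x) ^ (CARD('n) + 1)))"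
      by (rule integrable_mult_right[OF integrable_one_plus_norm])
    show "AE x in lborel. norm (cis (\<xi> \<bullet> x) * Q j x) \<le> B * (1 / (1 + norm x) ^ (CARD('n) + 1))" for j
    proof (rule AE_I2)
      fix x
      have "norm (cis (\<xi> \<bullet> x) * Q j x) \<le> total_seminorm (CARD('n) + 1) (Q j) * (1 / (1 + norm x) ^ (CARD('n) + 1))"
        using schwartz_integrable_bound[OF Qs] by (simp add: norm_mult)
      also have "... \<le> B * (1 / (1 + norm x) ^ (CARD('n) + 1))" by (intro mult_right_mono B) auto
      finally show "norm (cis (\<xi> \<bullet> x) * Q j x) \<le> B * (1 / (1 + norm x) ^ (CARD('n) + 1))" .
    qed
    show "AE x in lborel. (\<lambda>j. cis (\<xi> \<bullet> x) * Q j x) \<longlonglongrightarrow> cis (\<xi> \<bullet> x) * \<psi> x"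
      by (intro AE_I2 tendsto_mult_left lim)
  qed auto
  obtain C N where C: "C > 0" "\<And>\<xi>. norm (F \<xi>) \<le> C * (1 + norm \<xi>) ^ N" using poly_boundedE[OF F] by blast
  obtain B' where B': "\<And>j \<xi>. (1 + norm \<xi>) ^ (N + CARD('n) + 1) * norm (inv_fourier (Q j) \<xi>) \<le> B'"
    using bounded_family_decay[OF bounded_family_inv_fourier[OF Q]] by metis
  have "(\<lambda>j. LINT \<xi>|lborel. F \<xi> * inv_fourier (Q j) \<xi>) \<longlonglongrightarrow> (LINT \<xi>|lborel. F \<xi> * inv_fourier \<psi> \<xi>)"
  proof (rule integral_dominated_convergence)
    show "integrable lborel (\<lambda>x::real^'n. C * B' * (1 / (1 + norm x) ^ (CARD('n) + 1)))"
      by (rule integrable_mult_right[OF integrable_one_plus_norm])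
    show "AE x in lborel. norm (F x * inv_fourier (Q j) x) \<le> C * B' * (1 / (1 + norm x) ^ (CARD('n) + 1))" for j
      by (intro AE_I2 poly_bounded_schwartz_bound[where N=N] C B') (use C in auto)
    show "AE x in lborel. (\<lambda>j. F x * inv_fourier (Q j) x) \<longlonglongrightarrow> F x * inv_fourier \<psi> x"
      by (intro AE_I2 tendsto_mult_left I)
  qed auto
  then show ?thesis using Qs \<psi> by (simp add: ift_def)
qed

subsection \<open>Uniform boundedness and a product rule for distributions\<close>

lemma bounded_family_norm_bounded:
  assumes "bounded_family f"
  obtains B where "B > 0" "\<And>j x. norm (f j x) \<le> B"
proof -
  obtain B where "B > 0" "\<And>j x. (1 + norm x) ^ 0 * norm (f j x) \<le> B"
    using bounded_family_decay[OF assms, of 0] by blast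
  then show ?thesis using that by simp
qed

text \<open>The factor 3/2 is the sum of the series of 3^-i. The ratio 1/3 is small enough for the
  gliding hump: the tail after the k-th term is at most half of the bound for that term.\<close>

lemma geometric_tail:
  fixes a :: "nat \<Rightarrow> complex"
  assumes a: "\<And>m. norm (a m) \<le> B * (1 / 3) ^ m"
  shows "summable a" "norm (suminf a - (\<Sum>i<n. a i)) \<le> B * (3 / 2) * (1 / 3) ^ n"
proof -
  have s: "summable (\<lambda>m. B * (1 / 3) ^ m)" by (intro summable_mult summable_geometric) simp
  show sa: "summable a" by (rule summable_comparison_test'[OF s]) (use a in auto)
  have "suminf a - (\<Sum>i<n. a i) = (\<Sum>i. a (i + n))"
    using suminf_minus_initial_segment[OF sa, of n] by simp
  also have "norm ... \<le> (\<Sum>i. B * (1 / 3) ^ n * (1 / 3) ^ i)"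
  proof (rule norm_suminf_le)
    show "norm (a (i + n)) \<le> B * (1 / 3) ^ n * (1 / 3) ^ i" for i
      using a[of "i + n"] by (simp add: power_add mult_ac)
    show "summable (\<lambda>i. B * (1 / 3) ^ n * (1 / 3 :: real) ^ i)" by (intro summable_mult summable_geometric) simp
  qed
  also have "... = B * (1 / 3) ^ n * (\<Sum>i. (1 / 3) ^ i)"
    by (rule suminf_mult) (simp add: summable_geometric)
  also have "(\<Sum>i. (1 / 3 :: real) ^ i) = 3 / 2" by (subst suminf_geometric) auto
  finally show "norm (suminf a - (\<Sum>i<n. a i)) \<le> B * (3 / 2) * (1 / 3) ^ n" by (simp add: mult_ac)
qed

text \<open>The weights are summable and the first derivatives of the family are bounded, so the
  formally differentiated series converges uniformly in \<open>x\<close>, which justifies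
  differentiation term by term.\<close>

lemma series_has_derivative:
  fixes \<zeta> :: "nat \<Rightarrow> real^'n::finite \<Rightarrow> complex"
  assumes \<zeta>: "bounded_family \<zeta>" and c: "\<And>m. norm (c m) \<le> (1 / 3) ^ m"
  shows "((\<lambda>x. \<Sum>m. c m * \<zeta> m x) has_derivative
      (\<lambda>v. \<Sum>k\<in>UNIV. of_real (v $ k) * (\<Sum>m. c m * partial_deriv k (\<zeta> m) x))) (at x)"
proof -
  obtain B0 where "B0 > 0" and B0: "\<And>m x. norm (\<zeta> m x) \<le> B0"
    by (rule bounded_family_norm_bounded[OF \<zeta>]) (rule that)
  have "\<exists>B. \<forall>m x. norm (partial_deriv k (\<zeta> m) x) \<le> B" for k
  proof -
    obtain B where "B > 0" "\<And>m x. norm (partial_deriv k (\<zeta> m) x) \<le> B"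
      by (rule bounded_family_norm_bounded[OF bounded_family_partial[OF \<zeta>]]) (rule that)
    then show ?thesis by blast
  qed
  then obtain B where B: "\<And>k m x. norm (partial_deriv k (\<zeta> m) x) \<le> B k"
    by metis
  have geo0: "norm (c m * \<zeta> m x) \<le> B0 * (1 / 3) ^ m" for m x
    using mult_mono[OF c[of m] B0[of m x]] by (simp add: norm_mult mult.commute)
  have geo: "norm (c m * partial_deriv k (\<zeta> m) x) \<le> B k * (1 / 3) ^ m" for k m x
    using mult_mono[OF c[of m] B[of k m x]] by (simp add: norm_mult mult.commute)
  define f' where "f' m x v = c m * (\<Sum>k\<in>UNIV. of_real (v $ k) * partial_deriv k (\<zeta> m) x)" for m x and v :: "real^'n"
  define g' where "g' x v = (\<Sum>k\<in>UNIV. of_real (v $ k) * (\<Sum>m. c m * partial_deriv k (\<zeta> m) x))" for x and v :: "real^'n"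
  have tail: "norm ((\<Sum>i<n. f' i x v) - g' x v) \<le> (\<Sum>k\<in>UNIV. B k) * (3 / 2) * (1 / 3) ^ n * norm v" for n x v
  proof -
    have "(\<Sum>i<n. f' i x v) - g' x v = (\<Sum>k\<in>UNIV. of_real (v $ k) * ((\<Sum>i<n. c i * partial_deriv k (\<zeta> i) x) - (\<Sum>m. c m * partial_deriv k (\<zeta> m) x)))"
      unfolding f'_def g'_def sum_distrib_left right_diff_distrib sum_subtractf
      by (subst sum.swap) (simp add: mult_ac)
    also have "norm ... \<le> (\<Sum>k\<in>UNIV. norm v * (B k * (3 / 2) * (1 / 3) ^ n))"
    proof (rule order_trans[OF norm_sum sum_mono])
      fix k
      show "norm (of_real (v $ k) * ((\<Sum>i<n. c i * partial_deriv k (\<zeta> i) x) - (\<Sum>m. c m * partial_deriv k (\<zeta> m) x)))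
        \<le> norm v * (B k * (3 / 2) * (1 / 3) ^ n)"
        unfolding norm_mult
        using geometric_tail(2)[where a = "\<lambda>m. c m * partial_deriv k (\<zeta> m) x" and B = "B k" and n = n, OF geo] component_le_norm_cart[of v k]
        by (intro mult_mono) (auto simp: norm_minus_commute)
    qed
    also have "... = (\<Sum>k\<in>UNIV. B k) * (3 / 2) * (1 / 3) ^ n * norm v"
      by (simp add: sum_distrib_left sum_distrib_right mult_ac)
    finally show ?thesis .
  qed
  have "\<exists>g. \<forall>x\<in>UNIV. (\<lambda>m. c m * \<zeta> m x) sums (g x) \<and> (g has_derivative g' x) (at x within UNIV)"
  proof (rule has_derivative_series)
    show "((\<lambda>x. c m * \<zeta> m x) has_derivative f' m x) (at x within UNIV)" for m x
      unfolding f'_def by (rule has_derivative_mult_right[OF bounded_family_has_derivative[OF \<zeta>]])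
    show "\<forall>\<^sub>F n in sequentially. \<forall>x\<in>UNIV. \<forall>h. norm ((\<Sum>i<n. f' i x h) - g' x h) \<le> e * norm h" if "e > 0" for e
    proof -
      have "(\<lambda>n. (\<Sum>k\<in>UNIV. B k) * (3 / 2) * (1 / 3) ^ n) \<longlonglongrightarrow> (\<Sum>k\<in>UNIV. B k) * (3 / 2) * 0"
        by (intro tendsto_intros LIMSEQ_power_zero) auto
      then have "\<forall>\<^sub>F n in sequentially. (\<Sum>k\<in>UNIV. B k) * (3 / 2) * (1 / 3) ^ n < e"
        using that by (intro order_tendstoD(2)) auto
      then show ?thesis
      proof (rule eventually_mono, intro ballI allI)
        fix n x h assume "(\<Sum>k\<in>UNIV. B k) * (3 / 2) * (1 / 3) ^ n < e"
        then have "(\<Sum>k\<in>UNIV. B k) * (3 / 2) * (1 / 3) ^ n * norm (h::real^'n) \<le> e * norm h" by (intro mult_right_mono) auto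
        then show "norm ((\<Sum>i<n. f' i x h) - g' x h) \<le> e * norm h" using tail order_trans by blast
      qed
    qed
    show "(\<lambda>m. c m * \<zeta> m 0) sums (\<Sum>m. c m * \<zeta> m 0)" by (intro summable_sums geometric_tail(1)[OF geo0])
  qed auto
  then obtain g where g: "\<And>x. (\<lambda>m. c m * \<zeta> m x) sums (g x)" "\<And>x. (g has_derivative g' x) (at x)" by auto
  have "g = (\<lambda>x. \<Sum>m. c m * \<zeta> m x)" using g(1) by (auto simp: sums_iff)
  then show ?thesis using g(2)[of x] by (simp add: g'_def[abs_def])
qed

lemma bounded_family_series:
  fixes \<zeta> :: "'j \<Rightarrow> nat \<Rightarrow> real^'n::finite \<Rightarrow> complex"
  assumes \<zeta>: "bounded_family (\<lambda>(j, m). \<zeta> j m)" and c: "\<And>j m. norm (c j m) \<le> (1 / 3) ^ m"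
  shows "bounded_family (\<lambda>j x. \<Sum>m. c j m * \<zeta> j m x)"
proof -
  let ?Z = "{\<lambda>j x. \<Sum>m. c j m * \<zeta> j m x | \<zeta> :: 'j \<Rightarrow> nat \<Rightarrow> real^'n \<Rightarrow> complex. bounded_family (\<lambda>(j, m). \<zeta> j m)}"
  have sec: "bounded_family (\<zeta> j)" if "bounded_family (\<lambda>(j, m). \<zeta> j m)" for \<zeta> :: "'j \<Rightarrow> nat \<Rightarrow> real^'n \<Rightarrow> complex" and j
    using bounded_family_reindex[OF that, of "\<lambda>m. (j, m)"] by simp
  show ?thesis
  proof (rule bounded_family_coinduct[where Z = ?Z])
    show "(\<lambda>j x. \<Sum>m. c j m * \<zeta> j m x) \<in> ?Z" using \<zeta> by blast
  next
    fix h :: "'j \<Rightarrow> real^'n \<Rightarrow> complex" and j x assume "h \<in> ?Z"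
    then obtain \<zeta> where h: "h = (\<lambda>j x. \<Sum>m. c j m * \<zeta> j m x)" "bounded_family (\<lambda>(j, m). \<zeta> j m)" by blast
    show "h j differentiable at x"
      unfolding h(1) by (rule differentiableI[OF series_has_derivative[OF sec[OF h(2)] c]])
  next
    fix h :: "'j \<Rightarrow> real^'n \<Rightarrow> complex" and N assume "h \<in> ?Z"
    then obtain \<zeta> where h: "h = (\<lambda>j x. \<Sum>m. c j m * \<zeta> j m x)" "bounded_family (\<lambda>(j, m). \<zeta> j m)" by blast
    obtain B where B: "B > 0" "\<And>p x. (1 + norm x) ^ N * norm ((\<lambda>(j, m). \<zeta> j m) p x) \<le> B" using bounded_family_decay[OF h(2)] by blast
    have "(1 + norm x) ^ N * norm (h j x) \<le> B * (3 / 2)" for j x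
    proof -
      have "norm (of_real ((1 + norm x) ^ N) * (c j m * \<zeta> j m x)) \<le> B * (1 / 3) ^ m" for m
      proof -
        have "norm (of_real ((1 + norm x) ^ N) * (c j m * \<zeta> j m x)) = norm (c j m) * ((1 + norm x) ^ N * norm (\<zeta> j m x))"
          by (simp add: norm_mult norm_power add_nonneg_nonneg mult_ac del: of_real_power)
        also have "... \<le> (1 / 3) ^ m * B" using B(2)[of x "(j, m)"] by (intro mult_mono c) auto
        finally show ?thesis by (simp add: mult.commute)
      qed
      note t = geometric_tail[OF this]
      have "(\<Sum>m. of_real ((1 + norm x) ^ N) * (c j m * \<zeta> j m x)) = of_real ((1 + norm x) ^ N) * h j x"
      proof -
        have r: "complex_of_real ((1 + norm x) ^ N) \<noteq> 0" by (simp del: of_real_power) (smt (verit) norm_ge_zero)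
        have "summable (\<lambda>m. inverse (of_real ((1 + norm x) ^ N)) * (of_real ((1 + norm x) ^ N) * (c j m * \<zeta> j m x)))"
          by (rule summable_mult[OF t(1)])
        then have "summable (\<lambda>m. c j m * \<zeta> j m x)" using r by (simp add: mult.assoc[symmetric] del: of_real_power)
        then show ?thesis unfolding h by (rule suminf_mult)
      qed
      then show ?thesis using t(2)[of 0]
        by (simp add: norm_mult norm_power add_nonneg_nonneg del: of_real_power)
    qed
    then show "\<exists>C. \<forall>j x. (1 + norm x) ^ N * norm (h j x) \<le> C" by blast
  next
    fix h :: "'j \<Rightarrow> real^'n \<Rightarrow> complex" and i assume "h \<in> ?Z"
    then obtain \<zeta> where h: "h = (\<lambda>j x. \<Sum>m. c j m * \<zeta> j m x)" "bounded_family (\<lambda>(j, m). \<zeta> j m)" by blast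
    have "(\<lambda>j. partial_deriv i (h j)) = (\<lambda>j x. \<Sum>m. c j m * (\<lambda>j m. partial_deriv i (\<zeta> j m)) j m x)"
      unfolding h(1) by (intro ext) (subst partial_deriv_eq[OF series_has_derivative[OF sec[OF h(2)] c]]; simp)
    moreover have "bounded_family (\<lambda>(j, m). partial_deriv i (\<zeta> j m))"
      using bounded_family_partial[OF h(2), of i] by (simp add: case_prod_unfold)
    ultimately show "(\<lambda>j. partial_deriv i (h j)) \<in> ?Z"
      by (intro CollectI exI[of _ "\<lambda>j m. partial_deriv i (\<zeta> j m)"] conjI)
  qed
qed

lemma tempered_lin:
  "tempered T \<Longrightarrow> \<psi> \<in> schwartz \<Longrightarrow> \<eta> \<in> schwartz \<Longrightarrow> T (\<lambda>x. a * \<psi> x + b * \<eta> x) = a * T \<psi> + b * T \<eta>"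
  unfolding tempered_def by blast

lemma tempered_bound:
  assumes "tempered T"
  obtains C N where "C > 0" "\<And>\<psi>. \<psi> \<in> schwartz \<Longrightarrow> norm (T \<psi>) \<le> C * total_seminorm N \<psi>"
proof -
  obtain C N where C: "\<And>\<psi>. \<psi> \<in> schwartz \<Longrightarrow> norm (T \<psi>) \<le> C * total_seminorm N \<psi>"
    using assms unfolding tempered_def total_seminorm_def by blast
  have "norm (T \<psi>) \<le> max C 1 * total_seminorm N \<psi>" if "\<psi> \<in> schwartz" for \<psi>
    using C[OF that] by (rule order_trans) (intro mult_right_mono total_seminorm_nonneg that, auto)
  then show ?thesis using that[of "max C 1" N] by auto
qed

lemma tempered_bounded_family:
  assumes "tempered T" "bounded_family \<zeta>"
  obtains K where "K > 0" "\<And>j. norm (T (\<zeta> j)) \<le> K"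
proof -
  obtain C N where C: "C > 0" "\<And>\<psi>. \<psi> \<in> schwartz \<Longrightarrow> norm (T \<psi>) \<le> C * total_seminorm N \<psi>"
    using tempered_bound[OF assms(1)] by blast
  obtain B where B: "B > 0" "\<And>j. total_seminorm N (\<zeta> j) \<le> B" using bounded_family_total_seminorm[OF assms(2)] by blast
  have "norm (T (\<zeta> j)) \<le> C * B" for j
    by (rule order_trans[OF C(2)[OF bounded_family_imp_schwartz[OF assms(2)]] mult_left_mono[OF B(2) less_imp_le[OF C(1)]]])
  then show ?thesis using that[of "C * B"] B C by simp
qed

lemma tempered_lincomb:
  assumes S: "tempered S" and T: "tempered T"
  shows "tempered (\<lambda>\<psi>\<in>schwartz. a * S \<psi> + b * T \<psi>)"
  unfolding tempered_def
proof (intro conjI ballI allI)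
  fix \<psi> \<eta> :: "real^'a \<Rightarrow> complex" and c d assume s: "\<psi> \<in> schwartz" "\<eta> \<in> schwartz"
  then have "(\<lambda>x. c * \<psi> x + d * \<eta> x) \<in> schwartz" by (intro schwartz_add schwartz_cmult)
  then show "(\<lambda>\<psi>\<in>schwartz. a * S \<psi> + b * T \<psi>) (\<lambda>x. c * \<psi> x + d * \<eta> x) =
     c * (\<lambda>\<psi>\<in>schwartz. a * S \<psi> + b * T \<psi>) \<psi> + d * (\<lambda>\<psi>\<in>schwartz. a * S \<psi> + b * T \<psi>) \<eta>"
    using s tempered_lin[OF S s] tempered_lin[OF T s] by (simp add: algebra_simps)
next
  obtain C N where C: "C > 0" "\<And>\<psi>. \<psi> \<in> schwartz \<Longrightarrow> norm (S \<psi>) \<le> C * total_seminorm N \<psi>" using tempered_bound[OF S] by blast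
  obtain D M where D: "D > 0" "\<And>\<psi>. \<psi> \<in> schwartz \<Longrightarrow> norm (T \<psi>) \<le> D * total_seminorm M \<psi>" using tempered_bound[OF T] by blast
  have "norm (a * S \<psi> + b * T \<psi>) \<le> (norm a * C + norm b * D) * total_seminorm (max N M) \<psi>" if "\<psi> \<in> schwartz" for \<psi>
  proof -
    have "norm (S \<psi>) \<le> C * total_seminorm (max N M) \<psi>"
      by (rule order_trans[OF C(2)[OF that] mult_left_mono[OF total_seminorm_mono[OF that] less_imp_le[OF C(1)]]]) simp
    moreover have "norm (T \<psi>) \<le> D * total_seminorm (max N M) \<psi>"
      by (rule order_trans[OF D(2)[OF that] mult_left_mono[OF total_seminorm_mono[OF that] less_imp_le[OF D(1)]]]) simp
    ultimately have "norm a * norm (S \<psi>) + norm b * norm (T \<psi>) \<le> norm a * (C * total_seminorm (max N M) \<psi>) + norm b * (D * total_seminorm (max N M) \<psi>)"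
      by (intro add_mono mult_left_mono) auto
    moreover have "norm (a * S \<psi> + b * T \<psi>) \<le> norm a * norm (S \<psi>) + norm b * norm (T \<psi>)"
      by (metis norm_mult norm_triangle_ineq)
    ultimately show ?thesis by (simp add: algebra_simps)
  qed
  then show "\<exists>C N. \<forall>\<psi>\<in>schwartz. norm ((\<lambda>\<psi>\<in>schwartz. a * S \<psi> + b * T \<psi>) \<psi>) \<le> C * (\<Sum>is | length is \<le> N. schwartz_seminorm N is \<psi>)"
    unfolding total_seminorm_def by (intro exI[of _ "norm a * C + norm b * D"] exI[of _ "max N M"]) simp
qed simp

text \<open>The remainder after \<open>n\<close> terms, multiplied by \<open>3 ^ n\<close>, is again
  a series of the same kind. These functions \<open>R n\<close> form a bounded family, on which
  \<open>T\<close> is bounded, so the remainder itself contributes at most a constant times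
  3^-n.\<close>

lemma tempered_series:
  fixes \<zeta> :: "nat \<Rightarrow> real^'n::finite \<Rightarrow> complex"
  assumes T: "tempered T" and \<zeta>: "bounded_family \<zeta>" and c: "\<And>m. norm (c m) \<le> (1 / 3) ^ m"
  shows "(\<lambda>x. \<Sum>m. c m * \<zeta> m x) \<in> schwartz" "(\<lambda>m. c m * T (\<zeta> m)) sums T (\<lambda>x. \<Sum>m. c m * \<zeta> m x)"
proof -
  define R where "R n x = (\<Sum>m. (3 ^ n * c (m + n)) * \<zeta> (m + n) x)" for n x
  have R: "bounded_family R"
    unfolding R_def
  proof (rule bounded_family_series)
    show "bounded_family (\<lambda>(n, m). \<zeta> (m + n))"
      using bounded_family_reindex[OF \<zeta>, of "\<lambda>(n, m). m + n"] by (simp add: case_prod_unfold)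
    show "norm (3 ^ n * c (m + n)) \<le> (1 / 3) ^ m" for n m
      using c[of "m + n"] by (simp add: norm_mult norm_power power_add field_simps)
  qed
  have Rs: "R n \<in> schwartz" for n by (rule bounded_family_imp_schwartz[OF R])
  have R0: "R 0 = (\<lambda>x. \<Sum>m. c m * \<zeta> m x)" by (simp add: R_def[abs_def])
  show "(\<lambda>x. \<Sum>m. c m * \<zeta> m x) \<in> schwartz" using Rs[of 0] R0 by simp
  have \<zeta>s: "\<zeta> n \<in> schwartz" for n by (rule bounded_family_imp_schwartz[OF \<zeta>])
  obtain B where "B > 0" and B: "\<And>m x. norm (\<zeta> m x) \<le> B"
    by (rule bounded_family_norm_bounded[OF \<zeta>]) (rule that)
  have sm: "summable (\<lambda>m. c m * \<zeta> m x)" for x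
    by (rule geometric_tail(1)[of _ B]) (use mult_mono[OF c B] in \<open>auto simp: norm_mult mult.commute\<close>)
  have rec: "R n x = (3 ^ n * c n) * \<zeta> n x + (1 / 3) * R (Suc n) x" for n x
  proof -
    have s: "summable (\<lambda>m. (3 ^ n * c (m + n)) * \<zeta> (m + n) x)"
      using summable_mult[OF iffD2[OF summable_iff_shift sm], of "3 ^ n" n x] by (simp add: mult.assoc)
    have "R n x = (3 ^ n * c n) * \<zeta> n x + (\<Sum>m. (3 ^ n * c (Suc m + n)) * \<zeta> (Suc m + n) x)"
      unfolding R_def using suminf_split_head[OF s] by simp
    also have "(\<Sum>m. (3 ^ n * c (Suc m + n)) * \<zeta> (Suc m + n) x) = (\<Sum>m. (1 / 3) * ((3 ^ Suc n * c (m + Suc n)) * \<zeta> (m + Suc n) x))"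
      by (simp add: mult_ac)
    also have "... = (1 / 3) * R (Suc n) x"
      unfolding R_def
      using summable_mult[OF iffD2[OF summable_iff_shift sm], of "3 ^ Suc n" "Suc n" x]
      by (intro suminf_mult) (simp add: mult.assoc)
    finally show ?thesis .
  qed
  have recT: "T (R n) = (3 ^ n * c n) * T (\<zeta> n) + (1 / 3) * T (R (Suc n))" for n
  proof -
    have "R n = (\<lambda>x. (3 ^ n * c n) * \<zeta> n x + (1 / 3) * R (Suc n) x)" using rec by blast
    then show ?thesis using tempered_lin[OF T \<zeta>s Rs] by metis
  qed
  have part: "(\<Sum>m<n. c m * T (\<zeta> m)) = T (R 0) - (1 / 3) ^ n * T (R n)" for n
  proof (induction n)
    case (Suc n)
    have "(1 / 3) ^ n * T (R n) = c n * T (\<zeta> n) + (1 / 3) ^ Suc n * T (R (Suc n))"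
    proof -
      have "(1 / 3) ^ n * (3 ^ n * c n) = c n" by (simp add: power_divide)
      then have "(1 / 3) ^ n * ((3 ^ n * c n) * T (\<zeta> n) + (1 / 3) * T (R (Suc n))) = c n * T (\<zeta> n) + (1 / 3) ^ Suc n * T (R (Suc n))"
        by (simp only: distrib_left mult.assoc[symmetric] power_Suc2)
      then show ?thesis by (simp only: recT[of n])
    qed
    then show ?case using Suc by simp
  qed simp
  obtain K where K: "K > 0" "\<And>n. norm (T (R n)) \<le> K" using tempered_bounded_family[OF T R] by blast
  have "(\<lambda>n. (1 / 3) ^ n * T (R n)) \<longlonglongrightarrow> 0"
  proof (rule Lim_null_comparison)
    show "\<forall>\<^sub>F n in sequentially. norm ((1 / 3) ^ n * T (R n)) \<le> (1 / 3) ^ n * K"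
      using K by (intro always_eventually allI) (simp add: norm_mult norm_power norm_divide divide_right_mono)
    show "(\<lambda>n. (1 / 3) ^ n * K) \<longlonglongrightarrow> 0"
      by (intro tendsto_mult_left_zero LIMSEQ_power_zero) auto
  qed
  then have "(\<lambda>n. T (R 0) - (1 / 3) ^ n * T (R n)) \<longlonglongrightarrow> T (R 0) - 0" by (intro tendsto_intros)
  then show "(\<lambda>m. c m * T (\<zeta> m)) sums T (\<lambda>x. \<Sum>m. c m * \<zeta> m x)"
    unfolding sums_def part R0[symmetric] by simp
qed

text \<open>Gliding hump: if \<open>A\<^sub>j \<zeta>\<^sub>j\<close> were unbounded, a sum of the \<open>\<zeta>\<close>'s with weights \<open>\<plusminus>3\<^sup>-\<^sup>k\<close> and suitable
  signs would be a Schwartz function on which the \<open>A\<^sub>j\<close> are unbounded.\<close>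

lemma uniform_boundedness:
  fixes \<zeta> :: "nat \<Rightarrow> real^'n::finite \<Rightarrow> complex" and A :: "nat \<Rightarrow> 'n distribution"
  assumes A: "\<And>j. tempered (A j)" and pw: "\<And>\<psi>. \<psi> \<in> schwartz \<Longrightarrow> \<exists>B. \<forall>j. norm (A j \<psi>) \<le> B"
    and \<zeta>: "bounded_family \<zeta>"
  shows "\<exists>B. \<forall>j. norm (A j (\<zeta> j)) \<le> B"
proof (rule ccontr)
  assume neg: "\<nexists>B. \<forall>j. norm (A j (\<zeta> j)) \<le> B"
  have \<zeta>s: "\<zeta> n \<in> schwartz" for n by (rule bounded_family_imp_schwartz[OF \<zeta>])
  \<comment> \<open>The supremum over the whole family, not the single value at
    \<open>\<zeta> j\<close>, bounds all later terms of the series at once.\<close>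
  define K where "K j = (SUP l. norm (A j (\<zeta> l)))" for j
  have bdd: "bdd_above (range (\<lambda>l. norm (A j (\<zeta> l))))" for j
    using tempered_bounded_family[OF A \<zeta>, of j] by (meson bdd_aboveI2)
  have K: "norm (A j (\<zeta> l)) \<le> K j" for j l unfolding K_def by (rule cSUP_upper[OF UNIV_I bdd])
  have "\<exists>j. 3 ^ k * (real k + 1) < norm (A j (\<zeta> j))" for k :: nat
    using neg by (meson not_le)
  \<comment> \<open>The margin \<open>3 ^ k\<close> compensates the weight of the k-th term; the
    factor k+1 then forces unboundedness.\<close>
  then obtain js where js: "\<And>k. 3 ^ k * (real k + 1) < norm (A (js k) (\<zeta> (js k)))" by metis
  have Kj: "3 ^ k * (real k + 1) < K (js k)" for k using js[of k] K[of "js k" "js k"] by linarith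
  have Kpos: "K (js k) > 0" for k using Kj[of k] by (smt (verit) mult_nonneg_nonneg of_nat_0_le_iff zero_le_power)
  have "\<exists>l. 9 / 10 * K (js k) < norm (A (js k) (\<zeta> l))" for k
  proof -
    have "9 / 10 * K (js k) < (SUP l. norm (A (js k) (\<zeta> l)))" using Kpos[of k] by (simp add: K_def[symmetric])
    then show ?thesis using less_cSUP_iff[OF _ bdd, of "9 / 10 * K (js k)" "js k"] by auto
  qed
  then obtain ls where ls: "\<And>k. 9 / 10 * K (js k) < norm (A (js k) (\<zeta> (ls k)))" by metis
  \<comment> \<open>One of the two signs always works, since 2|b| <= |a+b| + |a-b| whatever value a
    the earlier terms have accumulated.\<close>
  define Q where "Q k X X' \<longleftrightarrow> (\<exists>\<sigma>::real. \<bar>\<sigma>\<bar> = 1 \<and> X' = (\<lambda>x. 1 * X x + (of_real \<sigma> * (1 / 3) ^ k) * \<zeta> (ls k) x) \<and>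
     (1 / 3) ^ k * norm (A (js k) (\<zeta> (ls k))) \<le> norm (A (js k) X'))" for k and X X' :: "'n cfun"
  have "\<exists>X :: nat \<Rightarrow> real^'n \<Rightarrow> complex. \<forall>k. (X k \<in> schwartz \<and> (k = 0 \<longrightarrow> X k = (\<lambda>_. 0))) \<and> Q k (X k) (X (Suc k))"
  proof (rule dependent_nat_choice)
    show "\<exists>x :: real^'n \<Rightarrow> complex. x \<in> schwartz \<and> ((0::nat) = 0 \<longrightarrow> x = (\<lambda>_. 0))" using schwartz_zero by blast
    fix X :: "'n cfun" and k :: nat assume X: "X \<in> schwartz \<and> (k = 0 \<longrightarrow> X = (\<lambda>_. 0))"
    define Y where "Y \<sigma> = (\<lambda>x. 1 * X x + (of_real \<sigma> * (1 / 3) ^ k) * \<zeta> (ls k) x)" for \<sigma> :: real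
    have Y: "Y \<sigma> \<in> schwartz" for \<sigma> unfolding Y_def using X by (intro schwartz_add schwartz_cmult \<zeta>s) auto
    have AY: "A (js k) (Y \<sigma>) = A (js k) X + of_real \<sigma> * ((1 / 3) ^ k * A (js k) (\<zeta> (ls k)))" for \<sigma>
      using tempered_lin[OF A _ \<zeta>s, of X "js k" 1 "of_real \<sigma> * (1 / 3) ^ k" "ls k"] X unfolding Y_def by (simp add: mult.assoc)
    have "2 * ((1 / 3) ^ k * A (js k) (\<zeta> (ls k))) = A (js k) (Y 1) - A (js k) (Y (-1))" unfolding AY by simp
    then have "2 * norm ((1 / 3) ^ k * A (js k) (\<zeta> (ls k))) \<le> norm (A (js k) (Y 1)) + norm (A (js k) (Y (-1)))"
      by (metis norm_mult norm_numeral norm_triangle_ineq4)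
    moreover have "norm ((1 / 3) ^ k * A (js k) (\<zeta> (ls k))) = (1 / 3) ^ k * norm (A (js k) (\<zeta> (ls k)))"
      by (simp add: norm_mult norm_power norm_divide)
    ultimately have "(1 / 3) ^ k * norm (A (js k) (\<zeta> (ls k))) \<le> norm (A (js k) (Y 1)) \<or>
      (1 / 3) ^ k * norm (A (js k) (\<zeta> (ls k))) \<le> norm (A (js k) (Y (-1)))" by linarith
    then obtain \<sigma> where "\<bar>\<sigma>\<bar> = 1" "(1 / 3) ^ k * norm (A (js k) (\<zeta> (ls k))) \<le> norm (A (js k) (Y \<sigma>))"
      by (elim disjE) (rule that[of 1], simp, assumption, rule that[of "-1"], simp, assumption)
    then have "Q k X (Y \<sigma>)" unfolding Q_def Y_def by blast
    then show "\<exists>y. (y \<in> schwartz \<and> (Suc k = 0 \<longrightarrow> y = (\<lambda>_. 0))) \<and> Q k X y" using Y by blast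
  qed
  then obtain X where X: "\<And>k. X k \<in> schwartz" "X 0 = (\<lambda>_. 0)" "\<And>k. Q k (X k) (X (Suc k))" by blast
  from X(3) obtain \<sigma> where \<sigma>: "\<And>k. \<bar>\<sigma> k\<bar> = (1::real)"
    "\<And>k. X (Suc k) = (\<lambda>x. 1 * X k x + (of_real (\<sigma> k) * (1 / 3) ^ k) * \<zeta> (ls k) x)"
    "\<And>k. (1 / 3) ^ k * norm (A (js k) (\<zeta> (ls k))) \<le> norm (A (js k) (X (Suc k)))"
    unfolding Q_def by metis
  define c where "c k = complex_of_real (\<sigma> k) * (1 / 3) ^ k" for k
  have c: "norm (c k) = (1 / 3) ^ k" for k using \<sigma>(1)[of k] by (simp add: c_def norm_mult norm_power norm_divide)
  have AX: "A j (X n) = (\<Sum>m<n. c m * A j (\<zeta> (ls m)))" for j n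
  proof (induction n)
    case 0
    have "A j (\<lambda>x. 0 * \<zeta> 0 x + 0 * \<zeta> 0 x) = 0 * A j (\<zeta> 0) + 0 * A j (\<zeta> 0)" by (rule tempered_lin[OF A \<zeta>s \<zeta>s])
    then show ?case by (simp add: X(2))
  next
    case (Suc n)
    show ?case unfolding \<sigma>(2) tempered_lin[OF A X(1) \<zeta>s] using Suc by (simp add: c_def)
  qed
  have \<zeta>l: "bounded_family (\<lambda>m. \<zeta> (ls m))" by (rule bounded_family_reindex[OF \<zeta>])
  define \<psi> where "\<psi> = (\<lambda>x. \<Sum>m. c m * \<zeta> (ls m) x)"
  have c': "norm (c m) \<le> (1 / 3) ^ m" for m using c[of m] by simp
  have \<psi>: "\<psi> \<in> schwartz" unfolding \<psi>_def by (rule tempered_series(1)[OF A \<zeta>l c'])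
  \<comment> \<open>In units of 3^-k \<open>K (js k)\<close>: the near-maximizer \<open>ls k\<close>
    secures 9/10, the tail costs at most (3/2)/3 = 1/2, and 4/10 is left.\<close>
  have big: "4 / 10 * (real k + 1) \<le> norm (A (js k) \<psi>)" for k
  proof -
    have "A (js k) \<psi> = (\<Sum>m. c m * A (js k) (\<zeta> (ls m)))"
      unfolding \<psi>_def using tempered_series(2)[OF A \<zeta>l c'] by (simp add: sums_iff)
    moreover have bnd: "norm (c m * A (js k) (\<zeta> (ls m))) \<le> K (js k) * (1 / 3) ^ m" for m
      using mult_mono[OF c' K, of m "js k" "ls m"] by (simp add: norm_mult mult.commute)
    ultimately have "norm (A (js k) \<psi> - A (js k) (X (Suc k))) \<le> K (js k) * (3 / 2) * (1 / 3) ^ Suc k"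
      unfolding AX
      using geometric_tail(2)[where a = "\<lambda>m. c m * A (js k) (\<zeta> (ls m))" and B = "K (js k)" and n = "Suc k", OF bnd]
      by simp
    then have "norm (A (js k) (X (Suc k))) \<le> norm (A (js k) \<psi>) + K (js k) * (3 / 2) * (1 / 3) ^ Suc k"
      using norm_triangle_ineq4[of "A (js k) \<psi>" "A (js k) \<psi> - A (js k) (X (Suc k))"] by simp
    moreover have "(1 / 3) ^ k * (9 / 10 * K (js k)) \<le> (1 / 3) ^ k * norm (A (js k) (\<zeta> (ls k)))"
      using ls[of k] by (intro mult_left_mono) auto
    ultimately have "(1 / 3) ^ k * (9 / 10 * K (js k)) \<le> norm (A (js k) \<psi>) + K (js k) * (3 / 2) * (1 / 3) ^ Suc k"
      using \<sigma>(3)[of k] by linarith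
    then have "4 / 10 * ((1 / 3) ^ k * K (js k)) \<le> norm (A (js k) \<psi>)" by (simp add: mult.commute)
    moreover have "(1 / 3) ^ k * (3 ^ k * (real k + 1)) \<le> (1 / 3) ^ k * K (js k)"
      using Kj[of k] by (intro mult_left_mono) auto
    moreover have "(1 / 3) ^ k * (3 ^ k * (real k + 1)) = real k + 1" by (simp add: power_divide)
    ultimately have "real k + 1 \<le> (1 / 3) ^ k * K (js k)" by simp
    then have "4 / 10 * (real k + 1) \<le> 4 / 10 * ((1 / 3) ^ k * K (js k))" by (rule mult_left_mono) simp
    then show ?thesis using \<open>4 / 10 * ((1 / 3) ^ k * K (js k)) \<le> norm (A (js k) \<psi>)\<close> by (rule order_trans)
  qed
  obtain B where B: "\<And>j. norm (A j \<psi>) \<le> B" using pw[OF \<psi>] by blast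
  obtain k :: nat where "B * 3 < real k" using reals_Archimedean2 by blast
  moreover have "4 / 10 * (real k + 1) \<le> B" by (rule order_trans[OF big B])
  ultimately show False by simp
qed

section \<open>Moving test functions\<close>

text \<open>What the product rule needs of a moving test function: a time derivative pointwise in
  \<open>x\<close>, and difference quotients along sequences that are bounded in the Schwartz space.
  Derivatives are taken within \<open>J\<close>, so they are one-sided at its end points.\<close>

definition schwartz_path :: "real set \<Rightarrow> (real \<Rightarrow> real^'n::finite \<Rightarrow> complex) \<Rightarrow> (real \<Rightarrow> real^'n \<Rightarrow> complex) \<Rightarrow> bool" where
  "schwartz_path J \<psi> \<psi>' \<longleftrightarrow> (\<forall>t\<in>J. \<psi> t \<in> schwartz \<and> \<psi>' t \<in> schwartz) \<and>
     (\<forall>t\<in>J. \<forall>x. ((\<lambda>t. \<psi> t x) has_vector_derivative \<psi>' t x) (at t within J)) \<and>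
     (\<forall>a\<in>J. \<forall>\<tau>::nat \<Rightarrow> real. (\<forall>j. \<tau> j \<in> J - {a}) \<longrightarrow>
        bounded_family (\<lambda>j x. (\<psi> (\<tau> j) x - \<psi> a x) / of_real (\<tau> j - a)))"

text \<open>Coinduction in space and time together. A bound on the time derivative, uniform in time,
  becomes one on the difference quotients by the mean value inequality along \<open>J\<close>; and
  the spatial derivative of a quotient is the quotient of the derivatives, so the quotients of
  members of \<open>Z\<close> form a class closed under differentiation.\<close>

lemma schwartz_pathI:
  fixes Z :: "(real \<Rightarrow> real^'n::finite \<Rightarrow> complex) set"
  assumes J: "convex J" and \<psi>: "\<psi> \<in> Z" and \<psi>': "\<psi>' \<in> Z"
    and der: "\<And>t x. t \<in> J \<Longrightarrow> ((\<lambda>t. \<psi> t x) has_vector_derivative \<psi>' t x) (at t within J)"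
    and diff: "\<And>\<psi> t x. \<psi> \<in> Z \<Longrightarrow> t \<in> J \<Longrightarrow> \<psi> t differentiable at x"
    and decay: "\<And>\<psi> N. \<psi> \<in> Z \<Longrightarrow> \<exists>C. \<forall>t\<in>J. \<forall>x. (1 + norm x) ^ N * norm (\<psi> t x) \<le> C"
    and step: "\<And>\<psi> i. \<psi> \<in> Z \<Longrightarrow> \<exists>\<psi>'\<in>Z. \<forall>t\<in>J. partial_deriv i (\<psi> t) = \<psi>' t"
    and tder: "\<And>\<psi>. \<psi> \<in> Z \<Longrightarrow> \<exists>\<psi>'\<in>Z. \<forall>t\<in>J. \<forall>x. ((\<lambda>t. \<psi> t x) has_vector_derivative \<psi>' t x) (at t within J)"
  shows "schwartz_path J \<psi> \<psi>'"
  unfolding schwartz_path_def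
proof (intro conjI ballI allI impI)
  have S: "\<psi> t \<in> schwartz" if \<psi>Z: "\<psi> \<in> Z" and tJ: "t \<in> J" for \<psi> t
  proof -
    have "bounded_family (\<lambda>_::unit. \<psi> t)"
    proof (rule bounded_family_coinduct[where Z = "{\<lambda>_. \<psi> t | \<psi>. \<psi> \<in> Z}"])
      fix g :: "unit \<Rightarrow> real^'n \<Rightarrow> complex" and i assume "g \<in> {\<lambda>_. \<psi> t | \<psi>. \<psi> \<in> Z}"
      then obtain \<psi> where g: "\<psi> \<in> Z" "g = (\<lambda>_. \<psi> t)" by blast
      from step[OF g(1), of i] obtain \<psi>' where p: "\<psi>' \<in> Z" "partial_deriv i (\<psi> t) = \<psi>' t" using tJ by blast
      show "(\<lambda>j. partial_deriv i (g j)) \<in> {\<lambda>_. \<psi> t | \<psi>. \<psi> \<in> Z}"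
        by (intro CollectI exI[of _ \<psi>']) (auto simp: g p)
    next
      fix g :: "unit \<Rightarrow> real^'n \<Rightarrow> complex" and N assume "g \<in> {\<lambda>_. \<psi> t | \<psi>. \<psi> \<in> Z}"
      then obtain \<psi> where g: "\<psi> \<in> Z" "g = (\<lambda>_. \<psi> t)" by blast
      then show "\<exists>C. \<forall>j x. (1 + norm x) ^ N * norm (g j x) \<le> C" using decay[OF g(1), of N] tJ by auto
    qed (use \<psi>Z tJ diff in auto)
    then show ?thesis by (simp add: schwartz_iff_bounded_family)
  qed
  show "\<psi> t \<in> schwartz" "\<psi>' t \<in> schwartz" if "t \<in> J" for t using S \<psi> \<psi>' that by auto
  show "((\<lambda>t. \<psi> t x) has_vector_derivative \<psi>' t x) (at t within J)" if "t \<in> J" for t x using der that by blast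
  fix a and \<tau> :: "nat \<Rightarrow> real" assume a: "a \<in> J" and \<tau>: "\<forall>j. \<tau> j \<in> J - {a}"
  let ?q = "\<lambda>\<psi> j x. (\<psi> (\<tau> j) x - \<psi> a x) / complex_of_real (\<tau> j - a)"
  show "bounded_family (?q \<psi>)"
  proof (rule bounded_family_coinduct[where Z = "{?q \<psi> | \<psi>. \<psi> \<in> Z}"])
    show "?q \<psi> \<in> {?q \<psi> | \<psi>. \<psi> \<in> Z}" using \<psi> by blast
  next
    fix g :: "nat \<Rightarrow> real^'n \<Rightarrow> complex" and j x assume "g \<in> {?q \<psi> | \<psi>. \<psi> \<in> Z}"
    then obtain \<psi> where g: "\<psi> \<in> Z" "g = ?q \<psi>" by blast
    have "(\<lambda>x. (\<psi> (\<tau> j) x - \<psi> a x) * inverse (complex_of_real (\<tau> j - a))) differentiable at x"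
      using \<tau> a by (intro differentiable_mult differentiable_diff differentiable_const diff g(1)) auto
    then show "g j differentiable at x" unfolding g(2) divide_inverse .
  next
    fix g :: "nat \<Rightarrow> real^'n \<Rightarrow> complex" and N assume "g \<in> {?q \<psi> | \<psi>. \<psi> \<in> Z}"
    then obtain \<psi> where g: "\<psi> \<in> Z" "g = ?q \<psi>" by blast
    obtain \<psi>' where p: "\<psi>' \<in> Z" "\<And>t x. t \<in> J \<Longrightarrow> ((\<lambda>t. \<psi> t x) has_vector_derivative \<psi>' t x) (at t within J)"
      using tder[OF g(1)] by blast
    obtain C where C: "\<And>t x. t \<in> J \<Longrightarrow> (1 + norm x) ^ N * norm (\<psi>' t x) \<le> C" using decay[OF p(1)] by blast
    have "(1 + norm x) ^ N * norm (g j x) \<le> C" for j x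
    proof -
      have r: "(1 + norm x) ^ N > 0" by (simp add: add_pos_nonneg)
      have "norm (\<psi> (\<tau> j) x - \<psi> a x) \<le> (C / (1 + norm x) ^ N) * \<bar>\<tau> j - a\<bar>"
      proof (rule norm_diff_le_vector_derivative[OF J])
        fix t assume t: "t \<in> J"
        show "((\<lambda>t. \<psi> t x) has_vector_derivative \<psi>' t x) (at t within J)" by (rule p(2)[OF t])
        show "norm (\<psi>' t x) \<le> C / (1 + norm x) ^ N" using C[OF t, of x] r by (simp add: field_simps)
      qed (use a \<tau> in auto)
      moreover have "\<tau> j \<noteq> a" using \<tau> by blast
      ultimately have "norm (g j x) \<le> C / (1 + norm x) ^ N"
        unfolding g(2) norm_divide norm_of_real by (subst pos_divide_le_eq) auto
      then show ?thesis using r by (simp add: field_simps)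
    qed
    then show "\<exists>C. \<forall>j x. (1 + norm x) ^ N * norm (g j x) \<le> C" by blast
  next
    fix g :: "nat \<Rightarrow> real^'n \<Rightarrow> complex" and i assume "g \<in> {?q \<psi> | \<psi>. \<psi> \<in> Z}"
    then obtain \<psi> where g: "\<psi> \<in> Z" "g = ?q \<psi>" by blast
    obtain \<psi>' where p: "\<psi>' \<in> Z" "\<And>t. t \<in> J \<Longrightarrow> partial_deriv i (\<psi> t) = \<psi>' t" using step[OF g(1)] by blast
    have "partial_deriv i (g j) x = ?q \<psi>' j x" for j x
    proof -
      have \<tau>j: "\<tau> j \<in> J" using \<tau> by blast
      have "((\<lambda>x. inverse (complex_of_real (\<tau> j - a)) * (\<psi> (\<tau> j) x - \<psi> a x)) has_derivative
         (\<lambda>v. inverse (complex_of_real (\<tau> j - a)) * ((\<Sum>k\<in>UNIV. of_real (v $ k) * partial_deriv k (\<psi> (\<tau> j)) x) - (\<Sum>k\<in>UNIV. of_real (v $ k) * partial_deriv k (\<psi> a) x)))) (at x)"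
        by (intro has_derivative_mult_right has_derivative_diff has_derivative_partials diff g(1) \<tau>j a)
      from partial_deriv_eq[OF this, of i, unfolded sum_axis_component] show ?thesis
        unfolding g(2) using p(2)[OF \<tau>j] p(2)[OF a] by (simp add: divide_inverse mult.commute)
    qed
    then have "(\<lambda>j. partial_deriv i (g j)) = ?q \<psi>'" by blast
    then show "(\<lambda>j. partial_deriv i (g j)) \<in> {?q \<psi> | \<psi>. \<psi> \<in> Z}" using p(1) by blast
  qed
qed

text \<open>The Fourier transform commutes with difference quotients and preserves bounded families.
  The pointwise derivative passes under the integral because boundedness of the quotients supplies
  an integrable majorant.\<close>

lemma schwartz_path_fourier:
  fixes \<psi> :: "real \<Rightarrow> real^'n::finite \<Rightarrow> complex"
  assumes p: "schwartz_path J \<psi> \<psi>'"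
  shows "schwartz_path J (\<lambda>t. fourier (\<psi> t)) (\<lambda>t. fourier (\<psi>' t))"
proof -
  have s: "\<psi> t \<in> schwartz" "\<psi>' t \<in> schwartz" if "t \<in> J" for t using p that by (auto simp: schwartz_path_def)
  have lin: "fourier (\<lambda>x. (f x - g x) / c) \<xi> = (fourier f \<xi> - fourier g \<xi>) / c" if "f \<in> schwartz" "g \<in> schwartz" for f g :: "'n cfun" and c \<xi>
    using inv_fourier_linear[OF that, of "1 / c" "- 1 / c" "- \<xi>"] by (simp add: inv_fourier_eq diff_divide_distrib)
  have q: "bounded_family (\<lambda>j x. (\<psi> (\<tau> j) x - \<psi> a x) / of_real (\<tau> j - a))"
    if "a \<in> J" "\<forall>j. \<tau> j \<in> J - {a}" for a and \<tau> :: "nat \<Rightarrow> real" using p that by (auto simp: schwartz_path_def)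
  show ?thesis
    unfolding schwartz_path_def
  proof (intro conjI ballI allI impI)
    fix t \<xi> assume t: "t \<in> J"
    show "((\<lambda>t. fourier (\<psi> t) \<xi>) has_vector_derivative fourier (\<psi>' t) \<xi>) (at t within J)"
      unfolding has_vector_derivative_iff_quotient tendsto_at_iff_sequentially o_def
    proof (intro allI impI)
      fix \<tau> assume \<tau>: "\<forall>i. \<tau> i \<in> J - {t}" "\<tau> \<longlonglongrightarrow> t"
      let ?Q = "\<lambda>j x. (\<psi> (\<tau> j) x - \<psi> t x) / of_real (\<tau> j - t)"
      have bf: "bounded_family ?Q" by (rule q[OF t \<tau>(1)])
      have lim: "(\<lambda>j. ?Q j x) \<longlonglongrightarrow> \<psi>' t x" for x
      proof -
        have "((\<lambda>t. \<psi> t x) has_vector_derivative \<psi>' t x) (at t within J)" using p t by (auto simp: schwartz_path_def)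
        then show ?thesis
          unfolding has_vector_derivative_iff_quotient tendsto_at_iff_sequentially o_def
          using \<tau> by (simp add: scaleR_conv_of_real divide_inverse mult.commute)
      qed
      obtain B where B: "B > 0" "\<And>j. total_seminorm (CARD('n) + 1) (?Q j) \<le> B" using bounded_family_total_seminorm[OF bf] by blast
      note [measurable] = schwartz_measurable[OF bounded_family_imp_schwartz[OF bf]] schwartz_measurable[OF s(2)[OF t]]
      have "(\<lambda>j. fourier (?Q j) \<xi>) \<longlonglongrightarrow> fourier (\<psi>' t) \<xi>"
        unfolding fourier_def
      proof (rule tendsto_mult_left, rule integral_dominated_convergence)
        show "integrable lborel (\<lambda>x::real^'n. B * (1 / (1 + norm x) ^ (CARD('n) + 1)))"
          by (rule integrable_mult_right[OF integrable_one_plus_norm])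
        show "AE x in lborel. norm (cis (- (x \<bullet> \<xi>)) * ?Q j x) \<le> B * (1 / (1 + norm x) ^ (CARD('n) + 1))" for j
        proof (rule AE_I2)
          fix x
          have "norm (cis (- (x \<bullet> \<xi>)) * ?Q j x) \<le> total_seminorm (CARD('n) + 1) (?Q j) * (1 / (1 + norm x) ^ (CARD('n) + 1))"
            using schwartz_integrable_bound[OF bounded_family_imp_schwartz[OF bf], of j x] by (simp only: norm_mult norm_cis mult_1_left)
          also have "... \<le> B * (1 / (1 + norm x) ^ (CARD('n) + 1))" by (intro mult_right_mono B) auto
          finally show "norm (cis (- (x \<bullet> \<xi>)) * ?Q j x) \<le> B * (1 / (1 + norm x) ^ (CARD('n) + 1))" .
        qed
        show "AE x in lborel. (\<lambda>j. cis (- (x \<bullet> \<xi>)) * ?Q j x) \<longlonglongrightarrow> cis (- (x \<bullet> \<xi>)) * \<psi>' t x"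
          by (intro AE_I2 tendsto_mult_left lim)
      qed measurable
      moreover have "fourier (?Q j) \<xi> = (fourier (\<psi> (\<tau> j)) \<xi> - fourier (\<psi> t) \<xi>) /\<^sub>R (\<tau> j - t)" for j
        using \<tau>(1) t s by (subst lin) (auto simp: scaleR_conv_of_real divide_inverse mult.commute)
      ultimately show "(\<lambda>j. (fourier (\<psi> (\<tau> j)) \<xi> - fourier (\<psi> t) \<xi>) /\<^sub>R (\<tau> j - t)) \<longlonglongrightarrow> fourier (\<psi>' t) \<xi>" by simp
    qed
  next
    fix a and \<tau> :: "nat \<Rightarrow> real" assume a: "a \<in> J" "\<forall>j. \<tau> j \<in> J - {a}"
    have "(\<lambda>j x. (fourier (\<psi> (\<tau> j)) x - fourier (\<psi> a) x) / of_real (\<tau> j - a)) =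
       (\<lambda>j. fourier ((\<lambda>j x. (\<psi> (\<tau> j) x - \<psi> a x) / of_real (\<tau> j - a)) j))"
      using a s by (intro ext) (subst lin, auto)
    then show "bounded_family (\<lambda>j x. (fourier (\<psi> (\<tau> j)) x - fourier (\<psi> a) x) / of_real (\<tau> j - a))"
      using bounded_family_fourier[OF q[OF a]] by simp
  qed (use s schwartz_fourier in auto)
qed

section \<open>Product rule for a distribution and a test function that both move\<close>

lemma convergent_imp_norm_bounded:
  fixes f :: "nat \<Rightarrow> complex"
  assumes "f \<longlonglongrightarrow> l" shows "\<exists>B. \<forall>j. norm (f j) \<le> B"
  using convergent_imp_Bseq[OF convergentI[OF assms]] by (auto simp: Bseq_def)

lemma path_decompose:
  assumes T: "tempered S" and p: "schwartz_path J \<psi> \<psi>'" and "t \<in> J" "a \<in> J" "t \<noteq> a"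
  shows "S (\<psi> t) = S (\<psi> a) + of_real (t - a) * S (\<lambda>x. (\<psi> t x - \<psi> a x) / of_real (t - a))"
proof -
  have s: "\<psi> t \<in> schwartz" "\<psi> a \<in> schwartz" using assms by (auto simp: schwartz_path_def)
  define c where "c = complex_of_real (t - a)"
  have c: "c \<noteq> 0" using assms(5) by (simp add: c_def)
  have "S (\<lambda>x. (1 / c) * \<psi> t x + (- 1 / c) * \<psi> a x) = (1 / c) * S (\<psi> t) + (- 1 / c) * S (\<psi> a)"
    by (rule tempered_lin[OF T s])
  moreover have "(\<lambda>x. (1 / c) * \<psi> t x + (- 1 / c) * \<psi> a x) = (\<lambda>x. (\<psi> t x - \<psi> a x) / c)"
    by (auto simp: diff_divide_distrib)
  ultimately have "S (\<lambda>x. (\<psi> t x - \<psi> a x) / c) = (1 / c) * S (\<psi> t) + (- 1 / c) * S (\<psi> a)" by simp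
  then show ?thesis unfolding c_def[symmetric] using c by (simp add: field_simps)
qed

text \<open>With \<open>A j\<close> the difference quotient of \<open>T\<close> and
  \<open>Q j\<close> that of \<open>\<psi>\<close>, the quotient of the pairing is exactly
  \<open>A j (\<psi> a) + (h j * A j (Q j) + T a (Q j))\<close>. The middle term is the obstacle,
  because \<open>A j\<close> converges only on fixed test functions; uniform boundedness makes it
  O(h). The representation \<open>ift F\<close> of \<open>T a\<close> yields the limit of the last
  term.\<close>

theorem distribution_product_rule:
  fixes T :: "real \<Rightarrow> 'n::finite distribution"
  assumes T: "\<And>t. t \<in> J \<Longrightarrow> tempered (T t)" and a: "a \<in> J" and F: "poly_bounded F" "T a = ift F"
    and der: "\<And>\<psi>. \<psi> \<in> schwartz \<Longrightarrow> ((\<lambda>t. T t \<psi>) has_vector_derivative D \<psi>) (at a within J)"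
    and p: "schwartz_path J \<psi> \<psi>'"
  shows "((\<lambda>t. T t (\<psi> t)) has_vector_derivative D (\<psi> a) + T a (\<psi>' a)) (at a within J)"
  unfolding has_vector_derivative_iff_quotient tendsto_at_iff_sequentially o_def
proof (intro allI impI)
  fix \<tau> assume \<tau>: "\<forall>i. \<tau> i \<in> J - {a}" "\<tau> \<longlonglongrightarrow> a"
  define Q where "Q j x = (\<psi> (\<tau> j) x - \<psi> a x) / of_real (\<tau> j - a)" for j x
  define h where "h j = complex_of_real (\<tau> j - a)" for j
  have h: "h j \<noteq> 0" for j using \<tau>(1) by (simp add: h_def)
  have h0: "h \<longlonglongrightarrow> 0"
    unfolding h_def using tendsto_of_real[OF tendsto_diff[OF \<tau>(2) tendsto_const[of a]]] by simp
  define A where "A j = (\<lambda>\<psi>\<in>schwartz. inverse (h j) * T (\<tau> j) \<psi> + (- inverse (h j)) * T a \<psi>)" for j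
  have \<tau>J: "\<tau> j \<in> J" "\<tau> j \<noteq> a" for j using \<tau>(1) by auto
  have \<psi>a: "\<psi> a \<in> schwartz" "\<psi>' a \<in> schwartz" using p a by (auto simp: schwartz_path_def)
  have Q: "bounded_family Q" using p a \<tau>(1) unfolding Q_def schwartz_path_def by blast
  have Qs: "Q j \<in> schwartz" for j by (rule bounded_family_imp_schwartz[OF Q])
  have At: "tempered (A j)" for j unfolding A_def by (intro tempered_lincomb T \<tau>J a)
  have Alim: "(\<lambda>j. A j \<eta>) \<longlonglongrightarrow> D \<eta>" if "\<eta> \<in> schwartz" for \<eta>
    using der[OF that] \<tau> that unfolding has_vector_derivative_iff_quotient tendsto_at_iff_sequentially o_def A_def h_def
    by (simp add: scaleR_conv_of_real algebra_simps)
  obtain B where B: "\<And>j. norm (A j (Q j)) \<le> B"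
    using uniform_boundedness[of A Q, OF At convergent_imp_norm_bounded[OF Alim] Q] by blast
  have "(\<lambda>j. h j * A j (Q j)) \<longlonglongrightarrow> 0"
  proof (rule Lim_null_comparison)
    show "\<forall>\<^sub>F j in sequentially. norm (h j * A j (Q j)) \<le> norm (h j) * B"
      using B by (intro always_eventually allI) (simp add: norm_mult mult_left_mono)
    show "(\<lambda>j. norm (h j) * B) \<longlonglongrightarrow> 0" by (intro tendsto_mult_left_zero tendsto_norm_zero h0)
  qed
  moreover have "(\<lambda>j. T a (Q j)) \<longlonglongrightarrow> T a (\<psi>' a)"
    unfolding F(2)
  proof (rule ift_tendsto[OF F(1) Q \<psi>a(2)])
    fix x
    have "((\<lambda>t. \<psi> t x) has_vector_derivative \<psi>' a x) (at a within J)" using p a by (auto simp: schwartz_path_def)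
    then show "(\<lambda>j. Q j x) \<longlonglongrightarrow> \<psi>' a x"
      unfolding has_vector_derivative_iff_quotient tendsto_at_iff_sequentially o_def Q_def
      using \<tau> by (simp add: scaleR_conv_of_real divide_inverse mult.commute)
  qed
  ultimately have "(\<lambda>j. A j (\<psi> a) + (h j * A j (Q j) + T a (Q j))) \<longlonglongrightarrow> D (\<psi> a) + (0 + T a (\<psi>' a))"
    by (intro tendsto_add Alim \<psi>a)
  moreover have "(T (\<tau> j) (\<psi> (\<tau> j)) - T a (\<psi> a)) /\<^sub>R (\<tau> j - a) = A j (\<psi> a) + (h j * A j (Q j) + T a (Q j))" for j
  proof -
    have "T (\<tau> j) (\<psi> (\<tau> j)) = T (\<tau> j) (\<psi> a) + h j * T (\<tau> j) (Q j)"
      unfolding h_def Q_def by (rule path_decompose[OF T[OF \<tau>J(1)] p \<tau>J(1) a \<tau>J(2)])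
    moreover have "h j * A j (Q j) = T (\<tau> j) (Q j) - T a (Q j)"
      using Qs h[of j] by (simp add: A_def distrib_left right_diff_distrib flip: mult.assoc)
    moreover have "(T (\<tau> j) (\<psi> (\<tau> j)) - T a (\<psi> a)) /\<^sub>R (\<tau> j - a) = inverse (h j) * (T (\<tau> j) (\<psi> (\<tau> j)) - T a (\<psi> a))"
      by (simp add: scaleR_conv_of_real h_def)
    ultimately show ?thesis using \<psi>a h[of j] by (simp add: A_def algebra_simps)
  qed
  ultimately show "(\<lambda>j. (T (\<tau> j) (\<psi> (\<tau> j)) - T a (\<psi> a)) /\<^sub>R (\<tau> j - a)) \<longlonglongrightarrow> D (\<psi> a) + T a (\<psi>' a)" by simp
qed

text \<open>The analogous decomposition when \<open>T\<close> merely converges, as at the initial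
  time: the motion of the test function contributes \<open>h j\<close> times a bounded
  quantity.\<close>

theorem distribution_product_limit:
  fixes T :: "real \<Rightarrow> 'n::finite distribution"
  assumes T: "\<And>t. t \<in> J \<Longrightarrow> tempered (T t)" and a: "a \<in> J"
    and lim: "\<And>\<psi>. \<psi> \<in> schwartz \<Longrightarrow> ((\<lambda>t. T t \<psi>) \<longlongrightarrow> L \<psi>) (at a within J)"
    and p: "schwartz_path J \<psi> \<psi>'"
  shows "((\<lambda>t. T t (\<psi> t)) \<longlongrightarrow> L (\<psi> a)) (at a within J)"
  unfolding tendsto_at_iff_sequentially o_def
proof (intro allI impI)
  fix \<tau> assume \<tau>: "\<forall>i. \<tau> i \<in> J - {a}" "\<tau> \<longlonglongrightarrow> a"
  define Q where "Q j x = (\<psi> (\<tau> j) x - \<psi> a x) / of_real (\<tau> j - a)" for j x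
  define h where "h j = complex_of_real (\<tau> j - a)" for j
  have h0: "h \<longlonglongrightarrow> 0"
    unfolding h_def using tendsto_of_real[OF tendsto_diff[OF \<tau>(2) tendsto_const[of a]]] by simp
  have \<tau>J: "\<tau> j \<in> J" "\<tau> j \<noteq> a" for j using \<tau>(1) by auto
  have \<psi>a: "\<psi> a \<in> schwartz" using p a by (auto simp: schwartz_path_def)
  have Q: "bounded_family Q" using p a \<tau>(1) unfolding Q_def schwartz_path_def by blast
  have Tlim: "(\<lambda>j. T (\<tau> j) \<eta>) \<longlonglongrightarrow> L \<eta>" if "\<eta> \<in> schwartz" for \<eta>
    using lim[OF that] \<tau> unfolding tendsto_at_iff_sequentially o_def by blast
  obtain B where B: "\<And>j. norm (T (\<tau> j) (Q j)) \<le> B"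
    using uniform_boundedness[of "\<lambda>j. T (\<tau> j)" Q, OF T[OF \<tau>J(1)] convergent_imp_norm_bounded[OF Tlim] Q] by blast
  have "(\<lambda>j. h j * T (\<tau> j) (Q j)) \<longlonglongrightarrow> 0"
  proof (rule Lim_null_comparison)
    show "\<forall>\<^sub>F j in sequentially. norm (h j * T (\<tau> j) (Q j)) \<le> norm (h j) * B"
      using B by (intro always_eventually allI) (simp add: norm_mult mult_left_mono)
    show "(\<lambda>j. norm (h j) * B) \<longlonglongrightarrow> 0" by (intro tendsto_mult_left_zero tendsto_norm_zero h0)
  qed
  then have "(\<lambda>j. T (\<tau> j) (\<psi> a) + h j * T (\<tau> j) (Q j)) \<longlonglongrightarrow> L (\<psi> a) + 0"
    by (intro tendsto_add Tlim \<psi>a)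
  moreover have "T (\<tau> j) (\<psi> (\<tau> j)) = T (\<tau> j) (\<psi> a) + h j * T (\<tau> j) (Q j)" for j
    unfolding h_def Q_def by (rule path_decompose[OF T[OF \<tau>J(1)] p \<tau>J(1) a \<tau>J(2)])
  ultimately show "(\<lambda>j. T (\<tau> j) (\<psi> (\<tau> j))) \<longlonglongrightarrow> L (\<psi> a)" by simp
qed

subsection \<open>The fractional heat equation on the Fourier side\<close>

lemma schwartz_decay:
  assumes "f \<in> schwartz"
  obtains C where "C > 0" "\<And>x. (1 + norm x) ^ N * norm (f x) \<le> C"
proof -
  obtain C where C: "C > 0" "\<And>j::unit. \<And>x. (1 + norm x) ^ N * norm (f x) \<le> C"
    by (rule bounded_family_decay[OF schwartz_imp_bounded_family[OF assms], where N = N]) (rule that)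
  show ?thesis by (rule that[OF C(1)]) (rule C(2))
qed

section \<open>Flattened and damped exponential multipliers\<close>

lemma powr_le_one_plus_power: "0 \<le> r \<Longrightarrow> r powr b \<le> (1 + r) ^ nat \<lceil>\<bar>b\<bar>\<rceil>" if "b \<ge> 0" for r b :: real
proof -
  assume r: "0 \<le> r"
  have "r powr b \<le> (1 + r) powr b" using r that by (intro powr_mono2) auto
  also have "... \<le> (1 + r) powr real (nat \<lceil>\<bar>b\<bar>\<rceil>)" using r order_trans[OF abs_ge_self real_nat_ceiling_ge] by (intro powr_mono) auto
  also have "... = (1 + r) ^ nat \<lceil>\<bar>b\<bar>\<rceil>" using r by (intro powr_realpow) auto
  finally show ?thesis .
qed

text \<open>The exponent beats any power at both ends: for r >= 1 through r^2, and for r < 1 the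
  substitution of 1/r for r exchanges the two terms.\<close>

lemma powr_gaussian_bound:
  assumes r: "r > (0::real)"
  shows "r powr b * exp (- r\<^sup>2 - 1 / r\<^sup>2) \<le> exp ((real (nat \<lceil>\<bar>b\<bar>\<rceil>))\<^sup>2 / 4)"
proof -
  let ?N = "nat \<lceil>\<bar>b\<bar>\<rceil>"
  have *: "q powr \<bar>b\<bar> * exp (- q\<^sup>2) \<le> exp ((real ?N)\<^sup>2 / 4)" if "q > 0" for q :: real
  proof -
    have "q powr \<bar>b\<bar> * exp (- q\<^sup>2) \<le> (1 + q) ^ ?N * exp (- 1 * q\<^sup>2)"
      using powr_le_one_plus_power[of "\<bar>b\<bar>" q] that by (intro mult_mono) auto
    also have "... \<le> exp ((real ?N)\<^sup>2 / (4 * 1))" using that by (intro power_exp_bound) auto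
    finally show ?thesis by simp
  qed
  show ?thesis
  proof (cases "r \<ge> 1")
    case True
    have "r powr b * exp (- r\<^sup>2 - 1 / r\<^sup>2) \<le> r powr \<bar>b\<bar> * exp (- r\<^sup>2)"
      using True by (intro mult_mono powr_mono) auto
    then show ?thesis using *[OF r] by linarith
  next
    case False
    have "r powr b * exp (- r\<^sup>2 - 1 / r\<^sup>2) \<le> (1 / r) powr \<bar>b\<bar> * exp (- (1 / r)\<^sup>2)"
    proof (rule mult_mono)
      have "r powr b \<le> r powr (- \<bar>b\<bar>)" using False r by (intro powr_mono') auto
      also have "... = (1 / r) powr \<bar>b\<bar>" using r by (simp add: powr_minus powr_divide divide_inverse inverse_powr)
      finally show "r powr b \<le> (1 / r) powr \<bar>b\<bar>" .
      show "exp (- r\<^sup>2 - 1 / r\<^sup>2) \<le> exp (- (1 / r)\<^sup>2)" by (simp add: power_divide)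
    qed auto
    then show ?thesis using *[of "1 / r"] r by simp
  qed
qed

text \<open>Multipliers \<open>|\<xi>|\<^sup>b exp (t |\<xi>|\<^sup>2\<^sup>s)\<close>, flattened at the origin and damped at infinity so that they
  are smooth and rapidly decreasing for \<open>0 \<le> t \<le> K - 1\<close>.\<close>

definition flat_mult :: "real \<Rightarrow> real \<Rightarrow> real \<Rightarrow> real \<Rightarrow> real^'n::finite \<Rightarrow> complex" where
  "flat_mult s K b t \<xi> = of_real (norm \<xi> powr b * exp (- K * (norm \<xi>)\<^sup>2 - 1 / (norm \<xi>)\<^sup>2 + t * norm \<xi> powr (2 * s)))"

lemma powr_2s_le: "0 < s \<Longrightarrow> s \<le> 1 \<Longrightarrow> 0 \<le> r \<Longrightarrow> r powr (2 * s) \<le> 1 + r\<^sup>2" for r s :: real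
proof -
  assume s: "0 < s" "s \<le> 1" and r: "0 \<le> r"
  show ?thesis
  proof (cases "r \<le> 1")
    case True
    then have "r powr (2 * s) \<le> 1 powr (2 * s)" using s r by (intro powr_mono2) auto
    also have "... \<le> 1 + r\<^sup>2" by simp
    finally show ?thesis .
  next
    case False
    then have "r powr (2 * s) \<le> r powr 2" using s by (intro powr_mono) auto
    then show ?thesis using False by (simp add: powr_numeral)
  qed
qed

lemma flat_mult_bound:
  assumes s: "0 < s" "s \<le> 1" and t: "0 \<le> t" "t \<le> K - 1"
  shows "norm (flat_mult s K b t \<xi>) \<le> exp (K + (real (nat \<lceil>\<bar>b\<bar>\<rceil>))\<^sup>2 / 4)"
proof (cases "\<xi> = 0")
  case False
  let ?r = "norm \<xi>"
  have r: "?r > 0" using False by simp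
  \<comment> \<open>Because t <= K-1, one unit of the damping K |xi|^2 survives, at the price of a
    factor exp(K-1).\<close>
  have "t * ?r powr (2 * s) \<le> (K - 1) * (1 + ?r\<^sup>2)"
    using t powr_2s_le[OF s, of ?r] by (intro mult_mono) auto
  then have "exp (- K * ?r\<^sup>2 - 1 / ?r\<^sup>2 + t * ?r powr (2 * s)) \<le> exp (K + (- ?r\<^sup>2 - 1 / ?r\<^sup>2))"
    by (simp add: algebra_simps)
  then have "?r powr b * exp (- K * ?r\<^sup>2 - 1 / ?r\<^sup>2 + t * ?r powr (2 * s)) \<le> ?r powr b * exp (K + (- ?r\<^sup>2 - 1 / ?r\<^sup>2))"
    by (rule mult_left_mono) simp
  moreover have "norm (flat_mult s K b t \<xi>) = ?r powr b * exp (- K * ?r\<^sup>2 - 1 / ?r\<^sup>2 + t * ?r powr (2 * s))"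
    by (simp add: flat_mult_def norm_mult)
  ultimately have "norm (flat_mult s K b t \<xi>) \<le> ?r powr b * exp (K + (- ?r\<^sup>2 - 1 / ?r\<^sup>2))" by simp
  also have "... = exp K * (?r powr b * exp (- ?r\<^sup>2 - 1 / ?r\<^sup>2))" by (simp only: exp_add mult_ac)
  also have "... \<le> exp K * exp ((real (nat \<lceil>\<bar>b\<bar>\<rceil>))\<^sup>2 / 4)" by (intro mult_left_mono powr_gaussian_bound r) auto
  finally show ?thesis by (simp add: exp_add)
qed (simp add: flat_mult_def)

text \<open>Differentiation only shifts the exponent \<open>b\<close>, by -2, 0, -4 and 2s-2, so
  these multipliers reproduce themselves. At the origin \<open>0 powr b = 0\<close> gives the value
  0, and the bound for the exponent \<open>b - 2\<close> makes the function O(|x|^2), hence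
  differentiable with derivative 0 there.\<close>

lemma flat_mult_has_derivative:
  fixes \<xi> :: "real^'n::finite"
  assumes s: "0 < s" "s \<le> 1" and t: "0 \<le> t" "t \<le> K - 1"
  shows "(flat_mult s K b t has_derivative (\<lambda>v. of_real (\<xi> \<bullet> v) * (of_real b * flat_mult s K (b - 2) t \<xi> -
     of_real (2 * K) * flat_mult s K b t \<xi> + 2 * flat_mult s K (b - 4) t \<xi> + of_real t * (of_real (2 * s) * flat_mult s K (b + 2 * s - 2) t \<xi>)))) (at \<xi>)"
    (is "(_ has_derivative ?D) _")
proof (cases "\<xi> = 0")
  case True
  define C where "C = exp (K + (real (nat \<lceil>\<bar>b - 2\<bar>\<rceil>))\<^sup>2 / 4)"
  have b2: "norm (flat_mult s K b t x) \<le> C * (norm x)\<^sup>2" for x :: "real^'n"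
  proof -
    have "norm x powr b = norm x powr (b - 2) * (norm x)\<^sup>2"
      by (cases "x = 0") (auto simp: powr_diff powr_numeral)
    then have "flat_mult s K b t x = flat_mult s K (b - 2) t x * of_real ((norm x)\<^sup>2)"
      by (simp add: flat_mult_def)
    then have "norm (flat_mult s K b t x) = norm (flat_mult s K (b - 2) t x) * (norm x)\<^sup>2"
      by (simp add: norm_mult norm_power)
    also have "... \<le> C * (norm x)\<^sup>2" unfolding C_def by (intro mult_right_mono flat_mult_bound s t) auto
    finally show ?thesis .
  qed
  have z: "flat_mult s K b t (0::real^'n) = 0" by (simp add: flat_mult_def)
  have "(flat_mult s K b t has_derivative (\<lambda>v. 0)) (at (0::real^'n))"
  proof (rule has_derivativeI_sandwich[OF zero_less_one])
    fix y :: "real^'n" assume "y \<noteq> 0"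
    then show "norm ((flat_mult s K b t y - flat_mult s K b t (0::real^'n)) - 0) / norm (y - 0) \<le> C * norm y"
      unfolding z using b2[of y] by (simp add: divide_le_eq power2_eq_square mult_ac)
  next
    show "((\<lambda>y. C * norm y) \<longlongrightarrow> 0) (at (0::real^'n))" by (auto intro!: tendsto_eq_intros)
  qed simp
  moreover have "?D = (\<lambda>v. 0)" using True by simp
  ultimately show ?thesis using True by simp
next
  case False
  define r where "r = norm \<xi>"
  have r: "r > 0" using False by (simp add: r_def)
  define e where "e = exp (- K * r\<^sup>2 - 1 / r\<^sup>2 + t * r powr (2 * s))"
  have "((\<lambda>r. r powr b * exp (- K * r\<^sup>2 - 1 / r\<^sup>2 + t * r powr (2 * s))) has_real_derivative
     (b * r powr (b - 1) * e + r powr b * (e * (- K * (2 * r) + 2 / r ^ 3 + t * (2 * s * r powr (2 * s - 1)))))) (at r)"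
    unfolding e_def using r
    by (auto intro!: derivative_eq_intros simp: power2_eq_square power3_eq_cube field_simps)
  then have g: "((\<lambda>r. r powr b * exp (- K * r\<^sup>2 - 1 / r\<^sup>2 + t * r powr (2 * s))) has_derivative
     (\<lambda>h. h * (b * r powr (b - 1) * e + r powr b * (e * (- K * (2 * r) + 2 / r ^ 3 + t * (2 * s * r powr (2 * s - 1))))))) (at (norm \<xi>))"
    unfolding has_field_derivative_def r_def by (simp add: mult_commute_abs)
  have n: "(norm has_derivative (\<lambda>v. v \<bullet> sgn \<xi>)) (at \<xi>)" using False by (rule has_derivative_norm)
  have d: "((\<lambda>\<xi>. norm \<xi> powr b * exp (- K * (norm \<xi>)\<^sup>2 - 1 / (norm \<xi>)\<^sup>2 + t * norm \<xi> powr (2 * s))) has_derivative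
     (\<lambda>v. (v \<bullet> sgn \<xi>) * (b * r powr (b - 1) * e + r powr b * (e * (- K * (2 * r) + 2 / r ^ 3 + t * (2 * s * r powr (2 * s - 1))))))) (at \<xi>)"
    by (rule has_derivative_compose[OF n g])
  have e: "(v \<bullet> sgn \<xi>) * (b * r powr (b - 1) * e + r powr b * (e * (- K * (2 * r) + 2 / r ^ 3 + t * (2 * s * r powr (2 * s - 1))))) =
    (\<xi> \<bullet> v) * (b * (r powr (b - 2) * e) - 2 * K * (r powr b * e) + 2 * (r powr (b - 4) * e) + t * (2 * s * (r powr (b + 2 * s - 2) * e)))" for v
  proof -
    have p0: "v \<bullet> sgn \<xi> = (\<xi> \<bullet> v) / r" by (simp add: sgn_div_norm r_def inner_commute divide_inverse mult.commute)
    have p': "r powr (b - 1) = r powr (b - 2) * r" "r powr b / r ^ 3 = r powr (b - 4) * r"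
      "r powr b * r powr (2 * s - 1) = r powr (b + 2 * s - 2) * r"
    proof -
      have "r powr (b - 2) * r powr 1 = r powr (b - 1)" unfolding powr_add[symmetric] by simp
      then show "r powr (b - 1) = r powr (b - 2) * r" using r by simp
      have "r powr (b - 4) * r powr 1 = r powr (b - 3)" unfolding powr_add[symmetric] by simp
      also have "... = r powr b / r ^ 3" using r by (simp add: powr_diff powr_numeral)
      finally show "r powr b / r ^ 3 = r powr (b - 4) * r" using r by simp
      have "r powr (b + 2 * s - 2) * r powr 1 = r powr b * r powr (2 * s - 1)" unfolding powr_add[symmetric] by (simp add: add_diff_eq)
      then show "r powr b * r powr (2 * s - 1) = r powr (b + 2 * s - 2) * r" using r by simp
    qed
    note p = p0 p'
    have gen: "B * (e * (- K * (2 * r) + 2 * i + t * (2 * s * q))) = - 2 * K * r * B * e + 2 * (B * i) * e + t * 2 * s * (B * q) * e" for B i q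
      by (simp add: algebra_simps)
    have "r powr b * (e * (- K * (2 * r) + 2 / r ^ 3 + t * (2 * s * r powr (2 * s - 1)))) =
       - 2 * K * r * r powr b * e + 2 * (r powr (b - 4) * r) * e + t * 2 * s * (r powr (b + 2 * s - 2) * r) * e"
      using gen[of "r powr b" "1 / r ^ 3" "r powr (2 * s - 1)"] p(3,4) by simp
    then have "(v \<bullet> sgn \<xi>) * (b * r powr (b - 1) * e + r powr b * (e * (- K * (2 * r) + 2 / r ^ 3 + t * (2 * s * r powr (2 * s - 1))))) =
      (\<xi> \<bullet> v) / r * (b * (r powr (b - 2) * r) * e + (- 2 * K * r * r powr b * e + 2 * (r powr (b - 4) * r) * e + t * 2 * s * (r powr (b + 2 * s - 2) * r) * e))"
      by (simp only: p(1,2))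
    also have "... = (\<xi> \<bullet> v) / r * (r * (b * (r powr (b - 2) * e) - 2 * K * (r powr b * e) + 2 * (r powr (b - 4) * e) + t * (2 * s * (r powr (b + 2 * s - 2) * e))))"
      by (rule arg_cong[where f = "(*) ((\<xi> \<bullet> v) / r)"]) (simp add: algebra_simps)
    also have "... = (\<xi> \<bullet> v) * (b * (r powr (b - 2) * e) - 2 * K * (r powr b * e) + 2 * (r powr (b - 4) * e) + t * (2 * s * (r powr (b + 2 * s - 2) * e)))"
      using r by simp
    finally show ?thesis .
  qed
  have "(flat_mult s K b t has_derivative (\<lambda>v. of_real ((\<xi> \<bullet> v) * (b * (r powr (b - 2) * e) - 2 * K * (r powr b * e) + 2 * (r powr (b - 4) * e) + t * (2 * s * (r powr (b + 2 * s - 2) * e)))))) (at \<xi>)"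
    using bounded_linear.has_derivative[OF bounded_linear_of_real d[unfolded e]]
    by (simp add: flat_mult_def[abs_def])
  moreover have "(\<lambda>v. of_real ((\<xi> \<bullet> v) * (b * (r powr (b - 2) * e) - 2 * K * (r powr b * e) + 2 * (r powr (b - 4) * e) + t * (2 * s * (r powr (b + 2 * s - 2) * e))))) = ?D"
    by (simp add: flat_mult_def e_def r_def fun_eq_iff)
  ultimately show ?thesis by simp
qed

lemma flat_mult_time_derivative:
  "((\<lambda>t. flat_mult s K b t \<xi>) has_vector_derivative flat_mult s K (b + 2 * s) t \<xi>) (at t within J)"
proof -
  have "((\<lambda>t. norm \<xi> powr b * exp (- K * (norm \<xi>)\<^sup>2 - 1 / (norm \<xi>)\<^sup>2 + t * norm \<xi> powr (2 * s))) has_real_derivative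
     norm \<xi> powr b * (exp (- K * (norm \<xi>)\<^sup>2 - 1 / (norm \<xi>)\<^sup>2 + t * norm \<xi> powr (2 * s)) * norm \<xi> powr (2 * s))) (at t within J)"
    by (auto intro!: derivative_eq_intros)
  then have "((\<lambda>t. of_real (norm \<xi> powr b * exp (- K * (norm \<xi>)\<^sup>2 - 1 / (norm \<xi>)\<^sup>2 + t * norm \<xi> powr (2 * s))) :: complex) has_vector_derivative
     of_real (norm \<xi> powr b * (exp (- K * (norm \<xi>)\<^sup>2 - 1 / (norm \<xi>)\<^sup>2 + t * norm \<xi> powr (2 * s)) * norm \<xi> powr (2 * s)))) (at t within J)"
    by (intro has_vector_derivative_of_real) (simp add: has_real_derivative_iff_has_vector_derivative)
  then show ?thesis by (simp add: flat_mult_def powr_add mult_ac)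
qed

inductive_set flat_class :: "real \<Rightarrow> real \<Rightarrow> (real \<Rightarrow> real^'n::finite \<Rightarrow> complex) set" for s K where
  flat_base: "\<psi> \<in> schwartz \<Longrightarrow> (\<lambda>t \<xi>. \<psi> \<xi> * flat_mult s K b t \<xi>) \<in> flat_class s K"
| flat_add: "f \<in> flat_class s K \<Longrightarrow> g \<in> flat_class s K \<Longrightarrow> (\<lambda>t \<xi>. f t \<xi> + g t \<xi>) \<in> flat_class s K"
| flat_time: "f \<in> flat_class s K \<Longrightarrow> (\<lambda>t \<xi>. of_real t * f t \<xi>) \<in> flat_class s K"

lemma flat_path:
  fixes \<psi> :: "'n::finite cfun"
  assumes s: "0 < s" "s \<le> 1" and \<psi>: "\<psi> \<in> schwartz"
  shows "schwartz_path {0..K - 1} (\<lambda>t \<xi>. \<psi> \<xi> * flat_mult s K b t \<xi>) (\<lambda>t \<xi>. \<psi> \<xi> * flat_mult s K (b + 2 * s) t \<xi>)"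
proof -
  let ?J = "{0..K - 1}" and ?Z = "flat_class s K :: (real \<Rightarrow> real^'n \<Rightarrow> complex) set"
  have D: "f t differentiable at x" if "f \<in> ?Z" "t \<in> ?J" for f t x
    using that
  proof (induction)
    case (flat_base \<psi> b)
    then show ?case
      using s by (intro differentiable_mult schwartz_differentiable differentiableI[OF flat_mult_has_derivative]) auto
  qed (auto intro!: differentiable_add differentiable_mult)
  show ?thesis
  proof (rule schwartz_pathI[where Z = ?Z])
    show "convex ?J" by simp
    show "(\<lambda>t \<xi>. \<psi> \<xi> * flat_mult s K b t \<xi>) \<in> ?Z" "(\<lambda>t \<xi>. \<psi> \<xi> * flat_mult s K (b + 2 * s) t \<xi>) \<in> ?Z"
      by (intro flat_base \<psi>)+
    show "((\<lambda>t. \<psi> x * flat_mult s K b t x) has_vector_derivative \<psi> x * flat_mult s K (b + 2 * s) t x) (at t within ?J)" for t x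
      by (intro has_vector_derivative_mult_right flat_mult_time_derivative)
    show "f t differentiable at x" if "f \<in> ?Z" "t \<in> ?J" for f t x by (rule D[OF that])
    show "\<exists>C. \<forall>t\<in>?J. \<forall>x. (1 + norm x) ^ N * norm (f t x) \<le> C" if "f \<in> ?Z" for f N
      using that
    proof (induction)
      case (flat_base \<psi> b)
      obtain A where A: "A > 0" "\<And>x. (1 + norm x) ^ N * norm (\<psi> x) \<le> A"
        by (rule schwartz_decay[OF flat_base]) (rule that)
      have "(1 + norm x) ^ N * norm (\<psi> x * flat_mult s K b t x) \<le> A * exp (K + (real (nat \<lceil>\<bar>b\<bar>\<rceil>))\<^sup>2 / 4)" if "t \<in> ?J" for t x
        using mult_mono[OF A(2)[of x] flat_mult_bound[OF s, of t K b x]] that A(1) by (simp add: norm_mult mult.assoc)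
      then show ?case by blast
    next
      case (flat_add f g)
      then obtain A B where AB: "\<forall>t\<in>?J. \<forall>x. (1 + norm x) ^ N * norm (f t x) \<le> A" "\<forall>t\<in>?J. \<forall>x. (1 + norm x) ^ N * norm (g t x) \<le> B" by blast
      have "(1 + norm x) ^ N * norm (f t x + g t x) \<le> A + B" if "t \<in> ?J" for t x
      proof -
        have "(1 + norm x) ^ N * norm (f t x + g t x) \<le> (1 + norm x) ^ N * norm (f t x) + (1 + norm x) ^ N * norm (g t x)"
          using mult_left_mono[OF norm_triangle_ineq[of "f t x" "g t x"], of "(1 + norm x) ^ N"] by (simp add: distrib_left)
        also have "... \<le> A + B" using AB that by (intro add_mono) blast+
        finally show ?thesis .
      qed
      then show ?case by blast
    next
      case (flat_time f)
      then obtain A where A: "\<forall>t\<in>?J. \<forall>x. (1 + norm x) ^ N * norm (f t x) \<le> A" by blast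
      have "(1 + norm x) ^ N * norm (of_real t * f t x) \<le> (K - 1) * A" if "t \<in> ?J" for t x
      proof -
        have "\<bar>t\<bar> * ((1 + norm x) ^ N * norm (f t x)) \<le> (K - 1) * A"
          using that A by (intro mult_mono) auto
        then show ?thesis by (simp add: norm_mult mult_ac)
      qed
      then show ?case by blast
    qed
    show "\<exists>f'\<in>?Z. \<forall>t\<in>?J. partial_deriv i (f t) = f' t" if "f \<in> ?Z" for f i
      using that
    proof (induction)
      case (flat_base \<psi> b)
      let ?c = "\<lambda>a. (\<lambda>x. a * (of_real (x $ i) * \<psi> x))"
      let ?f = "\<lambda>t x. partial_deriv i \<psi> x * flat_mult s K b t x + (?c (of_real b) x * flat_mult s K (b - 2) t x
        + (?c (- of_real (2 * K)) x * flat_mult s K b t x + (?c 2 x * flat_mult s K (b - 4) t x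
        + of_real t * (?c (of_real (2 * s)) x * flat_mult s K (b + 2 * s - 2) t x))))"
      have c: "?c a \<in> schwartz" for a by (intro schwartz_cmult schwartz_component_mult flat_base)
      have A: "?f \<in> ?Z"
        by (intro flat_class.flat_add flat_class.flat_time flat_class.flat_base schwartz_partial flat_base c)
      have B: "partial_deriv i (\<lambda>x. \<psi> x * flat_mult s K b t x) = ?f t" if "t \<in> ?J" for t
      proof
        fix x
        have "((\<lambda>x. \<psi> x * flat_mult s K b t x) has_derivative
          (\<lambda>v. \<psi> x * (of_real (x \<bullet> v) * (of_real b * flat_mult s K (b - 2) t x -
             of_real (2 * K) * flat_mult s K b t x + 2 * flat_mult s K (b - 4) t x + of_real t * (of_real (2 * s) * flat_mult s K (b + 2 * s - 2) t x))) +
             (\<Sum>k\<in>UNIV. of_real (v $ k) * partial_deriv k \<psi> x) * flat_mult s K b t x)) (at x)"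
          using s that by (intro has_derivative_mult schwartz_has_derivative flat_base flat_mult_has_derivative) auto
        from partial_deriv_eq[OF this, of i, unfolded sum_axis_component]
        show "partial_deriv i (\<lambda>x. \<psi> x * flat_mult s K b t x) x = ?f t x"
          by (simp add: inner_axis algebra_simps)
      qed
      show ?case by (rule bexI[OF _ A]) (rule ballI, rule B)
    next
      case (flat_add f g)
      then obtain f' g' where p: "f' \<in> ?Z" "g' \<in> ?Z" "\<And>t. t \<in> ?J \<Longrightarrow> partial_deriv i (f t) = f' t" "\<And>t. t \<in> ?J \<Longrightarrow> partial_deriv i (g t) = g' t" by blast
      have "partial_deriv i (\<lambda>x. f t x + g t x) x = f' t x + g' t x" if "t \<in> ?J" for t x
        using partial_deriv_eq[OF has_derivative_add[OF has_derivative_partials[OF D[OF flat_add.hyps(1) that]] has_derivative_partials[OF D[OF flat_add.hyps(2) that]]], of i]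
        by (simp add: p(3,4)[OF that])
      then show ?case using p by (intro bexI[OF _ flat_class.flat_add[OF p(1,2)]]) auto
    next
      case (flat_time f)
      then obtain f' where p: "f' \<in> ?Z" "\<And>t. t \<in> ?J \<Longrightarrow> partial_deriv i (f t) = f' t" by blast
      have "partial_deriv i (\<lambda>x. of_real t * f t x) x = of_real t * f' t x" if "t \<in> ?J" for t x
        using partial_deriv_eq[OF has_derivative_mult_right[OF has_derivative_partials[OF D[OF flat_time.hyps(1) that]]], of i]
        by (simp add: p(2)[OF that])
      then show ?case using p by (intro bexI[OF _ flat_class.flat_time[OF p(1)]]) auto
    qed
    show "\<exists>f'\<in>?Z. \<forall>t\<in>?J. \<forall>x. ((\<lambda>t. f t x) has_vector_derivative f' t x) (at t within ?J)" if "f \<in> ?Z" for f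
      using that
    proof (induction)
      case (flat_base \<psi> b)
      show ?case
        by (rule bexI[OF _ flat_class.flat_base[OF flat_base, where b = "b + 2 * s"]])
           (intro ballI allI has_vector_derivative_mult_right flat_mult_time_derivative)
    next
      case (flat_add f g)
      then obtain f' g' where p: "f' \<in> ?Z" "g' \<in> ?Z" "\<And>t x. t \<in> ?J \<Longrightarrow> ((\<lambda>t. f t x) has_vector_derivative f' t x) (at t within ?J)"
        "\<And>t x. t \<in> ?J \<Longrightarrow> ((\<lambda>t. g t x) has_vector_derivative g' t x) (at t within ?J)" by blast
      show ?case by (rule bexI[OF _ flat_class.flat_add[OF p(1,2)]]) (intro ballI allI has_vector_derivative_add p(3,4))
    next
      case (flat_time f)
      then obtain f' where p: "f' \<in> ?Z" "\<And>t x. t \<in> ?J \<Longrightarrow> ((\<lambda>t. f t x) has_vector_derivative f' t x) (at t within ?J)" by blast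
      have "((\<lambda>t. of_real t * f t x) has_vector_derivative of_real t * f' t x + 1 * f t x) (at t within ?J)" if "t \<in> ?J" for t x
        by (intro has_vector_derivative_mult p(2) that has_vector_derivative_of_real) (auto intro!: derivative_eq_intros)
      then show ?case
        by (intro bexI[OF _ flat_class.flat_add[OF flat_class.flat_time[OF p(1)] flat_time.hyps]]) auto
    qed
  qed
qed

section \<open>Uniqueness and existence for the evolution of symbols\<close>

lemma poly_bounded_powr:
  assumes "s > 0" shows "poly_bounded (\<lambda>\<xi>::real^'n::finite. of_real (norm \<xi> powr (2 * s)))"
  unfolding poly_bounded_def
  using powr_le_one_plus_power[of "2 * s" "norm _"] assms
  by (intro conjI exI[of _ 1] exI[of _ "nat \<lceil>\<bar>2 * s\<bar>\<rceil>"]) auto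

text \<open>The relation is single-valued here because the function representing a Fourier transform
  is unique almost everywhere and multiplication by |xi|^(2s) respects null sets.\<close>

lemma frac_laplacian_ift:
  assumes F: "poly_bounded F" and s: "s > 0"
  shows "frac_laplacian s (ift F) Q \<longleftrightarrow> Q = ift (\<lambda>\<xi>. of_real (norm \<xi> powr (2 * s)) * F \<xi>)"
proof
  have p: "poly_bounded (\<lambda>\<xi>. of_real (norm \<xi> powr (2 * s)) * F \<xi>)"
    by (rule poly_bounded_mult[OF poly_bounded_powr[OF s] F])
  show "frac_laplacian s (ift F) Q" if "Q = ift (\<lambda>\<xi>. of_real (norm \<xi> powr (2 * s)) * F \<xi>)"
    unfolding frac_laplacian_def that
    by (intro conjI tempered_ift p exI[of _ F] has_fourier_fun_ift poly_bounded_tempered_fun F)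
  assume "frac_laplacian s (ift F) Q"
  then obtain G where Q: "tempered Q" and G: "has_fourier_fun (ift F) G" "has_fourier_fun Q (\<lambda>\<xi>. of_real (norm \<xi> powr (2 * s)) * G \<xi>)"
    unfolding frac_laplacian_def by blast
  have "AE \<xi> in lborel. G \<xi> = F \<xi>"
    by (rule has_fourier_fun_unique[OF G(1) has_fourier_fun_ift[OF poly_bounded_tempered_fun[OF F]]])
  then have ae: "AE \<xi> in lborel. of_real (norm \<xi> powr (2 * s)) * G \<xi> = of_real (norm \<xi> powr (2 * s)) * F \<xi>"
    by eventually_elim simp
  have "Q = ift (\<lambda>\<xi>. of_real (norm \<xi> powr (2 * s)) * G \<xi>)"
    using has_fourier_fun_eq_ift[OF G(2)] Q by (simp add: tempered_def)
  also have "... = ift (\<lambda>\<xi>. of_real (norm \<xi> powr (2 * s)) * F \<xi>)"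
    using G(2) poly_bounded_measurable[OF p] by (intro ift_cong_AE ae) (auto simp: has_fourier_fun_def tempered_fun_def)
  finally show "Q = ift (\<lambda>\<xi>. of_real (norm \<xi> powr (2 * s)) * F \<xi>)" .
qed

definition heat_mult :: "real \<Rightarrow> real \<Rightarrow> real^'n::finite \<Rightarrow> complex" where
  "heat_mult s t \<xi> = of_real (exp (- t * norm \<xi> powr (2 * s)))"

lemma heat_mult_measurable [measurable]: "heat_mult s t \<in> borel_measurable borel"
  unfolding heat_mult_def by measurable

lemma poly_bounded_heat_mult: "t \<ge> 0 \<Longrightarrow> poly_bounded (heat_mult s t)"
  by (rule poly_bounded_bounded[of _ 1]) (auto simp: heat_mult_def)

lemma ift_fourier: "\<eta> \<in> schwartz \<Longrightarrow> ift F (fourier \<eta>) = (LINT \<xi>|lborel. F \<xi> * \<eta> \<xi>)"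
  by (simp add: ift_def schwartz_fourier inv_fourier_fourier)

text \<open>The pairing \<open>w\<close> has derivative zero: the equation and the time derivative
  of the multiplier both contribute |xi|^(2s) times the same integrand, with opposite signs.
  Flattening and damping do not depend on time and are positive off the origin, so they cancel from
  the identity between the times 0 and \<open>t\<close>.\<close>

lemma fractional_heat_unique:
  fixes \<phi> :: "real \<Rightarrow> 'n::finite distribution"
  assumes s: "0 < s" "s \<le> 1" and F: "\<And>t. t \<ge> 0 \<Longrightarrow> poly_bounded (F t) \<and> \<phi> t = ift (F t)"
    and sol: "cauchy_solution (frac_laplacian s) \<phi> \<phi>0" and t: "t \<ge> 0"
  shows "AE \<xi> in lborel. F t \<xi> = heat_mult s t \<xi> * F 0 \<xi>"
proof (cases "t = 0")
  case True
  then show ?thesis by (simp add: heat_mult_def)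
next
  case False
  then have t: "t > 0" using assms by simp
  \<comment> \<open>Then \<open>K - 1 = t + 1\<close>, so the multiplier is controlled on a time
    interval that contains \<open>{0..t}\<close>.\<close>
  define K where "K = t + 2"
  let ?J = "{0..K - 1}"
  have temp: "tempered (\<phi> r)" if "r \<ge> 0" for r using sol that by (auto simp: cauchy_solution_def)
  have eq: "(LINT \<xi>|lborel. (F t \<xi> * flat_mult s K 0 t \<xi>) * \<psi> \<xi>) = (LINT \<xi>|lborel. (F 0 \<xi> * flat_mult s K 0 0 \<xi>) * \<psi> \<xi>)"
    if \<psi>: "\<psi> \<in> schwartz" for \<psi>
  proof -
    define p where "p = (\<lambda>b r \<xi>. \<psi> \<xi> * flat_mult s K b r \<xi>)"
    have pp: "schwartz_path ?J (p 0) (p (2 * s))" using flat_path[OF s \<psi>, of K 0] by (simp add: p_def)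
    have ps: "p b r \<in> schwartz" if "r \<in> ?J" for b r
      using flat_path[OF s \<psi>, of K b] that by (auto simp: schwartz_path_def p_def)
    have pf: "schwartz_path ?J (\<lambda>r. fourier (p 0 r)) (\<lambda>r. fourier (p (2 * s) r))" by (rule schwartz_path_fourier[OF pp])
    define w where "w r = \<phi> r (fourier (p 0 r))" for r
    have wd: "(w has_vector_derivative 0) (at r within ?J)" if r: "r \<in> {0<..K - 1}" for r
    proof -
      obtain S where S: "frac_laplacian s (\<phi> r) S" "\<And>\<psi>. \<psi> \<in> schwartz \<Longrightarrow> ((\<lambda>t. \<phi> t \<psi>) has_vector_derivative - S \<psi>) (at r)"
        using sol r by (auto simp: cauchy_solution_def)
      have r0: "r \<ge> 0" "r \<in> ?J" using r by auto
      have SF: "S = ift (\<lambda>\<xi>. of_real (norm \<xi> powr (2 * s)) * F r \<xi>)"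
        using S(1) F[OF r0(1)] frac_laplacian_ift s by metis
      have "((\<lambda>r. \<phi> r (fourier (p 0 r))) has_vector_derivative - S (fourier (p 0 r)) + \<phi> r (fourier (p (2 * s) r))) (at r within ?J)"
        using F[OF r0(1)] temp S(2)
        by (intro distribution_product_rule[where F = "F r", OF _ r0(2) _ _ _ pf]) (auto intro: has_vector_derivative_at_within)
      moreover have "S (fourier (p 0 r)) = \<phi> r (fourier (p (2 * s) r))"
        unfolding SF
      proof -
        have m: "flat_mult s K (2 * s) r \<xi> = of_real (norm \<xi> powr (2 * s)) * flat_mult s K 0 r \<xi>" for \<xi> :: "real^'n"
          by (simp add: flat_mult_def)
        have e: "of_real (norm \<xi> powr (2 * s)) * F r \<xi> * p 0 r \<xi> = F r \<xi> * p (2 * s) r \<xi>" for \<xi>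
          unfolding p_def m by (simp only: mult_ac)
        show "ift (\<lambda>\<xi>. of_real (norm \<xi> powr (2 * s)) * F r \<xi>) (fourier (p 0 r)) = \<phi> r (fourier (p (2 * s) r))"
          unfolding conjunct2[OF F[OF r0(1)]] ift_fourier[OF ps[OF r0(2)]]
          by (rule Bochner_Integration.integral_cong[OF refl e])
      qed
      ultimately show ?thesis unfolding w_def by simp
    qed
    have w0: "(w \<longlongrightarrow> \<phi>0 (fourier (p 0 0))) (at 0 within ?J)"
      unfolding w_def
    proof (rule distribution_product_limit[OF _ _ _ pf])
      show "((\<lambda>t. \<phi> t \<psi>) \<longlongrightarrow> \<phi>0 \<psi>) (at 0 within ?J)" if "\<psi> \<in> schwartz" for \<psi>
      proof -
        have "((\<lambda>t. \<phi> t \<psi>) \<longlongrightarrow> \<phi>0 \<psi>) (at_right 0)" using sol that by (auto simp: cauchy_solution_def)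
        then show ?thesis using t by (subst at_within_Icc_at_right) (auto simp: K_def)
      qed
    qed (use temp t in \<open>auto simp: K_def\<close>)
    \<comment> \<open>The equation holds for positive times only; constancy is therefore shown on
      \<open>{r..t}\<close> and carried to time 0 by the limit \<open>w0\<close>.\<close>
    have const: "w r = w t" if "0 < r" "r \<le> t" for r
    proof -
      have "norm (w t - w r) \<le> 0 * \<bar>t - r\<bar>"
      proof (rule norm_diff_le_vector_derivative[where S = "{r..t}" and g' = "\<lambda>_. 0"])
        show "(w has_vector_derivative 0) (at x within {r..t})" if "x \<in> {r..t}" for x
        proof -
          have "x \<in> {0<..K - 1}" using that \<open>0 < r\<close> by (simp add: K_def)
          from wd[OF this] show ?thesis
            by (rule has_vector_derivative_within_subset) (use \<open>0 < r\<close> in \<open>auto simp: K_def\<close>)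
        qed
      qed (use that in auto)
      then show ?thesis by simp
    qed
    have "(w \<longlongrightarrow> w t) (at_right 0)"
    proof (rule tendsto_eventually)
      show "\<forall>\<^sub>F r in at_right 0. w r = w t"
        unfolding eventually_at_right[OF t] by (intro exI[of _ t] conjI t allI impI const) simp_all
    qed
    moreover have "(w \<longlongrightarrow> \<phi>0 (fourier (p 0 0))) (at_right 0)"
      using w0 t by (subst (asm) at_within_Icc_at_right) (auto simp: K_def)
    ultimately have "w t = \<phi>0 (fourier (p 0 0))" using tendsto_unique[OF trivial_limit_at_right_real] by blast
    also have "\<phi>0 = \<phi> 0" using sol by (simp add: cauchy_solution_def)
    finally have "ift (F t) (fourier (p 0 t)) = ift (F 0) (fourier (p 0 0))"
      unfolding w_def using F[of t] F[of 0] t by simp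
    then show ?thesis using t by (simp add: ift_fourier ps K_def) (simp add: p_def K_def mult_ac)
  qed
  have pb: "poly_bounded (\<lambda>\<xi>. F r \<xi> * flat_mult s K 0 r \<xi>)" if "r \<ge> 0" "r \<le> t" for r
  proof (rule poly_bounded_mult)
    show "poly_bounded (F r)" using F that by simp
    show "poly_bounded (flat_mult s K 0 r :: real^'n \<Rightarrow> complex)"
    proof (rule poly_bounded_bounded)
      show "flat_mult s K 0 r \<in> borel_measurable (borel :: (real^'n) measure)" unfolding flat_mult_def by measurable
      show "norm (flat_mult s K 0 r \<xi>) \<le> exp (K + (real (nat \<lceil>\<bar>0::real\<bar>\<rceil>))\<^sup>2 / 4)" for \<xi> :: "real^'n"
        using that by (intro flat_mult_bound s) (auto simp: K_def)
    qed
  qed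
  have "AE \<xi> in lborel. F t \<xi> * flat_mult s K 0 t \<xi> = F 0 \<xi> * flat_mult s K 0 0 \<xi>"
    using t by (intro dist_of_fun_eq_imp_AE poly_bounded_tempered_fun pb) (auto simp: dist_of_fun_def eq intro!: restrict_ext)
  moreover have "AE \<xi> in (lborel :: (real^'n) measure). \<xi> \<noteq> 0" by (rule AE_lborel_singleton)
  ultimately show ?thesis
  proof eventually_elim
    case (elim \<xi>)
    have "flat_mult s K 0 t \<xi> * heat_mult s t \<xi> = flat_mult s K 0 0 \<xi>" "flat_mult s K 0 t \<xi> \<noteq> 0"
      using elim(2) by (auto simp: flat_mult_def heat_mult_def exp_add[symmetric] simp flip: of_real_mult)
    then have "flat_mult s K 0 t \<xi> * F t \<xi> = flat_mult s K 0 t \<xi> * (heat_mult s t \<xi> * F 0 \<xi>)"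
      using elim(1) by (simp add: mult_ac flip: mult.assoc)
    then show ?case using \<open>flat_mult s K 0 t \<xi> \<noteq> 0\<close> by simp
  qed
qed

text \<open>For t >= 0 the function exp(-t a) is Lipschitz in t with constant a, so |xi|^(2s) times
  |F eta|, with eta the inverse transform of the test function, dominates the difference quotients.
  Taking the derivative within \<open>{0..}\<close> lets the case t = 0 deliver the initial
  condition.\<close>

lemma fractional_heat_derivative:
  fixes F :: "'n::finite cfun"
  assumes F: "poly_bounded F" and s: "s > 0" and t: "t \<ge> 0" and \<psi>: "\<psi> \<in> schwartz"
  shows "((\<lambda>t. ift (\<lambda>\<xi>. heat_mult s t \<xi> * F \<xi>) \<psi>) has_vector_derivative
     - ift (\<lambda>\<xi>. of_real (norm \<xi> powr (2 * s)) * (heat_mult s t \<xi> * F \<xi>)) \<psi>) (at t within {0..})"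
  unfolding has_vector_derivative_iff_quotient tendsto_at_iff_sequentially o_def
proof (intro allI impI)
  fix \<tau> assume \<tau>: "\<forall>i. \<tau> i \<in> {0..} - {t}" "\<tau> \<longlonglongrightarrow> t"
  define \<eta> where "\<eta> = inv_fourier \<psi>"
  have \<eta>: "\<eta> \<in> schwartz" unfolding \<eta>_def by (rule schwartz_inv_fourier[OF \<psi>])
  note [measurable] = poly_bounded_measurable[OF F] schwartz_measurable[OF \<eta>]
  define a where "a = (\<lambda>\<xi>::real^'n. norm \<xi> powr (2 * s))"
  have [measurable]: "a \<in> borel_measurable borel" unfolding a_def by measurable
  have a0: "a \<xi> \<ge> 0" for \<xi> by (simp add: a_def)
  have int: "integrable lborel (\<lambda>\<xi>. heat_mult s r \<xi> * F \<xi> * \<eta> \<xi>)" if "r \<ge> 0" for r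
    using poly_bounded_tempered_fun[OF poly_bounded_mult[OF poly_bounded_heat_mult[OF that] F]] \<eta> by (auto simp: tempered_fun_def)
  have exp_lip: "\<bar>(exp (- x * a \<xi>) - exp (- y * a \<xi>)) / (x - y)\<bar> \<le> a \<xi>" if "x \<ge> 0" "y \<ge> 0" "x \<noteq> y" for x y \<xi>
  proof -
    have "norm (exp (- x * a \<xi>) - exp (- y * a \<xi>)) \<le> a \<xi> * \<bar>x - y\<bar>"
    proof (rule norm_diff_le_vector_derivative[where S = "{0..}" and g' = "\<lambda>t. exp (- t * a \<xi>) * - a \<xi>"])
      fix t :: real assume t: "t \<in> {0..}"
      show "((\<lambda>t. exp (- t * a \<xi>)) has_vector_derivative exp (- t * a \<xi>) * - a \<xi>) (at t within {0..})"
        unfolding has_real_derivative_iff_has_vector_derivative[symmetric] by (auto intro!: derivative_eq_intros)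
      show "norm (exp (- t * a \<xi>) * - a \<xi>) \<le> a \<xi>" using t a0[of \<xi>] by (simp add: mult_left_le_one_le)
    qed (use that in auto)
    then show ?thesis using that by (simp add: divide_le_eq)
  qed
  have "(\<lambda>j. LINT \<xi>|lborel. of_real ((exp (- \<tau> j * a \<xi>) - exp (- t * a \<xi>)) / (\<tau> j - t)) * (F \<xi> * \<eta> \<xi>)) \<longlonglongrightarrow>
     (LINT \<xi>|lborel. of_real (- a \<xi> * exp (- t * a \<xi>)) * (F \<xi> * \<eta> \<xi>))"
  proof (rule integral_dominated_convergence)
    show "integrable lborel (\<lambda>\<xi>. norm (of_real (a \<xi>) * F \<xi> * \<eta> \<xi>))"
      using poly_bounded_tempered_fun[OF poly_bounded_mult[OF poly_bounded_powr[OF s] F]] \<eta>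
      by (intro integrable_norm) (auto simp: tempered_fun_def a_def)
    show "AE \<xi> in lborel. norm (of_real ((exp (- \<tau> j * a \<xi>) - exp (- t * a \<xi>)) / (\<tau> j - t)) * (F \<xi> * \<eta> \<xi>)) \<le> norm (of_real (a \<xi>) * F \<xi> * \<eta> \<xi>)" for j
    proof (rule AE_I2)
      fix \<xi>
      have "\<bar>(exp (- \<tau> j * a \<xi>) - exp (- t * a \<xi>)) / (\<tau> j - t)\<bar> \<le> a \<xi>" using \<tau>(1) t by (intro exp_lip) auto
      then show "norm (of_real ((exp (- \<tau> j * a \<xi>) - exp (- t * a \<xi>)) / (\<tau> j - t)) * (F \<xi> * \<eta> \<xi>)) \<le> norm (of_real (a \<xi>) * F \<xi> * \<eta> \<xi>)"
        using a0[of \<xi>] by (simp only: norm_mult norm_of_real mult.assoc) (intro mult_right_mono, auto)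
    qed
    show "AE \<xi> in lborel. (\<lambda>j. of_real ((exp (- \<tau> j * a \<xi>) - exp (- t * a \<xi>)) / (\<tau> j - t)) * (F \<xi> * \<eta> \<xi>)) \<longlonglongrightarrow> of_real (- a \<xi> * exp (- t * a \<xi>)) * (F \<xi> * \<eta> \<xi>)"
    proof (intro AE_I2 tendsto_mult_right tendsto_of_real)
      fix \<xi>
      have "((\<lambda>t. exp (- t * a \<xi>)) has_vector_derivative - a \<xi> * exp (- t * a \<xi>)) (at t within {0..})"
        unfolding has_real_derivative_iff_has_vector_derivative[symmetric] by (auto intro!: derivative_eq_intros)
      then show "(\<lambda>j. (exp (- \<tau> j * a \<xi>) - exp (- t * a \<xi>)) / (\<tau> j - t)) \<longlonglongrightarrow> - a \<xi> * exp (- t * a \<xi>)"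
        using \<tau> unfolding has_vector_derivative_iff_quotient tendsto_at_iff_sequentially o_def
        by (simp add: divide_inverse mult.commute)
    qed
  qed measurable
  moreover have "(LINT \<xi>|lborel. of_real ((exp (- \<tau> j * a \<xi>) - exp (- t * a \<xi>)) / (\<tau> j - t)) * (F \<xi> * \<eta> \<xi>)) =
     (ift (\<lambda>\<xi>. heat_mult s (\<tau> j) \<xi> * F \<xi>) \<psi> - ift (\<lambda>\<xi>. heat_mult s t \<xi> * F \<xi>) \<psi>) /\<^sub>R (\<tau> j - t)" for j
  proof -
    have "\<tau> j \<ge> 0" using \<tau>(1) by auto
    then have "ift (\<lambda>\<xi>. heat_mult s (\<tau> j) \<xi> * F \<xi>) \<psi> - ift (\<lambda>\<xi>. heat_mult s t \<xi> * F \<xi>) \<psi> =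
       (LINT \<xi>|lborel. heat_mult s (\<tau> j) \<xi> * F \<xi> * \<eta> \<xi> - heat_mult s t \<xi> * F \<xi> * \<eta> \<xi>)"
      using \<psi> t by (simp add: ift_def \<eta>_def[symmetric] Bochner_Integration.integral_diff int)
    then have "(ift (\<lambda>\<xi>. heat_mult s (\<tau> j) \<xi> * F \<xi>) \<psi> - ift (\<lambda>\<xi>. heat_mult s t \<xi> * F \<xi>) \<psi>) /\<^sub>R (\<tau> j - t) =
       (LINT \<xi>|lborel. (heat_mult s (\<tau> j) \<xi> * F \<xi> * \<eta> \<xi> - heat_mult s t \<xi> * F \<xi> * \<eta> \<xi>) /\<^sub>R (\<tau> j - t))"
      by (simp only: integral_scaleR_right)
    also have "... = (LINT \<xi>|lborel. of_real ((exp (- \<tau> j * a \<xi>) - exp (- t * a \<xi>)) / (\<tau> j - t)) * (F \<xi> * \<eta> \<xi>))"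
      by (intro Bochner_Integration.integral_cong refl) (simp add: heat_mult_def a_def scaleR_conv_of_real divide_inverse algebra_simps)
    finally show ?thesis by simp
  qed
  moreover have "(LINT \<xi>|lborel. of_real (- a \<xi> * exp (- t * a \<xi>)) * (F \<xi> * \<eta> \<xi>)) =
     - ift (\<lambda>\<xi>. of_real (norm \<xi> powr (2 * s)) * (heat_mult s t \<xi> * F \<xi>)) \<psi>"
    using \<psi> by (simp add: ift_def heat_mult_def a_def \<eta>_def[symmetric] mult.assoc)
  ultimately show "(\<lambda>j. (ift (\<lambda>\<xi>. heat_mult s (\<tau> j) \<xi> * F \<xi>) \<psi> - ift (\<lambda>\<xi>. heat_mult s t \<xi> * F \<xi>) \<psi>) /\<^sub>R (\<tau> j - t)) \<longlonglongrightarrow>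
     - ift (\<lambda>\<xi>. of_real (norm \<xi> powr (2 * s)) * (heat_mult s t \<xi> * F \<xi>)) \<psi>" by simp
qed

lemma fractional_heat_exists:
  fixes F :: "'n::finite cfun"
  assumes F: "poly_bounded F" and s: "s > 0"
  shows "cauchy_solution (frac_laplacian s) (\<lambda>t. ift (\<lambda>\<xi>. heat_mult s t \<xi> * F \<xi>)) (ift F)"
  unfolding cauchy_solution_def
proof (intro conjI allI impI ballI)
  have p: "poly_bounded (\<lambda>\<xi>. heat_mult s t \<xi> * F \<xi>)" if "t \<ge> 0" for t
    by (rule poly_bounded_mult[OF poly_bounded_heat_mult[OF that] F])
  fix t :: real
  show "tempered (ift (\<lambda>\<xi>. heat_mult s t \<xi> * F \<xi>))" if "0 \<le> t" by (rule tempered_ift[OF p[OF that]])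
  assume t: "0 < t"
  show "\<exists>S. frac_laplacian s (ift (\<lambda>\<xi>. heat_mult s t \<xi> * F \<xi>)) S \<and>
     (\<forall>\<psi>\<in>schwartz. ((\<lambda>t. ift (\<lambda>\<xi>. heat_mult s t \<xi> * F \<xi>) \<psi>) has_vector_derivative - S \<psi>) (at t))"
  proof (intro exI[of _ "ift (\<lambda>\<xi>. of_real (norm \<xi> powr (2 * s)) * (heat_mult s t \<xi> * F \<xi>))"] conjI ballI)
    show "frac_laplacian s (ift (\<lambda>\<xi>. heat_mult s t \<xi> * F \<xi>)) (ift (\<lambda>\<xi>. of_real (norm \<xi> powr (2 * s)) * (heat_mult s t \<xi> * F \<xi>)))"
      using t s p by (subst frac_laplacian_ift) auto
    fix \<psi> :: "'n cfun" assume "\<psi> \<in> schwartz"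
    note d = fractional_heat_derivative[OF F s less_imp_le[OF t] this]
    have "at t within {0..} = at t" using t by (intro at_within_interior) simp
    with d show "((\<lambda>t. ift (\<lambda>\<xi>. heat_mult s t \<xi> * F \<xi>) \<psi>) has_vector_derivative - ift (\<lambda>\<xi>. of_real (norm \<xi> powr (2 * s)) * (heat_mult s t \<xi> * F \<xi>)) \<psi>) (at t)"
      by (simp only:)
  qed
next
  show "ift (\<lambda>\<xi>. heat_mult s 0 \<xi> * F \<xi>) = ift F" by (simp add: heat_mult_def)
  fix \<psi> :: "'n cfun" assume \<psi>: "\<psi> \<in> schwartz"
  have "((\<lambda>t. ift (\<lambda>\<xi>. heat_mult s t \<xi> * F \<xi>) \<psi>) \<longlongrightarrow> ift (\<lambda>\<xi>. heat_mult s 0 \<xi> * F \<xi>) \<psi>) (at 0 within {0..})"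
    using has_vector_derivative_continuous[OF fractional_heat_derivative[OF F s order_refl \<psi>]]
    by (simp add: continuous_within)
  then show "((\<lambda>t. ift (\<lambda>\<xi>. heat_mult s t \<xi> * F \<xi>) \<psi>) \<longlongrightarrow> ift F \<psi>) (at_right 0)"
    by (simp add: heat_mult_def at_within_Ici_at_right)
qed

subsection \<open>Dilations and self-similar variables\<close>

text \<open>The generator of dilations: along \<open>exp (k * t) *\<^sub>R x\<close> the time
  derivative of \<open>f\<close> is \<open>k\<close> times this operator.\<close>

definition euler_op :: "(real^'n::finite \<Rightarrow> complex) \<Rightarrow> real^'n \<Rightarrow> complex" where
  "euler_op f x = (\<Sum>i\<in>UNIV. of_real (x $ i) * partial_deriv i f x)"

lemma schwartz_euler_op: "f \<in> schwartz \<Longrightarrow> euler_op f \<in> schwartz"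
  unfolding euler_op_def[abs_def] by (intro schwartz_sum schwartz_component_mult schwartz_partial)

lemma schwartz_dilate_has_derivative:
  fixes f :: "'n::finite cfun"
  assumes "f \<in> schwartz"
  shows "((\<lambda>x. f (c *\<^sub>R x)) has_derivative (\<lambda>v. \<Sum>k\<in>UNIV. of_real (v $ k) * (of_real c * partial_deriv k f (c *\<^sub>R x)))) (at x)"
proof -
  have "((\<lambda>x. c *\<^sub>R x) has_derivative (\<lambda>v. c *\<^sub>R v)) (at x)" by (auto intro!: derivative_eq_intros)
  from has_derivative_compose[OF this schwartz_has_derivative[OF assms]]
  have "((\<lambda>x. f (c *\<^sub>R x)) has_derivative (\<lambda>v. \<Sum>k\<in>UNIV. of_real ((c *\<^sub>R v) $ k) * partial_deriv k f (c *\<^sub>R x))) (at x)" .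
  moreover have "(\<lambda>v. \<Sum>k\<in>UNIV. of_real ((c *\<^sub>R v) $ k) * partial_deriv k f (c *\<^sub>R x)) =
     (\<lambda>v::real^'n. \<Sum>k\<in>UNIV. of_real (v $ k) * (of_real c * partial_deriv k f (c *\<^sub>R x)))"
    by (intro ext sum.cong refl) (simp only: vector_scaleR_component real_scaleR_def of_real_mult mult_ac)
  ultimately show ?thesis by (simp only:)
qed

lemma partial_deriv_dilate:
  "f \<in> schwartz \<Longrightarrow> partial_deriv i (\<lambda>x. f (c *\<^sub>R x)) x = of_real c * partial_deriv i f (c *\<^sub>R x)"
  using partial_deriv_eq[OF schwartz_dilate_has_derivative, of f i c x] by (simp only: sum_axis_component)

lemma euler_op_dilate:
  "f \<in> schwartz \<Longrightarrow> euler_op (\<lambda>x. f (c *\<^sub>R x)) = (\<lambda>x. euler_op f (c *\<^sub>R x))"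
  by (intro ext) (simp only: euler_op_def partial_deriv_dilate vector_scaleR_component real_scaleR_def of_real_mult mult_ac)

lemma schwartz_dilation_time_derivative:
  fixes f :: "'n::finite cfun"
  assumes "f \<in> schwartz"
  shows "((\<lambda>t. f (exp (k * t) *\<^sub>R x)) has_vector_derivative of_real k * euler_op f (exp (k * t) *\<^sub>R x)) (at t within J)"
proof -
  have "((\<lambda>t. exp (k * t) *\<^sub>R x) has_derivative (\<lambda>h. (h * k * exp (k * t)) *\<^sub>R x)) (at t within J)"
    by (auto intro!: derivative_eq_intros simp: mult_ac)
  from has_derivative_compose[OF this schwartz_has_derivative[OF assms]]
  have "((\<lambda>t. f (exp (k * t) *\<^sub>R x)) has_derivative
    (\<lambda>h. \<Sum>i\<in>UNIV. of_real (((h * k * exp (k * t)) *\<^sub>R x) $ i) * partial_deriv i f (exp (k * t) *\<^sub>R x))) (at t within J)" .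
  moreover have "(\<lambda>h. \<Sum>i\<in>UNIV. of_real (((h * k * exp (k * t)) *\<^sub>R x) $ i) * partial_deriv i f (exp (k * t) *\<^sub>R x)) =
     (\<lambda>h. h *\<^sub>R (of_real k * euler_op f (exp (k * t) *\<^sub>R x)))"
    unfolding euler_op_def sum_distrib_left scaleR_sum_right
    by (intro ext sum.cong refl) (simp only: vector_scaleR_component real_scaleR_def of_real_mult scaleR_conv_of_real[where 'a=complex] mult_ac)
  ultimately show ?thesis unfolding has_vector_derivative_def by (simp only:)
qed

lemma dilation_path:
  fixes \<psi> :: "'n::finite cfun"
  assumes \<psi>: "\<psi> \<in> schwartz"
  shows "schwartz_path {a..b} (\<lambda>t x. \<psi> (exp (k * t) *\<^sub>R x)) (\<lambda>t x. of_real k * euler_op \<psi> (exp (k * t) *\<^sub>R x))"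
proof -
  let ?J = "{a..b}"
  let ?g = "\<lambda>N f t x. of_real (exp (k * t) ^ N) * f (exp (k * t) *\<^sub>R x)"
  \<comment> \<open>\<open>N\<close> counts the factors exp(kt) that spatial derivatives bring down;
    the time derivative returns to the same form with \<open>f\<close> replaced by a combination of
    \<open>f\<close> and \<open>euler_op f\<close>.\<close>
  let ?Z = "{?g N f | N (f :: real^'n \<Rightarrow> complex). f \<in> schwartz}"
  show ?thesis
  proof (rule schwartz_pathI[where Z = ?Z])
    show "convex ?J" by simp
    show "(\<lambda>t x. \<psi> (exp (k * t) *\<^sub>R x)) \<in> ?Z"
      by (intro CollectI exI[of _ 0] exI[of _ \<psi>]) (simp add: \<psi>)
    show "(\<lambda>t x. of_real k * euler_op \<psi> (exp (k * t) *\<^sub>R x)) \<in> ?Z"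
      by (intro CollectI exI[of _ 0] exI[of _ "\<lambda>x. of_real k * euler_op \<psi> x"]) (simp add: schwartz_cmult schwartz_euler_op \<psi>)
    show "((\<lambda>t. \<psi> (exp (k * t) *\<^sub>R x)) has_vector_derivative of_real k * euler_op \<psi> (exp (k * t) *\<^sub>R x)) (at t within ?J)" for t x
      by (rule schwartz_dilation_time_derivative[OF \<psi>])
  next
    fix g t x assume "g \<in> ?Z" "t \<in> ?J"
    then obtain N f where g: "g = ?g N f" "f \<in> schwartz" by blast
    show "g t differentiable at x"
      unfolding g(1) by (intro differentiable_mult differentiable_const differentiableI[OF schwartz_dilate_has_derivative[OF g(2)]])
  next
    fix g M assume "g \<in> ?Z"
    then obtain N f where g: "g = ?g N f" "f \<in> schwartz" by blast
    \<comment> \<open>On the compact time interval the dilation factor stays between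
      \<open>m\<close> and \<open>L = 1 / m\<close>.\<close>
    define m where "m = exp (- \<bar>k\<bar> * max \<bar>a\<bar> \<bar>b\<bar>)"
    define L where "L = exp (\<bar>k\<bar> * max \<bar>a\<bar> \<bar>b\<bar>)"
    have mL: "m > 0" "L > 0" "L = 1 / m" "L \<ge> 1" by (auto simp: m_def L_def exp_minus divide_inverse)
    obtain C where C: "C > 0" "\<And>x. (1 + norm x) ^ M * norm (f x) \<le> C" by (rule schwartz_decay[OF g(2)]) (rule that)
    have "(1 + norm x) ^ M * norm (g t x) \<le> L ^ N * (L ^ M * C)" if t: "t \<in> ?J" for t x
    proof -
      define c where "c = exp (k * t)"
      have "\<bar>k * t\<bar> \<le> \<bar>k\<bar> * max \<bar>a\<bar> \<bar>b\<bar>" using t by (auto simp: abs_mult intro!: mult_left_mono)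
      then have kt: "k * t \<le> \<bar>k\<bar> * max \<bar>a\<bar> \<bar>b\<bar>" "- \<bar>k\<bar> * max \<bar>a\<bar> \<bar>b\<bar> \<le> k * t" by auto
      then have c: "c \<le> L" "m \<le> c" "c > 0" by (auto simp: c_def L_def m_def)
      have "1 \<le> L * c" using c(2) mL by (simp add: mL(3) field_simps)
      then have "norm x \<le> L * norm (c *\<^sub>R x)" using c(3) mult_right_mono[of 1 "L * c" "norm x"] by (simp add: mult.assoc)
      then have "1 + norm x \<le> L * (1 + norm (c *\<^sub>R x))" using mL(4) by (simp add: distrib_left)
      then have "(1 + norm x) ^ M \<le> (L * (1 + norm (c *\<^sub>R x))) ^ M" by (intro power_mono) auto
      then have "(1 + norm x) ^ M * norm (f (c *\<^sub>R x)) \<le> (L * (1 + norm (c *\<^sub>R x))) ^ M * norm (f (c *\<^sub>R x))" by (rule mult_right_mono) simp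
      also have "... = L ^ M * ((1 + norm (c *\<^sub>R x)) ^ M * norm (f (c *\<^sub>R x)))" by (simp only: power_mult_distrib mult.assoc)
      also have "... \<le> L ^ M * C" using mL(2) by (intro mult_left_mono C) auto
      finally have A: "(1 + norm x) ^ M * norm (f (c *\<^sub>R x)) \<le> L ^ M * C" .
      have "c ^ N * ((1 + norm x) ^ M * norm (f (c *\<^sub>R x))) \<le> L ^ N * (L ^ M * C)"
        by (rule mult_mono[OF power_mono[OF c(1) less_imp_le[OF c(3)]] A]) (use mL in auto)
      moreover have "norm (g t x) = c ^ N * norm (f (c *\<^sub>R x))"
        unfolding g(1) c_def[symmetric] norm_mult norm_of_real using c(3) by simp
      ultimately show ?thesis by (simp only: mult_ac)
    qed
    then show "\<exists>C. \<forall>t\<in>?J. \<forall>x. (1 + norm x) ^ M * norm (g t x) \<le> C" by blast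
  next
    fix g i assume "g \<in> ?Z"
    then obtain N f where g: "g = ?g N f" "f \<in> schwartz" by blast
    have "partial_deriv i (g t) x = ?g (Suc N) (partial_deriv i f) t x" for t x
      unfolding g(1)
      by (subst partial_deriv_eq[OF has_derivative_mult_right[OF schwartz_dilate_has_derivative[OF g(2)]]])
         (simp only: sum_axis_component power_Suc2 of_real_mult mult.assoc)
    then show "\<exists>g'\<in>?Z. \<forall>t\<in>?J. partial_deriv i (g t) = g' t"
      using schwartz_partial[OF g(2), of i] by (intro bexI[of _ "?g (Suc N) (partial_deriv i f)"]) (blast, blast)
  next
    fix g assume "g \<in> ?Z"
    then obtain N f where g: "g = ?g N f" "f \<in> schwartz" by blast
    define f' where "f' = (\<lambda>x. (of_real (real N * k)) * f x + of_real k * euler_op f x)"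
    have f': "f' \<in> schwartz" unfolding f'_def by (intro schwartz_add schwartz_cmult schwartz_euler_op g(2))
    have "((\<lambda>t. g t x) has_vector_derivative ?g N f' t x) (at t within ?J)" for t x
    proof -
      have "((\<lambda>t. exp (k * t) ^ N) has_real_derivative real N * k * exp (k * t) ^ N) (at t within ?J)"
        unfolding exp_of_nat_mult[symmetric]
        by (auto intro!: derivative_eq_intros)
      from has_vector_derivative_mult[OF has_vector_derivative_of_real[OF this] schwartz_dilation_time_derivative[OF g(2), of k x t ?J]]
      show ?thesis unfolding g(1) by (rule has_vector_derivative_eq_rhs) (simp add: f'_def algebra_simps)
    qed
    then show "\<exists>g'\<in>?Z. \<forall>t\<in>?J. \<forall>x. ((\<lambda>t. g t x) has_vector_derivative g' t x) (at t within ?J)"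
      using f' by (intro bexI[of _ "?g N f'"]) (blast, blast)
  qed
qed

lemma inv_fourier_dilate:
  fixes f :: "'n::finite cfun"
  assumes f: "f \<in> schwartz" and c: "c > 0"
  shows "inv_fourier (\<lambda>x. f (c *\<^sub>R x)) (c *\<^sub>R \<xi>) = of_real (1 / c ^ CARD('n)) * inv_fourier f \<xi>"
proof -
  note [measurable] = schwartz_measurable[OF f]
  have "(LINT x|lborel. cis (\<xi> \<bullet> x) * f x) = (c ^ CARD('n)) *\<^sub>R (LINT x|lborel. cis ((c *\<^sub>R \<xi>) \<bullet> x) * f (c *\<^sub>R x))"
    using c by (subst lborel_integral_affine[where c = c and t = 0]) auto
  then show ?thesis using c by (simp add: inv_fourier_def scaleR_conv_of_real[where 'a=complex] field_simps)
qed

text \<open>The Jacobian of the substitution cancels the factor c^-n in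
  \<open>inv_fourier_dilate\<close>, so dilating the test function dilates the symbol by the same
  \<open>c\<close>.\<close>

lemma ift_dilate:
  fixes F :: "'n::finite cfun"
  assumes F: "F \<in> borel_measurable borel" and \<psi>: "\<psi> \<in> schwartz" and c: "c > 0"
  shows "ift F (\<lambda>x. \<psi> (c *\<^sub>R x)) = ift (\<lambda>\<xi>. F (c *\<^sub>R \<xi>)) \<psi>"
proof -
  have d: "(\<lambda>x. \<psi> (c *\<^sub>R x)) \<in> schwartz" using c by (intro schwartz_dilate \<psi>) simp
  note [measurable] = F schwartz_measurable[OF schwartz_inv_fourier[OF d]]
  have "(LINT \<xi>|lborel. F \<xi> * inv_fourier (\<lambda>x. \<psi> (c *\<^sub>R x)) \<xi>) =
     (c ^ CARD('n)) *\<^sub>R (LINT \<xi>|lborel. F (c *\<^sub>R \<xi>) * inv_fourier (\<lambda>x. \<psi> (c *\<^sub>R x)) (c *\<^sub>R \<xi>))"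
    using c by (subst lborel_integral_affine[where c = c and t = 0]) auto
  also have "... = (LINT \<xi>|lborel. (c ^ CARD('n)) *\<^sub>R (F (c *\<^sub>R \<xi>) * inv_fourier (\<lambda>x. \<psi> (c *\<^sub>R x)) (c *\<^sub>R \<xi>)))"
    by simp
  also have "... = (LINT \<xi>|lborel. F (c *\<^sub>R \<xi>) * inv_fourier \<psi> \<xi>)"
    unfolding inv_fourier_dilate[OF \<psi> c]
    using c by (intro Bochner_Integration.integral_cong refl) (simp add: scaleR_conv_of_real[where 'a=complex])
  finally show ?thesis using d \<psi> by (simp add: ift_def)
qed

lemma poly_bounded_dilate:
  fixes F :: "'n::finite cfun"
  assumes F: "poly_bounded F" and c: "c > 0"
  shows "poly_bounded (\<lambda>\<xi>. F (c *\<^sub>R \<xi>))"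
proof -
  obtain C N where C: "C > 0" "\<And>\<xi>. norm (F \<xi>) \<le> C * (1 + norm \<xi>) ^ N" using poly_boundedE[OF F] by blast
  have "norm (F (c *\<^sub>R \<xi>)) \<le> (C * (max 1 c) ^ N) * (1 + norm \<xi>) ^ N" for \<xi>
  proof -
    have "1 + norm (c *\<^sub>R \<xi>) \<le> max 1 c * (1 + norm \<xi>)"
      using c by (auto simp: distrib_left max_def intro!: mult_right_mono add_mono)
        (metis dual_order.trans less_eq_real_def linorder_not_le mult_left_le_one_le norm_ge_zero)
    then have "(1 + norm (c *\<^sub>R \<xi>)) ^ N \<le> (max 1 c * (1 + norm \<xi>)) ^ N" by (intro power_mono) auto
    then have "C * (1 + norm (c *\<^sub>R \<xi>)) ^ N \<le> C * (max 1 c * (1 + norm \<xi>)) ^ N" using C(1) by simp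
    then show ?thesis using C(2)[of "c *\<^sub>R \<xi>"] by (simp add: power_mult_distrib mult.assoc)
  qed
  then show ?thesis
    using poly_bounded_measurable[OF F] unfolding poly_bounded_def by (intro conjI exI) auto
qed

lemma tempered_sum:
  assumes T: "tempered T" and "finite I" and f: "\<And>k. k \<in> I \<Longrightarrow> f k \<in> schwartz"
  shows "T (\<lambda>x. \<Sum>k\<in>I. f k x) = (\<Sum>k\<in>I. T (f k))"
  using assms(2,3)
proof (induction I)
  case empty
  have "T (\<lambda>x. 0 * 0 + 0 * 0) = 0 * T (\<lambda>_. 0) + 0 * T (\<lambda>_. 0)" by (rule tempered_lin[OF T schwartz_zero schwartz_zero])
  then show ?case by simp
next
  case (insert k I)
  have "T (\<lambda>x. 1 * f k x + 1 * (\<Sum>k\<in>I. f k x)) = 1 * T (f k) + 1 * T (\<lambda>x. \<Sum>k\<in>I. f k x)"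
    by (rule tempered_lin[OF T]) (use insert.prems in \<open>auto intro: schwartz_sum\<close>)
  then show ?case using insert by simp
qed

lemma tempered_cmult: "tempered T \<Longrightarrow> \<psi> \<in> schwartz \<Longrightarrow> T (\<lambda>x. c * \<psi> x) = c * T \<psi>"
  using tempered_lin[of T \<psi> \<psi> c 0] by simp

text \<open>The product rule contributes one copy of \<open>\<psi>\<close> for each coordinate,
  whence the dimension.\<close>

lemma r_deriv_r_eq:
  fixes T :: "'n::finite distribution"
  assumes T: "tempered T" and \<psi>: "\<psi> \<in> schwartz"
  shows "r_deriv_r T \<psi> = - (of_nat CARD('n) * T \<psi> + T (euler_op \<psi>))"
proof -
  have p: "partial_deriv i (\<lambda>x. of_real (x $ i) * \<psi> x) = (\<lambda>x. 1 * \<psi> x + 1 * (of_real (x $ i) * partial_deriv i \<psi> x))" for i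
  proof
    fix x
    show "partial_deriv i (\<lambda>x. of_real (x $ i) * \<psi> x) x = 1 * \<psi> x + 1 * (of_real (x $ i) * partial_deriv i \<psi> x)"
      using partial_deriv_eq[OF has_derivative_mult[OF has_derivative_component schwartz_has_derivative[OF \<psi>]], of i i x, unfolded sum_axis_component]
      by (simp add: axis_def)
  qed
  have "T (partial_deriv i (\<lambda>x. of_real (x $ i) * \<psi> x)) = T \<psi> + T (\<lambda>x. of_real (x $ i) * partial_deriv i \<psi> x)" for i
    unfolding p using tempered_lin[OF T \<psi>, of "\<lambda>x. of_real (x $ i) * partial_deriv i \<psi> x" 1 1]
    by (simp add: schwartz_component_mult schwartz_partial \<psi>)
  moreover have "T (euler_op \<psi>) = (\<Sum>i\<in>UNIV. T (\<lambda>x. of_real (x $ i) * partial_deriv i \<psi> x))"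
    unfolding euler_op_def[abs_def] by (rule tempered_sum[OF T]) (auto intro: schwartz_component_mult schwartz_partial \<psi>)
  ultimately show ?thesis using \<psi> by (simp add: r_deriv_r_def sum.distrib)
qed

text \<open>The zeroth-order term n/(2s) of the operator cancels the n produced by transposing the
  radial derivative. What remains is the multiplier |xi|^(2s) and the generator of dilations with
  factor 1/(2s).\<close>

lemma L_op_ift:
  fixes U :: "'n::finite cfun"
  assumes U: "poly_bounded U" and s: "s > 0"
  shows "L_op s (ift U) S \<longleftrightarrow> S = (\<lambda>\<psi>\<in>schwartz. ift (\<lambda>\<xi>. of_real (norm \<xi> powr (2 * s)) * U \<xi>) \<psi> +
     of_real (1 / (2 * s)) * ift U (euler_op \<psi>))"
proof -
  have "(\<lambda>\<psi>\<in>schwartz. Q \<psi> - of_real (1 / (2 * s)) * r_deriv_r (ift U) \<psi> - of_real (real CARD('n) / (2 * s)) * ift U \<psi>) =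
    (\<lambda>\<psi>\<in>schwartz. Q \<psi> + of_real (1 / (2 * s)) * ift U (euler_op \<psi>))" for Q
  proof (rule restrict_ext)
    fix \<psi> :: "'n cfun" assume \<psi>: "\<psi> \<in> schwartz"
    have a: "q - k * (- (n * t + e)) - (k * n) * t = q + k * e" for q k n t e :: complex
      by (simp add: algebra_simps)
    have c: "complex_of_real (real CARD('n) / (2 * s)) = of_real (1 / (2 * s)) * of_nat CARD('n)" by simp
    show "Q \<psi> - of_real (1 / (2 * s)) * r_deriv_r (ift U) \<psi> - of_real (real CARD('n) / (2 * s)) * ift U \<psi> =
      Q \<psi> + of_real (1 / (2 * s)) * ift U (euler_op \<psi>)"
      unfolding r_deriv_r_eq[OF tempered_ift[OF U] \<psi>] c by (rule a)
  qed
  then show ?thesis unfolding L_op_def using frac_laplacian_ift[OF U s] by auto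
qed

section \<open>Transfer of the equation to self-similar variables\<close>

text \<open>The amplitude (1+t)^(-n/(2s)) cancels the Jacobian in \<open>dist_dilate\<close>, so the
  change of variables only dilates the test function. The dilation factor is written as an
  exponential in \<open>ln (1 + t)\<close> to match \<open>dilation_path\<close>.\<close>

lemma self_similar_apply:
  fixes u :: "real \<Rightarrow> 'n::finite distribution"
  assumes "self_similar s \<phi> u" "t \<ge> 0" "s > 0" "\<psi> \<in> schwartz"
  shows "\<phi> t \<psi> = u (ln (1 + t)) (\<lambda>x. \<psi> (exp (1 / (2 * s) * ln (1 + t)) *\<^sub>R x))"
proof -
  define c where "c = (t + 1) powr (1 / (2 * s))"
  have c: "c = exp (1 / (2 * s) * ln (1 + t))" "c > 0" using assms(2) by (auto simp: c_def powr_def add.commute)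
  have "c ^ CARD('n) = c powr real CARD('n)" using c(2) by (simp add: powr_realpow)
  also have "... = (1 + t) powr (real CARD('n) / (2 * s))" by (simp add: c_def powr_powr add.commute)
  finally have cn: "c ^ CARD('n) = (1 + t) powr (real CARD('n) / (2 * s))" .
  have "\<phi> t \<psi> = of_real (1 / c ^ CARD('n)) * (of_real (c ^ CARD('n)) * u (ln (t + 1)) (\<lambda>x. \<psi> (c *\<^sub>R x)))"
  proof -
    have "\<phi> t = dist_scale (of_real (1 / (1 + t) powr (real CARD('n) / (2 * s))))
       (dist_dilate ((t + 1) powr (1 / (2 * s))) (u (ln (t + 1))))"
      using assms(1,2) unfolding self_similar_def by blast
    then show ?thesis
      unfolding dist_scale_def dist_dilate_def cn[symmetric] c_def[symmetric] using assms(4) by simp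
  qed
  also have "... = u (ln (t + 1)) (\<lambda>x. \<psi> (c *\<^sub>R x))" using c(2) by simp
  finally show ?thesis unfolding c(1) by (simp add: add.commute)
qed

lemma self_similar_extensional: "self_similar s \<phi> u \<Longrightarrow> t \<ge> 0 \<Longrightarrow> \<phi> t \<in> extensional schwartz"
  unfolding self_similar_def dist_scale_def by simp

lemma powr_2s_dilate: "s > 0 \<Longrightarrow> norm (exp (1 / (2 * s) * t) *\<^sub>R \<xi>) powr (2 * s) = exp t * norm \<xi> powr (2 * s)"
  by (simp add: powr_mult powr_def[of "exp _"])

text \<open>The change of variables is split in two. \<open>\<Phi> \<sigma>\<close> is
  \<open>\<phi>\<close> at time exp(sigma)-1, with space untouched; then \<open>u\<close> and
  \<open>\<Phi>\<close> differ by a dilation of the test function that moves with sigma, and the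
  product rule creates the dilation term of \<open>L_op\<close> in one direction and removes it in
  the other.\<close>

lemma self_similar_equivalence:
  fixes u :: "real \<Rightarrow> 'n::finite distribution"
  assumes s: "s > 0" and ss: "self_similar s \<phi> u"
    and nice: "\<And>\<tau>. \<tau> \<ge> 0 \<Longrightarrow> \<exists>U. poly_bounded U \<and> u \<tau> = ift U"
  shows "cauchy_solution (frac_laplacian s) \<phi> \<phi>0 \<longleftrightarrow> cauchy_solution (L_op s) u \<phi>0"
proof -
  define k where "k = 1 / (2 * s)"
  define \<Phi> where "\<Phi> \<sigma> = \<phi> (exp \<sigma> - 1)" for \<sigma>
  obtain U where U: "\<And>\<tau>. \<tau> \<ge> 0 \<Longrightarrow> poly_bounded (U \<tau>)" "\<And>\<tau>. \<tau> \<ge> 0 \<Longrightarrow> u \<tau> = ift (U \<tau>)" using nice by metis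
  have \<Phi>u: "\<Phi> \<sigma> \<psi> = u \<sigma> (\<lambda>x. \<psi> (exp (k * \<sigma>) *\<^sub>R x))" if "\<sigma> \<ge> 0" "\<psi> \<in> schwartz" for \<sigma> \<psi>
    using self_similar_apply[OF ss _ s that(2), of "exp \<sigma> - 1"] that(1) by (simp add: \<Phi>_def k_def)
  have u\<Phi>: "u \<sigma> \<psi> = \<Phi> \<sigma> (\<lambda>x. \<psi> (exp (- k * \<sigma>) *\<^sub>R x))" if "\<sigma> \<ge> 0" "\<psi> \<in> schwartz" for \<sigma> \<psi>
    using \<Phi>u[OF that(1) schwartz_dilate[OF that(2), of "exp (- k * \<sigma>)"]] by (simp add: exp_minus)
  define F where "F \<sigma> = (\<lambda>\<xi>. U \<sigma> (exp (k * \<sigma>) *\<^sub>R \<xi>))" for \<sigma>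
  have F: "poly_bounded (F \<sigma>)" "\<Phi> \<sigma> = ift (F \<sigma>)" if "\<sigma> \<ge> 0" for \<sigma>
  proof -
    show "poly_bounded (F \<sigma>)" unfolding F_def by (rule poly_bounded_dilate[OF U(1)[OF that]]) simp
    show "\<Phi> \<sigma> = ift (F \<sigma>)"
    proof (rule extensionalityI[of _ schwartz])
      show "\<Phi> \<sigma> \<in> extensional schwartz" unfolding \<Phi>_def using that by (intro self_similar_extensional[OF ss]) simp
      show "ift (F \<sigma>) \<in> extensional schwartz" by (simp add: ift_def)
      fix \<psi> :: "'n cfun" assume "\<psi> \<in> schwartz"
      then show "\<Phi> \<sigma> \<psi> = ift (F \<sigma>) \<psi>"
        unfolding F_def \<Phi>u[OF that \<open>\<psi> \<in> schwartz\<close>] U(2)[OF that]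
        by (intro ift_dilate poly_bounded_measurable U(1) that) auto
    qed
  qed
  have tU: "tempered (u \<sigma>)" and t\<Phi>: "tempered (\<Phi> \<sigma>)" if "\<sigma> \<ge> 0" for \<sigma>
    using tempered_ift U F that by auto
  have \<phi>\<Phi>: "\<phi> t = \<Phi> (ln (1 + t))" if "t \<ge> 0" for t using that by (simp add: \<Phi>_def)
  let ?a = "\<lambda>\<xi>::real^'n. complex_of_real (norm \<xi> powr (2 * s))"
  have pa: "poly_bounded (\<lambda>\<xi>. ?a \<xi> * G \<xi>)" if "poly_bounded G" for G
    by (rule poly_bounded_mult[OF poly_bounded_powr[OF s] that])
  \<comment> \<open>Homogeneity of degree 2s turns the dilation by exp(sigma/(2s)) into the factor
    exp(sigma), which is also the derivative of t = exp(sigma)-1; the two cancel in the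
    equation.\<close>
  have aU: "ift (\<lambda>\<xi>. ?a \<xi> * U \<sigma> \<xi>) (\<lambda>x. \<psi> (exp (k * \<sigma>) *\<^sub>R x)) = of_real (exp \<sigma>) * ift (\<lambda>\<xi>. ?a \<xi> * F \<sigma> \<xi>) \<psi>"
    if "\<sigma> \<ge> 0" "\<psi> \<in> schwartz" for \<sigma> \<psi>
  proof -
    have "ift (\<lambda>\<xi>. ?a \<xi> * U \<sigma> \<xi>) (\<lambda>x. \<psi> (exp (k * \<sigma>) *\<^sub>R x)) = ift (\<lambda>\<xi>. ?a (exp (k * \<sigma>) *\<^sub>R \<xi>) * U \<sigma> (exp (k * \<sigma>) *\<^sub>R \<xi>)) \<psi>"
      by (intro ift_dilate poly_bounded_measurable[OF pa[OF U(1)]] that) auto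
    also have "(\<lambda>\<xi>. ?a (exp (k * \<sigma>) *\<^sub>R \<xi>) * U \<sigma> (exp (k * \<sigma>) *\<^sub>R \<xi>)) = (\<lambda>\<xi>. of_real (exp \<sigma>) * (?a \<xi> * F \<sigma> \<xi>))"
      unfolding k_def powr_2s_dilate[OF s] F_def by (simp only: of_real_mult mult_ac)
    finally show ?thesis using that(2) by (simp add: ift_def mult.assoc)
  qed
  \<comment> \<open>Dilation paths are controlled on compact intervals; around an interior time this
    does not affect the derivative.\<close>
  have at: "at \<tau> within {\<tau> / 2..\<tau> + 1} = at \<tau>" if "\<tau> > 0" for \<tau> :: real
    using that by (intro at_within_interior) auto
  have at0: "at 0 within {0..1::real} = at_right 0" by (rule at_within_Icc_at_right) simp
  have init: "\<phi> 0 = u 0"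
  proof (rule extensionalityI[of _ schwartz])
    show "\<phi> 0 \<in> extensional schwartz" by (intro self_similar_extensional[OF ss]) simp
    show "u 0 \<in> extensional schwartz" using tU[of 0] by (simp add: tempered_def)
    fix \<psi> :: "'n cfun" assume "\<psi> \<in> schwartz"
    then show "\<phi> 0 \<psi> = u 0 \<psi>" using \<Phi>u[of 0 \<psi>] by (simp add: \<Phi>_def)
  qed
  show ?thesis
  proof
    assume sol: "cauchy_solution (frac_laplacian s) \<phi> \<phi>0"
    show "cauchy_solution (L_op s) u \<phi>0"
      unfolding cauchy_solution_def
    proof (intro conjI allI impI ballI)
      fix \<tau> :: real
      show "tempered (u \<tau>)" if "0 \<le> \<tau>" by (rule tU[OF that])
      assume \<tau>: "0 < \<tau>"
      let ?J = "{\<tau> / 2..\<tau> + 1}"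
      let ?S = "\<lambda>\<psi>\<in>schwartz. ift (\<lambda>\<xi>. ?a \<xi> * U \<tau> \<xi>) \<psi> + of_real (1 / (2 * s)) * ift (U \<tau>) (euler_op \<psi>)"
      show "\<exists>S. L_op s (u \<tau>) S \<and> (\<forall>\<psi>\<in>schwartz. ((\<lambda>t. u t \<psi>) has_vector_derivative - S \<psi>) (at \<tau>))"
      proof (intro exI[of _ ?S] conjI ballI)
        show "L_op s (u \<tau>) ?S" using \<tau> by (simp add: U L_op_ift s)
        fix \<psi> :: "'n cfun" assume \<psi>: "\<psi> \<in> schwartz"
        obtain S where S: "frac_laplacian s (\<Phi> \<tau>) S" "\<And>\<psi>. \<psi> \<in> schwartz \<Longrightarrow> ((\<lambda>t. \<phi> t \<psi>) has_vector_derivative - S \<psi>) (at (exp \<tau> - 1))"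
          using sol \<tau> unfolding cauchy_solution_def \<Phi>_def by (metis diff_gt_0_iff_gt one_less_exp_iff)
        have S': "S = ift (\<lambda>\<xi>. ?a \<xi> * F \<tau> \<xi>)" using S(1) F[of \<tau>] \<tau> frac_laplacian_ift[OF F(1) s] by simp
        have d: "((\<lambda>\<sigma>. \<Phi> \<sigma> \<eta>) has_vector_derivative exp \<tau> *\<^sub>R (- S \<eta>)) (at \<tau> within ?J)" if "\<eta> \<in> schwartz" for \<eta>
        proof -
          have "((\<lambda>\<sigma>. exp \<sigma> - 1) has_vector_derivative exp \<tau>) (at \<tau>)"
            unfolding has_real_derivative_iff_has_vector_derivative[symmetric] by (auto intro!: derivative_eq_intros)
          from vector_diff_chain_at[OF this S(2)[OF that]] show ?thesis
            unfolding at[OF \<tau>] by (simp add: \<Phi>_def o_def)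
        qed
        have d1: "((\<lambda>\<sigma>. \<Phi> \<sigma> (\<lambda>x. \<psi> (exp (- k * \<sigma>) *\<^sub>R x))) has_vector_derivative
           exp \<tau> *\<^sub>R (- S (\<lambda>x. \<psi> (exp (- k * \<tau>) *\<^sub>R x))) + \<Phi> \<tau> (\<lambda>x. of_real (- k) * euler_op \<psi> (exp (- k * \<tau>) *\<^sub>R x))) (at \<tau> within ?J)"
          using \<tau> F[of \<tau>] t\<Phi>
          by (intro distribution_product_rule[where F = "F \<tau>", OF _ _ _ _ d dilation_path[OF \<psi>]]) auto
        have e1: "\<Phi> \<tau> (\<lambda>x. of_real (- k) * euler_op \<psi> (exp (- k * \<tau>) *\<^sub>R x)) = - of_real k * ift (U \<tau>) (euler_op \<psi>)"
        proof -
          have "\<Phi> \<tau> (\<lambda>x. of_real (- k) * euler_op \<psi> (exp (- k * \<tau>) *\<^sub>R x)) = of_real (- k) * \<Phi> \<tau> (\<lambda>x. euler_op \<psi> (exp (- k * \<tau>) *\<^sub>R x))"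
            using \<tau> by (intro tempered_cmult t\<Phi> schwartz_dilate schwartz_euler_op \<psi>) auto
          then show ?thesis using u\<Phi>[of \<tau> "euler_op \<psi>"] \<tau> by (simp add: schwartz_euler_op \<psi> U)
        qed
        have e2: "exp \<tau> *\<^sub>R S (\<lambda>x. \<psi> (exp (- k * \<tau>) *\<^sub>R x)) = ift (\<lambda>\<xi>. ?a \<xi> * U \<tau> \<xi>) \<psi>"
        proof -
          have "(\<lambda>x. \<psi> (exp (- k * \<tau>) *\<^sub>R x)) \<in> schwartz" by (intro schwartz_dilate \<psi>) simp
          from aU[OF _ this, of \<tau>] \<tau> show ?thesis
            unfolding S' scaleR_conv_of_real[where 'a=complex] by (simp add: exp_minus)
        qed
        have "((\<lambda>\<sigma>. \<Phi> \<sigma> (\<lambda>x. \<psi> (exp (- k * \<sigma>) *\<^sub>R x))) has_vector_derivative - ?S \<psi>) (at \<tau> within ?J)"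
          by (rule has_vector_derivative_eq_rhs[OF d1]) (simp only: scaleR_minus_right e1 e2, simp add: \<psi> k_def)
        then have "((\<lambda>\<sigma>. u \<sigma> \<psi>) has_vector_derivative - ?S \<psi>) (at \<tau> within ?J)"
          using \<tau> by (rule_tac has_vector_derivative_transform[rotated 2]) (auto simp: u\<Phi> \<psi>)
        then show "((\<lambda>\<sigma>. u \<sigma> \<psi>) has_vector_derivative - ?S \<psi>) (at \<tau>)" unfolding at[OF \<tau>] .
      qed
    next
      show "u 0 = \<phi>0" using sol init by (simp add: cauchy_solution_def)
      fix \<psi> :: "'n cfun" assume \<psi>: "\<psi> \<in> schwartz"
      have "((\<lambda>\<sigma>. \<Phi> \<sigma> (\<lambda>x. \<psi> (exp (- k * \<sigma>) *\<^sub>R x))) \<longlongrightarrow> \<phi>0 (\<lambda>x. \<psi> (exp (- k * 0) *\<^sub>R x))) (at 0 within {0..1})"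
      proof (rule distribution_product_limit[OF _ _ _ dilation_path[OF \<psi>]])
        fix \<eta> :: "'n cfun" assume "\<eta> \<in> schwartz"
        then have "((\<lambda>t. \<phi> t \<eta>) \<longlongrightarrow> \<phi>0 \<eta>) (at_right 0)" using sol by (simp add: cauchy_solution_def)
        moreover have "filterlim (\<lambda>\<sigma>::real. exp \<sigma> - 1) (at_right 0) (at_right 0)"
        proof -
          have "((\<lambda>\<sigma>::real. exp \<sigma> - 1) \<longlongrightarrow> exp 0 - 1) (at_right 0)" by (intro tendsto_intros)
          moreover have "\<forall>\<^sub>F \<sigma> in at_right 0. exp \<sigma> - 1 > (0::real)" by (auto simp: eventually_at_filter)
          ultimately show ?thesis by (auto simp: filterlim_at elim: eventually_mono)
        qed
        ultimately show "((\<lambda>\<sigma>. \<Phi> \<sigma> \<eta>) \<longlongrightarrow> \<phi>0 \<eta>) (at 0 within {0..1})"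
          unfolding at0 \<Phi>_def by (rule filterlim_compose)
      qed (use t\<Phi> in auto)
      then have "((\<lambda>\<sigma>. \<Phi> \<sigma> (\<lambda>x. \<psi> (exp (- k * \<sigma>) *\<^sub>R x))) \<longlongrightarrow> \<phi>0 \<psi>) (at_right 0)" by (simp add: at0)
      moreover have "\<forall>\<^sub>F \<sigma> in at_right 0. \<Phi> \<sigma> (\<lambda>x. \<psi> (exp (- k * \<sigma>) *\<^sub>R x)) = u \<sigma> \<psi>"
        by (auto simp: eventually_at_filter u\<Phi> \<psi>)
      ultimately show "((\<lambda>t. u t \<psi>) \<longlongrightarrow> \<phi>0 \<psi>) (at_right 0)" by (rule Lim_transform_eventually)
    qed
  next
    assume sol: "cauchy_solution (L_op s) u \<phi>0"
    show "cauchy_solution (frac_laplacian s) \<phi> \<phi>0"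
      unfolding cauchy_solution_def
    proof (intro conjI allI impI ballI)
      fix t :: real
      show "tempered (\<phi> t)" if "0 \<le> t" using t\<Phi>[of "ln (1 + t)"] \<phi>\<Phi>[OF that] that by simp
      assume t: "0 < t"
      define \<tau> where "\<tau> = ln (1 + t)"
      have \<tau>: "\<tau> > 0" using t by (simp add: \<tau>_def)
      have et: "exp \<tau> = 1 + t" using t by (simp add: \<tau>_def)
      let ?J = "{\<tau> / 2..\<tau> + 1}"
      let ?S = "ift (\<lambda>\<xi>. ?a \<xi> * F \<tau> \<xi>)"
      show "\<exists>S. frac_laplacian s (\<phi> t) S \<and> (\<forall>\<psi>\<in>schwartz. ((\<lambda>t. \<phi> t \<psi>) has_vector_derivative - S \<psi>) (at t))"
      proof (intro exI[of _ ?S] conjI ballI)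
        show "frac_laplacian s (\<phi> t) ?S" using t \<tau> \<phi>\<Phi>[of t] by (simp add: \<tau>_def[symmetric] F frac_laplacian_ift s)
        fix \<psi> :: "'n cfun" assume \<psi>: "\<psi> \<in> schwartz"
        obtain S where S: "L_op s (u \<tau>) S" "\<And>\<psi>. \<psi> \<in> schwartz \<Longrightarrow> ((\<lambda>t. u t \<psi>) has_vector_derivative - S \<psi>) (at \<tau>)"
          using sol \<tau> unfolding cauchy_solution_def by blast
        have S': "S = (\<lambda>\<psi>\<in>schwartz. ift (\<lambda>\<xi>. ?a \<xi> * U \<tau> \<xi>) \<psi> + of_real (1 / (2 * s)) * ift (U \<tau>) (euler_op \<psi>))"
          using S(1) \<tau> by (simp add: U L_op_ift s)
        have \<psi>c: "(\<lambda>x. \<psi> (exp (k * \<tau>) *\<^sub>R x)) \<in> schwartz" by (intro schwartz_dilate \<psi>) simp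
        have "((\<lambda>\<sigma>. u \<sigma> (\<lambda>x. \<psi> (exp (k * \<sigma>) *\<^sub>R x))) has_vector_derivative
           - S (\<lambda>x. \<psi> (exp (k * \<tau>) *\<^sub>R x)) + u \<tau> (\<lambda>x. of_real k * euler_op \<psi> (exp (k * \<tau>) *\<^sub>R x))) (at \<tau> within ?J)"
          using \<tau> U[of \<tau>] tU S(2)
          by (intro distribution_product_rule[where F = "U \<tau>", OF _ _ _ _ _ dilation_path[OF \<psi>]]) (auto simp: at)
        moreover have "u \<tau> (\<lambda>x. of_real k * euler_op \<psi> (exp (k * \<tau>) *\<^sub>R x)) = of_real k * ift (U \<tau>) (euler_op (\<lambda>x. \<psi> (exp (k * \<tau>) *\<^sub>R x)))"
        proof -
          have "u \<tau> (\<lambda>x. of_real k * euler_op \<psi> (exp (k * \<tau>) *\<^sub>R x)) = of_real k * u \<tau> (\<lambda>x. euler_op \<psi> (exp (k * \<tau>) *\<^sub>R x))"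
            using \<tau> by (intro tempered_cmult tU schwartz_dilate schwartz_euler_op \<psi>) auto
          then show ?thesis unfolding euler_op_dilate[OF \<psi>] U(2)[OF less_imp_le[OF \<tau>]] .
        qed
        ultimately have "((\<lambda>\<sigma>. u \<sigma> (\<lambda>x. \<psi> (exp (k * \<sigma>) *\<^sub>R x))) has_vector_derivative - (of_real (exp \<tau>) * ?S \<psi>)) (at \<tau> within ?J)"
          using aU[OF less_imp_le[OF \<tau>] \<psi>] \<psi>c by (simp add: S' k_def)
        then have "((\<lambda>\<sigma>. \<Phi> \<sigma> \<psi>) has_vector_derivative - (of_real (exp \<tau>) * ?S \<psi>)) (at \<tau> within ?J)"
          using \<tau> by (rule_tac has_vector_derivative_transform[rotated 2]) (auto simp: \<Phi>u \<psi>)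
        then have d\<Phi>: "((\<lambda>\<sigma>. \<Phi> \<sigma> \<psi>) has_vector_derivative - (of_real (exp \<tau>) * ?S \<psi>)) (at (ln (1 + t)))"
          unfolding at[OF \<tau>] by (simp add: \<tau>_def)
        have dln: "((\<lambda>t. ln (1 + t)) has_vector_derivative 1 / (1 + t)) (at t)"
          unfolding has_real_derivative_iff_has_vector_derivative[symmetric] using t by (auto intro!: derivative_eq_intros)
        have "((\<lambda>t. \<Phi> (ln (1 + t)) \<psi>) has_vector_derivative (1 / (1 + t)) *\<^sub>R - (of_real (exp \<tau>) * ?S \<psi>)) (at t)"
          using vector_diff_chain_at[OF dln d\<Phi>] by (simp only: o_def)
        moreover have "(1 / (1 + t)) *\<^sub>R - (of_real (exp \<tau>) * ?S \<psi>) = - ?S \<psi>"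
          using t by (simp add: et scaleR_conv_of_real[where 'a=complex] del: of_real_add)
        ultimately have "((\<lambda>t. \<Phi> (ln (1 + t)) \<psi>) has_vector_derivative - ?S \<psi>) (at t)" by simp
        then show "((\<lambda>t. \<phi> t \<psi>) has_vector_derivative - ?S \<psi>) (at t)"
          by (rule has_vector_derivative_transform_within_open[where S = "{0<..}"]) (use t in \<open>auto simp: \<phi>\<Phi>\<close>)
      qed
    next
      show "\<phi> 0 = \<phi>0" using sol init by (simp add: cauchy_solution_def)
      fix \<psi> :: "'n cfun" assume \<psi>: "\<psi> \<in> schwartz"
      have "((\<lambda>\<sigma>. u \<sigma> (\<lambda>x. \<psi> (exp (k * \<sigma>) *\<^sub>R x))) \<longlongrightarrow> \<phi>0 (\<lambda>x. \<psi> (exp (k * 0) *\<^sub>R x))) (at 0 within {0..1})"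
        by (rule distribution_product_limit[OF _ _ _ dilation_path[OF \<psi>]])
           (use sol tU in \<open>auto simp: at0 cauchy_solution_def\<close>)
      then have "((\<lambda>\<sigma>. u \<sigma> (\<lambda>x. \<psi> (exp (k * \<sigma>) *\<^sub>R x))) \<longlongrightarrow> \<phi>0 \<psi>) (at_right 0)" by (simp add: at0)
      moreover have "\<forall>\<^sub>F \<sigma> in at_right 0. u \<sigma> (\<lambda>x. \<psi> (exp (k * \<sigma>) *\<^sub>R x)) = \<Phi> \<sigma> \<psi>"
        by (auto simp: eventually_at_filter \<Phi>u \<psi>)
      ultimately have "((\<lambda>\<sigma>. \<Phi> \<sigma> \<psi>) \<longlongrightarrow> \<phi>0 \<psi>) (at_right 0)" by (rule Lim_transform_eventually)
      moreover have "filterlim (\<lambda>t::real. ln (1 + t)) (at_right 0) (at_right 0)"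
      proof -
        have "((\<lambda>t::real. ln (1 + t)) \<longlongrightarrow> ln (1 + 0)) (at_right 0)" by (intro tendsto_intros) auto
        moreover have "\<forall>\<^sub>F t in at_right 0. ln (1 + t) > (0::real)" by (auto simp: eventually_at_filter)
        ultimately show ?thesis by (auto simp: filterlim_at elim: eventually_mono)
      qed
      ultimately have "((\<lambda>t. \<Phi> (ln (1 + t)) \<psi>) \<longlongrightarrow> \<phi>0 \<psi>) (at_right 0)" by (rule filterlim_compose)
      moreover have "\<forall>\<^sub>F t in at_right 0. \<Phi> (ln (1 + t)) \<psi> = \<phi> t \<psi>"
        by (auto simp: eventually_at_filter \<phi>\<Phi>)
      ultimately show "((\<lambda>t. \<phi> t \<psi>) \<longlongrightarrow> \<phi>0 \<psi>) (at_right 0)" by (rule Lim_transform_eventually)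
    qed
  qed
qed

subsection \<open>Square integrable functions and the Riesz--Fischer theorem\<close>

definition sq_integrable :: "'a measure \<Rightarrow> ('a \<Rightarrow> complex) \<Rightarrow> bool" where
  "sq_integrable M f \<longleftrightarrow> f \<in> borel_measurable M \<and> integrable M (\<lambda>x. (norm (f x))\<^sup>2)"

definition l2_inner :: "'a measure \<Rightarrow> ('a \<Rightarrow> complex) \<Rightarrow> ('a \<Rightarrow> complex) \<Rightarrow> complex" where
  "l2_inner M f g = (LINT x|M. f x * cnj (g x))"

lemma cnj_measurable [measurable]: "cnj \<in> borel_measurable borel"
  by (rule borel_measurable_continuous_onI) (rule bounded_linear.continuous_on[OF bounded_linear_cnj continuous_on_id])

lemma sq_integrable_measurable [measurable_dest]: "sq_integrable M f \<Longrightarrow> f \<in> borel_measurable M"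
  by (simp add: sq_integrable_def)

lemma sq_integrable_mult:
  assumes "sq_integrable M f" "sq_integrable M g"
  shows "integrable M (\<lambda>x. f x * cnj (g x))"
proof (rule Bochner_Integration.integrable_bound)
  show "integrable M (\<lambda>x. (norm (f x))\<^sup>2 + (norm (g x))\<^sup>2)" using assms by (simp add: sq_integrable_def)
  show "(\<lambda>x. f x * cnj (g x)) \<in> borel_measurable M"
    using assms by (intro borel_measurable_times measurable_compose[OF _ cnj_measurable]) (auto simp: sq_integrable_def)
  show "AE x in M. norm (f x * cnj (g x)) \<le> norm ((norm (f x))\<^sup>2 + (norm (g x))\<^sup>2)"
  proof (rule AE_I2)
    fix x
    have "0 \<le> (norm (f x) - norm (g x))\<^sup>2" by simp
    then have "2 * (norm (f x) * norm (g x)) \<le> (norm (f x))\<^sup>2 + (norm (g x))\<^sup>2" by (simp add: power2_diff)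
    moreover have "norm (f x) * norm (g x) \<le> 2 * (norm (f x) * norm (g x))" by simp
    moreover have "(norm (f x))\<^sup>2 + (norm (g x))\<^sup>2 \<le> norm ((norm (f x))\<^sup>2 + (norm (g x))\<^sup>2)" by simp
    ultimately have "norm (f x) * norm (g x) \<le> norm ((norm (f x))\<^sup>2 + (norm (g x))\<^sup>2)"
      by (meson order_trans)
    then show "norm (f x * cnj (g x)) \<le> norm ((norm (f x))\<^sup>2 + (norm (g x))\<^sup>2)"
      by (simp only: norm_mult complex_mod_cnj)
  qed
qed

lemma sq_integrable_cmult: "sq_integrable M f \<Longrightarrow> sq_integrable M (\<lambda>x. c * f x)"
  by (auto simp: sq_integrable_def norm_mult power_mult_distrib)

lemma sq_integrable_add:
  assumes "sq_integrable M f" "sq_integrable M g" shows "sq_integrable M (\<lambda>x. f x + g x)"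
  unfolding sq_integrable_def
proof
  show m: "(\<lambda>x. f x + g x) \<in> borel_measurable M" using assms by (auto simp: sq_integrable_def)
  show "integrable M (\<lambda>x. (norm (f x + g x))\<^sup>2)"
  proof (rule Bochner_Integration.integrable_bound)
    show "integrable M (\<lambda>x. 2 * (norm (f x))\<^sup>2 + 2 * (norm (g x))\<^sup>2)" using assms by (simp add: sq_integrable_def)
    show "(\<lambda>x. (norm (f x + g x))\<^sup>2) \<in> borel_measurable M" using m by measurable
    show "AE x in M. norm ((norm (f x + g x))\<^sup>2) \<le> norm (2 * (norm (f x))\<^sup>2 + 2 * (norm (g x))\<^sup>2)"
    proof (rule AE_I2)
      fix x
      have "(norm (f x + g x))\<^sup>2 \<le> (norm (f x) + norm (g x))\<^sup>2" by (intro power_mono norm_triangle_ineq) auto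
      also have "... \<le> 2 * (norm (f x))\<^sup>2 + 2 * (norm (g x))\<^sup>2"
        using zero_le_power2[of "norm (f x) - norm (g x)"] by (simp add: power2_diff power2_sum)
      finally show "norm ((norm (f x + g x))\<^sup>2) \<le> norm (2 * (norm (f x))\<^sup>2 + 2 * (norm (g x))\<^sup>2)" by simp
    qed
  qed
qed

lemma sq_integrable_zero: "sq_integrable M (\<lambda>_. 0)"
  by (simp add: sq_integrable_def)

lemma sq_integrable_diff: "sq_integrable M f \<Longrightarrow> sq_integrable M g \<Longrightarrow> sq_integrable M (\<lambda>x. f x - g x)"
  using sq_integrable_add[of M f "\<lambda>x. -1 * g x"] sq_integrable_cmult[of M g "-1"] by simp

lemma sq_integrable_sum: "(\<And>k. k \<in> I \<Longrightarrow> sq_integrable M (f k)) \<Longrightarrow> sq_integrable M (\<lambda>x. \<Sum>k\<in>I. f k x)"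
  by (induction I rule: infinite_finite_induct) (auto intro: sq_integrable_add sq_integrable_zero)

lemma l2_inner_diff_left:
  assumes "sq_integrable M f" "sq_integrable M g" "sq_integrable M h"
  shows "l2_inner M (\<lambda>x. f x - g x) h = l2_inner M f h - l2_inner M g h"
  unfolding l2_inner_def left_diff_distrib using assms by (intro Bochner_Integration.integral_diff sq_integrable_mult)

lemma l2_inner_cmult_left: "l2_inner M (\<lambda>x. c * f x) h = c * l2_inner M f h"
  unfolding l2_inner_def mult.assoc by (rule integral_mult_right_zero)

lemma l2_inner_cmult_right: "l2_inner M f (\<lambda>x. c * h x) = cnj c * l2_inner M f h"
  unfolding l2_inner_def complex_cnj_mult mult.left_commute[of _ "cnj c"] by (rule integral_mult_right_zero)

lemma l2_inner_cnj: "l2_inner M g f = cnj (l2_inner M f g)"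
proof -
  have "cnj (LINT x|M. f x * cnj (g x)) = (LINT x|M. cnj (f x * cnj (g x)))"
    by (rule Bochner_Integration.integral_cnj[symmetric])
  then show ?thesis by (simp add: l2_inner_def mult.commute)
qed

lemma l2_inner_sum_left:
  assumes "\<And>k. k \<in> I \<Longrightarrow> sq_integrable M (f k)" "sq_integrable M h"
  shows "l2_inner M (\<lambda>x. \<Sum>k\<in>I. f k x) h = (\<Sum>k\<in>I. l2_inner M (f k) h)"
  unfolding l2_inner_def sum_distrib_right using assms by (intro Bochner_Integration.integral_sum sq_integrable_mult)

lemma l2_inner_self: "l2_inner M f f = of_real (LINT x|M. (norm (f x))\<^sup>2)"
  unfolding l2_inner_def complex_norm_square[symmetric] by (rule integral_complex_of_real)

text \<open>The arithmetic-geometric inequality with a free weight \<open>d\<close>, in the role of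
  Cauchy-Schwarz: first the norm of \<open>f\<close> and then \<open>d\<close> is sent to 0.\<close>

lemma l2_inner_bound:
  assumes f: "sq_integrable M f" and g: "sq_integrable M g" and d: "d > 0"
  shows "norm (l2_inner M f g) \<le> (LINT x|M. (norm (f x))\<^sup>2) / d + d * (LINT x|M. (norm (g x))\<^sup>2)"
proof -
  have "norm (l2_inner M f g) \<le> (LINT x|M. norm (f x * cnj (g x)))" unfolding l2_inner_def by (rule integral_norm_bound)
  also have "... \<le> (LINT x|M. (norm (f x))\<^sup>2 / d + d * (norm (g x))\<^sup>2)"
  proof (intro integral_mono integrable_norm sq_integrable_mult f g)
    show "integrable M (\<lambda>x. (norm (f x))\<^sup>2 / d + d * (norm (g x))\<^sup>2)" using f g by (simp add: sq_integrable_def)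
    fix x
    have "0 \<le> (norm (f x) - d * norm (g x))\<^sup>2" by simp
    then have "2 * (norm (f x) * norm (g x)) * d \<le> (norm (f x))\<^sup>2 + d * d * (norm (g x))\<^sup>2"
      by (simp add: power2_eq_square algebra_simps)
    then have "2 * (norm (f x) * norm (g x)) \<le> (norm (f x))\<^sup>2 / d + d * (norm (g x))\<^sup>2"
      using d by (simp add: field_simps)
    moreover have "0 \<le> norm (f x) * norm (g x)" by simp
    ultimately show "norm (f x * cnj (g x)) \<le> (norm (f x))\<^sup>2 / d + d * (norm (g x))\<^sup>2"
      unfolding norm_mult complex_mod_cnj by (rule_tac order_trans[of _ "2 * (norm (f x) * norm (g x))"]) auto
  qed
  also have "... = (LINT x|M. (norm (f x))\<^sup>2) / d + d * (LINT x|M. (norm (g x))\<^sup>2)"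
    using f g by (subst Bochner_Integration.integral_add) (auto simp: sq_integrable_def)
  finally show ?thesis .
qed

section \<open>Orthonormal sequences: Bessel's inequality and Riesz-Fischer\<close>

context
  fixes M :: "'a measure" and e :: "nat \<Rightarrow> 'a \<Rightarrow> complex"
  assumes e: "\<And>k. sq_integrable M (e k)"
    and ortho: "\<And>j k. l2_inner M (e j) (e k) = (if j = k then 1 else 0)"
begin

lemma norm_lincomb:
  assumes "finite I"
  shows "(LINT x|M. (norm (\<Sum>k\<in>I. c k * e k x))\<^sup>2) = (\<Sum>k\<in>I. (norm (c k))\<^sup>2)"
proof -
  have s: "sq_integrable M (\<lambda>x. c k * e k x)" for k by (intro sq_integrable_cmult e)
  have "l2_inner M (\<lambda>x. \<Sum>k\<in>I. c k * e k x) (\<lambda>x. \<Sum>k\<in>I. c k * e k x) = (\<Sum>j\<in>I. l2_inner M (\<lambda>x. c j * e j x) (\<lambda>x. \<Sum>k\<in>I. c k * e k x))"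
    by (intro l2_inner_sum_left sq_integrable_sum s)
  also have "... = (\<Sum>j\<in>I. \<Sum>k\<in>I. c j * cnj (c k) * (if j = k then 1 else 0))"
  proof (intro sum.cong refl)
    fix j
    have "l2_inner M (\<lambda>x. c j * e j x) (\<lambda>x. \<Sum>k\<in>I. c k * e k x) = cnj (\<Sum>k\<in>I. l2_inner M (\<lambda>x. c k * e k x) (\<lambda>x. c j * e j x))"
      by (subst l2_inner_cnj) (intro arg_cong[where f=cnj] l2_inner_sum_left sq_integrable_sum s)
    also have "... = (\<Sum>k\<in>I. c j * cnj (c k) * (if j = k then 1 else 0))"
      unfolding cnj_sum l2_inner_cmult_left l2_inner_cmult_right ortho by (intro sum.cong refl) auto
    finally show "l2_inner M (\<lambda>x. c j * e j x) (\<lambda>x. \<Sum>k\<in>I. c k * e k x) = (\<Sum>k\<in>I. c j * cnj (c k) * (if j = k then 1 else 0))" .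
  qed
  also have "... = (\<Sum>j\<in>I. c j * cnj (c j))"
    using assms by (intro sum.cong refl) (simp add: if_distrib cong: if_cong)
  also have "... = of_real (\<Sum>k\<in>I. (norm (c k))\<^sup>2)" by (simp only: of_real_sum complex_norm_square)
  finally show ?thesis unfolding l2_inner_self by (simp only: of_real_eq_iff)
qed

text \<open>The squared norm of \<open>f\<close> minus its N-th partial sum is nonnegative and
  equals the squared norm of \<open>f\<close> minus the sum of the first N squared
  coefficients.\<close>

lemma bessel:
  assumes f: "sq_integrable M f"
  shows "summable (\<lambda>k. (norm (l2_inner M f (e k)))\<^sup>2)"
proof (rule summableI_nonneg_bounded)
  fix N
  define c where "c k = l2_inner M f (e k)" for k
  define S where "S = (\<lambda>x. \<Sum>k<N. c k * e k x)"
  have S: "sq_integrable M S" unfolding S_def by (intro sq_integrable_sum sq_integrable_cmult e)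
  have SS: "l2_inner M S S = of_real (\<Sum>k<N. (norm (c k))\<^sup>2)"
    unfolding l2_inner_self S_def by (simp add: norm_lincomb)
  have Sf: "l2_inner M S f = of_real (\<Sum>k<N. (norm (c k))\<^sup>2)"
  proof -
    have "l2_inner M S f = (\<Sum>k<N. c k * cnj (c k))"
      unfolding S_def using e f by (subst l2_inner_sum_left)
        (auto intro!: sq_integrable_cmult sum.cong simp: l2_inner_cmult_left c_def l2_inner_cnj[of M "e _" f])
    then show ?thesis by (simp only: of_real_sum complex_norm_square)
  qed
  have fS: "l2_inner M f S = of_real (\<Sum>k<N. (norm (c k))\<^sup>2)" by (subst l2_inner_cnj, subst Sf) simp
  have "0 \<le> (LINT x|M. (norm (f x - S x))\<^sup>2)" by simp
  have "complex_of_real (LINT x|M. (norm (f x - S x))\<^sup>2) = l2_inner M (\<lambda>x. f x - S x) (\<lambda>x. f x - S x)"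
    by (simp only: l2_inner_self)
  moreover have "l2_inner M (\<lambda>x. f x - S x) (\<lambda>x. f x - S x) = l2_inner M f (\<lambda>x. f x - S x) - l2_inner M S (\<lambda>x. f x - S x)"
    by (intro l2_inner_diff_left sq_integrable_diff f S)
  moreover have "l2_inner M f (\<lambda>x. f x - S x) = cnj (l2_inner M f f - l2_inner M S f)"
    by (subst l2_inner_cnj) (simp only: l2_inner_diff_left[OF f S f])
  moreover have "l2_inner M S (\<lambda>x. f x - S x) = cnj (l2_inner M f S - l2_inner M S S)"
    by (subst l2_inner_cnj) (simp only: l2_inner_diff_left[OF f S S])
  ultimately have "complex_of_real (LINT x|M. (norm (f x - S x))\<^sup>2) = of_real ((LINT x|M. (norm (f x))\<^sup>2) - (\<Sum>k<N. (norm (c k))\<^sup>2))"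
  proof -
    assume *: "complex_of_real (LINT x|M. (norm (f x - S x))\<^sup>2) = l2_inner M (\<lambda>x. f x - S x) (\<lambda>x. f x - S x)"
      "l2_inner M (\<lambda>x. f x - S x) (\<lambda>x. f x - S x) = l2_inner M f (\<lambda>x. f x - S x) - l2_inner M S (\<lambda>x. f x - S x)"
      "l2_inner M f (\<lambda>x. f x - S x) = cnj (l2_inner M f f - l2_inner M S f)"
      "l2_inner M S (\<lambda>x. f x - S x) = cnj (l2_inner M f S - l2_inner M S S)"
    have "complex_of_real (LINT x|M. (norm (f x - S x))\<^sup>2) = cnj (l2_inner M f f - l2_inner M S f) - cnj (l2_inner M f S - l2_inner M S S)"
      by (simp only: *)
    also have "... = of_real ((LINT x|M. (norm (f x))\<^sup>2) - (\<Sum>k<N. (norm (c k))\<^sup>2))"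
      unfolding SS Sf fS l2_inner_self[of M f] complex_cnj_diff complex_cnj_complex_of_real by simp
    finally show ?thesis .
  qed
  then have "(LINT x|M. (norm (f x - S x))\<^sup>2) = (LINT x|M. (norm (f x))\<^sup>2) - (\<Sum>k<N. (norm (c k))\<^sup>2)"
    by (simp only: of_real_eq_iff)
  then show "(\<Sum>k<N. (norm (l2_inner M f (e k)))\<^sup>2) \<le> (LINT x|M. (norm (f x))\<^sup>2)"
    using \<open>0 \<le> (LINT x|M. (norm (f x - S x))\<^sup>2)\<close> by (simp add: c_def)
qed auto

text \<open>Along a subsequence whose increments have squared norms at most \<open>4\<^sup>-\<^sup>j\<close>, the partial sums converge
  almost everywhere; Fatou's lemma then gives convergence in norm.\<close>

lemma riesz_fischer:
  assumes c: "summable (\<lambda>k. (norm (c k))\<^sup>2)"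
  shows "\<exists>g. sq_integrable M g \<and> (\<forall>k. l2_inner M g (e k) = c k) \<and>
     (\<lambda>N. LINT x|M. (norm (g x - (\<Sum>k<N. c k * e k x)))\<^sup>2) \<longlonglongrightarrow> 0"
proof -
  define S where "S N = (\<lambda>x. \<Sum>k<N. c k * e k x)" for N
  have S: "sq_integrable M (S N)" for N unfolding S_def by (intro sq_integrable_sum sq_integrable_cmult e)
  note [measurable] = sq_integrable_measurable[OF S]
  define R where "R N = (\<Sum>k. (norm (c (k + N)))\<^sup>2)" for N
  have R0: "R \<longlonglongrightarrow> 0" unfolding R_def by (rule suminf_exist_split2[OF c])
  have Rnn: "R N \<ge> 0" for N unfolding R_def by (intro suminf_nonneg summable_ignore_initial_segment[OF c]) auto
  have SD: "(LINT x|M. (norm (S L x - S N x))\<^sup>2) \<le> R N" if "N \<le> L" for N L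
  proof -
    have "S L x - S N x = (\<Sum>k\<in>{N..<L}. c k * e k x)" for x
    proof -
      have "{..<L} = {..<N} \<union> {N..<L}" using that by auto
      then have "S L x = (\<Sum>k\<in>{..<N}. c k * e k x) + (\<Sum>k\<in>{N..<L}. c k * e k x)"
        unfolding S_def by (simp add: sum.union_disjoint ivl_disj_int)
      then show ?thesis by (simp add: S_def)
    qed
    then have "(LINT x|M. (norm (S L x - S N x))\<^sup>2) = (\<Sum>k\<in>{N..<L}. (norm (c k))\<^sup>2)" by (simp add: norm_lincomb)
    also have "... = (\<Sum>k<L - N. (norm (c (k + N)))\<^sup>2)"
      using that by (intro sum.reindex_bij_witness[of _ "\<lambda>k. k + N" "\<lambda>k. k - N"]) auto
    also have "... \<le> R N"
      unfolding R_def by (intro sum_le_suminf summable_ignore_initial_segment[OF c]) auto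
    finally show ?thesis .
  qed
  have "\<exists>m. strict_mono m \<and> (\<forall>j. R (m j) < (1 / 4) ^ j)"
  proof -
    have "\<exists>N>n. R N < (1 / 4) ^ j" for n j
    proof -
      have "\<forall>\<^sub>F N in sequentially. R N < (1 / 4) ^ j" by (rule order_tendstoD(2)[OF R0]) simp
      then have "\<forall>\<^sub>F N in sequentially. R N < (1 / 4) ^ j \<and> n < N" using eventually_gt_at_top[of n] by (rule eventually_conj)
      then show ?thesis using eventually_happens[of _ sequentially] by auto
    qed
    then have "\<exists>m. \<forall>j. R (m j) < (1 / 4) ^ j \<and> m j < m (Suc j)"
      using dependent_nat_choice[where P = "\<lambda>j n. R n < (1 / 4) ^ j" and Q = "\<lambda>j a b. a < b"] by blast
    then show ?thesis by (auto simp: strict_mono_Suc_iff)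
  qed
  then obtain m where m: "strict_mono m" "\<And>j. R (m j) < (1 / 4) ^ j" by blast
  define d where "d j x = S (m (Suc j)) x - S (m j) x" for j x
  have di: "integrable M (\<lambda>x. (norm (d j x))\<^sup>2)" for j
    using sq_integrable_diff[OF S S] by (simp add: sq_integrable_def d_def)
  have dn: "(LINT x|M. (norm (d j x))\<^sup>2) \<le> (1 / 4) ^ j" for j
  proof -
    have "m j \<le> m (Suc j)" using m(1) by (simp add: strict_mono_less_eq)
    from SD[OF this] m(2)[of j] show ?thesis by (simp add: d_def)
  qed
  have [measurable]: "d j \<in> borel_measurable M" for j unfolding d_def by measurable
  have "(\<integral>\<^sup>+x. (\<Sum>j. ennreal (2 ^ j * (norm (d j x))\<^sup>2)) \<partial>M) = (\<Sum>j. \<integral>\<^sup>+x. ennreal (2 ^ j * (norm (d j x))\<^sup>2) \<partial>M)"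
    by (rule nn_integral_suminf) measurable
  also have "... \<le> (\<Sum>j. ennreal ((1 / 2) ^ j))"
  proof (intro suminf_le summableI)
    fix j
    have "(\<integral>\<^sup>+x. ennreal (2 ^ j * (norm (d j x))\<^sup>2) \<partial>M) = ennreal (LINT x|M. 2 ^ j * (norm (d j x))\<^sup>2)"
      using di by (intro nn_integral_eq_integral) auto
    also have "... \<le> ennreal (2 ^ j * (1 / 4) ^ j)" using dn by (intro ennreal_leI) (simp add: mult_left_mono del: times_divide_eq_right)
    also have "2 ^ j * (1 / 4) ^ j = ((1 / 2) ^ j :: real)" by (simp flip: power_mult_distrib)
    finally show "(\<integral>\<^sup>+x. ennreal (2 ^ j * (norm (d j x))\<^sup>2) \<partial>M) \<le> ennreal ((1 / 2) ^ j)" .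
  qed
  also have "... = ennreal (\<Sum>j. (1 / 2) ^ j)" by (rule suminf_ennreal2) (auto simp: summable_geometric)
  finally have fin: "(\<integral>\<^sup>+x. (\<Sum>j. ennreal (2 ^ j * (norm (d j x))\<^sup>2)) \<partial>M) \<noteq> \<infinity>" by (auto simp: top_unique)
  have "AE x in M. (\<Sum>j. ennreal (2 ^ j * (norm (d j x))\<^sup>2)) \<noteq> \<infinity>"
    by (rule nn_integral_PInf_AE[OF _ fin]) measurable
  then have conv: "AE x in M. convergent (\<lambda>j. S (m j) x)"
  proof eventually_elim
    case (elim x)
    have s: "summable (\<lambda>j. 2 ^ j * (norm (d j x))\<^sup>2)"
      by (rule summable_suminf_not_top[OF _ elim[unfolded infinity_ennreal_def]]) simp
    have "summable (\<lambda>j. 2 ^ j * (norm (d j x))\<^sup>2 + (1 / 2) ^ j)" by (intro summable_add s summable_geometric) auto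
    then have "summable (\<lambda>j. d j x)"
    proof (rule summable_comparison_test'[where N=0])
      fix j :: nat
      \<comment> \<open>Yields 2|d| <= 2^j |d|^2 + 2^-j, so the weighted sum of squares controls the
        sum of the increments; the weight \<open>2 ^ j\<close> was inserted for this.\<close>
      have "0 \<le> (2 ^ j * norm (d j x) - 1)\<^sup>2" by simp
      then have "2 ^ j * (2 * norm (d j x)) \<le> 2 ^ j * (2 ^ j * (norm (d j x))\<^sup>2 + (1 / 2) ^ j)"
        by (simp add: power2_eq_square algebra_simps power_divide)
      then have "2 * norm (d j x) \<le> 2 ^ j * (norm (d j x))\<^sup>2 + (1 / 2) ^ j" by (simp only: mult_le_cancel_left_pos zero_less_power zero_less_numeral)
      then show "norm (d j x) \<le> 2 ^ j * (norm (d j x))\<^sup>2 + (1 / 2) ^ j" using norm_ge_zero[of "d j x"] by (rule_tac order_trans[of _ "2 * norm (d j x)"]) auto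
    qed
    then have "convergent (\<lambda>n. \<Sum>j<n. d j x)" by (simp add: summable_iff_convergent)
    moreover have "(\<Sum>j<n. d j x) = S (m n) x - S (m 0) x" for n
      unfolding d_def by (rule sum_lessThan_telescope)
    ultimately have "convergent (\<lambda>n. S (m n) x - S (m 0) x)" by simp
    then show ?case by (simp add: convergent_diff_const_right_iff)
  qed
  define g where "g x = lim (\<lambda>j. S (m j) x)" for x
  have [measurable]: "g \<in> borel_measurable M" unfolding g_def by (rule borel_measurable_lim_metric) measurable
  have gl: "AE x in M. (\<lambda>j. S (m j) x) \<longlonglongrightarrow> g x"
    using conv by eventually_elim (simp add: g_def convergent_LIMSEQ_iff)
  \<comment> \<open>Fatou along the subsequence for fixed \<open>N\<close>: every later partial sum
    is at squared distance at most \<open>R N\<close> from \<open>S N\<close>.\<close>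
  have gS: "(\<integral>\<^sup>+x. ennreal ((norm (g x - S N x))\<^sup>2) \<partial>M) \<le> ennreal (R N)" for N
  proof -
    have "(\<integral>\<^sup>+x. ennreal ((norm (g x - S N x))\<^sup>2) \<partial>M) = (\<integral>\<^sup>+x. liminf (\<lambda>j. ennreal ((norm (S (m j) x - S N x))\<^sup>2)) \<partial>M)"
    proof (rule nn_integral_cong_AE)
      show "AE x in M. ennreal ((norm (g x - S N x))\<^sup>2) = liminf (\<lambda>j. ennreal ((norm (S (m j) x - S N x))\<^sup>2))"
        using gl
      proof eventually_elim
        case (elim x)
        have "(\<lambda>j. ennreal ((norm (S (m j) x - S N x))\<^sup>2)) \<longlonglongrightarrow> ennreal ((norm (g x - S N x))\<^sup>2)"
          by (intro tendsto_ennrealI tendsto_intros elim)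
        then show ?case by (intro lim_imp_Liminf[symmetric]) auto
      qed
    qed
    also have "... \<le> liminf (\<lambda>j. \<integral>\<^sup>+x. ennreal ((norm (S (m j) x - S N x))\<^sup>2) \<partial>M)"
      by (rule nn_integral_liminf) measurable
    also have "... \<le> ennreal (R N)"
    proof (rule Liminf_le)
      show "\<forall>\<^sub>F j in sequentially. (\<integral>\<^sup>+x. ennreal ((norm (S (m j) x - S N x))\<^sup>2) \<partial>M) \<le> ennreal (R N)"
      proof (rule eventually_sequentiallyI[of N])
        fix j assume "N \<le> j"
        then have "N \<le> m j" using seq_suble[OF m(1), of j] by simp
        have "(\<integral>\<^sup>+x. ennreal ((norm (S (m j) x - S N x))\<^sup>2) \<partial>M) = ennreal (LINT x|M. (norm (S (m j) x - S N x))\<^sup>2)"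
          using sq_integrable_diff[OF S S] by (intro nn_integral_eq_integral) (auto simp: sq_integrable_def)
        also have "... \<le> ennreal (R N)" by (intro ennreal_leI SD \<open>N \<le> m j\<close>)
        finally show "(\<integral>\<^sup>+x. ennreal ((norm (S (m j) x - S N x))\<^sup>2) \<partial>M) \<le> ennreal (R N)" .
      qed
    qed simp
    finally show ?thesis .
  qed
  have gSi: "sq_integrable M (\<lambda>x. g x - S N x)" for N
    unfolding sq_integrable_def
  proof
    show "integrable M (\<lambda>x. (norm (g x - S N x))\<^sup>2)"
      by (rule integrableI_nonneg) (use gS[of N] in \<open>auto simp: less_top top_unique intro: order_le_less_trans\<close>)
  qed measurable
  have gSn: "(LINT x|M. (norm (g x - S N x))\<^sup>2) \<le> R N" for N
  proof -
    have "ennreal (LINT x|M. (norm (g x - S N x))\<^sup>2) = (\<integral>\<^sup>+x. ennreal ((norm (g x - S N x))\<^sup>2) \<partial>M)"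
      using gSi by (intro nn_integral_eq_integral[symmetric]) (auto simp: sq_integrable_def)
    also have "... \<le> ennreal (R N)" by (rule gS)
    finally show ?thesis using Rnn by (simp add: ennreal_le_iff)
  qed
  have g: "sq_integrable M g" using gSi[of 0] by (simp add: S_def)
  have lim: "(\<lambda>N. LINT x|M. (norm (g x - S N x))\<^sup>2) \<longlonglongrightarrow> 0"
    by (rule tendsto_sandwich[OF _ _ tendsto_const R0]) (auto intro!: always_eventually gSn)
  have "l2_inner M g (e k) = c k" for k
  proof -
    have "l2_inner M g (e k) - c k = l2_inner M (\<lambda>x. g x - S N x) (e k)" if "k < N" for N
    proof -
      have "l2_inner M (S N) (e k) = (\<Sum>j<N. l2_inner M (\<lambda>x. c j * e j x) (e k))"
        unfolding S_def by (intro l2_inner_sum_left sq_integrable_cmult e)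
      also have "... = c k" using that by (simp add: l2_inner_cmult_left ortho if_distrib cong: if_cong)
      finally show ?thesis by (simp add: l2_inner_diff_left[OF g S e])
    qed
    then have b: "norm (l2_inner M g (e k) - c k) \<le> R N / \<delta> + \<delta>" if "k < N" "\<delta> > 0" for N \<delta>
    proof -
      have "norm (l2_inner M g (e k) - c k) \<le> (LINT x|M. (norm (g x - S N x))\<^sup>2) / \<delta> + \<delta> * (LINT x|M. (norm (e k x))\<^sup>2)"
        using \<open>k < N \<Longrightarrow> l2_inner M g (e k) - c k = l2_inner M (\<lambda>x. g x - S N x) (e k)\<close>[OF that(1)]
          l2_inner_bound[OF gSi e that(2), of N k] by simp
      moreover have "(LINT x|M. (norm (e k x))\<^sup>2) = 1"
        using ortho[of k k] unfolding l2_inner_self by (simp add: of_real_eq_1_iff)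
      moreover have "(LINT x|M. (norm (g x - S N x))\<^sup>2) / \<delta> \<le> R N / \<delta>" using gSn that(2) by (intro divide_right_mono) auto
      ultimately show ?thesis by simp
    qed
    \<comment> \<open>The weight is held fixed at \<open>\<epsilon>\<close> while \<open>N\<close>
      tends to infinity, which removes the first term of the bound.\<close>
    have "norm (l2_inner M g (e k) - c k) \<le> 0 + \<epsilon>" if "\<epsilon> > 0" for \<epsilon>
    proof (rule tendsto_lowerbound[where F = sequentially])
      have "(\<lambda>N. R N / \<epsilon> + \<epsilon>) \<longlonglongrightarrow> 0 / \<epsilon> + \<epsilon>" using that by (intro tendsto_intros R0) auto
      then show "(\<lambda>N. R N / \<epsilon> + \<epsilon>) \<longlonglongrightarrow> 0 + \<epsilon>" by simp
      show "\<forall>\<^sub>F N in sequentially. norm (l2_inner M g (e k) - c k) \<le> R N / \<epsilon> + \<epsilon>"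
        using eventually_gt_at_top[of k] by eventually_elim (rule b[OF _ that])
    qed simp
    then have "norm (l2_inner M g (e k) - c k) \<le> 0" by (rule field_le_epsilon)
    then show ?thesis by simp
  qed
  then show ?thesis using g lim unfolding S_def by (intro exI[of _ g] conjI allI)
qed

end

subsection \<open>Radial functions and moments\<close>

text \<open>The weight of \<open>inner_dagger\<close> as a measure on the line that charges only r
  >= 0. Compared with the weight exp(|x|^2/4) on the whole space, the area of the unit sphere is
  left out.\<close>

definition dag_measure :: "nat \<Rightarrow> real measure" where
  "dag_measure n = density lborel (\<lambda>r. ennreal (indicator {0..} r * exp (r\<^sup>2 / 4) * r ^ (n - 1)))"

lemma dag_weight_nonneg: "0 \<le> indicator {0..} r * exp (r\<^sup>2 / 4) * r ^ (n - 1)" for r :: real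
  by (auto simp: indicator_def)

lemma sets_dag_measure [measurable_cong]: "sets (dag_measure n) = sets borel"
  by (simp add: dag_measure_def)

lemma measurable_dag_measure: "g \<in> borel_measurable (dag_measure n) \<longleftrightarrow> g \<in> borel_measurable borel"
  by (simp add: measurable_cong_sets[OF sets_dag_measure refl])

lemma sq_integrable_dag:
  "sq_integrable (dag_measure n) g \<longleftrightarrow> g \<in> borel_measurable borel \<and>
     integrable lborel (\<lambda>r. indicator {0..} r * exp (r\<^sup>2 / 4) * r ^ (n - 1) * (norm (g r))\<^sup>2)"
proof (cases "g \<in> borel_measurable borel")
  case True
  then have [measurable]: "g \<in> borel_measurable borel" .
  have "integrable (dag_measure n) (\<lambda>r. (norm (g r))\<^sup>2) \<longleftrightarrow>
      integrable lborel (\<lambda>r. (indicator {0..} r * exp (r\<^sup>2 / 4) * r ^ (n - 1)) *\<^sub>R (norm (g r))\<^sup>2)"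
    unfolding dag_measure_def
  proof (rule integrable_density)
    show "AE r::real in lborel. 0 \<le> indicator {0..} r * exp (r\<^sup>2 / 4) * r ^ (n - 1)" by (intro AE_I2 dag_weight_nonneg)
  qed measurable
  then show ?thesis using True by (simp add: sq_integrable_def measurable_dag_measure)
qed (simp add: sq_integrable_def measurable_dag_measure)

lemma integral_dag_measure:
  fixes f :: "real \<Rightarrow> complex"
  assumes [measurable]: "f \<in> borel_measurable borel"
  shows "(LINT r|dag_measure n. f r) = (LINT r|lborel. of_real (indicator {0..} r * exp (r\<^sup>2 / 4) * r ^ (n - 1)) * f r)"
proof -
  have "(LINT r|dag_measure n. f r) = (LINT r|lborel. (indicator {0..} r * exp (r\<^sup>2 / 4) * r ^ (n - 1)) *\<^sub>R f r)"
    unfolding dag_measure_def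
  proof (rule integral_density)
    show "AE r::real in lborel. 0 \<le> indicator {0..} r * exp (r\<^sup>2 / 4) * r ^ (n - 1)" by (intro AE_I2 dag_weight_nonneg)
  qed measurable
  then show ?thesis by (simp only: scaleR_conv_of_real)
qed

lemma power_le_fact_exp:
  assumes "0 \<le> (r::real)" shows "r ^ j \<le> fact j * exp r"
proof -
  have "(\<Sum>k\<in>{j}. r ^ k /\<^sub>R fact k) \<le> (\<Sum>k. r ^ k /\<^sub>R fact k)"
    using assms by (intro sum_le_suminf summable_exp_generic) auto
  then show ?thesis by (simp add: exp_def divide_simps mult_ac)
qed

text \<open>Completing the square gives r + b r - r^2/4 <= 2(b+1)^2 - r^2/8; the remaining Gaussian
  is a multiple of the normal density with standard deviation 2.\<close>

lemma gauss_int: "integrable lborel (\<lambda>r::real. indicator {0..} r * r ^ j * exp (b * r - r\<^sup>2 / 4))"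
proof (rule Bochner_Integration.integrable_bound)
  let ?K = "fact j * exp (2 * (b + 1)\<^sup>2) * sqrt (8 * pi)"
  show "integrable lborel (\<lambda>r. ?K * normal_density 0 2 r)" by (intro integrable_mult_right integrable_normal_density) simp
  show "AE r in lborel. norm (indicator {0..} r * r ^ j * exp (b * r - r\<^sup>2 / 4)) \<le> norm (?K * normal_density 0 2 r)"
  proof (rule AE_I2)
    fix r :: real
    show "norm (indicator {0..} r * r ^ j * exp (b * r - r\<^sup>2 / 4)) \<le> norm (?K * normal_density 0 2 r)"
    proof (cases "0 \<le> r")
      case True
      have "0 \<le> (r - 4 * (b + 1))\<^sup>2" by simp
      then have le: "r + (b * r - r\<^sup>2 / 4) \<le> 2 * (b + 1)\<^sup>2 + - r\<^sup>2 / 8" by (simp add: power2_eq_square field_simps)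
      have "r ^ j * exp (b * r - r\<^sup>2 / 4) \<le> fact j * exp r * exp (b * r - r\<^sup>2 / 4)"
        by (intro mult_right_mono power_le_fact_exp True) simp
      also have "... = fact j * exp (r + (b * r - r\<^sup>2 / 4))" by (simp only: exp_add mult.assoc)
      also have "... \<le> fact j * exp (2 * (b + 1)\<^sup>2 + - r\<^sup>2 / 8)" using le by simp
      also have "... = fact j * exp (2 * (b + 1)\<^sup>2) * exp (- r\<^sup>2 / 8)" by (simp only: exp_add mult.assoc)
      also have "... = ?K * normal_density 0 2 r" by (simp add: normal_density_def)
      finally show ?thesis using True by (simp add: abs_mult)
    qed simp
  qed
qed measurable

text \<open>The integrand splits into exp(r^2/8) |g| and exp(b r - r^2/8), and pq <= p^2+q^2 is
  applied to the two. All exponential moments of \<open>g\<close> are thus finite, which is what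
  makes the power series of its transform converge everywhere.\<close>

lemma dag_exp_integrable:
  assumes g: "sq_integrable (dag_measure n) g"
  shows "integrable lborel (\<lambda>r. of_real (indicator {0..} r * r ^ (n - 1) * exp (b * r)) * g r)"
proof (rule Bochner_Integration.integrable_bound)
  note [measurable] = g[unfolded sq_integrable_dag, THEN conjunct1]
  show "integrable lborel (\<lambda>r. indicator {0..} r * exp (r\<^sup>2 / 4) * r ^ (n - 1) * (norm (g r))\<^sup>2
      + indicator {0..} r * r ^ (n - 1) * exp (2 * b * r - r\<^sup>2 / 4))" (is "integrable _ ?B")
    using g by (intro Bochner_Integration.integrable_add gauss_int) (simp add: sq_integrable_dag)
  show "AE r in lborel. norm (of_real (indicator {0..} r * r ^ (n - 1) * exp (b * r)) * g r) \<le> norm (?B r)"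
  proof (rule AE_I2)
    fix r :: real
    define w where "w = indicator {0..} r * r ^ (n - 1)"
    define p where "p = exp (r\<^sup>2 / 8) * norm (g r)"
    define q where "q = exp (b * r - r\<^sup>2 / 8)"
    have w: "w \<ge> 0" by (auto simp: w_def indicator_def)
    have "p * q \<ge> 0" by (simp add: p_def q_def)
    moreover have "2 * (p * q) \<le> p\<^sup>2 + q\<^sup>2"
      using zero_le_power2[of "p - q"] by (simp add: power2_diff)
    ultimately have pq: "p * q \<le> p\<^sup>2 + q\<^sup>2" by linarith
    have "exp (r\<^sup>2 / 8) * exp (b * r - r\<^sup>2 / 8) = exp (b * r)" by (simp flip: exp_add)
    then have *: "p * q = exp (b * r) * norm (g r)" by (simp add: p_def q_def mult_ac)
    have "norm (of_real (indicator {0..} r * r ^ (n - 1) * exp (b * r)) * g r) = w * (p * q)"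
    proof -
      have "\<bar>indicator {0..} r * r ^ (n - 1) * exp (b * r)\<bar> = w * exp (b * r)"
        using w by (simp only: w_def[symmetric] abs_mult abs_of_nonneg abs_exp_cancel)
      then show ?thesis unfolding * norm_mult norm_of_real by (simp only: mult.assoc)
    qed
    also have "... \<le> w * (p\<^sup>2 + q\<^sup>2)" using w pq by (intro mult_left_mono)
    also have "p\<^sup>2 = exp (r\<^sup>2 / 4) * (norm (g r))\<^sup>2" by (simp add: p_def power_mult_distrib flip: exp_of_nat_mult)
    also have "q\<^sup>2 = exp (2 * b * r - r\<^sup>2 / 4)" by (simp add: q_def algebra_simps flip: exp_of_nat_mult)
    also have "w * (exp (r\<^sup>2 / 4) * (norm (g r))\<^sup>2 + exp (2 * b * r - r\<^sup>2 / 4)) = ?B r"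
      by (simp add: w_def algebra_simps)
    finally show "norm (of_real (indicator {0..} r * r ^ (n - 1) * exp (b * r)) * g r) \<le> norm (?B r)"
      by (rule order_trans) simp
  qed
qed (use g[unfolded sq_integrable_dag, THEN conjunct1] in measurable)

lemma radial_exp_integrable:
  assumes g: "sq_integrable (dag_measure CARD('n::finite)) g"
  shows "integrable lborel (\<lambda>x::real^'n. of_real (exp (b * norm x)) * g (norm x))"
proof -
  note [measurable] = g[unfolded sq_integrable_dag, THEN conjunct1]
  have "integrable lborel (\<lambda>r. of_real (polar_const (0::real^'n) 0 * r ^ (2 * 0 + CARD('n) - 1) * indicator {0..} r) * (of_real (exp (b * r)) * g r))"
    using integrable_mult_right[OF dag_exp_integrable[OF g, of b], of "of_real (polar_const (0::real^'n) 0)"]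
    by (simp add: mult_ac)
  then have "integrable lborel (\<lambda>x. of_real ((x \<bullet> (0::real^'n)) ^ (2 * 0)) * (of_real (exp (b * norm x)) * g (norm x)))"
    by (rule iffD2[OF integrable_polar[where h = "\<lambda>r. of_real (exp (b * r)) * g r"], rotated]) measurable
  then show ?thesis by simp
qed

lemma radial_integrable:
  assumes g: "sq_integrable (dag_measure CARD('n::finite)) g"
  shows "integrable lborel (\<lambda>x::real^'n. g (norm x))"
  using radial_exp_integrable[OF g, of 0] by simp

section \<open>Radial Fourier transforms as power series of moments\<close>

text \<open>The profile along one coordinate axis; \<open>undefined\<close> selects some coordinate,
  and \<open>fourier_radial\<close> shows that the choice is immaterial. The type argument carries
  the dimension.\<close>

definition radial_ft :: "'n::finite itself \<Rightarrow> (real \<Rightarrow> complex) \<Rightarrow> real \<Rightarrow> complex" where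
  "radial_ft (_ :: 'n itself) g \<theta> = fourier (\<lambda>x::real^'n. g (norm x)) (\<theta> *\<^sub>R axis undefined 1)"

lemma fourier_radial:
  fixes \<xi> :: "real^'n::finite"
  assumes [measurable]: "g \<in> borel_measurable borel"
  shows "fourier (\<lambda>x. g (norm x)) \<xi> = radial_ft TYPE('n) g (norm \<xi>)"
proof -
  let ?e = "norm \<xi> *\<^sub>R axis undefined 1 :: real^'n"
  have "norm ?e = norm \<xi>" by simp
  then obtain A where A: "orthogonal_transformation A" "A ?e = \<xi>"
    by (rule orthogonal_transformation_exists)
  have "(LINT x|lborel. cis (- (x \<bullet> \<xi>)) * g (norm x)) = (LINT x|lborel. cis (- (A x \<bullet> \<xi>)) * g (norm (A x)))"
    by (rule lborel_integral_orthogonal[OF A(1), symmetric]) measurable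
  also have "... = (LINT x|lborel. cis (- (x \<bullet> ?e)) * g (norm x))"
  proof (rule Bochner_Integration.integral_cong[OF refl])
    fix x
    have "A x \<bullet> \<xi> = x \<bullet> ?e" using A unfolding orthogonal_transformation_def by metis
    then show "cis (- (A x \<bullet> \<xi>)) * g (norm (A x)) = cis (- (x \<bullet> ?e)) * g (norm x)"
      using A(1) by (simp add: orthogonal_transformation_norm)
  qed
  finally show ?thesis by (simp add: fourier_def radial_ft_def)
qed

definition radial_moment :: "nat \<Rightarrow> nat \<Rightarrow> (real \<Rightarrow> complex) \<Rightarrow> complex" where
  "radial_moment n m g = (LINT r|lborel. of_real (r ^ (2 * m + n - 1) * indicator {0..} r) * g r)"

lemma cos_partial_sum_bound:
  fixes y :: real
  shows "\<bar>\<Sum>m<N. (-1) ^ m / fact (2 * m) * y ^ (2 * m)\<bar> \<le> exp \<bar>y\<bar>"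
proof -
  have "\<bar>\<Sum>m<N. (-1) ^ m / fact (2 * m) * y ^ (2 * m)\<bar> \<le> (\<Sum>m<N. \<bar>(-1) ^ m / fact (2 * m) * y ^ (2 * m)\<bar>)" by (rule sum_abs)
  also have "... = (\<Sum>m<N. \<bar>y\<bar> ^ (2 * m) /\<^sub>R fact (2 * m))"
    by (intro sum.cong refl) (simp add: abs_mult power_abs divide_simps)
  also have "... = (\<Sum>k\<in>(\<lambda>m. 2 * m) ` {..<N}. \<bar>y\<bar> ^ k /\<^sub>R fact k)"
    by (subst sum.reindex) (auto simp: inj_on_def)
  also have "... \<le> (\<Sum>k. \<bar>y\<bar> ^ k /\<^sub>R fact k)" by (intro sum_le_suminf summable_exp_generic) auto
  finally show ?thesis by (simp add: exp_def)
qed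

text \<open>By reflection only the cosine survives. Its Taylor polynomials are dominated by
  exp(|theta| |x|), against which \<open>g\<close> is integrable, and polar coordinates turn each
  term into a moment.\<close>

lemma radial_ft_series:
  assumes g: "sq_integrable (dag_measure CARD('n::finite)) g"
  shows "(\<lambda>m. of_real ((2 * pi) powr (- real CARD('n) / 2) * ((-1) ^ m / fact (2 * m) * polar_const (axis undefined 1 :: real^'n) m) * \<theta> ^ (2 * m))
     * radial_moment CARD('n) m g) sums radial_ft TYPE('n) g \<theta>"
proof -
  note [measurable] = g[unfolded sq_integrable_dag, THEN conjunct1]
  define e where "e = (axis undefined 1 :: real^'n)"
  define c where "c = (2 * pi) powr (- real CARD('n) / 2)"
  have e1: "\<bar>x \<bullet> e\<bar> \<le> norm x" for x using Cauchy_Schwarz_ineq2[of x e] by (simp add: e_def)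
  have gi: "integrable lborel (\<lambda>x::real^'n. g (norm x))" by (rule radial_integrable[OF g])
  let ?I = "\<lambda>f. LINT x|lborel. f x * g (norm (x::real^'n))"
  have reflect: "?I (\<lambda>x. cis (- (x \<bullet> (\<theta> *\<^sub>R e)))) = ?I (\<lambda>x. cis (x \<bullet> (\<theta> *\<^sub>R e)))"
    using lborel_integral_orthogonal[of "\<lambda>x::real^'n. - x" "\<lambda>x. cis (x \<bullet> (\<theta> *\<^sub>R e)) * g (norm x)"]
    by (simp add: orthogonal_transformation_neg orthogonal_transformation_id)
  have "?I (\<lambda>x. cis (- (x \<bullet> (\<theta> *\<^sub>R e)))) + ?I (\<lambda>x. cis (x \<bullet> (\<theta> *\<^sub>R e))) =
      (LINT x|lborel. cis (- (x \<bullet> (\<theta> *\<^sub>R e))) * g (norm x) + cis (x \<bullet> (\<theta> *\<^sub>R e)) * g (norm x))"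
    by (intro Bochner_Integration.integral_add[symmetric] integrable_cis_mult gi) auto
  also have "... = (LINT x|lborel. 2 * (of_real (cos (\<theta> * (x \<bullet> e))) * g (norm x)))"
  proof (rule Bochner_Integration.integral_cong[OF refl])
    fix x
    have "cis (- (x \<bullet> (\<theta> *\<^sub>R e))) + cis (x \<bullet> (\<theta> *\<^sub>R e)) = 2 * of_real (cos (\<theta> * (x \<bullet> e)))"
      by (simp add: complex_eq_iff)
    then show "cis (- (x \<bullet> (\<theta> *\<^sub>R e))) * g (norm x) + cis (x \<bullet> (\<theta> *\<^sub>R e)) * g (norm x) =
        2 * (of_real (cos (\<theta> * (x \<bullet> e))) * g (norm x))"
      by (simp only: distrib_right[symmetric] mult.assoc)
  qed
  also have "... = 2 * ?I (\<lambda>x. of_real (cos (\<theta> * (x \<bullet> e))))"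
    by (rule integral_mult_right_zero)
  finally have "radial_ft TYPE('n) g \<theta> = of_real c * ?I (\<lambda>x. of_real (cos (\<theta> * (x \<bullet> e))))"
    using reflect by (simp add: radial_ft_def fourier_def c_def e_def)
  moreover
  define S where "S N y = (\<Sum>m<N. (-1) ^ m / fact (2 * m) * y ^ (2 * m))" for N :: nat and y :: real
  have "(\<lambda>N. ?I (\<lambda>x. of_real (S N (\<theta> * (x \<bullet> e))))) \<longlonglongrightarrow> ?I (\<lambda>x. of_real (cos (\<theta> * (x \<bullet> e))))"
  proof (rule integral_dominated_convergence)
    show "integrable lborel (\<lambda>x::real^'n. norm (of_real (exp (\<bar>\<theta>\<bar> * norm x)) * g (norm x)))"
      by (intro integrable_norm radial_exp_integrable g)
    show "AE x in lborel. (\<lambda>N. of_real (S N (\<theta> * (x \<bullet> e))) * g (norm x)) \<longlonglongrightarrow> of_real (cos (\<theta> * (x \<bullet> e))) * g (norm x)"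
    proof (rule AE_I2)
      fix x
      have "(\<lambda>N. S N (\<theta> * (x \<bullet> e))) \<longlonglongrightarrow> cos (\<theta> * (x \<bullet> e))"
        using cos_paired[of "\<theta> * (x \<bullet> e)"] unfolding sums_def S_def .
      then show "(\<lambda>N. of_real (S N (\<theta> * (x \<bullet> e))) * g (norm x)) \<longlonglongrightarrow> of_real (cos (\<theta> * (x \<bullet> e))) * g (norm x)"
        by (intro tendsto_intros)
    qed
    show "AE x in lborel. norm (of_real (S N (\<theta> * (x \<bullet> e))) * g (norm x)) \<le> norm (of_real (exp (\<bar>\<theta>\<bar> * norm x)) * g (norm x))" for N
    proof (rule AE_I2)
      fix x
      have "\<bar>\<theta> * (x \<bullet> e)\<bar> \<le> \<bar>\<theta>\<bar> * norm x" unfolding abs_mult using e1 by (intro mult_left_mono) auto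
      then have "exp \<bar>\<theta> * (x \<bullet> e)\<bar> \<le> exp (\<bar>\<theta>\<bar> * norm x)" by simp
      with cos_partial_sum_bound[where N = N and y = "\<theta> * (x \<bullet> e)"] have "\<bar>S N (\<theta> * (x \<bullet> e))\<bar> \<le> exp (\<bar>\<theta>\<bar> * norm x)"
        unfolding S_def by (rule order_trans)
      then show "norm (of_real (S N (\<theta> * (x \<bullet> e))) * g (norm x)) \<le> norm (of_real (exp (\<bar>\<theta>\<bar> * norm x)) * g (norm x))"
        by (simp add: norm_mult mult_right_mono)
    qed
  qed (auto simp: S_def)
  then have "(\<lambda>N. of_real c * ?I (\<lambda>x. of_real (S N (\<theta> * (x \<bullet> e))))) \<longlonglongrightarrow> of_real c * ?I (\<lambda>x. of_real (cos (\<theta> * (x \<bullet> e))))"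
    by (intro tendsto_intros)
  moreover have "of_real c * ?I (\<lambda>x. of_real (S N (\<theta> * (x \<bullet> e)))) =
     (\<Sum>m<N. of_real (c * ((-1) ^ m / fact (2 * m) * polar_const e m) * \<theta> ^ (2 * m)) * radial_moment CARD('n) m g)" for N
  proof -
    have mi: "integrable lborel (\<lambda>x. of_real ((x \<bullet> e) ^ (2 * m)) * g (norm x))" for m
    proof (rule Bochner_Integration.integrable_bound[OF integrable_mult_right[OF radial_exp_integrable[OF g, of 1], of "fact (2 * m)"]])
      show "AE x in lborel. norm (of_real ((x \<bullet> e) ^ (2 * m)) * g (norm x)) \<le> norm (fact (2 * m) * (of_real (exp (1 * norm x)) * g (norm x)))"
      proof (rule AE_I2)
        fix x
        have "\<bar>x \<bullet> e\<bar> ^ (2 * m) \<le> norm x ^ (2 * m)" using e1 by (intro power_mono) auto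
        also have "... \<le> fact (2 * m) * exp (norm x)" by (rule power_le_fact_exp) simp
        finally have "\<bar>x \<bullet> e\<bar> ^ (2 * m) * norm (g (norm x)) \<le> fact (2 * m) * exp (norm x) * norm (g (norm x))"
          by (rule mult_right_mono) simp
        then show "norm (of_real ((x \<bullet> e) ^ (2 * m)) * g (norm x)) \<le> norm (fact (2 * m) * (of_real (exp (1 * norm x)) * g (norm x)))"
          by (simp add: norm_mult norm_power power_abs)
      qed
    qed measurable
    have "?I (\<lambda>x. of_real (S N (\<theta> * (x \<bullet> e)))) =
       (LINT x|lborel. (\<Sum>m<N. of_real ((-1) ^ m / fact (2 * m) * \<theta> ^ (2 * m)) * (of_real ((x \<bullet> e) ^ (2 * m)) * g (norm x))))"
      by (intro Bochner_Integration.integral_cong refl) (simp add: S_def sum_distrib_right sum_distrib_left power_mult_distrib mult_ac)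
    also have "... = (\<Sum>m<N. LINT x|lborel. of_real ((-1) ^ m / fact (2 * m) * \<theta> ^ (2 * m)) * (of_real ((x \<bullet> e) ^ (2 * m)) * g (norm x)))"
      by (intro Bochner_Integration.integral_sum integrable_mult_right mi)
    also have "... = (\<Sum>m<N. of_real ((-1) ^ m / fact (2 * m) * \<theta> ^ (2 * m)) * (of_real (polar_const e m) * radial_moment CARD('n) m g))"
    proof (rule sum.cong[OF refl])
      fix m
      have "(LINT x|lborel. of_real ((x \<bullet> e) ^ (2 * m)) * g (norm x)) =
          (LINT r|lborel. of_real (polar_const e m * r ^ (2 * m + CARD('n) - 1) * indicator {0..} r) * g r)"
        by (rule integral_polar) measurable
      also have "... = (LINT r|lborel. of_real (polar_const e m) * (of_real (r ^ (2 * m + CARD('n) - 1) * indicator {0..} r) * g r))"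
        by (simp add: mult.assoc)
      also have "... = of_real (polar_const e m) * radial_moment CARD('n) m g"
        unfolding radial_moment_def by (rule integral_mult_right_zero)
      finally show "(LINT x|lborel. of_real ((-1) ^ m / fact (2 * m) * \<theta> ^ (2 * m)) * (of_real ((x \<bullet> e) ^ (2 * m)) * g (norm x))) =
          of_real ((-1) ^ m / fact (2 * m) * \<theta> ^ (2 * m)) * (of_real (polar_const e m) * radial_moment CARD('n) m g)"
        by (simp only: integral_mult_right_zero)
    qed
    finally show ?thesis by (simp add: sum_distrib_left mult_ac)
  qed
  ultimately show ?thesis by (simp only: sums_def c_def e_def)
qed

text \<open>Once the coefficients below \<open>m\<close> agree, the difference of the two series can
  be divided by theta^(2m), and letting theta tend to 0 isolates the m-th coefficient.\<close>

lemma powser_coeffs_unique: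
  fixes a b :: "nat \<Rightarrow> complex"
  assumes a: "\<And>\<theta>. (\<lambda>m. a m * of_real (\<theta> ^ (2 * m))) sums f \<theta>"
    and b: "\<And>\<theta>. (\<lambda>m. b m * of_real (\<theta> ^ (2 * m))) sums f \<theta>"
  shows "a m = b m"
proof (induction m rule: less_induct)
  case (less m)
  define d where "d k = a k - b k" for k
  have d: "(\<lambda>k. d k * of_real (\<theta> ^ (2 * k))) sums 0" for \<theta>
    using sums_diff[OF a b, of \<theta> \<theta>] by (simp add: d_def algebra_simps)
  have z: "(\<lambda>k. d (k + m) * of_real (\<theta>\<^sup>2) ^ k) sums 0" if "\<theta> \<noteq> 0" for \<theta>
  proof -
    have 0: "(\<Sum>k<m. d k * of_real (\<theta> ^ (2 * k))) = 0" using less by (intro sum.neutral) (simp add: d_def)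
    have "(\<lambda>k. d (k + m) * of_real (\<theta> ^ (2 * (k + m)))) sums 0"
      by (rule iffD2[OF sums_iff_shift[of "\<lambda>k. d k * of_real (\<theta> ^ (2 * k))" m 0]])
         (use d[of \<theta>] in \<open>simp only: 0 add_0\<close>)
    from sums_mult[OF this, of "inverse (of_real (\<theta> ^ (2 * m)))"]
    have "(\<lambda>k. inverse (of_real (\<theta> ^ (2 * m))) * (d (k + m) * of_real (\<theta> ^ (2 * (k + m))))) sums 0" by simp
    moreover have "inverse (of_real (\<theta> ^ (2 * m))) * (d (k + m) * of_real (\<theta> ^ (2 * (k + m)))) = d (k + m) * of_real (\<theta>\<^sup>2) ^ k" for k
    proof -
      have "\<theta> ^ (2 * (k + m)) = (\<theta>\<^sup>2) ^ k * \<theta> ^ (2 * m)" by (simp add: distrib_left power_add power_mult)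
      then show ?thesis using that by (simp add: field_simps)
    qed
    ultimately show ?thesis by (simp only:)
  qed
  have "summable (\<lambda>k. d (k + m) * w ^ k)" for w :: complex
  proof (rule powser_inside)
    show "norm w < norm (of_real ((norm w + 1)\<^sup>2) :: complex)"
      unfolding norm_of_real by (simp add: power2_eq_square algebra_simps add_strict_increasing)
    show "summable (\<lambda>k. d (k + m) * of_real ((norm w + 1)\<^sup>2) ^ k)"
      by (rule sums_summable[OF z]) (use norm_ge_zero[of w] in linarith)
  qed
  then have s: "(\<lambda>k. d (k + m) * w ^ k) sums (\<Sum>k. d (k + m) * w ^ k)" for w :: complex
    by (rule summable_sums)
  have lim: "((\<lambda>w. \<Sum>k. d (k + m) * w ^ k) \<longlongrightarrow> d (0 + m)) (at (0::complex))"
    by (rule powser_limit_0[of 1 "\<lambda>k. d (k + m)"]) (simp, rule s)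
  \<comment> \<open>The series is known to vanish only at squares of nonzero reals, so the limit at
    0 is taken along such points.\<close>
  let ?w = "\<lambda>j. complex_of_real ((inverse (real (Suc j)))\<^sup>2)"
  have "?w \<longlonglongrightarrow> of_real (0\<^sup>2)"
    by (intro tendsto_intros LIMSEQ_inverse_real_of_nat)
  moreover have "?w j \<noteq> 0" for j by (simp del: of_nat_Suc)
  ultimately have "filterlim ?w (at 0) sequentially" unfolding filterlim_at by simp
  from filterlim_compose[OF lim this] have "(\<lambda>j. \<Sum>k. d (k + m) * ?w j ^ k) \<longlonglongrightarrow> d m" by simp
  moreover have "(\<Sum>k. d (k + m) * ?w j ^ k) = 0" for j
    by (rule sums_unique[OF z, symmetric]) simp
  ultimately have "d m = 0" by (simp only: LIMSEQ_const_iff)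
  then show ?case by (simp add: d_def)
qed

subsection \<open>Gaussian moments and the Laguerre basis\<close>

definition gauss_moment :: "nat \<Rightarrow> nat \<Rightarrow> real" where
  "gauss_moment n m = (LINT r|lborel. indicator {0..} r * r ^ (2 * m + n - 1) * exp (- r\<^sup>2 / 4))"

lemma gauss_moment_integrable: "integrable lborel (\<lambda>r::real. indicator {0..} r * r ^ j * exp (- r\<^sup>2 / 4))"
  using gauss_int[of j 0] by simp

lemma radial_moment_gauss: "radial_moment n m (\<lambda>r. of_real (r ^ (2 * i) * exp (- r\<^sup>2 / 4))) = of_real (gauss_moment n (i + m))" if "n > 0"
proof -
  have *: "r ^ (2 * m + n - 1) * r ^ (2 * i) = r ^ (2 * (i + m) + n - 1)" for r :: real
    using that by (simp add: power_add[symmetric] algebra_simps)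
  have "r ^ (2 * m + n - 1) * indicator {0..} r * (r ^ (2 * i) * exp (- r\<^sup>2 / 4)) =
     indicator {0..} r * r ^ (2 * (i + m) + n - 1) * exp (- r\<^sup>2 / 4)" for r :: real
    unfolding *[symmetric] by (simp only: mult_ac)
  then show ?thesis
    unfolding radial_moment_def gauss_moment_def of_real_mult[symmetric] by (simp only: integral_complex_of_real)
qed

text \<open>Integration of the derivative of -2 r^(2m+n) exp(-r^2/4) over the half-line; the
  boundary terms vanish, at 0 because 2m+n > 0.\<close>

lemma gauss_moment_Suc:
  assumes n: "n > 0"
  shows "gauss_moment n (Suc m) = 2 * real (2 * m + n) * gauss_moment n m"
proof -
  define N where "N = 2 * m + n"
  have N: "N > 0" using n by (simp add: N_def)
  define F where "F r = -2 * r ^ N * exp (- r\<^sup>2 / 4)" for r :: real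
  define f where "f r = r ^ (N + 1) * exp (- r\<^sup>2 / 4) - 2 * real N * (r ^ (N - 1) * exp (- r\<^sup>2 / 4))" for r :: real
  have dF: "(F has_vector_derivative f r) (at r within S)" for r S
    unfolding F_def f_def has_real_derivative_iff_has_vector_derivative[symmetric] using N
    by (auto intro!: derivative_eq_intros simp: power_add power2_eq_square algebra_simps)
  have FTC: "(LINT r|lborel. indicator {0..R} r *\<^sub>R f r) = F R - F 0" if "R \<ge> 0" for R
    by (rule integral_FTC_atLeastAtMost[OF that dF]) (auto simp: f_def intro!: continuous_intros)
  let ?f = "\<lambda>r. indicator {0..} r * f r"
  have feq: "?f = (\<lambda>r. indicator {0..} r * r ^ (N + 1) * exp (- r\<^sup>2 / 4) - 2 * real N * (indicator {0..} r * r ^ (N - 1) * exp (- r\<^sup>2 / 4)))"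
    by (simp add: f_def algebra_simps fun_eq_iff)
  have fi: "integrable lborel ?f" unfolding feq
    by (intro Bochner_Integration.integrable_diff integrable_mult_right gauss_moment_integrable)
  have "((\<lambda>R. LINT r|lborel. indicator {..R} r *\<^sub>R ?f r) \<longlongrightarrow> (LINT r|lborel. ?f r)) at_top"
    by (rule tendsto_integral_at_top[OF _ fi]) simp
  moreover have "((\<lambda>R. LINT r|lborel. indicator {..R} r *\<^sub>R ?f r) \<longlongrightarrow> 0) at_top"
  proof (rule Lim_transform_eventually)
    have "((\<lambda>R::real. -2 * (R ^ N / exp R)) \<longlongrightarrow> -2 * 0) at_top" by (rule tendsto_mult[OF tendsto_const tendsto_power_div_exp_0])
    then have lo: "((\<lambda>R::real. -2 * (R ^ N / exp R)) \<longlongrightarrow> 0) at_top" by (simp only: mult_zero_right)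
    show "(F \<longlongrightarrow> 0) at_top"
    proof (rule tendsto_sandwich[OF _ _ lo tendsto_const])
      show "\<forall>\<^sub>F R in at_top. -2 * (R ^ N / exp R) \<le> F R"
        using eventually_ge_at_top[of 4]
      proof eventually_elim
        case (elim R)
        have "R \<le> R\<^sup>2 / 4" using elim by (simp add: power2_eq_square)
        then have "exp (- R\<^sup>2 / 4) \<le> exp (- R)" by simp
        then have "R ^ N * exp (- R\<^sup>2 / 4) \<le> R ^ N * exp (- R)" using elim by (intro mult_left_mono) auto
        moreover have "R ^ N * exp (- R) = R ^ N / exp R" by (simp only: exp_minus divide_inverse)
        moreover have "F R = -2 * (R ^ N * exp (- R\<^sup>2 / 4))" by (simp only: F_def mult.assoc)
        ultimately show ?case by linarith
      qed
      show "\<forall>\<^sub>F R in at_top. F R \<le> 0"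
        using eventually_ge_at_top[of 0] by eventually_elim (simp add: F_def)
    qed
    show "\<forall>\<^sub>F R in at_top. F R = (LINT r|lborel. indicator {..R} r *\<^sub>R ?f r)"
      using eventually_ge_at_top[of 0]
    proof eventually_elim
      case (elim R)
      have "indicator {..R} r *\<^sub>R ?f r = indicator {0..R} r *\<^sub>R f r" for r by (auto simp: indicator_def)
      then have "(LINT r|lborel. indicator {..R} r *\<^sub>R ?f r) = F R - F 0"
        using FTC[OF elim] by (simp only:)
      moreover have "F 0 = 0" using N by (simp add: F_def)
      ultimately show ?case by simp
    qed
  qed
  ultimately have "(LINT r|lborel. ?f r) = 0" by (rule tendsto_unique[rotated]) simp
  moreover have "(LINT r|lborel. ?f r) = gauss_moment n (Suc m) - 2 * real N * gauss_moment n m"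
  proof -
    have "2 * Suc m + n - 1 = N + 1" "2 * m + n - 1 = N - 1" by (auto simp: N_def)
    then show ?thesis unfolding feq gauss_moment_def
      by (simp only: Bochner_Integration.integral_diff[OF gauss_moment_integrable integrable_mult_right[OF gauss_moment_integrable]] integral_mult_right_zero)
  qed
  ultimately show ?thesis by (simp add: N_def)
qed

text \<open>In this form the quotient of two moments is a rising factorial of degree
  \<open>i\<close> in \<open>m\<close>, which is what the finite difference identity acts
  on.\<close>

lemma gauss_moment_add:
  assumes n: "n > 0"
  shows "gauss_moment n (m + i) = 4 ^ i * pochhammer (real n / 2 + real m) i * gauss_moment n m"
proof (induction i)
  case (Suc i)
  have "gauss_moment n (m + Suc i) = 2 * real (2 * (m + i) + n) * gauss_moment n (m + i)"
    using gauss_moment_Suc[OF n, of "m + i"] by simp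
  moreover have "4 ^ Suc i * pochhammer (real n / 2 + real m) (Suc i) * gauss_moment n m =
      4 * (real n / 2 + real m + real i) * (4 ^ i * pochhammer (real n / 2 + real m) i * gauss_moment n m)"
    by (simp only: pochhammer_Suc power_Suc mult_ac)
  moreover have "2 * real (2 * (m + i) + n) = 4 * (real n / 2 + real m + real i)" by simp
  ultimately show ?case by (simp only: Suc)
qed simp

lemma radial_ft_gauss:
  "radial_ft TYPE('n::finite) (\<lambda>r. of_real (exp (- r\<^sup>2 / 4))) \<theta> = of_real (2 powr (real CARD('n) / 2) * exp (- \<theta>\<^sup>2))"
proof -
  define \<xi> where "\<xi> = \<theta> *\<^sub>R (axis undefined 1 :: real^'n)"
  have "(LINT x|lborel. cis (- (x \<bullet> \<xi>)) * of_real (exp (- (norm x)\<^sup>2 / 4))) =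
      \<bar>sqrt 2\<bar> ^ DIM(real^'n) *\<^sub>R (LINT x|lborel. cis (- ((0 + sqrt 2 *\<^sub>R x) \<bullet> \<xi>)) * of_real (exp (- (norm (0 + sqrt 2 *\<^sub>R x))\<^sup>2 / 4)))"
    by (rule lborel_integral_affine) auto
  also have "(LINT x|lborel. cis (- ((0 + sqrt 2 *\<^sub>R x) \<bullet> \<xi>)) * of_real (exp (- (norm (0 + sqrt 2 *\<^sub>R x))\<^sup>2 / 4))) =
      (LINT x|lborel. cis (x \<bullet> (- sqrt 2 *\<^sub>R \<xi>)) * of_real (exp (- (norm x)\<^sup>2 / 2)))"
    by (intro Bochner_Integration.integral_cong refl) (simp add: power_mult_distrib)
  also have "... = of_real ((2 * pi) powr (real CARD('n) / 2) * exp (- (norm (- sqrt 2 *\<^sub>R \<xi>))\<^sup>2 / 2))"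
    by (rule gaussian_char)
  also have "norm (- sqrt 2 *\<^sub>R \<xi>) = sqrt 2 * \<bar>\<theta>\<bar>" by (simp add: \<xi>_def abs_mult)
  also have "- (sqrt 2 * \<bar>\<theta>\<bar>)\<^sup>2 / 2 = - \<theta>\<^sup>2" by (simp add: power_mult_distrib)
  also have "\<bar>sqrt 2\<bar> ^ DIM(real^'n) = 2 powr (real CARD('n) / 2)"
    by (simp add: powr_half_sqrt[symmetric] powr_powr flip: powr_realpow)
  finally have *: "(LINT x|lborel. cis (- (x \<bullet> \<xi>)) * of_real (exp (- (norm x)\<^sup>2 / 4))) =
      2 powr (real CARD('n) / 2) *\<^sub>R of_real ((2 * pi) powr (real CARD('n) / 2) * exp (- \<theta>\<^sup>2))" .
  have **: "(2 * pi) powr (- real CARD('n) / 2) * (2 * pi) powr (real CARD('n) / 2) = 1"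
    by (simp flip: powr_add)
  have "(2 * pi) powr (- real CARD('n) / 2) * (2 powr (real CARD('n) / 2) * ((2 * pi) powr (real CARD('n) / 2) * exp (- \<theta>\<^sup>2)))
      = ((2 * pi) powr (- real CARD('n) / 2) * (2 * pi) powr (real CARD('n) / 2)) * (2 powr (real CARD('n) / 2) * exp (- \<theta>\<^sup>2))"
    by (simp only: mult_ac)
  then show ?thesis unfolding radial_ft_def fourier_def \<xi>_def[symmetric] *
    by (simp only: ** scaleR_conv_of_real of_real_mult[symmetric] mult_1_left)
qed

lemma sq_integrable_monomial: "sq_integrable (dag_measure n) (\<lambda>r. of_real (r ^ j * exp (- r\<^sup>2 / 4)))"
  unfolding sq_integrable_dag
proof
  have "indicator {0..} r * exp (r\<^sup>2 / 4) * r ^ (n - 1) * (norm (complex_of_real (r ^ j * exp (- r\<^sup>2 / 4))))\<^sup>2 =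
      indicator {0..} r * r ^ (n - 1 + 2 * j) * exp (- r\<^sup>2 / 4)" for r :: real
  proof -
    have "(norm (complex_of_real (r ^ j * exp (- r\<^sup>2 / 4))))\<^sup>2 = r ^ (2 * j) * (exp (- r\<^sup>2 / 4) * exp (- r\<^sup>2 / 4))"
      unfolding norm_of_real power2_abs by (simp add: power2_eq_square power_mult_distrib power_mult mult_ac)
    moreover have "exp (r\<^sup>2 / 4) * (exp (- r\<^sup>2 / 4) * exp (- r\<^sup>2 / 4)) = exp (- r\<^sup>2 / 4)" by (simp flip: exp_add)
    ultimately show ?thesis by (simp add: power_add mult_ac)
  qed
  then show "integrable lborel (\<lambda>r. indicator {0..} r * exp (r\<^sup>2 / 4) * r ^ (n - 1) * (norm (complex_of_real (r ^ j * exp (- r\<^sup>2 / 4))))\<^sup>2)"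
    using gauss_moment_integrable[of "n - 1 + 2 * j"] by (simp only:)
qed measurable

text \<open>This determines the sphere integrals indirectly: the moment series of the Gaussian and
  the exponential series represent the same function, and comparison of coefficients gives the
  product of \<open>polar_const\<close> with the Gaussian moment.\<close>

lemma gauss_moment_polar:
  "(2 * pi) powr (- real CARD('n) / 2) * ((-1) ^ m / fact (2 * m) * polar_const (axis undefined 1 :: real^'n) m) * gauss_moment CARD('n::finite) m
    = 2 powr (real CARD('n) / 2) * (-1) ^ m / fact m"
proof -
  define D where "D m = (2 * pi) powr (- real CARD('n) / 2) * ((-1) ^ m / fact (2 * m) * polar_const (axis undefined 1 :: real^'n) m)" for m
  let ?C = "2 powr (real CARD('n) / 2)"
  let ?f = "\<lambda>\<theta>::real. complex_of_real (?C * exp (- \<theta>\<^sup>2))"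
  have "of_real (D m * gauss_moment CARD('n) m) = complex_of_real (?C * (-1) ^ m / fact m)"
  proof (rule powser_coeffs_unique[of _ ?f])
    fix \<theta> :: real
    have s: "sq_integrable (dag_measure CARD('n)) (\<lambda>r. of_real (exp (- r\<^sup>2 / 4)))"
      using sq_integrable_monomial[of "CARD('n)" 0] by simp
    have m: "radial_moment CARD('n) m (\<lambda>r. of_real (exp (- r\<^sup>2 / 4))) = of_real (gauss_moment CARD('n) m)" for m
      using radial_moment_gauss[of "CARD('n)" m 0] by simp
    show "(\<lambda>m. of_real (D m * gauss_moment CARD('n) m) * of_real (\<theta> ^ (2 * m))) sums ?f \<theta>"
      using radial_ft_series[OF s, of \<theta>] unfolding radial_ft_gauss m D_def[symmetric] by (simp add: mult_ac)
    have "(\<lambda>m. ?C * ((- \<theta>\<^sup>2) ^ m /\<^sub>R fact m)) sums (?C * exp (- \<theta>\<^sup>2))"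
      by (intro sums_mult exp_converges)
    then have "(\<lambda>m. complex_of_real (?C * ((- \<theta>\<^sup>2) ^ m /\<^sub>R fact m))) sums ?f \<theta>" by (rule sums_of_real)
    moreover have "?C * ((- \<theta>\<^sup>2) ^ m /\<^sub>R fact m) = ?C * (-1) ^ m / fact m * \<theta> ^ (2 * m)" for m
    proof -
      have "(- \<theta>\<^sup>2) ^ m = (-1) ^ m * \<theta> ^ (2 * m)" by (simp only: power_mult power_mult_distrib[symmetric] mult_minus1)
      then show ?thesis by (simp only: real_scaleR_def divide_inverse mult_ac)
    qed
    ultimately show "(\<lambda>m. complex_of_real (?C * (-1) ^ m / fact m) * of_real (\<theta> ^ (2 * m))) sums ?f \<theta>"
      by (simp only: of_real_mult[symmetric])
  qed
  then show ?thesis unfolding of_real_eq_iff D_def .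
qed

text \<open>The integrand is nonnegative, and a vanishing moment would contradict
  \<open>gauss_moment_polar\<close>, whose right-hand side is not zero.\<close>

lemma gauss_moment_pos: "gauss_moment CARD('n::finite) m > 0"
proof -
  have "gauss_moment CARD('n) m \<ge> 0" unfolding gauss_moment_def
    by (intro Bochner_Integration.integral_nonneg) (auto simp: indicator_def)
  moreover have "gauss_moment CARD('n) m \<noteq> 0" using gauss_moment_polar[where 'n = 'n, of m] by auto
  ultimately show ?thesis by simp
qed

section \<open>Laguerre functions and their orthogonality\<close>

text \<open>Up to a constant factor, the Laguerre polynomial of degree \<open>k\<close> and
  parameter n/2-1 in r^2/4, times exp(-r^2/4): by \<open>gauss_moment_add\<close> the m-th moment is
  4^m (n/2)_m times the zeroth one, so the sum is a terminating confluent hypergeometric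
  series.\<close>

definition lag :: "nat \<Rightarrow> nat \<Rightarrow> real \<Rightarrow> complex" where
  "lag n k r = (\<Sum>m\<le>k. of_real (real (k choose m) * (-1) ^ m / gauss_moment n m) * of_real (r ^ (2 * m) * exp (- r\<^sup>2 / 4)))"

lemma sq_integrable_lag: "sq_integrable (dag_measure n) (lag n k)"
  unfolding lag_def by (intro sq_integrable_sum sq_integrable_cmult sq_integrable_monomial)

text \<open>Phrased through moments so that it can be recognized as a coefficient of a power series;
  \<open>l2_inner_lag\<close> identifies it with an inner product.\<close>

definition lag_coeff :: "nat \<Rightarrow> nat \<Rightarrow> (real \<Rightarrow> complex) \<Rightarrow> complex" where
  "lag_coeff n k g = (\<Sum>m\<le>k. of_real (real (k choose m) * (-1) ^ m / gauss_moment n m) * radial_moment n m g)"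

lemma moment_integrable:
  assumes g: "sq_integrable (dag_measure n) g" and n: "n > 0"
  shows "integrable lborel (\<lambda>r. of_real (r ^ (2 * m + n - 1) * indicator {0..} r) * g r)"
proof (rule Bochner_Integration.integrable_bound[OF integrable_mult_right[OF dag_exp_integrable[OF g, of 1], of "fact (2 * m)"]])
  show "AE r in lborel. norm (of_real (r ^ (2 * m + n - 1) * indicator {0..} r) * g r)
      \<le> norm (fact (2 * m) * (of_real (indicator {0..} r * r ^ (n - 1) * exp (1 * r)) * g r))"
  proof (rule AE_I2)
    fix r :: real
    show "norm (of_real (r ^ (2 * m + n - 1) * indicator {0..} r) * g r)
      \<le> norm (fact (2 * m) * (of_real (indicator {0..} r * r ^ (n - 1) * exp (1 * r)) * g r))"
    proof (cases "r \<ge> 0")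
      case True
      have "r ^ (2 * m) * (r ^ (n - 1) * norm (g r)) \<le> fact (2 * m) * exp r * (r ^ (n - 1) * norm (g r))"
        using True by (intro mult_right_mono power_le_fact_exp) auto
      moreover have "r ^ (2 * m + n - 1) = r ^ (2 * m) * r ^ (n - 1)" using n by (simp flip: power_add)
      ultimately show ?thesis using True by (simp add: norm_mult norm_power mult_ac)
    qed simp
  qed
qed (use g[unfolded sq_integrable_dag, THEN conjunct1] in measurable)

text \<open>The weight exp(r^2/4) of the inner product cancels the Gaussian in \<open>lag\<close>
  and leaves monomials integrated against \<open>g\<close>.\<close>

lemma l2_inner_lag:
  assumes g: "sq_integrable (dag_measure n) g" and n: "n > 0"
  shows "l2_inner (dag_measure n) g (lag n k) = lag_coeff n k g"
proof -
  note [measurable] = g[unfolded sq_integrable_dag, THEN conjunct1] sq_integrable_lag[unfolded sq_integrable_dag, THEN conjunct1]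
  have "l2_inner (dag_measure n) g (lag n k) =
     (LINT r|lborel. of_real (indicator {0..} r * exp (r\<^sup>2 / 4) * r ^ (n - 1)) * (g r * cnj (lag n k r)))"
    unfolding l2_inner_def by (rule integral_dag_measure) (auto intro: measurable_compose[OF _ cnj_measurable])
  also have "... = (LINT r|lborel. (\<Sum>m\<le>k. of_real (real (k choose m) * (-1) ^ m / gauss_moment n m) * (of_real (r ^ (2 * m + n - 1) * indicator {0..} r) * g r)))"
  proof (rule Bochner_Integration.integral_cong[OF refl])
    fix r :: real
    have e: "exp (r\<^sup>2 / 4) * exp (- r\<^sup>2 / 4) = 1" by (simp flip: exp_add)
    have "of_real (indicator {0..} r * exp (r\<^sup>2 / 4) * r ^ (n - 1)) * (g r * (of_real a * of_real (r ^ (2 * m) * exp (- r\<^sup>2 / 4)))) =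
        of_real a * (of_real (r ^ (2 * m + n - 1) * indicator {0..} r) * g r)" for a m
    proof -
      have "r ^ (2 * m + n - 1) = r ^ (2 * m) * r ^ (n - 1)" using n by (simp flip: power_add)
      then have "indicator {0..} r * exp (r\<^sup>2 / 4) * r ^ (n - 1) * (a * (r ^ (2 * m) * exp (- r\<^sup>2 / 4))) =
          (exp (r\<^sup>2 / 4) * exp (- r\<^sup>2 / 4)) * (a * (r ^ (2 * m + n - 1) * indicator {0..} r))" by (simp only: mult_ac)
      also have "... = a * (r ^ (2 * m + n - 1) * indicator {0..} r)" by (simp only: e mult_1_left)
      finally have "complex_of_real (indicator {0..} r * exp (r\<^sup>2 / 4) * r ^ (n - 1) * (a * (r ^ (2 * m) * exp (- r\<^sup>2 / 4)))) =
          complex_of_real (a * (r ^ (2 * m + n - 1) * indicator {0..} r))" by (simp only:)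
      then have "complex_of_real (indicator {0..} r * exp (r\<^sup>2 / 4) * r ^ (n - 1) * (a * (r ^ (2 * m) * exp (- r\<^sup>2 / 4)))) * g r =
          complex_of_real (a * (r ^ (2 * m + n - 1) * indicator {0..} r)) * g r" by (simp only:)
      then show ?thesis by (simp only: of_real_mult mult_ac)
    qed
    moreover have "cnj (lag n k r) = (\<Sum>m\<le>k. of_real (real (k choose m) * (-1) ^ m / gauss_moment n m) * of_real (r ^ (2 * m) * exp (- r\<^sup>2 / 4)))"
      unfolding lag_def cnj_sum complex_cnj_mult complex_cnj_complex_of_real ..
    ultimately show "of_real (indicator {0..} r * exp (r\<^sup>2 / 4) * r ^ (n - 1)) * (g r * cnj (lag n k r)) =
       (\<Sum>m\<le>k. of_real (real (k choose m) * (-1) ^ m / gauss_moment n m) * (of_real (r ^ (2 * m + n - 1) * indicator {0..} r) * g r))"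
      by (simp only: sum_distrib_left)
  qed
  also have "... = (\<Sum>m\<le>k. LINT r|lborel. of_real (real (k choose m) * (-1) ^ m / gauss_moment n m) * (of_real (r ^ (2 * m + n - 1) * indicator {0..} r) * g r))"
    by (intro Bochner_Integration.integral_sum integrable_mult_right moment_integrable g n)
  also have "... = lag_coeff n k g" unfolding lag_coeff_def radial_moment_def
    by (simp only: integral_mult_right_zero)
  finally show ?thesis .
qed

text \<open>Pascal's rule. Up to sign the alternating sum is a finite difference at 0, and one order
  can be spent by differencing \<open>f\<close> first.\<close>

lemma alternating_binomial_Suc:
  fixes f :: "nat \<Rightarrow> real"
  shows "(\<Sum>m\<le>Suc k. (-1) ^ m * real (Suc k choose m) * f m) = (\<Sum>m\<le>k. (-1) ^ m * real (k choose m) * (f m - f (Suc m)))"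
proof -
  let ?t = "\<lambda>m. (-1) ^ m * real (k choose m) * f m"
  have "(\<Sum>m\<le>Suc k. (-1) ^ m * real (Suc k choose m) * f m) =
      f 0 + (\<Sum>m\<le>k. (-1) ^ Suc m * real (Suc k choose Suc m) * f (Suc m))"
    by (subst sum.atMost_Suc_shift) simp
  also have "... = f 0 + (\<Sum>m\<le>k. ?t (Suc m) - (-1) ^ m * real (k choose m) * f (Suc m))"
    by (intro arg_cong2[where f = "(+)"] sum.cong refl) (simp add: algebra_simps)
  also have "... = (f 0 + (\<Sum>m\<le>k. ?t (Suc m))) - (\<Sum>m\<le>k. (-1) ^ m * real (k choose m) * f (Suc m))"
    by (simp only: sum_subtractf add_diff_eq)
  also have "f 0 + (\<Sum>m\<le>k. ?t (Suc m)) = (\<Sum>m\<le>Suc k. ?t m)"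
    by (subst sum.atMost_Suc_shift) simp
  also have "... = (\<Sum>m\<le>k. ?t m)" by simp
  finally show ?thesis by (simp only: sum_subtractf[symmetric] right_diff_distrib)
qed

text \<open>A difference lowers the degree of a rising factorial by one and shifts its argument.
  Differences of order above the degree therefore vanish, and the order equal to the degree leaves a
  constant.\<close>

lemma alternating_binomial_pochhammer:
  fixes x :: real
  assumes "i \<le> k"
  shows "(\<Sum>m\<le>k. (-1) ^ m * real (k choose m) * pochhammer (x + real m) i) = (if i = k then (-1) ^ k * fact k else 0)"
  using assms
proof (induction k arbitrary: i x)
  case (Suc k)
  show ?case
  proof (cases i)
    case 0
    then show ?thesis unfolding alternating_binomial_Suc by simp
  next
    case [simp]: (Suc j)
    have "pochhammer (x + real m) (Suc j) - pochhammer (x + real (Suc m)) (Suc j) = - real (Suc j) * pochhammer (x + 1 + real m) j" for m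
    proof -
      define y where "y = x + real m"
      have "pochhammer y (Suc j) - pochhammer (y + 1) (Suc j) = - real (Suc j) * pochhammer (y + 1) j"
        unfolding pochhammer_rec[of y] pochhammer_Suc[of "y + 1"] by (simp add: algebra_simps)
      moreover have "x + real (Suc m) = y + 1" "x + 1 + real m = y + 1" by (auto simp: y_def)
      ultimately show ?thesis by (simp only: y_def)
    qed
    then have "(\<Sum>m\<le>Suc k. (-1) ^ m * real (Suc k choose m) * pochhammer (x + real m) i) =
        (\<Sum>m\<le>k. - real (Suc j) * ((-1) ^ m * real (k choose m) * pochhammer (x + 1 + real m) j))"
      unfolding alternating_binomial_Suc by (simp only: Suc mult_ac)
    also have "... = - real (Suc j) * (\<Sum>m\<le>k. (-1) ^ m * real (k choose m) * pochhammer (x + 1 + real m) j)"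
      by (rule sum_distrib_left[symmetric])
    also have "... = - real (Suc j) * (if j = k then (-1) ^ k * fact k else 0)"
      using Suc.prems by (subst Suc.IH) auto
    finally have *: "(\<Sum>m\<le>Suc k. (-1) ^ m * real (Suc k choose m) * pochhammer (x + real m) i) =
        - real (Suc j) * (if j = k then (-1) ^ k * fact k else 0)" .
    have "- real (Suc k) * ((-1) ^ k * fact k) = (-1) ^ Suc k * fact (Suc k)"
      by (simp only: power_Suc fact_Suc of_nat_mult of_nat_fact mult_ac minus_mult_left[symmetric] minus_mult_right[symmetric] mult_1_left mult_1_right)
    then show ?thesis unfolding * by simp
  qed
qed simp

lemma radial_moment_sum_cmult:
  assumes "\<And>j. j \<in> I \<Longrightarrow> sq_integrable (dag_measure n) (f j)" "n > 0"
  shows "radial_moment n m (\<lambda>r. \<Sum>j\<in>I. c j * f j r) = (\<Sum>j\<in>I. c j * radial_moment n m (f j))"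
proof -
  have "radial_moment n m (\<lambda>r. \<Sum>j\<in>I. c j * f j r) =
     (LINT r|lborel. (\<Sum>j\<in>I. c j * (of_real (r ^ (2 * m + n - 1) * indicator {0..} r) * f j r)))"
    unfolding radial_moment_def sum_distrib_left by (simp only: mult_ac)
  also have "... = (\<Sum>j\<in>I. LINT r|lborel. c j * (of_real (r ^ (2 * m + n - 1) * indicator {0..} r) * f j r))"
    by (intro Bochner_Integration.integral_sum integrable_mult_right moment_integrable assms)
  finally show ?thesis unfolding radial_moment_def by (simp only: integral_mult_right_zero)
qed

text \<open>Orthogonality to lower degrees: the division by Gaussian moments in \<open>lag\<close>
  leaves a rising factorial of degree \<open>i\<close>, which the k-th difference annihilates unless
  i = k.\<close>

lemma radial_moment_lag:
  assumes "i \<le> k"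
  shows "radial_moment CARD('n::finite) i (lag CARD('n) k) = of_real (if i = k then 4 ^ k * (-1) ^ k * fact k else 0)"
proof -
  let ?n = "CARD('n)"
  have "radial_moment ?n i (lag ?n k) = (\<Sum>m\<le>k. of_real (real (k choose m) * (-1) ^ m / gauss_moment ?n m) * of_real (gauss_moment ?n (m + i)))"
    unfolding lag_def radial_moment_gauss[OF zero_less_card_finite, symmetric]
    by (intro radial_moment_sum_cmult sq_integrable_monomial zero_less_card_finite)
  also have "... = (\<Sum>m\<le>k. of_real (4 ^ i * ((-1) ^ m * real (k choose m) * pochhammer (real ?n / 2 + real m) i)))"
  proof (intro sum.cong refl)
    fix m
    have "gauss_moment ?n m \<noteq> 0" using gauss_moment_pos[where 'n = 'n, of m] by simp
    then have "real (k choose m) * (-1) ^ m / gauss_moment ?n m * gauss_moment ?n (m + i) = 4 ^ i * ((-1) ^ m * real (k choose m) * pochhammer (real ?n / 2 + real m) i)"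
      unfolding gauss_moment_add[OF zero_less_card_finite] by simp
    then show "of_real (real (k choose m) * (-1) ^ m / gauss_moment ?n m) * complex_of_real (gauss_moment ?n (m + i)) =
       of_real (4 ^ i * ((-1) ^ m * real (k choose m) * pochhammer (real ?n / 2 + real m) i))"
      by (simp only: of_real_mult[symmetric])
  qed
  also have "... = of_real (4 ^ i * (\<Sum>m\<le>k. (-1) ^ m * real (k choose m) * pochhammer (real ?n / 2 + real m) i))"
    by (simp only: of_real_sum sum_distrib_left)
  finally show ?thesis unfolding alternating_binomial_pochhammer[OF assms] by auto
qed

definition lag_norm2 :: "nat \<Rightarrow> nat \<Rightarrow> real" where
  "lag_norm2 n k = 4 ^ k * fact k / gauss_moment n k"

lemma lag_norm2_pos: "lag_norm2 CARD('n::finite) k > 0"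
  using gauss_moment_pos[where 'n = 'n, of k] by (simp add: lag_norm2_def)

text \<open>For j <= k only the moment of order k can be nonzero, and it occurs only if j = k. The
  case j > k follows from hermitian symmetry, the coefficient being an inner product.\<close>

lemma lag_coeff_lag:
  "lag_coeff CARD('n::finite) j (lag CARD('n) k) = (if j = k then of_real (lag_norm2 CARD('n) k) else 0)"
proof -
  let ?n = "CARD('n)"
  have le: "lag_coeff ?n j (lag ?n k) = (if j = k then of_real (lag_norm2 ?n k) else 0)" if "j \<le> k" for j k
  proof -
    have "lag_coeff ?n j (lag ?n k) = (\<Sum>m\<le>j. if m = k then of_real (lag_norm2 ?n k) else 0)"
      unfolding lag_coeff_def
    proof (rule sum.cong[OF refl])
      fix m assume "m \<in> {..j}"
      then have m: "m \<le> k" using that by simp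
      show "of_real (real (j choose m) * (-1) ^ m / gauss_moment ?n m) * radial_moment ?n m (lag ?n k) = (if m = k then of_real (lag_norm2 ?n k) else 0)"
      proof (cases "m = k")
        case True
        then have "j = k" using that \<open>m \<in> {..j}\<close> by simp
        have "real (j choose m) * (-1) ^ m / gauss_moment ?n m * (4 ^ k * (-1) ^ k * fact k) = lag_norm2 ?n k"
          using True \<open>j = k\<close> by (simp add: lag_norm2_def flip: power_mult_distrib)
        then have "complex_of_real (real (j choose m) * (-1) ^ m / gauss_moment ?n m) * complex_of_real (4 ^ k * (-1) ^ k * fact k) = of_real (lag_norm2 ?n k)"
          by (simp only: of_real_mult[symmetric])
        moreover have "radial_moment ?n m (lag ?n k) = complex_of_real (4 ^ k * (-1) ^ k * fact k)"
          using radial_moment_lag[where 'n = 'n, OF m] True by simp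
        ultimately show ?thesis using True by simp
      qed (use m in \<open>simp add: radial_moment_lag\<close>)
    qed
    then show ?thesis using that by (auto simp: sum.delta')
  qed
  show ?thesis
  proof (cases "j \<le> k")
    case False
    have "lag_coeff ?n j (lag ?n k) = cnj (lag_coeff ?n k (lag ?n j))"
      unfolding l2_inner_lag[OF sq_integrable_lag zero_less_card_finite, symmetric] by (rule l2_inner_cnj)
    then show ?thesis using False le[of k j] by simp
  qed (rule le)
qed

section \<open>Laguerre coefficients as Taylor coefficients\<close>

lemma radial_ft_gauss_series:
  assumes g: "sq_integrable (dag_measure CARD('n::finite)) g"
  shows "(\<lambda>m. of_real (2 powr (real CARD('n) / 2) * (-1) ^ m / fact m / gauss_moment CARD('n) m) * radial_moment CARD('n) m g * of_real (\<theta> ^ (2 * m)))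
     sums radial_ft TYPE('n) g \<theta>"
proof -
  have "(2 * pi) powr (- real CARD('n) / 2) * ((-1) ^ m / fact (2 * m) * polar_const (axis undefined 1 :: real^'n) m)
    = 2 powr (real CARD('n) / 2) * (-1) ^ m / fact m / gauss_moment CARD('n) m" for m
    using gauss_moment_polar[where 'n = 'n, of m] gauss_moment_pos[where 'n = 'n, of m] by (simp add: field_simps)
  from radial_ft_series[OF g, of \<theta>, unfolded this] show ?thesis by (simp only: of_real_mult mult_ac)
qed

text \<open>Multiplication by exp(theta^2) is a Cauchy product, and its coefficients are binomial
  sums of moments of \<open>g\<close> divided by Gaussian moments, that is, \<open>lag_coeff\<close>
  up to the factor 2^(n/2)/k!.\<close>

lemma exp_radial_ft_series:
  assumes g: "sq_integrable (dag_measure CARD('n::finite)) g"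
  shows "(\<lambda>k. lag_coeff CARD('n) k g * of_real (2 powr (real CARD('n) / 2) / fact k) * of_real (\<theta> ^ (2 * k)))
     sums (radial_ft TYPE('n) g \<theta> * of_real (exp (\<theta>\<^sup>2)))"
proof -
  let ?n = "CARD('n)" and ?C = "2 powr (real CARD('n) / 2)"
  define f where "f m = of_real (?C * (-1) ^ m / fact m / gauss_moment ?n m) * radial_moment ?n m g" for m
  have s: "(\<lambda>m. f m * of_real (\<theta>\<^sup>2) ^ m) sums radial_ft TYPE('n) g \<theta>" for \<theta>
    using radial_ft_gauss_series[OF g, of \<theta>] unfolding f_def by (simp add: power_mult)
  have sn: "summable (\<lambda>m. norm (f m * of_real (\<theta>\<^sup>2) ^ m))"
  proof (rule powser_insidea)
    show "summable (\<lambda>m. f m * of_real ((\<bar>\<theta>\<bar> + 1)\<^sup>2) ^ m)" by (rule sums_summable[OF s])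
    have "\<theta>\<^sup>2 < (\<bar>\<theta>\<bar> + 1)\<^sup>2" by (simp add: power2_eq_square algebra_simps)
    then show "norm (complex_of_real (\<theta>\<^sup>2)) < norm (complex_of_real ((\<bar>\<theta>\<bar> + 1)\<^sup>2))" unfolding norm_of_real by simp
  qed
  let ?e = "\<lambda>k. complex_of_real ((\<theta>\<^sup>2) ^ k /\<^sub>R fact k)"
  have "(\<lambda>k. (\<theta>\<^sup>2) ^ k /\<^sub>R fact k) sums exp (\<theta>\<^sup>2)" by (rule exp_converges)
  then have e: "?e sums of_real (exp (\<theta>\<^sup>2))" by (rule sums_of_real)
  have en: "summable (\<lambda>k. norm (?e k))"
    using summable_exp_generic[of "\<theta>\<^sup>2"] unfolding norm_of_real by (simp add: abs_mult)
  have "(\<lambda>k. \<Sum>i\<le>k. f i * of_real (\<theta>\<^sup>2) ^ i * ?e (k - i)) sums (radial_ft TYPE('n) g \<theta> * of_real (exp (\<theta>\<^sup>2)))"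
    using Cauchy_product_sums[OF sn en] unfolding sums_unique[OF s, symmetric] sums_unique[OF e, symmetric] .
  moreover have "(\<Sum>i\<le>k. f i * of_real (\<theta>\<^sup>2) ^ i * ?e (k - i)) = lag_coeff ?n k g * of_real (?C / fact k) * of_real (\<theta> ^ (2 * k))" for k
  proof -
    have "f i * of_real (\<theta>\<^sup>2) ^ i * ?e (k - i) =
       of_real (real (k choose i) * (-1) ^ i / gauss_moment ?n i) * radial_moment ?n i g * (of_real (?C / fact k) * of_real (\<theta> ^ (2 * k)))" if "i \<le> k" for i
    proof -
      have p: "(\<theta>\<^sup>2) ^ i * (\<theta>\<^sup>2) ^ (k - i) = \<theta> ^ (2 * k)"
        using that by (simp add: power_mult flip: power_add)
      have "?C * (-1) ^ i / fact i / gauss_moment ?n i * ((\<theta>\<^sup>2) ^ i * ((\<theta>\<^sup>2) ^ (k - i) / fact (k - i)))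
          = ?C * (-1) ^ i / fact i / gauss_moment ?n i * (((\<theta>\<^sup>2) ^ i * (\<theta>\<^sup>2) ^ (k - i)) / fact (k - i))" by simp
      also have "... = real (k choose i) * (-1) ^ i / gauss_moment ?n i * (?C / fact k * \<theta> ^ (2 * k))"
        unfolding p binomial_fact[OF that] by (simp add: field_simps)
      finally have "complex_of_real (?C * (-1) ^ i / fact i / gauss_moment ?n i * ((\<theta>\<^sup>2) ^ i * ((\<theta>\<^sup>2) ^ (k - i) / fact (k - i)))) * radial_moment ?n i g
          = complex_of_real (real (k choose i) * (-1) ^ i / gauss_moment ?n i * (?C / fact k * \<theta> ^ (2 * k))) * radial_moment ?n i g"
        by (simp only:)
      moreover have "(\<theta>\<^sup>2) ^ (k - i) /\<^sub>R fact (k - i) = (\<theta>\<^sup>2) ^ (k - i) / fact (k - i)" by (simp add: divide_inverse mult.commute)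
      ultimately show ?thesis unfolding f_def by (simp only: of_real_mult of_real_power mult_ac)
    qed
    then have "(\<Sum>i\<le>k. f i * of_real (\<theta>\<^sup>2) ^ i * ?e (k - i)) =
        (\<Sum>i\<le>k. of_real (real (k choose i) * (-1) ^ i / gauss_moment ?n i) * radial_moment ?n i g * (of_real (?C / fact k) * of_real (\<theta> ^ (2 * k))))"
      by (intro sum.cong refl) simp
    then show ?thesis unfolding lag_coeff_def by (simp only: sum_distrib_right mult.assoc)
  qed
  ultimately show ?thesis by (simp only:)
qed

text \<open>By orthogonality a single term of the expansion survives.\<close>

lemma radial_ft_lag:
  "radial_ft TYPE('n::finite) (lag CARD('n) k) \<theta> =
    of_real (lag_norm2 CARD('n) k * 2 powr (real CARD('n) / 2) / fact k * (exp (- \<theta>\<^sup>2) * \<theta> ^ (2 * k)))"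
proof -
  let ?n = "CARD('n)" and ?C = "2 powr (real CARD('n) / 2)"
  have "(\<lambda>j. if j = k then of_real (lag_norm2 ?n k) * of_real (?C / fact k) * of_real (\<theta> ^ (2 * k)) else 0)
     sums (radial_ft TYPE('n) (lag ?n k) \<theta> * of_real (exp (\<theta>\<^sup>2)))"
    using exp_radial_ft_series[where 'n = 'n, OF sq_integrable_lag, of k \<theta>] unfolding lag_coeff_lag
    by (rule back_subst[where P = "\<lambda>f. f sums _"]) auto
  from sums_unique2[OF this sums_single]
  have eq: "radial_ft TYPE('n) (lag ?n k) \<theta> * of_real (exp (\<theta>\<^sup>2)) = of_real (lag_norm2 ?n k * (?C / fact k) * \<theta> ^ (2 * k))"
    by (simp only: of_real_mult)
  have e: "exp (\<theta>\<^sup>2) * exp (- \<theta>\<^sup>2) = 1" by (simp flip: exp_add)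
  have "radial_ft TYPE('n) (lag ?n k) \<theta> = radial_ft TYPE('n) (lag ?n k) \<theta> * of_real (exp (\<theta>\<^sup>2) * exp (- \<theta>\<^sup>2))"
    unfolding e by simp
  also have "... = of_real (lag_norm2 ?n k * (?C / fact k) * \<theta> ^ (2 * k)) * of_real (exp (- \<theta>\<^sup>2))"
    unfolding of_real_mult mult.assoc[symmetric] eq[unfolded of_real_mult] ..
  finally show ?thesis by (simp only: of_real_mult[symmetric] times_divide_eq_right mult_ac)
qed

lemma radial_tempered_fun:
  assumes g: "sq_integrable (dag_measure CARD('n::finite)) g"
  shows "tempered_fun (\<lambda>x::real^'n. g (norm x))"
  unfolding tempered_fun_def
proof (intro conjI ballI)
  note m[measurable] = g[unfolded sq_integrable_dag, THEN conjunct1]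
  show "(\<lambda>x::real^'n. g (norm x)) \<in> borel_measurable borel" by measurable
  fix \<psi> :: "'n cfun" assume \<psi>: "\<psi> \<in> schwartz"
  obtain B where B: "\<And>x. norm (\<psi> x) \<le> B" using schwartz_decay[OF \<psi>, of 0] by auto
  show "integrable lborel (\<lambda>x::real^'n. g (norm x) * \<psi> x)"
  proof (rule Bochner_Integration.integrable_bound[OF integrable_mult_right[OF radial_integrable[OF g], of "of_real B"]])
    show "AE x in lborel. norm (g (norm x) * \<psi> x) \<le> norm (of_real B * g (norm x))"
    proof (rule AE_I2)
      fix x
      have "norm (\<psi> x) * norm (g (norm x)) \<le> \<bar>B\<bar> * norm (g (norm x))"
        using B[of x] by (intro mult_right_mono) auto
      then show "norm (g (norm x) * \<psi> x) \<le> norm (of_real B * g (norm x))" by (simp add: norm_mult mult.commute)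
    qed
  qed (use schwartz_measurable[OF \<psi>] in measurable)
qed

definition lag_basis :: "nat \<Rightarrow> nat \<Rightarrow> real \<Rightarrow> complex" where
  "lag_basis n k r = of_real (1 / sqrt (lag_norm2 n k)) * lag n k r"

lemma sq_integrable_lag_basis: "sq_integrable (dag_measure n) (lag_basis n k)"
  unfolding lag_basis_def by (intro sq_integrable_cmult sq_integrable_lag)

lemma lag_basis_orthonormal:
  "l2_inner (dag_measure CARD('n::finite)) (lag_basis CARD('n) j) (lag_basis CARD('n) k) = (if j = k then 1 else 0)"
  unfolding lag_basis_def l2_inner_cmult_left l2_inner_cmult_right l2_inner_lag[OF sq_integrable_lag zero_less_card_finite] lag_coeff_lag
  using lag_norm2_pos[where 'n = 'n, of k] by (auto simp: field_simps simp flip: of_real_mult)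

lemma lag_coeff_basis:
  assumes g: "sq_integrable (dag_measure CARD('n::finite)) g"
  shows "lag_coeff CARD('n) k g = of_real (sqrt (lag_norm2 CARD('n) k)) * l2_inner (dag_measure CARD('n)) g (lag_basis CARD('n) k)"
  unfolding lag_basis_def l2_inner_cmult_right l2_inner_lag[OF g zero_less_card_finite]
  using lag_norm2_pos[where 'n = 'n, of k] by simp

text \<open>The Fourier image of the semigroup that multiplies the \<open>k\<close>-th coefficient by \<open>exp (- k \<tau>)\<close> is
  obtained by replacing \<open>\<theta>\<close> by \<open>exp (- \<tau> / 2) \<theta>\<close> in the generating series.\<close>

lemma lag_semigroup:
  assumes g: "sq_integrable (dag_measure CARD('n::finite)) g" and \<tau>: "\<tau> \<ge> 0"
  defines "a \<equiv> \<lambda>k. l2_inner (dag_measure CARD('n)) g (lag_basis CARD('n) k) * of_real (exp (- real k * \<tau>))"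
  obtains h where "sq_integrable (dag_measure CARD('n)) h"
    and "\<And>\<theta>. radial_ft TYPE('n) h \<theta> = of_real (exp (- (\<theta>\<^sup>2) + (exp (- \<tau> / 2) * \<theta>)\<^sup>2)) * radial_ft TYPE('n) g (exp (- \<tau> / 2) * \<theta>)"
    and "(\<lambda>N. LINT r|dag_measure CARD('n). (norm (h r - (\<Sum>k<N. a k * lag_basis CARD('n) k r)))\<^sup>2) \<longlonglongrightarrow> 0"
proof -
  let ?n = "CARD('n)" and ?C = "2 powr (real CARD('n) / 2)"
  note E = sq_integrable_lag_basis lag_basis_orthonormal
  have "summable (\<lambda>k. (norm (a k))\<^sup>2)"
  proof (rule summable_comparison_test'[where N = 0])
    show "summable (\<lambda>k. (norm (l2_inner (dag_measure ?n) g (lag_basis ?n k)))\<^sup>2)"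
      by (rule bessel[OF E g])
    fix k
    have "norm (a k) \<le> norm (l2_inner (dag_measure ?n) g (lag_basis ?n k)) * 1"
      unfolding a_def norm_mult using \<tau> by (intro mult_left_mono) auto
    then have "(norm (a k))\<^sup>2 \<le> (norm (l2_inner (dag_measure ?n) g (lag_basis ?n k)))\<^sup>2"
      by (intro power_mono) auto
    then show "norm ((norm (a k))\<^sup>2) \<le> (norm (l2_inner (dag_measure ?n) g (lag_basis ?n k)))\<^sup>2" by simp
  qed
  from riesz_fischer[OF E this] obtain h where h: "sq_integrable (dag_measure ?n) h"
    and ha: "\<And>k. l2_inner (dag_measure ?n) h (lag_basis ?n k) = a k"
    and lim: "(\<lambda>N. LINT r|dag_measure ?n. (norm (h r - (\<Sum>k<N. a k * lag_basis ?n k r)))\<^sup>2) \<longlonglongrightarrow> 0" by auto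
  have "radial_ft TYPE('n) h \<theta> = of_real (exp (- (\<theta>\<^sup>2) + (exp (- \<tau> / 2) * \<theta>)\<^sup>2)) * radial_ft TYPE('n) g (exp (- \<tau> / 2) * \<theta>)" for \<theta>
  proof -
    have "lag_coeff ?n k h * of_real (?C / fact k) * of_real (\<theta> ^ (2 * k)) =
        lag_coeff ?n k g * of_real (?C / fact k) * of_real ((exp (- \<tau> / 2) * \<theta>) ^ (2 * k))" for k
    proof -
      have "exp (- \<tau> / 2) ^ (2 * k) = exp (real (2 * k) * (- \<tau> / 2))" by (rule exp_of_nat_mult[symmetric])
      also have "real (2 * k) * (- \<tau> / 2) = - real k * \<tau>" by simp
      finally have "(exp (- \<tau> / 2) * \<theta>) ^ (2 * k) = exp (- real k * \<tau>) * \<theta> ^ (2 * k)"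
        by (simp only: power_mult_distrib)
      then show ?thesis unfolding lag_coeff_basis[OF g] lag_coeff_basis[OF h] ha a_def by (simp only: of_real_mult mult_ac)
    qed
    then have eq: "radial_ft TYPE('n) h \<theta> * of_real (exp (\<theta>\<^sup>2)) = radial_ft TYPE('n) g (exp (- \<tau> / 2) * \<theta>) * of_real (exp ((exp (- \<tau> / 2) * \<theta>)\<^sup>2))"
      using sums_unique2[OF exp_radial_ft_series[OF h, of \<theta>]] exp_radial_ft_series[OF g, of "exp (- \<tau> / 2) * \<theta>"] by (simp only:)
    have e: "exp (\<theta>\<^sup>2) * exp (- (\<theta>\<^sup>2)) = 1" by (simp flip: exp_add)
    have "radial_ft TYPE('n) h \<theta> = radial_ft TYPE('n) h \<theta> * of_real (exp (\<theta>\<^sup>2) * exp (- (\<theta>\<^sup>2)))" unfolding e by simp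
    also have "... = radial_ft TYPE('n) g (exp (- \<tau> / 2) * \<theta>) * of_real (exp ((exp (- \<tau> / 2) * \<theta>)\<^sup>2)) * of_real (exp (- (\<theta>\<^sup>2)))"
      unfolding of_real_mult mult.assoc[symmetric] eq ..
    finally show ?thesis unfolding exp_add of_real_mult by (simp only: mult_ac)
  qed
  then show thesis using h lim by (intro that)
qed

subsection \<open>The space \<open>L2_dagger\<close>\<close>

lemma radial_ft_measurable:
  assumes g: "sq_integrable (dag_measure CARD('n::finite)) g"
  shows "radial_ft TYPE('n) g \<in> borel_measurable borel"
  by (rule borel_measurable_LIMSEQ_metric[OF _ radial_ft_gauss_series[OF g, unfolded sums_def]]) measurable

text \<open>This undoes the dagger: if \<open>g\<close> is the dagger of \<open>T\<close>, the
  transform of \<open>T\<close> at |xi| is the transform of g(|x|) at radius |xi|^s.\<close>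

definition radial_symbol :: "real \<Rightarrow> (real \<Rightarrow> complex) \<Rightarrow> real^'n::finite \<Rightarrow> complex" where
  "radial_symbol s g \<xi> = radial_ft TYPE('n) g (norm \<xi> powr s)"

lemma radial_symbol_poly_bounded:
  assumes g: "sq_integrable (dag_measure CARD('n::finite)) g"
  shows "poly_bounded (radial_symbol s g :: real^'n \<Rightarrow> complex)"
proof (rule poly_bounded_bounded)
  note [measurable] = radial_ft_measurable[OF g]
  show "(radial_symbol s g :: real^'n \<Rightarrow> complex) \<in> borel_measurable borel"
    unfolding radial_symbol_def by measurable
  show "norm (radial_symbol s g \<xi>) \<le> (2 * pi) powr (- real CARD('n) / 2) * (LINT x|lborel. norm (g (norm (x::real^'n))))" for \<xi> :: "real^'n"
    unfolding radial_symbol_def radial_ft_def by (rule norm_fourier_le)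
qed

text \<open>Membership in \<open>L2_dagger\<close> in a form free of the choice operator in
  \<open>dagger\<close>, with an explicit bounded symbol. For extensional \<open>T\<close> and
  square integrable \<open>g\<close> it amounts to \<open>is_dagger\<close>, by
  \<open>dagger_rep_is_dagger\<close> and \<open>is_dagger_dagger_rep\<close>.\<close>

definition dagger_rep :: "real \<Rightarrow> 'n::finite distribution \<Rightarrow> (real \<Rightarrow> complex) \<Rightarrow> bool" where
  "dagger_rep s T g \<longleftrightarrow> sq_integrable (dag_measure CARD('n)) g \<and> T = ift (radial_symbol s g)"

lemma fourier_dist_of_fun:
  assumes G: "integrable lborel G"
  shows "fourier_dist (dist_of_fun G) = dist_of_fun (fourier G)"
  unfolding fourier_dist_def
proof (rule extensionalityI[of _ schwartz])
  show "dist_of_fun (fourier G) \<in> extensional schwartz" by (simp add: dist_of_fun_def)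
  fix \<psi> :: "real^'a \<Rightarrow> complex" assume \<psi>: "\<psi> \<in> schwartz"
  show "(\<lambda>\<psi>\<in>schwartz. dist_of_fun G (fourier \<psi>)) \<psi> = dist_of_fun (fourier G) \<psi>"
    using fourier_swap[OF G schwartz_integrable[OF \<psi>]] \<psi> schwartz_fourier[OF \<psi>] by (simp add: dist_of_fun_def)
qed simp

text \<open>On r > 0 the inverse power map is differentiable and therefore maps null sets to null
  sets; 0 is left out because a power need not be differentiable there.\<close>

lemma AE_powr:
  assumes P: "Measurable.pred borel P" and s: "s > 0" and ae: "AE r in lborel. r > 0 \<longrightarrow> P (r::real)"
  shows "AE r in lborel. r > 0 \<longrightarrow> P (r powr s)"
proof -
  note [measurable] = P
  define N where "N = {r. r > 0 \<and> \<not> P r}"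
  define N' where "N' = {r. r > 0 \<and> \<not> P (r powr s)}"
  have N: "N \<in> sets lborel" unfolding N_def by measurable
  have "(\<lambda>r. r powr s) \<in> borel_measurable borel" by measurable
  from measurable_compose[OF this P] have [measurable]: "Measurable.pred borel (\<lambda>r. P (r powr s))" .
  have N': "N' \<in> sets lborel" unfolding N'_def by measurable
  have "AE r in lborel. r \<notin> N" using ae by eventually_elim (simp add: N_def)
  then have "negligible N" unfolding negligible_iff_null_sets null_sets_completion_iff[OF N] AE_iff_null_sets[OF N] .
  moreover have "(\<lambda>r. r powr (1 / s)) differentiable_on N"
    unfolding differentiable_on_def
  proof
    fix r assume "r \<in> N"
    then have "r > 0" by (simp add: N_def)
    then have "((\<lambda>r. r powr (1 / s)) has_real_derivative (1 / s) * r powr (1 / s - 1)) (at r within N)"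
      by (intro DERIV_subset[OF has_real_derivative_powr]) auto
    then show "(\<lambda>r. r powr (1 / s)) differentiable at r within N"
      by (auto simp: has_field_derivative_def differentiable_def)
  qed
  ultimately have "negligible ((\<lambda>r. r powr (1 / s)) ` N)" by (intro negligible_differentiable_image_negligible) auto
  moreover have "N' \<subseteq> (\<lambda>r. r powr (1 / s)) ` N"
  proof
    fix r assume "r \<in> N'"
    then have "r powr s \<in> N" "r = (r powr s) powr (1 / s)" using s by (auto simp: N_def N'_def powr_powr)
    then show "r \<in> (\<lambda>r. r powr (1 / s)) ` N" by blast
  qed
  ultimately have "negligible N'" by (rule negligible_subset)
  then have "AE r in lborel. r \<notin> N'" unfolding negligible_iff_null_sets null_sets_completion_iff[OF N'] AE_iff_null_sets[OF N'] .
  then show ?thesis by eventually_elim (simp add: N'_def)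
qed

text \<open>The definition of \<open>is_dagger\<close> makes the radial function on the space
  measurable, but says nothing about its profile as a function on the line. Restriction to a ray
  provides a measurable profile with the same values for r >= 0.\<close>

lemma radial_profile:
  assumes f: "(\<lambda>\<xi>::real^'n::finite. f (norm \<xi>)) \<in> borel_measurable borel"
  shows "\<exists>h\<in>borel_measurable borel. \<forall>r\<ge>0. f r = h (r::real)"
proof (rule bexI[where x = "\<lambda>r. f (norm (r *\<^sub>R (axis undefined 1 :: real^'n)))"])
  have "(\<lambda>r::real. r *\<^sub>R (axis undefined 1 :: real^'n)) \<in> borel_measurable borel" by measurable
  from measurable_compose[OF this f] show "(\<lambda>r. f (norm (r *\<^sub>R (axis undefined 1 :: real^'n)))) \<in> borel_measurable borel" .
qed simp

lemma AE_radial_powr: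
  fixes f g :: "real \<Rightarrow> complex"
  assumes s: "s > 0" and f: "(\<lambda>\<xi>::real^'n::finite. f (norm \<xi>)) \<in> borel_measurable borel"
    and g: "(\<lambda>\<xi>::real^'n. g (norm \<xi>)) \<in> borel_measurable borel"
    and ae: "AE \<xi>::real^'n in lborel. f (norm \<xi>) = g (norm \<xi>)"
  shows "AE \<xi>::real^'n in lborel. f (norm \<xi> powr s) = g (norm \<xi> powr s)"
proof -
  obtain f' where f': "f' \<in> borel_measurable borel" "\<And>r. r \<ge> 0 \<Longrightarrow> f r = f' r" using radial_profile[OF f] by blast
  obtain g' where g': "g' \<in> borel_measurable borel" "\<And>r. r \<ge> 0 \<Longrightarrow> g r = g' r" using radial_profile[OF g] by blast
  have P[measurable]: "Measurable.pred borel (\<lambda>r. f' r = g' r)" using f'(1) g'(1) by measurable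
  have P': "Measurable.pred borel (\<lambda>r. f' (r powr s) = g' (r powr s))"
    by (rule measurable_compose[OF _ P]) measurable
  have "AE \<xi>::real^'n in lborel. f' (norm \<xi>) = g' (norm \<xi>)" using ae by (simp add: f'(2) g'(2))
  then have "AE r in lborel. r > 0 \<longrightarrow> f' r = g' r" unfolding AE_norm_iff[OF P] .
  from AE_powr[OF P s this] have "AE \<xi>::real^'n in lborel. f' (norm \<xi> powr s) = g' (norm \<xi> powr s)"
    unfolding AE_norm_iff[OF P'] .
  then show ?thesis by (simp add: f'(2) g'(2))
qed

text \<open>The profile of the transform of \<open>T\<close> is the radial transform of
  \<open>g\<close> at the s-th power of the radius; inserting |xi|^(1/s) gives back the transform of
  g(|x|).\<close>

lemma dagger_rep_is_dagger:
  fixes T :: "'n::finite distribution"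
  assumes s: "s > 0" and T: "dagger_rep s T g"
  shows "is_dagger s T g"
proof -
  have g: "sq_integrable (dag_measure CARD('n)) g" and Tg: "T = ift (radial_symbol s g)" using T by (auto simp: dagger_rep_def)
  note m = g[unfolded sq_integrable_dag, THEN conjunct1]
  have "has_fourier_fun T (\<lambda>\<xi>. radial_ft TYPE('n) g (norm \<xi> powr s))"
    unfolding Tg radial_symbol_def[symmetric]
    by (rule has_fourier_fun_ift[OF poly_bounded_tempered_fun[OF radial_symbol_poly_bounded[OF g]]])
  moreover have "has_fourier_fun (dist_of_fun (\<lambda>x::real^'n. g (norm x))) (\<lambda>\<xi>. radial_ft TYPE('n) g ((norm \<xi> powr (1 / s)) powr s))"
  proof -
    have "(norm \<xi> powr (1 / s)) powr s = norm \<xi> powr 1" for \<xi> :: "real^'n" using s by (simp add: powr_powr)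
    then have e: "(\<lambda>\<xi>::real^'n. radial_ft TYPE('n) g ((norm \<xi> powr (1 / s)) powr s)) = radial_symbol 1 g"
      by (simp add: radial_symbol_def fun_eq_iff)
    have e': "radial_symbol 1 g = fourier (\<lambda>x::real^'n. g (norm x))"
      by (simp add: radial_symbol_def fourier_radial[OF m] fun_eq_iff)
    show ?thesis unfolding has_fourier_fun_def e
      using poly_bounded_tempered_fun[OF radial_symbol_poly_bounded[OF g]] fourier_dist_of_fun[OF radial_integrable[OF g]]
      by (simp add: e'[symmetric])
  qed
  ultimately show ?thesis unfolding is_dagger_def using m radial_tempered_fun[OF g]
    by (intro conjI exI[of _ "\<lambda>\<zeta>. radial_ft TYPE('n) g (\<zeta> powr s)"])
qed

lemma has_fourier_fun_measurable: "has_fourier_fun T F \<Longrightarrow> F \<in> borel_measurable borel"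
  by (simp add: has_fourier_fun_def tempered_fun_def)

text \<open>This makes the choice in \<open>dagger\<close> harmless. Two profiles of the transform
  of \<open>T\<close> agree almost everywhere, also after the substitution |xi|^(1/s), and Fourier
  inversion carries the equality back to \<open>g\<close> and \<open>h\<close>.\<close>

lemma is_dagger_unique:
  fixes T :: "'n::finite distribution"
  assumes s: "s > 0" and g: "is_dagger s T g" and h: "is_dagger s T h"
  shows "AE r in lborel. r > 0 \<longrightarrow> g r = h r"
proof -
  have gm[measurable]: "g \<in> borel_measurable borel" and gt: "tempered_fun (\<lambda>x::real^'n. g (norm x))" using g by (auto simp: is_dagger_def)
  have hm[measurable]: "h \<in> borel_measurable borel" and ht: "tempered_fun (\<lambda>x::real^'n. h (norm x))" using h by (auto simp: is_dagger_def)
  obtain f where f: "has_fourier_fun T (\<lambda>\<xi>. f (norm \<xi>))"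
    "has_fourier_fun (dist_of_fun (\<lambda>x::real^'n. g (norm x))) (\<lambda>\<xi>. f (norm \<xi> powr (1 / s)))" using g unfolding is_dagger_def by auto
  obtain k where k: "has_fourier_fun T (\<lambda>\<xi>. k (norm \<xi>))"
    "has_fourier_fun (dist_of_fun (\<lambda>x::real^'n. h (norm x))) (\<lambda>\<xi>. k (norm \<xi> powr (1 / s)))" using h unfolding is_dagger_def by auto
  have "AE \<xi>::real^'n in lborel. f (norm \<xi> powr (1 / s)) = k (norm \<xi> powr (1 / s))"
    using s by (intro AE_radial_powr has_fourier_fun_unique[OF f(1) k(1)] has_fourier_fun_measurable[OF f(1)] has_fourier_fun_measurable[OF k(1)]) simp
  then have "dist_of_fun (\<lambda>\<xi>::real^'n. f (norm \<xi> powr (1 / s))) = dist_of_fun (\<lambda>\<xi>. k (norm \<xi> powr (1 / s)))"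
    by (rule dist_of_fun_cong_AE[OF has_fourier_fun_measurable[OF f(2)] has_fourier_fun_measurable[OF k(2)]])
  then have eq: "fourier_dist (dist_of_fun (\<lambda>x::real^'n. g (norm x))) = fourier_dist (dist_of_fun (\<lambda>x. h (norm x)))"
    using f(2) k(2) unfolding has_fourier_fun_def by simp
  have "dist_of_fun (\<lambda>x::real^'n. g (norm x)) = dist_of_fun (\<lambda>x. h (norm x))"
  proof (rule extensionalityI[of _ schwartz])
    fix \<psi> :: "'n cfun" assume \<psi>: "\<psi> \<in> schwartz"
    have "D \<psi> = fourier_dist D (inv_fourier \<psi>)" for D
      using schwartz_inv_fourier[OF \<psi>] by (simp add: fourier_dist_def fourier_inv_fourier[OF \<psi>])
    then show "dist_of_fun (\<lambda>x::real^'n. g (norm x)) \<psi> = dist_of_fun (\<lambda>x. h (norm x)) \<psi>" using eq by metis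
  qed (simp_all add: dist_of_fun_def)
  then have ae: "AE x::real^'n in lborel. g (norm x) = h (norm x)" by (rule dist_of_fun_eq_imp_AE[OF gt ht])
  have P: "Measurable.pred borel (\<lambda>r. g r = h r)" by measurable
  from ae show ?thesis unfolding AE_norm_iff[OF P] .
qed

text \<open>Square integrability makes g(|x|) integrable, so its transform is the function
  \<open>radial_symbol 1 g\<close>; the substitution |xi|^s then recovers the transform of
  \<open>T\<close> almost everywhere.\<close>

lemma is_dagger_dagger_rep:
  fixes T :: "'n::finite distribution"
  assumes s: "s > 0" and g: "is_dagger s T g" and sq: "sq_integrable (dag_measure CARD('n)) g" and T: "T \<in> extensional schwartz"
  shows "dagger_rep s T g"
proof -
  have m: "g \<in> borel_measurable borel" using g by (simp add: is_dagger_def)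
  obtain f where f: "has_fourier_fun T (\<lambda>\<xi>. f (norm \<xi>))"
    "has_fourier_fun (dist_of_fun (\<lambda>x::real^'n. g (norm x))) (\<lambda>\<xi>. f (norm \<xi> powr (1 / s)))" using g unfolding is_dagger_def by auto
  have e: "radial_symbol 1 g = fourier (\<lambda>x::real^'n. g (norm x))"
    by (simp add: radial_symbol_def fourier_radial[OF m] fun_eq_iff)
  have "has_fourier_fun (dist_of_fun (\<lambda>x::real^'n. g (norm x))) (radial_symbol 1 g)"
    unfolding has_fourier_fun_def
    using poly_bounded_tempered_fun[OF radial_symbol_poly_bounded[OF sq]] fourier_dist_of_fun[OF radial_integrable[OF sq]]
    by (simp add: e[symmetric])
  from has_fourier_fun_unique[OF f(2) this]
  have ae: "AE \<xi>::real^'n in lborel. f (norm \<xi> powr (1 / s)) = radial_ft TYPE('n) g (norm \<xi>)"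
    by (simp add: radial_symbol_def)
  have m': "(\<lambda>\<xi>::real^'n. radial_ft TYPE('n) g (norm \<xi>)) \<in> borel_measurable borel"
    by (rule measurable_compose[OF _ radial_ft_measurable[OF sq]]) measurable
  have "AE \<xi>::real^'n in lborel. f ((norm \<xi> powr s) powr (1 / s)) = radial_ft TYPE('n) g (norm \<xi> powr s)"
    by (rule AE_radial_powr[where f = "\<lambda>r. f (r powr (1 / s))", OF s has_fourier_fun_measurable[OF f(2)] m' ae])
  moreover have "(norm \<xi> powr s) powr (1 / s) = norm \<xi>" for \<xi> :: "real^'n" using s by (simp add: powr_powr)
  ultimately have ae': "AE \<xi>::real^'n in lborel. f (norm \<xi>) = radial_symbol s g \<xi>" unfolding radial_symbol_def by (simp only:)
  have "T = ift (\<lambda>\<xi>. f (norm \<xi>))" by (rule has_fourier_fun_eq_ift[OF f(1) T])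
  also have "... = ift (radial_symbol s g)"
    by (rule ift_cong_AE[OF has_fourier_fun_measurable[OF f(1)] poly_bounded_measurable[OF radial_symbol_poly_bounded[OF sq]] ae'])
  finally show ?thesis using sq by (simp add: dagger_rep_def)
qed

lemma inv_fourier_orthogonal:
  fixes \<psi> :: "'n::finite cfun" and A :: "real^'n \<Rightarrow> real^'n"
  assumes A: "orthogonal_transformation A" and \<psi>: "\<psi> \<in> borel_measurable borel"
  shows "inv_fourier (\<psi> \<circ> A) \<xi> = inv_fourier \<psi> (A \<xi>)"
proof -
  note [measurable] = \<psi>
  have "(LINT x|lborel. cis (A \<xi> \<bullet> x) * \<psi> x) = (LINT x|lborel. cis (A \<xi> \<bullet> A x) * \<psi> (A x))"
    by (rule lborel_integral_orthogonal[OF A, symmetric]) measurable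
  also have "... = (LINT x|lborel. cis (\<xi> \<bullet> x) * \<psi> (A x))"
    using A by (simp add: orthogonal_transformation_def)
  finally show ?thesis by (simp add: inv_fourier_def)
qed

lemma radial_dist_ift:
  assumes F: "(F :: real^'n::finite \<Rightarrow> complex) \<in> borel_measurable borel"
    and rad: "\<And>(A :: real^'n \<Rightarrow> real^'n) \<xi>. orthogonal_transformation A \<Longrightarrow> F (A \<xi>) = F \<xi>"
  shows "radial_dist (ift F)"
  unfolding radial_dist_def
proof (intro allI impI ballI)
  fix A :: "real^'n \<Rightarrow> real^'n" and \<psi> :: "'n cfun"
  assume A: "orthogonal_transformation A" and \<psi>: "\<psi> \<in> schwartz"
  note [measurable] = F schwartz_measurable[OF schwartz_inv_fourier[OF \<psi>]]
  have "(LINT \<xi>|lborel. F \<xi> * inv_fourier (\<psi> \<circ> A) \<xi>) = (LINT \<xi>|lborel. F (A \<xi>) * inv_fourier \<psi> (A \<xi>))"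
    by (simp add: inv_fourier_orthogonal[OF A schwartz_measurable[OF \<psi>]] rad[OF A])
  also have "... = (LINT \<xi>|lborel. F \<xi> * inv_fourier \<psi> \<xi>)"
    by (rule lborel_integral_orthogonal[OF A, where f = "\<lambda>\<xi>. F \<xi> * inv_fourier \<psi> \<xi>"]) measurable
  finally show "ift F (\<psi> \<circ> A) = ift F \<psi>" using \<psi> schwartz_orthogonal[OF \<psi> A] by (simp add: ift_def)
qed

text \<open>Polar coordinates; the two integrals differ by the positive area of the unit
  sphere.\<close>

lemma weighted_integrable_iff:
  assumes [measurable]: "g \<in> borel_measurable borel"
  shows "integrable lborel (\<lambda>x::real^'n::finite. (norm (g (norm x)))\<^sup>2 * exp ((norm x)\<^sup>2 / 4)) \<longleftrightarrow>
    sq_integrable (dag_measure CARD('n)) g"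
proof -
  let ?p = "polar_const (0::real^'n) 0"
  define h where "h r = complex_of_real ((norm (g r))\<^sup>2 * exp (r\<^sup>2 / 4))" for r
  have h: "h \<in> borel_measurable borel" unfolding h_def by measurable
  have "integrable lborel (\<lambda>x::real^'n. (norm (g (norm x)))\<^sup>2 * exp ((norm x)\<^sup>2 / 4)) \<longleftrightarrow> integrable lborel (\<lambda>x::real^'n. h (norm x))"
    unfolding h_def complex_of_real_integrable_eq ..
  also have "... \<longleftrightarrow> integrable lborel (\<lambda>x::real^'n. of_real ((x \<bullet> 0) ^ (2 * 0)) * h (norm x))" by simp
  also have "... \<longleftrightarrow> integrable lborel (\<lambda>r. of_real (?p * r ^ (2 * 0 + CARD('n) - 1) * indicator {0..} r) * h r)"
    by (rule integrable_polar[OF h])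
  also have "(\<lambda>r. of_real (?p * r ^ (2 * 0 + CARD('n) - 1) * indicator {0..} r) * h r) =
      (\<lambda>r. complex_of_real (?p * (indicator {0..} r * exp (r\<^sup>2 / 4) * r ^ (CARD('n) - 1) * (norm (g r))\<^sup>2)))"
    unfolding h_def of_real_mult[symmetric] by (simp add: fun_eq_iff mult_ac)
  also have "integrable lborel ... \<longleftrightarrow> integrable lborel (\<lambda>r. indicator {0..} r * exp (r\<^sup>2 / 4) * r ^ (CARD('n) - 1) * (norm (g r))\<^sup>2)"
    unfolding complex_of_real_integrable_eq using polar_const_0_pos[where 'n = 'n, of 0]
    by (subst integrable_mult_left_iff) auto
  finally show ?thesis unfolding sq_integrable_dag by simp
qed

lemma L2_dagger_iff:
  fixes T :: "'n::finite distribution"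
  assumes s: "s > 0"
  shows "T \<in> L2_dagger s \<longleftrightarrow> (\<exists>g. dagger_rep s T g)"
proof
  assume "T \<in> L2_dagger s"
  then obtain g where T: "tempered T" and g: "is_dagger s T g"
    "integrable lborel (\<lambda>x::real^'n. (norm (g (norm x)))\<^sup>2 * exp ((norm x)\<^sup>2 / 4))" unfolding L2_dagger_def by auto
  have "g \<in> borel_measurable borel" using g(1) by (simp add: is_dagger_def)
  with g(2) have "sq_integrable (dag_measure CARD('n)) g" by (simp add: weighted_integrable_iff)
  then show "\<exists>g. dagger_rep s T g" using T by (intro exI[of _ g] is_dagger_dagger_rep[OF s g(1)]) (simp_all add: tempered_def)
next
  assume "\<exists>g. dagger_rep s T g"
  then obtain g where rep: "dagger_rep s T g" by auto
  then have g: "sq_integrable (dag_measure CARD('n)) g" and Tg: "T = ift (radial_symbol s g)" by (auto simp: dagger_rep_def)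
  have "tempered T" unfolding Tg by (rule tempered_ift[OF radial_symbol_poly_bounded[OF g]])
  moreover have "radial_dist T" unfolding Tg
    by (rule radial_dist_ift[OF poly_bounded_measurable[OF radial_symbol_poly_bounded[OF g]]])
       (simp add: radial_symbol_def orthogonal_transformation_norm)
  moreover have "integrable lborel (\<lambda>x::real^'n. (norm (g (norm x)))\<^sup>2 * exp ((norm x)\<^sup>2 / 4))"
    using weighted_integrable_iff g unfolding sq_integrable_dag by blast
  ultimately show "T \<in> L2_dagger s" unfolding L2_dagger_def using dagger_rep_is_dagger[OF s rep] by auto
qed

section \<open>Inner product and linear operations on representatives\<close>

text \<open>Whatever function \<open>dagger\<close> selects, it agrees with the representative
  almost everywhere on r > 0, and the integral does not see the rest of the line.\<close>

lemma inner_dagger_rep: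
  fixes T1 T2 :: "'n::finite distribution"
  assumes s: "s > 0" and T1: "dagger_rep s T1 g1" and T2: "dagger_rep s T2 g2"
  shows "inner_dagger s T1 T2 = l2_inner (dag_measure CARD('n)) g1 g2"
proof -
  have D: "is_dagger s T (dagger s T)" "AE r in lborel. r > 0 \<longrightarrow> dagger s T r = g r" if "dagger_rep s T g" for T :: "'n distribution" and g
  proof -
    show *: "is_dagger s T (dagger s T)" unfolding dagger_def by (rule someI[of "is_dagger s T", OF dagger_rep_is_dagger[OF s that]])
    show "AE r in lborel. r > 0 \<longrightarrow> dagger s T r = g r" by (rule is_dagger_unique[OF s * dagger_rep_is_dagger[OF s that]])
  qed
  have [measurable]: "dagger s T1 \<in> borel_measurable borel" "dagger s T2 \<in> borel_measurable borel"
    using D(1)[OF T1] D(1)[OF T2] by (auto simp: is_dagger_def)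
  have [measurable]: "g1 \<in> borel_measurable borel" "g2 \<in> borel_measurable borel"
    using T1 T2 by (auto simp: dagger_rep_def sq_integrable_dag)
  note [measurable] = measurable_compose[OF _ cnj_measurable]
  have "inner_dagger s T1 T2 = (LINT r|lborel. of_real (indicator {0..} r * exp (r\<^sup>2 / 4) * r ^ (CARD('n) - 1)) * (g1 r * cnj (g2 r)))"
    unfolding inner_dagger_def set_lebesgue_integral_def
  proof (rule integral_cong_AE)
    show "AE r in lborel. indicator {0..} r *\<^sub>R (dagger s T1 r * cnj (dagger s T2 r) * of_real (exp (r\<^sup>2 / 4) * r ^ (CARD('n) - 1))) =
        of_real (indicator {0..} r * exp (r\<^sup>2 / 4) * r ^ (CARD('n) - 1)) * (g1 r * cnj (g2 r))"
      using D(2)[OF T1] D(2)[OF T2] AE_lborel_singleton[of 0]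
      by eventually_elim (auto simp: indicator_def mult_ac)
  qed measurable
  then show ?thesis unfolding l2_inner_def by (subst integral_dag_measure) auto
qed

lemma norm_dagger_rep:
  fixes T :: "'n::finite distribution"
  assumes "s > 0" "dagger_rep s T g"
  shows "norm_dagger s T = sqrt (LINT r|dag_measure CARD('n). (norm (g r))\<^sup>2)"
  unfolding norm_dagger_def inner_dagger_rep[OF assms(1,2,2)] l2_inner_self by simp

lemma radial_ft_cmult: "radial_ft TYPE('n::finite) (\<lambda>r. c * g r) \<theta> = c * radial_ft TYPE('n) g \<theta>"
proof -
  have "(LINT x|lborel. cis (- (x \<bullet> \<xi>)) * (c * g (norm x))) = c * (LINT x|lborel. cis (- (x \<bullet> \<xi>)) * g (norm x))" for \<xi> :: "real^'n"
    unfolding mult.left_commute[of _ c] by (rule integral_mult_right_zero)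
  then show ?thesis unfolding radial_ft_def fourier_def by (simp only: mult.left_commute)
qed

lemma radial_ft_diff_sum:
  assumes g: "sq_integrable (dag_measure CARD('n::finite)) g" and h: "\<And>k. k \<in> I \<Longrightarrow> sq_integrable (dag_measure CARD('n)) (h k)"
  shows "radial_ft TYPE('n) (\<lambda>r. g r - (\<Sum>k\<in>I. h k r)) \<theta> = radial_ft TYPE('n) g \<theta> - (\<Sum>k\<in>I. radial_ft TYPE('n) (h k) \<theta>)"
proof -
  define \<xi> where "\<xi> = \<theta> *\<^sub>R (axis undefined 1 :: real^'n)"
  have i: "integrable lborel (\<lambda>x::real^'n. cis (- (x \<bullet> \<xi>)) * f (norm x))" if "sq_integrable (dag_measure CARD('n)) f" for f
    by (intro integrable_cis_mult radial_integrable that) measurable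
  have "(LINT x|lborel. cis (- (x \<bullet> \<xi>)) * (g (norm x) - (\<Sum>k\<in>I. h k (norm x)))) =
      (LINT x|lborel. cis (- (x \<bullet> \<xi>)) * g (norm x) - (\<Sum>k\<in>I. cis (- (x \<bullet> \<xi>)) * h k (norm x)))"
    by (simp only: right_diff_distrib sum_distrib_left)
  also have "... = (LINT x|lborel. cis (- (x \<bullet> \<xi>)) * g (norm x)) - (LINT x|lborel. (\<Sum>k\<in>I. cis (- (x \<bullet> \<xi>)) * h k (norm x)))"
    by (intro Bochner_Integration.integral_diff Bochner_Integration.integrable_sum i g h)
  also have "(LINT x|lborel. (\<Sum>k\<in>I. cis (- (x \<bullet> \<xi>)) * h k (norm x))) = (\<Sum>k\<in>I. LINT x|lborel. cis (- (x \<bullet> \<xi>)) * h k (norm x))"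
    by (intro Bochner_Integration.integral_sum i h)
  finally show ?thesis unfolding radial_ft_def fourier_def \<xi>_def[symmetric] by (simp only: right_diff_distrib sum_distrib_left)
qed

lemma ift_integrable:
  fixes F :: "'n::finite cfun"
  assumes "poly_bounded F" "\<psi> \<in> schwartz"
  shows "integrable lborel (\<lambda>\<xi>. F \<xi> * inv_fourier \<psi> \<xi>)"
  using poly_bounded_tempered_fun[OF assms(1)] schwartz_inv_fourier[OF assms(2)] by (simp add: tempered_fun_def)

lemma dagger_rep_scale:
  fixes T :: "'n::finite distribution"
  assumes "dagger_rep s T g" shows "dagger_rep s (dist_scale c T) (\<lambda>r. c * g r)"
proof -
  have g: "sq_integrable (dag_measure CARD('n)) g" and T: "T = ift (radial_symbol s g)" using assms by (auto simp: dagger_rep_def)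
  have "c * (LINT \<xi>|lborel. radial_symbol s g \<xi> * inv_fourier \<psi> \<xi>) = (LINT \<xi>|lborel. radial_symbol s (\<lambda>r. c * g r) \<xi> * inv_fourier \<psi> \<xi>)" for \<psi> :: "'n cfun"
    unfolding radial_symbol_def radial_ft_cmult mult.assoc by (rule integral_mult_right_zero[symmetric])
  then have "dist_scale c T = ift (radial_symbol s (\<lambda>r. c * g r))"
    unfolding dist_scale_def T ift_def by (intro restrict_ext) simp
  then show ?thesis unfolding dagger_rep_def by (intro conjI sq_integrable_cmult g)
qed

lemma dagger_rep_diff_sum:
  fixes T :: "'n::finite distribution"
  assumes T: "dagger_rep s T g" and v: "\<And>k. k \<in> I \<Longrightarrow> dagger_rep s (v k) (h k)"
  shows "dagger_rep s (\<lambda>\<psi>\<in>schwartz. T \<psi> - (\<Sum>k\<in>I. v k \<psi>)) (\<lambda>r. g r - (\<Sum>k\<in>I. h k r))"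
proof -
  have g: "sq_integrable (dag_measure CARD('n)) g" and Tg: "T = ift (radial_symbol s g)" using T by (auto simp: dagger_rep_def)
  have h: "sq_integrable (dag_measure CARD('n)) (h k)" and vh: "v k = ift (radial_symbol s (h k))" if "k \<in> I" for k
    using v[OF that] by (auto simp: dagger_rep_def)
  have "(\<lambda>\<psi>\<in>schwartz. T \<psi> - (\<Sum>k\<in>I. v k \<psi>)) = ift (radial_symbol s (\<lambda>r. g r - (\<Sum>k\<in>I. h k r)))"
    unfolding ift_def
  proof (rule restrict_ext)
    fix \<psi> :: "'n cfun" assume \<psi>: "\<psi> \<in> schwartz"
    note i = ift_integrable[OF radial_symbol_poly_bounded \<psi>]
    have "(LINT \<xi>|lborel. radial_symbol s (\<lambda>r. g r - (\<Sum>k\<in>I. h k r)) \<xi> * inv_fourier \<psi> \<xi>) =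
       (LINT \<xi>|lborel. radial_symbol s g \<xi> * inv_fourier \<psi> \<xi> - (\<Sum>k\<in>I. radial_symbol s (h k) \<xi> * inv_fourier \<psi> \<xi>))"
      by (simp only: radial_symbol_def radial_ft_diff_sum[OF g h] left_diff_distrib sum_distrib_right)
    also have "... = (LINT \<xi>|lborel. radial_symbol s g \<xi> * inv_fourier \<psi> \<xi>) - (LINT \<xi>|lborel. (\<Sum>k\<in>I. radial_symbol s (h k) \<xi> * inv_fourier \<psi> \<xi>))"
      by (intro Bochner_Integration.integral_diff Bochner_Integration.integrable_sum i g h)
    also have "(LINT \<xi>|lborel. (\<Sum>k\<in>I. radial_symbol s (h k) \<xi> * inv_fourier \<psi> \<xi>)) = (\<Sum>k\<in>I. LINT \<xi>|lborel. radial_symbol s (h k) \<xi> * inv_fourier \<psi> \<xi>)"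
      by (intro Bochner_Integration.integral_sum i h)
    also have "... = (\<Sum>k\<in>I. v k \<psi>)" using vh \<psi> by (intro sum.cong refl) (simp add: ift_def)
    also have "(LINT \<xi>|lborel. radial_symbol s g \<xi> * inv_fourier \<psi> \<xi>) = T \<psi>" using Tg \<psi> by (simp add: ift_def)
    finally show "T \<psi> - (\<Sum>k\<in>I. v k \<psi>) = (LINT \<xi>|lborel. radial_symbol s (\<lambda>r. g r - (\<Sum>k\<in>I. h k r)) \<xi> * inv_fourier \<psi> \<xi>)" ..
  qed
  moreover have "sq_integrable (dag_measure CARD('n)) (\<lambda>r. g r - (\<Sum>k\<in>I. h k r))"
    by (intro sq_integrable_diff sq_integrable_sum g h)
  ultimately show ?thesis unfolding dagger_rep_def by (intro conjI)
qed

section \<open>The eigenfunctions\<close>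

text \<open>With t = |xi|^(2s), a power of 1+|xi| is bounded by a constant times 1 plus a power of
  t, and t^j <= j! exp t lets the exponential win.\<close>

lemma eigen_symbol_integrable:
  assumes s: "s > 0"
  shows "integrable lborel (\<lambda>\<xi>::real^'n::finite. complex_of_real (exp (- (norm \<xi> powr (2 * s))) * norm \<xi> powr (2 * s * real k)))"
proof (rule Bochner_Integration.integrable_bound)
  \<comment> \<open>Chosen so that t^M >= |xi|^(n+1) whenever |xi| > 1.\<close>
  define M where "M = nat \<lceil>real (CARD('n) + 1) / (2 * s)\<rceil>"
  let ?N = "CARD('n) + 1"
  define K :: real where "K = 2 ^ ?N * (fact k + fact (M + k))"
  show "integrable lborel (\<lambda>\<xi>::real^'n. K * (1 / (1 + norm \<xi>) ^ ?N))"
    by (rule integrable_mult_right[OF integrable_one_plus_norm])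
  show "AE \<xi>::real^'n in lborel. norm (complex_of_real (exp (- (norm \<xi> powr (2 * s))) * norm \<xi> powr (2 * s * real k))) \<le> norm (K * (1 / (1 + norm \<xi>) ^ ?N))"
  proof (rule AE_I2)
    fix \<xi> :: "real^'n"
    define t where "t = norm \<xi> powr (2 * s)"
    have t: "t \<ge> 0" by (simp add: t_def)
    have "norm \<xi> powr (2 * s * real k) = t powr real k" by (simp add: t_def powr_powr)
    \<comment> \<open>An inequality because for t = 0 and k = 0 the left side is
      \<open>0 powr 0 = 0\<close>.\<close>
    also have "... \<le> t ^ k" using t by (cases "t = 0") (auto simp: powr_realpow)
    finally have tk: "norm \<xi> powr (2 * s * real k) \<le> t ^ k" .
    have "(1 + norm \<xi>) ^ ?N \<le> 2 ^ ?N * (1 + t ^ M)"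
    proof (cases "norm \<xi> \<le> 1")
      case True
      then have "(1 + norm \<xi>) ^ ?N \<le> 2 ^ ?N" by (intro power_mono) auto
      also have "... * 1 \<le> 2 ^ ?N * (1 + t ^ M)" using t by (intro mult_left_mono) auto
      finally show ?thesis by simp
    next
      case False
      then have t1: "t \<ge> 1" unfolding t_def using s by (intro ge_one_powr_ge_zero) auto
      have "norm \<xi> = t powr (1 / (2 * s))" using False s by (simp add: t_def powr_powr)
      then have "norm \<xi> ^ ?N = (t powr (1 / (2 * s))) powr real ?N" using t1 by (subst powr_realpow) auto
      also have "... = t powr (real ?N / (2 * s))" by (simp add: powr_powr)
      also have "... \<le> t powr real M"
        by (rule powr_mono[OF _ t1]) (unfold M_def, rule real_nat_ceiling_ge)
      also have "... = t ^ M" using t1 by (intro powr_realpow) auto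
      finally have *: "norm \<xi> ^ ?N \<le> t ^ M" .
      have "(1 + norm \<xi>) ^ ?N \<le> (2 * norm \<xi>) ^ ?N" using False by (intro power_mono) auto
      also have "... = 2 ^ ?N * norm \<xi> ^ ?N" by (rule power_mult_distrib)
      also have "... \<le> 2 ^ ?N * (1 + t ^ M)" using * by (intro mult_left_mono) auto
      finally show ?thesis .
    qed
    then have "(1 + norm \<xi>) ^ ?N * t ^ k \<le> 2 ^ ?N * (1 + t ^ M) * t ^ k" using t by (intro mult_right_mono) auto
    also have "... = 2 ^ ?N * (t ^ k + t ^ (M + k))" by (simp add: algebra_simps power_add)
    also have "... \<le> 2 ^ ?N * (fact k * exp t + fact (M + k) * exp t)" using power_le_fact_exp[OF t] by (intro mult_left_mono add_mono) auto
    finally have "(1 + norm \<xi>) ^ ?N * t ^ k \<le> K * exp t" by (simp add: K_def algebra_simps)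
    then have b: "exp (- t) * t ^ k \<le> K * (1 / (1 + norm \<xi>) ^ ?N)"
      by (simp add: exp_minus field_simps add_pos_nonneg)
    have "norm (complex_of_real (exp (- t) * norm \<xi> powr (2 * s * real k))) = exp (- t) * norm \<xi> powr (2 * s * real k)"
      unfolding norm_of_real by simp
    also have "... \<le> exp (- t) * t ^ k" using tk by (intro mult_left_mono) auto
    also have "... \<le> K * (1 / (1 + norm \<xi>) ^ ?N)" by (rule b)
    also have "K * (1 / (1 + norm \<xi>) ^ ?N) \<le> norm (K * (1 / (1 + norm \<xi>) ^ ?N))"
      unfolding real_norm_def by (rule abs_ge_self)
    finally show "norm (complex_of_real (exp (- (norm \<xi> powr (2 * s))) * norm \<xi> powr (2 * s * real k))) \<le> norm (K * (1 / (1 + norm \<xi>) ^ ?N))"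
      unfolding t_def .
  qed
qed measurable

lemma dist_of_fun_inv_fourier:
  fixes F :: "'n::finite cfun"
  assumes F: "integrable lborel F"
  shows "dist_of_fun (inv_fourier F) = ift F"
  unfolding dist_of_fun_def ift_def
proof (rule restrict_ext)
  fix \<psi> :: "'n cfun" assume \<psi>: "\<psi> \<in> schwartz"
  note [measurable] = borel_measurable_integrable[OF F] schwartz_measurable[OF \<psi>]
  have r: "(\<lambda>x. F (- x)) \<in> borel_measurable borel" "integrable lborel (\<lambda>x. F (- x))"
    using F lborel_integrable_affine_iff[of F "-1" 0] by auto
  have "inv_fourier F = fourier (\<lambda>x. F (- x))"
    by (simp add: inv_fourier_eq fourier_reflect fun_eq_iff)
  then have "(LINT x|lborel. inv_fourier F x * \<psi> x) = (LINT x|lborel. F (- x) * fourier \<psi> x)"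
    using fourier_swap[OF r(2) schwartz_integrable[OF \<psi>]] by simp
  also have "... = (LINT x|lborel. F (- x) * inv_fourier \<psi> (- x))" by (simp add: inv_fourier_eq)
  also have "... = (LINT x|lborel. F x * inv_fourier \<psi> x)"
  proof -
    have [measurable]: "inv_fourier \<psi> \<in> borel_measurable borel" by (rule schwartz_measurable[OF schwartz_inv_fourier[OF \<psi>]])
    show ?thesis using lborel_integral_affine[of "\<lambda>x. F x * inv_fourier \<psi> x" "-1" 0] by simp
  qed
  finally show "(LINT x|lborel. inv_fourier F x * \<psi> x) = (LINT x|lborel. F x * inv_fourier \<psi> x)" .
qed

text \<open>Under theta = |xi|^s the transform of \<open>lag\<close>, a multiple of exp(-theta^2)
  theta^(2k), becomes the symbol of the eigenfunction; the equality is claimed off the origin, where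
  the convention for \<open>0 powr 0\<close> does not interfere. Normalization removes the remaining
  constant.\<close>

lemma eigen_rep:
  assumes s: "s > 0"
  shows "dagger_rep s (eigen s k :: 'n::finite distribution) (lag_basis CARD('n) k)"
proof -
  let ?n = "CARD('n)"
  define \<gamma> where "\<gamma> = lag_norm2 ?n k"
  have \<gamma>: "\<gamma> > 0" unfolding \<gamma>_def by (rule lag_norm2_pos)
  \<comment> \<open>The reciprocal of the constant in \<open>radial_ft_lag\<close>.\<close>
  define \<kappa> where "\<kappa> = fact k / (\<gamma> * 2 powr (real ?n / 2))"
  have \<kappa>: "\<kappa> > 0" using \<gamma> by (simp add: \<kappa>_def)
  let ?e = "\<lambda>r. complex_of_real \<kappa> * lag ?n k r"
  let ?F = "\<lambda>\<xi>::real^'n. complex_of_real (exp (- (norm \<xi> powr (2 * s))) * norm \<xi> powr (2 * s * real k))"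
  have sq: "sq_integrable (dag_measure ?n) ?e" by (intro sq_integrable_cmult sq_integrable_lag)
  have "eigen_unnormalized s k = ift ?F"
    unfolding eigen_unnormalized_def by (rule dist_of_fun_inv_fourier[OF eigen_symbol_integrable[OF s]])
  also have "... = ift (radial_symbol s ?e)"
  proof (rule ift_cong_AE)
    show "AE \<xi> in lborel. ?F \<xi> = radial_symbol s ?e \<xi>"
      using AE_lborel_singleton[of 0]
    proof eventually_elim
      case (elim \<xi>)
      define \<theta> where "\<theta> = norm \<xi> powr s"
      have \<theta>: "\<theta> > 0" using elim by (simp add: \<theta>_def)
      have a: "\<theta>\<^sup>2 = norm \<xi> powr (2 * s)" unfolding \<theta>_def power2_eq_square by (simp flip: powr_add)
      have b: "\<theta> ^ (2 * k) = norm \<xi> powr (2 * s * real k)"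
        using \<theta> unfolding powr_realpow[symmetric, OF \<theta>] by (simp add: \<theta>_def powr_powr mult_ac)
      have "\<kappa> * (\<gamma> * 2 powr (real ?n / 2) / fact k * (exp (- \<theta>\<^sup>2) * \<theta> ^ (2 * k))) = exp (- \<theta>\<^sup>2) * \<theta> ^ (2 * k)"
        using \<gamma> by (simp add: \<kappa>_def)
      then show ?case
        unfolding radial_symbol_def radial_ft_cmult radial_ft_lag \<theta>_def[symmetric] \<gamma>_def[symmetric] of_real_mult[symmetric] a b by simp
    qed
  qed (use poly_bounded_measurable[OF radial_symbol_poly_bounded[OF sq]] in measurable)
  finally have rep: "dagger_rep s (eigen_unnormalized s k :: 'n distribution) ?e" using sq by (simp add: dagger_rep_def)
  have "complex_of_real (LINT r|dag_measure ?n. (norm (?e r))\<^sup>2) = of_real (\<kappa>\<^sup>2 * \<gamma>)"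
    unfolding l2_inner_self[symmetric] l2_inner_cmult_left l2_inner_cmult_right
      l2_inner_lag[OF sq_integrable_lag zero_less_card_finite] lag_coeff_lag \<gamma>_def[symmetric]
    by (simp add: power2_eq_square)
  then have "norm_dagger s (eigen_unnormalized s k :: 'n distribution) = sqrt (\<kappa>\<^sup>2 * \<gamma>)"
    unfolding norm_dagger_rep[OF s rep] of_real_eq_iff by simp
  then have nd: "norm_dagger s (eigen_unnormalized s k :: 'n distribution) = \<kappa> * sqrt \<gamma>"
    using \<kappa> by (simp add: real_sqrt_mult)
  have "(\<lambda>r. complex_of_real (1 / (\<kappa> * sqrt \<gamma>)) * ?e r) = lag_basis ?n k"
    using \<kappa> unfolding lag_basis_def \<gamma>_def[symmetric] mult.assoc[symmetric] of_real_mult[symmetric] by (simp add: fun_eq_iff)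
  with dagger_rep_scale[OF rep, of "of_real (1 / (\<kappa> * sqrt \<gamma>))"] show ?thesis
    unfolding eigen_def nd by simp
qed

subsection \<open>The Cauchy problem in self-similar variables\<close>

text \<open>Converse of \<open>self_similar_apply\<close>: distributions are extensional, so their
  values on test functions decide the relation.\<close>

lemma self_similarI:
  fixes u :: "real \<Rightarrow> 'n::finite distribution"
  assumes s: "s > 0" and ext: "\<And>t. t \<ge> 0 \<Longrightarrow> \<phi> t \<in> extensional schwartz"
    and eq: "\<And>t \<psi>. t \<ge> 0 \<Longrightarrow> \<psi> \<in> schwartz \<Longrightarrow> \<phi> t \<psi> = u (ln (1 + t)) (\<lambda>x. \<psi> (exp (1 / (2 * s) * ln (1 + t)) *\<^sub>R x))"
  shows "self_similar s \<phi> u"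
proof -
  define \<phi>' where "\<phi>' t = dist_scale (of_real (1 / (1 + t) powr (real CARD('n) / (2 * s))))
       (dist_dilate ((t + 1) powr (1 / (2 * s))) (u (ln (t + 1))))" for t
  have ss: "self_similar s \<phi>' u" by (simp add: self_similar_def \<phi>'_def)
  have "\<phi> t = \<phi>' t" if t: "t \<ge> 0" for t
  proof (rule extensionalityI[of _ schwartz])
    fix \<psi> :: "'n cfun" assume "\<psi> \<in> schwartz"
    then show "\<phi> t \<psi> = \<phi>' t \<psi>" using eq[OF t] self_similar_apply[OF ss t s] by simp
  qed (use ext[OF t] self_similar_extensional[OF ss t] in auto)
  then show ?thesis by (simp add: self_similar_def \<phi>'_def)
qed

text \<open>Every test function is the dilation of another one, with a factor depending on \<tau>
  only, so \<open>\<phi>\<close> at time exp(\<tau>)-1 determines \<open>u \<tau>\<close>.\<close>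

lemma self_similar_determines:
  fixes u u' :: "real \<Rightarrow> 'n::finite distribution"
  assumes s: "s > 0" and ss: "self_similar s \<phi> u" and ss': "self_similar s \<phi>' u'"
    and eq: "\<And>t. t \<ge> 0 \<Longrightarrow> \<phi> t = \<phi>' t" and \<tau>: "\<tau> \<ge> 0"
    and ext: "u \<tau> \<in> extensional schwartz" "u' \<tau> \<in> extensional schwartz"
  shows "u \<tau> = u' \<tau>"
proof (rule extensionalityI[OF ext])
  fix \<psi> :: "'n cfun" assume \<psi>: "\<psi> \<in> schwartz"
  let ?c = "exp (1 / (2 * s) * \<tau>)"
  define \<eta> where "\<eta> = (\<lambda>x. \<psi> (inverse ?c *\<^sub>R x))"
  have \<eta>: "\<eta> \<in> schwartz" unfolding \<eta>_def by (intro schwartz_dilate \<psi>) simp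
  have t: "exp \<tau> - 1 \<ge> 0" using \<tau> by simp
  have e: "(\<lambda>x. \<eta> (?c *\<^sub>R x)) = \<psi>" by (simp add: \<eta>_def)
  have l: "ln (1 + (exp \<tau> - 1)) = \<tau>" by simp
  have "\<phi> (exp \<tau> - 1) \<eta> = u \<tau> \<psi>" using self_similar_apply[OF ss t s \<eta>] unfolding l e .
  moreover have "\<phi>' (exp \<tau> - 1) \<eta> = u' \<tau> \<psi>" using self_similar_apply[OF ss' t s \<eta>] unfolding l e .
  ultimately show "u \<tau> \<psi> = u' \<tau> \<psi>" using eq[OF t] by simp
qed

text \<open>Undoing the dilation keeps the symbols polynomially bounded and thereby brings
  \<open>\<phi>\<close> under \<open>fractional_heat_unique\<close>; its symbol at time 0 equals
  \<open>F\<close> almost everywhere.\<close>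

lemma fractional_heat_unique_self_similar:
  fixes u :: "real \<Rightarrow> 'n::finite distribution"
  assumes s: "0 < s" "s \<le> 1" and ss: "self_similar s \<phi> u"
    and nice: "\<And>\<tau>. \<tau> \<ge> 0 \<Longrightarrow> \<exists>U. poly_bounded U \<and> u \<tau> = ift U"
    and sol: "cauchy_solution (frac_laplacian s) \<phi> (ift F)" and F: "poly_bounded F" and t: "t \<ge> 0"
  shows "\<phi> t = ift (\<lambda>\<xi>. heat_mult s t \<xi> * F \<xi>)"
proof -
  obtain U where U: "\<And>\<tau>. \<tau> \<ge> 0 \<Longrightarrow> poly_bounded (U \<tau>)" "\<And>\<tau>. \<tau> \<ge> 0 \<Longrightarrow> u \<tau> = ift (U \<tau>)" using nice by metis
  define V where "V t = (\<lambda>\<xi>. U (ln (1 + t)) (exp (1 / (2 * s) * ln (1 + t)) *\<^sub>R \<xi>))" for t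
  have V: "poly_bounded (V t) \<and> \<phi> t = ift (V t)" if "t \<ge> 0" for t
  proof
    have l: "ln (1 + t) \<ge> 0" using that by simp
    show "poly_bounded (V t)" unfolding V_def by (rule poly_bounded_dilate[OF U(1)[OF l]]) simp
    show "\<phi> t = ift (V t)"
    proof (rule extensionalityI[of _ schwartz])
      show "\<phi> t \<in> extensional schwartz" by (rule self_similar_extensional[OF ss that])
      show "ift (V t) \<in> extensional schwartz" by (simp add: ift_def)
      fix \<psi> :: "'n cfun" assume \<psi>: "\<psi> \<in> schwartz"
      show "\<phi> t \<psi> = ift (V t) \<psi>" unfolding self_similar_apply[OF ss that s(1) \<psi>] V_def U(2)[OF l]
        by (rule ift_dilate[OF poly_bounded_measurable[OF U(1)[OF l]] \<psi>]) simp
    qed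
  qed
  have "\<phi> 0 = ift F" using sol by (simp add: cauchy_solution_def)
  then have "ift (V 0) = ift F" using V[of 0] by simp
  then have "AE \<xi> in lborel. V 0 \<xi> = F \<xi>"
    using has_fourier_fun_ift[OF poly_bounded_tempered_fun[OF F]] has_fourier_fun_ift[OF poly_bounded_tempered_fun[of "V 0"]] V[of 0]
    by (intro has_fourier_fun_unique[of "ift F"]) auto
  moreover have "AE \<xi> in lborel. V t \<xi> = heat_mult s t \<xi> * V 0 \<xi>"
    by (rule fractional_heat_unique[OF s V sol t])
  ultimately have ae: "AE \<xi> in lborel. V t \<xi> = heat_mult s t \<xi> * F \<xi>" by eventually_elim simp
  have "ift (V t) = ift (\<lambda>\<xi>. heat_mult s t \<xi> * F \<xi>)"
    by (rule ift_cong_AE[OF poly_bounded_measurable[OF V[OF t, THEN conjunct1]]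
      poly_bounded_measurable[OF poly_bounded_mult[OF poly_bounded_heat_mult[OF t] F]] ae])
  then show ?thesis using V[OF t] by simp
qed

theorem corollary1p2:
  fixes s :: real and \<phi>0 :: "'n::finite distribution"
  assumes "0 < s" and "s < 1" and "2 \<le> CARD('n)" and "\<phi>0 \<in> L2_dagger s"
  shows "(\<exists>\<phi> u. in_L2_dagger s \<phi> u \<and> cauchy_solution (frac_laplacian s) \<phi> \<phi>0 \<and>
            (\<forall>\<phi>' u'. in_L2_dagger s \<phi>' u' \<and> cauchy_solution (frac_laplacian s) \<phi>' \<phi>0 \<longrightarrow>
               (\<forall>t\<ge>0. \<phi>' t = \<phi> t))) \<and>
         (\<forall>\<phi> u. in_L2_dagger s \<phi> u \<longrightarrow>
            (cauchy_solution (frac_laplacian s) \<phi> \<phi>0 \<longleftrightarrow> cauchy_solution (L_op s) u \<phi>0)) \<and>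
         (\<forall>\<phi> u. in_L2_dagger s \<phi> u \<and> cauchy_solution (frac_laplacian s) \<phi> \<phi>0 \<longrightarrow>
            (\<forall>\<tau>\<ge>0. sums_dagger s
               (\<lambda>k. dist_scale (inner_dagger s \<phi>0 (eigen s k) * of_real (exp (- real k * \<tau>)))
                       (eigen s k))
               (u \<tau>)))"
proof -
  let ?n = "CARD('n)"
  note s = \<open>0 < s\<close>
  obtain g where rep0: "dagger_rep s \<phi>0 g" using assms(4) L2_dagger_iff[OF s] by blast
  then have g: "sq_integrable (dag_measure ?n) g" and \<phi>0: "\<phi>0 = ift (radial_symbol s g)" by (auto simp: dagger_rep_def)
  define F where "F = (radial_symbol s g :: real^'n \<Rightarrow> complex)"
  have F: "poly_bounded F" unfolding F_def by (rule radial_symbol_poly_bounded[OF g])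
  define a where "a \<tau> k = l2_inner (dag_measure ?n) g (lag_basis ?n k) * of_real (exp (- real k * \<tau>))" for \<tau> k
  \<comment> \<open>Gathers the three conclusions of \<open>lag_semigroup\<close>, so that one
    function \<open>h \<tau>\<close> with all of them can be selected for each time.\<close>
  define P where "P \<tau> h \<longleftrightarrow> sq_integrable (dag_measure ?n) h \<and>
      (\<forall>\<theta>. radial_ft TYPE('n) h \<theta> = of_real (exp (- (\<theta>\<^sup>2) + (exp (- \<tau> / 2) * \<theta>)\<^sup>2)) * radial_ft TYPE('n) g (exp (- \<tau> / 2) * \<theta>)) \<and>
      (\<lambda>N. LINT r|dag_measure ?n. (norm (h r - (\<Sum>k<N. a \<tau> k * lag_basis ?n k r)))\<^sup>2) \<longlonglongrightarrow> 0" for \<tau> h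
  have ex: "\<exists>h. P \<tau> h" if "\<tau> \<ge> 0" for \<tau>
    unfolding a_def P_def by (rule lag_semigroup[OF g that]) (intro exI conjI allI)
  define h where "h \<tau> = (SOME h. P \<tau> h)" for \<tau>
  have Ph: "P \<tau> (h \<tau>)" if "\<tau> \<ge> 0" for \<tau>
    unfolding h_def by (rule someI_ex[OF ex[OF that]])
  have h: "sq_integrable (dag_measure ?n) (h \<tau>)" if "\<tau> \<ge> 0" for \<tau>
    by (rule Ph[OF that, unfolded P_def, THEN conjunct1])
  have hft: "radial_ft TYPE('n) (h \<tau>) \<theta> = of_real (exp (- (\<theta>\<^sup>2) + (exp (- \<tau> / 2) * \<theta>)\<^sup>2)) * radial_ft TYPE('n) g (exp (- \<tau> / 2) * \<theta>)"
    if "\<tau> \<ge> 0" for \<tau> \<theta>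
    by (rule Ph[OF that, unfolded P_def, THEN conjunct2, THEN conjunct1, THEN spec])
  have lim: "(\<lambda>N. LINT r|dag_measure ?n. (norm (h \<tau> r - (\<Sum>k<N. a \<tau> k * lag_basis ?n k r)))\<^sup>2) \<longlonglongrightarrow> 0"
    if "\<tau> \<ge> 0" for \<tau>
    by (rule Ph[OF that, unfolded P_def, THEN conjunct2, THEN conjunct2])
  define u where "u \<tau> = ift (radial_symbol s (h \<tau>) :: real^'n \<Rightarrow> complex)" for \<tau>
  define \<phi> where "\<phi> t = ift (\<lambda>\<xi>. heat_mult s t \<xi> * F \<xi>)" for t
  \<comment> \<open>The two scalings meet here. Dilating xi by exp(\<tau>/(2s)) multiplies |xi|^s by
    exp(\<tau>/2), which cancels exp(-\<tau>/2) in the argument of the transform of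
    \<open>g\<close>; the Gaussian prefactor becomes the heat multiplier at time
    exp(\<tau>)-1.\<close>
  have hF: "radial_symbol s (h \<tau>) (exp (1 / (2 * s) * \<tau>) *\<^sub>R \<xi>) = heat_mult s (exp \<tau> - 1) \<xi> * F \<xi>" if "\<tau> \<ge> 0" for \<tau> \<xi>
  proof -
    define \<theta> where "\<theta> = norm (exp (1 / (2 * s) * \<tau>) *\<^sub>R \<xi>) powr s"
    have \<theta>: "\<theta> = exp (\<tau> / 2) * norm \<xi> powr s" using s by (simp add: \<theta>_def powr_mult powr_def[of "exp _"])
    have e1: "exp (- \<tau> / 2) * \<theta> = norm \<xi> powr s" unfolding \<theta> by (simp add: mult.assoc[symmetric] flip: exp_add)
    have p: "(norm \<xi> powr s)\<^sup>2 = norm \<xi> powr (2 * s)" unfolding power2_eq_square by (simp flip: powr_add)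
    have e2: "\<theta>\<^sup>2 = exp \<tau> * norm \<xi> powr (2 * s)"
      unfolding \<theta> power_mult_distrib p by (simp flip: exp_of_nat_mult)
    have "- (\<theta>\<^sup>2) + (exp (- \<tau> / 2) * \<theta>)\<^sup>2 = - (exp \<tau> - 1) * norm \<xi> powr (2 * s)"
      unfolding e1 p e2 by (simp add: algebra_simps)
    then show ?thesis
      unfolding radial_symbol_def \<theta>_def[symmetric] hft[OF that] F_def heat_mult_def by (simp only: e1)
  qed
  have urep: "dagger_rep s (u \<tau>) (h \<tau>)" if "\<tau> \<ge> 0" for \<tau> using h[OF that] by (simp add: dagger_rep_def u_def)
  have ss: "self_similar s \<phi> u"
  proof (rule self_similarI[OF s])
    show "\<phi> t \<in> extensional schwartz" for t by (simp add: \<phi>_def ift_def)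
    fix t :: real and \<psi> :: "'n cfun" assume t: "t \<ge> 0" and \<psi>: "\<psi> \<in> schwartz"
    have l: "ln (1 + t) \<ge> 0" "exp (ln (1 + t)) - 1 = t" using t by auto
    have "u (ln (1 + t)) (\<lambda>x. \<psi> (exp (1 / (2 * s) * ln (1 + t)) *\<^sub>R x)) =
        ift (\<lambda>\<xi>. radial_symbol s (h (ln (1 + t))) (exp (1 / (2 * s) * ln (1 + t)) *\<^sub>R \<xi>)) \<psi>"
      unfolding u_def by (rule ift_dilate[OF poly_bounded_measurable[OF radial_symbol_poly_bounded[OF h[OF l(1)]]] \<psi>]) simp
    then show "\<phi> t \<psi> = u (ln (1 + t)) (\<lambda>x. \<psi> (exp (1 / (2 * s) * ln (1 + t)) *\<^sub>R x))"
      unfolding hF[OF l(1)] l(2) \<phi>_def by (rule sym)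
  qed
  have in_L2: "in_L2_dagger s \<phi> u"
    unfolding in_L2_dagger_def L2_dagger_iff[OF s] using ss urep by blast
  have sol: "cauchy_solution (frac_laplacian s) \<phi> \<phi>0"
    unfolding \<phi>_def \<phi>0 F_def[symmetric] by (rule fractional_heat_exists[OF F s])
  \<comment> \<open>A competing solution is known only to lie in \<open>L2_dagger\<close> at each
    time; this already provides a bounded symbol, as the uniqueness result requires.\<close>
  have nice: "\<exists>U. poly_bounded U \<and> u' \<tau> = ift U" if L: "in_L2_dagger s \<phi>' u'" and \<tau>: "\<tau> \<ge> 0" for \<phi>' and u' :: "real \<Rightarrow> 'n distribution" and \<tau> :: real
  proof -
    have "u' \<tau> \<in> L2_dagger s" using L \<tau> by (simp add: in_L2_dagger_def)
    then obtain g' where g': "dagger_rep s (u' \<tau>) g'" unfolding L2_dagger_iff[OF s] by (rule exE)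
    show ?thesis
      by (rule exI[of _ "radial_symbol s g'"]) (use g' radial_symbol_poly_bounded[where 'n = 'n] in \<open>simp add: dagger_rep_def\<close>)
  qed
  have uniq: "\<phi>' t = \<phi> t"
    if "in_L2_dagger s \<phi>' u'" "cauchy_solution (frac_laplacian s) \<phi>' \<phi>0" "t \<ge> 0" for \<phi>' u' and t :: real
    unfolding \<phi>_def
    by (rule fractional_heat_unique_self_similar[OF s _ _ nice[OF that(1)] _ F that(3)])
       (use that assms(2) in \<open>auto simp: in_L2_dagger_def \<phi>0 F_def\<close>)
  have series: "sums_dagger s (\<lambda>k. dist_scale (inner_dagger s \<phi>0 (eigen s k) * of_real (exp (- real k * \<tau>))) (eigen s k)) (u' \<tau>)"
    if L: "in_L2_dagger s \<phi>' u'" and S: "cauchy_solution (frac_laplacian s) \<phi>' \<phi>0" and \<tau>: "\<tau> \<ge> 0" for \<phi>' u' and \<tau> :: real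
  proof -
    have ss': "self_similar s \<phi>' u'" using L by (simp add: in_L2_dagger_def)
    have ext: "u' \<tau> \<in> extensional schwartz" using nice[OF L \<tau>] by (auto simp: ift_def)
    \<comment> \<open>Uniqueness reduces an arbitrary solution to the constructed one, whose
      expansion is known.\<close>
    have u': "u' \<tau> = u \<tau>"
      by (rule self_similar_determines[OF s ss' ss uniq[OF L S] \<tau> ext]) (simp_all add: u_def ift_def)
    have inn: "inner_dagger s \<phi>0 (eigen s k) * of_real (exp (- real k * \<tau>)) = a \<tau> k" for k
      unfolding a_def inner_dagger_rep[OF s rep0 eigen_rep[OF s]] ..
    have v: "dagger_rep s (dist_scale (a \<tau> k) (eigen s k :: 'n distribution)) (\<lambda>r. a \<tau> k * lag_basis ?n k r)" for k
      by (rule dagger_rep_scale[OF eigen_rep[OF s]])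
    have "norm_dagger s (\<lambda>\<psi>\<in>schwartz. u \<tau> \<psi> - (\<Sum>k<N. dist_scale (a \<tau> k) (eigen s k) \<psi>)) =
        sqrt (LINT r|dag_measure ?n. (norm (h \<tau> r - (\<Sum>k<N. a \<tau> k * lag_basis ?n k r)))\<^sup>2)" for N
      by (rule norm_dagger_rep[OF s dagger_rep_diff_sum[OF urep[OF \<tau>] v]])
    moreover have "(\<lambda>N. sqrt (LINT r|dag_measure ?n. (norm (h \<tau> r - (\<Sum>k<N. a \<tau> k * lag_basis ?n k r)))\<^sup>2)) \<longlonglongrightarrow> 0"
      using tendsto_real_sqrt[OF lim[OF \<tau>]] by simp
    ultimately have "(\<lambda>N. norm_dagger s (\<lambda>\<psi>\<in>schwartz. u \<tau> \<psi> - (\<Sum>k<N. dist_scale (a \<tau> k) (eigen s k) \<psi>))) \<longlonglongrightarrow> 0"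
      by (simp only:)
    moreover have "u \<tau> \<in> L2_dagger s" unfolding L2_dagger_iff[OF s] by (rule exI[where P = "dagger_rep s (u \<tau>)", OF urep[OF \<tau>]])
    moreover have "dist_scale (a \<tau> k) (eigen s k :: 'n distribution) \<in> L2_dagger s" for k
      unfolding L2_dagger_iff[OF s] by (rule exI[where P = "dagger_rep s (dist_scale (a \<tau> k) (eigen s k))", OF v])
    ultimately show ?thesis unfolding sums_dagger_def inn u' by (intro conjI allI)
  qed
  have equiv: "cauchy_solution (frac_laplacian s) \<phi>' \<phi>0 \<longleftrightarrow> cauchy_solution (L_op s) u' \<phi>0" if "in_L2_dagger s \<phi>' u'" for \<phi>' u'
    by (rule self_similar_equivalence[OF s _ nice[OF that]]) (use that in \<open>simp_all add: in_L2_dagger_def\<close>)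
  have part1: "\<exists>\<phi> u. in_L2_dagger s \<phi> u \<and> cauchy_solution (frac_laplacian s) \<phi> \<phi>0 \<and>
            (\<forall>\<phi>' u'. in_L2_dagger s \<phi>' u' \<and> cauchy_solution (frac_laplacian s) \<phi>' \<phi>0 \<longrightarrow>
               (\<forall>t\<ge>0. \<phi>' t = \<phi> t))"
    by (rule exI[of _ \<phi>], rule exI[of _ u]) (intro conjI in_L2 sol allI impI, elim conjE, rule uniq)
  show ?thesis
    by (intro conjI part1 allI impI equiv) (assumption, elim conjE, rule series)
qed

end
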